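(* Let $N$ be sufficiently large. For any coprime integers $a,b$, there exist $t \le O(\log N)$ and $i_1,\ldots,i_t \in \{1,2\}$ such that $$\begin{pmatrix} a \\ b \end{pmatrix} \equiv A^{i_1}DA^{i_2}D\cdots A^{i_t}D \begin{pmatrix} 1 \\ 0 \end{pmatrix} \pmod{N}.$$ In particular, there exists an $O(\log N)$-planar-feasible vector $\begin{pmatrix} x \\ y \end{pmatrix}$ such that $x\equiv a \pmod{N}$ and $y \equiv b \pmod{N}$.
   Context: Here $A=\begin{pmatrix} 1 & 1\\ 0 & 1\end{pmatrix}$ and $D=\begin{pmatrix} 1 & 0\\ 1 & 1\end{pmatrix}$. For a (simple) graph $G$, $\tau(G)$ denotes its number of spanning trees; $G/e$ is the (multi)graph obtained by contracting edge $e$ and $G-e$ the graph obtained by deleting $e$. A vector $\begin{pmatrix} t \\ u \end{pmatrix}$ is called $n$-planar-feasible if there exists a planar graph $G$ on at most $n$ vertices and an edge $e\in E(G)$ with $t=\tau(G/e)$ and $u=\tau(G-e)$. All logarithms are base two. *)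

theory Defs
  imports "HOL-Analysis.Analysis" "HOL-Number_Theory.Cong"
begin

section \<open>Multigraphs, deletion and contraction\<close>

text \<open>
  Undirected multigraphs: an edge name \<open>e\<close> has the set \<open>ends G e\<close> of its endpoints, which is a
  singleton exactly when \<open>e\<close> is a loop.
\<close>

record ('v, 'e) multigraph =
  verts :: "'v set"
  edges :: "'e set"
  ends :: "'e \<Rightarrow> 'v set"

definition wf_multigraph :: "('v, 'e) multigraph \<Rightarrow> bool" where
  "wf_multigraph G \<longleftrightarrow> finite (verts G) \<and> finite (edges G) \<and>
     (\<forall>e \<in> edges G. ends G e \<subseteq> verts G \<and> card (ends G e) \<in> {1, 2})"

definition simple_graph :: "('v, 'e) multigraph \<Rightarrow> bool" where
  "simple_graph G \<longleftrightarrow> wf_multigraph G \<and>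
     (\<forall>e \<in> edges G. card (ends G e) = 2) \<and> inj_on (ends G) (edges G)"

definition delete_edge :: "('v, 'e) multigraph \<Rightarrow> 'e \<Rightarrow> ('v, 'e) multigraph" where
  "delete_edge G e = G\<lparr>edges := edges G - {e}\<rparr>"

text \<open>
  The vertices of the contraction are the classes of the identification: the two ends of \<open>e\<close>
  become the single vertex \<open>ends G e\<close>, and any other vertex \<open>v\<close> becomes \<open>{v}\<close>. All edges other
  than \<open>e\<close> are kept, so parallel edges may arise.
\<close>

definition merge_ends :: "('v, 'e) multigraph \<Rightarrow> 'e \<Rightarrow> 'v \<Rightarrow> 'v set" where
  "merge_ends G e v = (if v \<in> ends G e then ends G e else {v})"

definition contract_edge :: "('v, 'e) multigraph \<Rightarrow> 'e \<Rightarrow> ('v set, 'e) multigraph" where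
  "contract_edge G e = \<lparr> verts = merge_ends G e ` verts G,
                         edges = edges G - {e},
                         ends = (\<lambda>f. merge_ends G e ` ends G f) \<rparr>"

section \<open>Spanning trees\<close>

definition connected_graph :: "('v, 'e) multigraph \<Rightarrow> bool" where
  "connected_graph G \<longleftrightarrow> verts G \<noteq> {} \<and>
     (\<forall>u \<in> verts G. \<forall>v \<in> verts G. (u, v) \<in> {(x, y). \<exists>e \<in> edges G. ends G e = {x, y}}\<^sup>*)"

text \<open>A loop is a cycle of length 1, and a pair of parallel edges is a cycle of length 2.\<close>

definition has_cycle :: "('v, 'e) multigraph \<Rightarrow> bool" where
  "has_cycle G \<longleftrightarrow> (\<exists>vs es. es \<noteq> [] \<and> length vs = length es \<and> distinct vs \<and> distinct es \<and>
     set vs \<subseteq> verts G \<and> set es \<subseteq> edges G \<and>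
     (\<forall>i < length es. ends G (es ! i) = {vs ! i, vs ! (Suc i mod length es)}))"

definition tree_graph :: "('v, 'e) multigraph \<Rightarrow> bool" where
  "tree_graph G \<longleftrightarrow> connected_graph G \<and> \<not> has_cycle G"

text \<open>A spanning tree is identified with its edge set; parallel edges are distinguished.\<close>

definition spanning_trees :: "('v, 'e) multigraph \<Rightarrow> 'e set set" where
  "spanning_trees G = {T. T \<subseteq> edges G \<and> tree_graph (G\<lparr>edges := T\<rparr>)}"

definition num_spanning_trees :: "('v, 'e) multigraph \<Rightarrow> nat" where
  "num_spanning_trees G = card (spanning_trees G)"

section \<open>Planarity\<close>

text \<open>
  A drawing without crossings in the plane \<open>complex\<close>: vertices are distinct points, and edges are
  simple curves joining their ends that meet the vertices and each other only in common ends. By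
  the condition on its two endpoints, the curve of an edge that is not a loop is an arc.
\<close>

definition plane_drawing ::
    "('v, 'e) multigraph \<Rightarrow> ('v \<Rightarrow> complex) \<Rightarrow> ('e \<Rightarrow> real \<Rightarrow> complex) \<Rightarrow> bool" where
  "plane_drawing G p \<gamma> \<longleftrightarrow>
     inj_on p (verts G) \<and>
     (\<forall>e \<in> edges G. simple_path (\<gamma> e) \<and>
        {pathstart (\<gamma> e), pathfinish (\<gamma> e)} = p ` ends G e \<and>
        path_image (\<gamma> e) \<inter> p ` verts G = p ` ends G e) \<and>
     (\<forall>e \<in> edges G. \<forall>f \<in> edges G. e \<noteq> f \<longrightarrow>
        path_image (\<gamma> e) \<inter> path_image (\<gamma> f) = p ` (ends G e \<inter> ends G f))"

definition planar_graph :: "('v, 'e) multigraph \<Rightarrow> bool" where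
  "planar_graph G \<longleftrightarrow> (\<exists>p \<gamma>. plane_drawing G p \<gamma>)"

text \<open>
  Every finite graph is isomorphic to one whose vertices and edges are named by natural numbers,
  so quantifying over \<open>(nat, nat) multigraph\<close> is no restriction.
\<close>

definition planar_feasible :: "nat \<Rightarrow> int ^ 2 \<Rightarrow> bool" where
  "planar_feasible n w \<longleftrightarrow>
     (\<exists>(G :: (nat, nat) multigraph) e.
        simple_graph G \<and> planar_graph G \<and> card (verts G) \<le> n \<and> e \<in> edges G \<and>
        w $ 1 = int (num_spanning_trees (contract_edge G e)) \<and>
        w $ 2 = int (num_spanning_trees (delete_edge G e)))"

section \<open>Matrix words\<close>

definition A_mat :: "int ^ 2 ^ 2" where
  "A_mat = vector [vector [1, 1], vector [0, 1]]"

definition D_mat :: "int ^ 2 ^ 2" where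
  "D_mat = vector [vector [1, 0], vector [1, 1]]"

text \<open>The overloaded power on \<open>int ^ 2 ^ 2\<close> is entrywise, hence a separate matrix power.\<close>

primrec mat_pow :: "int ^ 2 ^ 2 \<Rightarrow> nat \<Rightarrow> int ^ 2 ^ 2" where
  "mat_pow M 0 = mat 1"
| "mat_pow M (Suc k) = M ** mat_pow M k"

text \<open>\<open>AD_word [i\<^sub>1, \<dots>, i\<^sub>t]\<close> is the product \<open>A ^ i\<^sub>1 D \<dots> A ^ i\<^sub>t D\<close>, in this order.\<close>

definition AD_word :: "nat list \<Rightarrow> int ^ 2 ^ 2" where
  "AD_word is = foldr (\<lambda>i M. mat_pow A_mat i ** D_mat ** M) is (mat 1)"

definition vec_cong :: "int ^ 2 \<Rightarrow> int ^ 2 \<Rightarrow> int \<Rightarrow> bool" where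
  "vec_cong v w m \<longleftrightarrow> (\<forall>k. [v $ k = w $ k] (mod m))"

end

theory Submission
  imports Defs "HOL-Number_Theory.Number_Theory" "HOL-Real_Asymp.Real_Asymp"
begin

text \<open>
  The operators of \<open>A\<close> and \<open>D\<close> on functions of mean zero on the primitive vectors modulo \<open>N\<close> have a
  spectral gap that is uniform in \<open>N\<close>. This is an elementary version of the arguments of Sarnak--Xue
  and Gamburd. Splitting off the functions of level \<open>N div p\<close> and decomposing under the scalars, one
  may assume that \<open>f\<close> is new and a joint eigenfunction of the unit scalars. Being new forces the sum of
  \<open>\<bar>\<langle>f \<circ> h, f\<rangle>\<bar>\<^sup>2\<close> over all matrices \<open>h\<close> modulo \<open>N\<close> to be at most \<open>N\<^sup>3 \<parallel>f\<parallel>\<^sup>4\<close>, and the scalars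
  reduce this, over the matrices of determinant one, to almost \<open>N\<^sup>2 \<parallel>f\<parallel>\<^sup>4\<close>. If the average over the
  matrices of size about \<open>Q\<close> hardly moved \<open>f\<close>, then for \<open>Q\<^sup>n\<close> a suitable power of \<open>N\<close> too many pairs of
  words of length \<open>n\<close> would have congruent products. Indeed at most \<open>K\<^sup>n / \<parallel>g\<parallel>\<close> words have the product
  \<open>g\<close>, and there are few \<open>g\<close> congruent to the identity since their trace is \<open>2\<close> modulo \<open>N\<^sup>2\<close>. The gap
  passes to the random walk with steps \<open>A D\<close> and \<open>A\<^sup>2 D\<close>, which therefore reaches every primitive
  vector within \<open>O(log N)\<close> steps.

  For the graphs, take the fan with path \<open>1, \<dots>, n\<close>, some spokes, and one more spoke \<open>e\<close> to the end \<open>n\<close>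
  of the path. Doubling \<open>e\<close> acts on the pair of numbers of spanning trees of \<open>G/e\<close> and \<open>G-e\<close> as \<open>D\<close>,
  and moving \<open>e\<close> to a new end \<open>n + 1\<close> of the path acts as \<open>A\<close>. In a word \<open>A ^ i D \<dots>\<close> every \<open>D\<close> is
  followed by an extension of the path, so the graph stays simple.
\<close>

section \<open>Functions on vectors modulo \<open>N\<close>\<close>

text \<open>Averages over matrices of size about \<open>Q\<close> are used because their rate is
  nearly optimal: there are about \<open>Q^2\<close> such matrices, while the constant
  \<open>K\<close> of the overview is only about \<open>Q log Q\<close>. With
  \<open>R = (2 Q)^(2 n)\<close>, one large fixed \<open>Q\<close> thus loses at most a factor
  \<open>R^(1/50)\<close> against the ideal decay \<open>1 / R\<close>. Among all words of length
  \<open>2 n\<close>, the share of those congruent to the identity is at most about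
  \<open>R^(-49/50) (1 + R / N^3)\<close>, up to \<open>N^(1/10)\<close> and logarithms. The squared
  correlations contribute \<open>N^(101/50)\<close>. The trivial exponent 3 would just fail for
  every \<open>R\<close>; an exponent near 2 leaves the window from \<open>N^(5/2)\<close> to
  \<open>N^5\<close>, wide enough for \<open>n\<close> to be a power of two. Neither the spectral
  theorem nor representations of \<open>SL_2\<close> are used: eigenvalues are replaced by repeated
  squaring with Cauchy-Schwarz, and the large dimension of new representations by the vanishing of a
  kernel. The reductions to new forms and to eigenfunctions are orthogonal splittings valid for
  \<open>nsq\<close> and \<open>defect\<close> alike, so they cost nothing in the constant.\<close>

type_synonym ivec = "int \<times> int"
type_synonym imat = "int \<times> int \<times> int \<times> int"

fun act :: "imat \<Rightarrow> ivec \<Rightarrow> ivec" where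
  "act (a, b, c, d) (x, y) = (a * x + b * y, c * x + d * y)"

fun mmul :: "imat \<Rightarrow> imat \<Rightarrow> imat" where
  "mmul (a, b, c, d) (a', b', c', d') =
     (a * a' + b * c', a * b' + b * d', c * a' + d * c', c * b' + d * d')"

fun mdet :: "imat \<Rightarrow> int" where "mdet (a, b, c, d) = a * d - b * c"

fun madj :: "imat \<Rightarrow> imat" where "madj (a, b, c, d) = (d, - b, - c, a)"

fun smul :: "int \<Rightarrow> ivec \<Rightarrow> ivec" where "smul k (x, y) = (k * x, k * y)"

definition mone :: imat where "mone = (1, 0, 0, 1)"
definition mA :: imat where "mA = (1, 1, 0, 1)"
definition mD :: imat where "mD = (1, 0, 1, 1)"

lemma mdet_mmul: "mdet (mmul g h) = mdet g * mdet h"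
  by (cases g; cases h) (simp add: algebra_simps)

lemma act_mmul: "act (mmul g h) v = act g (act h v)"
  by (cases g; cases h; cases v) (simp add: algebra_simps)

lemma mmul_assoc: "mmul (mmul g h) k = mmul g (mmul h k)"
  by (cases g; cases h; cases k) (simp add: algebra_simps)

lemma mmul_mone [simp]: "mmul mone g = g" "mmul g mone = g"
  by (cases g; simp add: mone_def)+

lemma act_mone [simp]: "act mone v = v"
  by (cases v) (simp add: mone_def)

lemma mdet_madj [simp]: "mdet (madj g) = mdet g"
  by (cases g) simp

lemma madj_madj [simp]: "madj (madj g) = g"
  by (cases g) simp

lemma madj_mmul: "madj (mmul g h) = mmul (madj h) (madj g)"
  by (cases g; cases h) (simp add: algebra_simps)

lemma mmul_madj: "mdet g = 1 \<Longrightarrow> mmul g (madj g) = mone" "mdet g = 1 \<Longrightarrow> mmul (madj g) g = mone"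
  by (cases g; simp add: mone_def algebra_simps)+

lemma act_madj [simp]: "mdet g = 1 \<Longrightarrow> act g (act (madj g) v) = v"
    "mdet g = 1 \<Longrightarrow> act (madj g) (act g v) = v"
  by (simp_all flip: act_mmul add: mmul_madj)

lemma mdet_simps [simp]: "mdet mone = 1" "mdet mA = 1" "mdet mD = 1"
  by (simp_all add: mone_def mA_def mD_def)

lemma act_add: "act g (u + v) = act g u + act g v"
  by (cases g; cases u; cases v) (simp add: algebra_simps)

lemma act_smul: "act g (smul k v) = smul k (act g v)"
  by (cases g; cases v) (simp add: algebra_simps)

definition vmod :: "int \<Rightarrow> ivec \<Rightarrow> ivec" where "vmod N v = (fst v mod N, snd v mod N)"

definition zbox :: "int \<Rightarrow> ivec set" where "zbox N = {0..<N} \<times> {0..<N}"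

text \<open>Functions live on all integer vectors and are merely invariant under reduction, so that
  \<open>act\<close> and \<open>smul\<close> need no reduction modulo \<open>N\<close>; only the
  sums over \<open>zbox N\<close> see residues.\<close>

definition periodic :: "int \<Rightarrow> (ivec \<Rightarrow> 'a) \<Rightarrow> bool" where
  "periodic N f \<longleftrightarrow> (\<forall>v. f (vmod N v) = f v)"

text \<open>This is the condition for the residue of \<open>v\<close> to be a column of a
  determinant-one matrix modulo \<open>N\<close>; the integer gcd itself may exceed 1.\<close>

definition prim :: "int \<Rightarrow> ivec \<Rightarrow> bool" where
  "prim N v \<longleftrightarrow> coprime (gcd (fst v) (snd v)) N"

definition nsq :: "int \<Rightarrow> (ivec \<Rightarrow> complex) \<Rightarrow> real" where
  "nsq N f = (\<Sum>v\<in>zbox N. (cmod (f v))\<^sup>2)"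

text \<open>The Dirichlet form of the generators \<open>A\<close> and \<open>D\<close>: bounding it
  below by \<open>nsq\<close> is the spectral gap.\<close>

definition defect :: "int \<Rightarrow> (ivec \<Rightarrow> complex) \<Rightarrow> real" where
  "defect N f = nsq N (\<lambda>v. f (act mA v) - f v) + nsq N (\<lambda>v. f (act mD v) - f v)"

lemma finite_zbox [simp]: "finite (zbox N)"
  by (simp add: zbox_def)

lemma card_zbox: "N \<ge> 0 \<Longrightarrow> card (zbox N) = nat N ^ 2"
  by (simp add: zbox_def card_cartesian_product power2_eq_square)

lemma vmod_in_zbox: "N > 0 \<Longrightarrow> vmod N v \<in> zbox N"
  by (simp add: zbox_def vmod_def)

lemma vmod_zbox [simp]: "v \<in> zbox N \<Longrightarrow> vmod N v = v"
  by (auto simp: zbox_def vmod_def)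

lemma vmod_eq_iff: "vmod N u = vmod N v \<longleftrightarrow> N dvd fst u - fst v \<and> N dvd snd u - snd v"
  by (simp add: vmod_def mod_eq_dvd_iff)

lemma vmod_vmod [simp]: "vmod N (vmod N v) = vmod N v"
  by (simp add: vmod_def)

lemma vmod_dvd: "M dvd N \<Longrightarrow> vmod N u = vmod N v \<Longrightarrow> vmod M u = vmod M v"
  unfolding vmod_eq_iff by (meson dvd_trans)

lemma periodicD: "periodic N f \<Longrightarrow> vmod N u = vmod N v \<Longrightarrow> f u = f v"
  unfolding periodic_def by metis

lemma periodicI: "(\<And>u v. vmod N u = vmod N v \<Longrightarrow> f u = f v) \<Longrightarrow> periodic N f"
  unfolding periodic_def using vmod_vmod by blast

text \<open>Says that \<open>h\<close> descends to residue classes, which is what makes composition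
  with \<open>h\<close> preserve periodicity.\<close>

definition compat :: "int \<Rightarrow> (ivec \<Rightarrow> ivec) \<Rightarrow> bool" where
  "compat N h \<longleftrightarrow> (\<forall>u v. vmod N u = vmod N v \<longrightarrow> vmod N (h u) = vmod N (h v))"

lemma compatD: "compat N h \<Longrightarrow> vmod N u = vmod N v \<Longrightarrow> vmod N (h u) = vmod N (h v)"
  unfolding compat_def by blast

lemma periodic_comp: "periodic N f \<Longrightarrow> compat N h \<Longrightarrow> periodic N (\<lambda>v. f (h v))"
  by (intro periodicI) (meson compatD periodicD)

lemma compat_act: "compat N (act g)"
proof -
  obtain a b c d where g: "g = (a, b, c, d)" by (cases g)
  have *: "N dvd (p * x + q * y) - (p * x' + q * y')"
    if "N dvd x - x'" "N dvd y - y'" for p q x x' y y'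
  proof -
    have "(p * x + q * y) - (p * x' + q * y') = p * (x - x') + q * (y - y')"
      by (simp add: algebra_simps)
    then show ?thesis using that by simp
  qed
  show ?thesis
    unfolding compat_def vmod_eq_iff g split_paired_All act.simps fst_conv snd_conv
    using * by blast
qed

lemma compat_smul: "compat N (smul k)"
proof -
  have "smul k = act (k, 0, 0, k)"
    by (auto simp: fun_eq_iff)
  then show ?thesis by (simp add: compat_act)
qed

lemma compat_plus: "compat N (\<lambda>v. v + w)"
  by (simp add: compat_def vmod_eq_iff)

lemma compat_plus_left: "compat N (\<lambda>v. w + v)"
  by (simp add: compat_def vmod_eq_iff)

lemma compat_comp: "compat N h \<Longrightarrow> compat N k \<Longrightarrow> compat N (\<lambda>v. h (k v))"
  unfolding compat_def by blast

lemma sum_zbox_reindex: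
  fixes F :: "ivec \<Rightarrow> 'a :: comm_monoid_add"
  assumes "N > 0" "periodic N F" "compat N h" "compat N k"
    and hk: "\<And>v. vmod N (h (k v)) = vmod N v" and kh: "\<And>v. vmod N (k (h v)) = vmod N v"
  shows "(\<Sum>v\<in>zbox N. F (h v)) = (\<Sum>v\<in>zbox N. F v)"
proof (rule sum.reindex_bij_witness[of _ "\<lambda>v. vmod N (k v)" "\<lambda>v. vmod N (h v)"])
  fix v assume v: "v \<in> zbox N"
  have "vmod N (k (vmod N (h v))) = vmod N (k (h v))" "vmod N (h (vmod N (k v))) = vmod N (h (k v))"
    using assms(3,4) unfolding compat_def by (meson vmod_vmod)+
  then show "vmod N (k (vmod N (h v))) = v" "vmod N (h (vmod N (k v))) = v"
    using hk[of v] kh[of v] v by simp_all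
  show "F (vmod N (h v)) = F (h v)"
    using assms(2) unfolding periodic_def by blast
qed (use \<open>N > 0\<close> in \<open>auto intro: vmod_in_zbox\<close>)

text \<open>Determinant one is asked for only modulo \<open>N\<close>, since the change of basis in
  \<open>kern_coordinates\<close> is invertible only there; the adjugate is then an inverse on
  residues.\<close>

lemma sum_zbox_act:
  fixes F :: "ivec \<Rightarrow> 'a :: comm_monoid_add"
  assumes "N > 0" "periodic N F" "N dvd mdet g - 1"
  shows "(\<Sum>v\<in>zbox N. F (act g v)) = (\<Sum>v\<in>zbox N. F v)"
proof (rule sum_zbox_reindex[where k = "act (madj g)"])
  obtain a b c d where g: "g = (a, b, c, d)" by (cases g)
  have *: "act g (act (madj g) v) = smul (mdet g) v" "act (madj g) (act g v) = smul (mdet g) v" for v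
    by (cases v; simp add: g algebra_simps)+
  have "vmod N (smul (mdet g) v) = vmod N v" for v
  proof (cases v)
    case (Pair x y)
    have "mdet g * x - x = (mdet g - 1) * x" "mdet g * y - y = (mdet g - 1) * y"
      by (simp_all add: algebra_simps)
    then show ?thesis using assms(3) Pair by (simp add: vmod_eq_iff)
  qed
  then show "vmod N (act g (act (madj g) v)) = vmod N v" "vmod N (act (madj g) (act g v)) = vmod N v" for v
    by (simp_all add: *)
qed (use assms in \<open>auto intro: compat_act\<close>)

lemma sum_zbox_shift:
  fixes F :: "ivec \<Rightarrow> 'a :: comm_monoid_add"
  assumes "N > 0" "periodic N F"
  shows "(\<Sum>v\<in>zbox N. F (v + w)) = (\<Sum>v\<in>zbox N. F v)"
  using assms by (intro sum_zbox_reindex[where k = "\<lambda>v. v + (- w)"] compat_plus) auto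

lemma sum_zbox_smul:
  fixes F :: "ivec \<Rightarrow> 'a :: comm_monoid_add"
  assumes "N > 0" "periodic N F" "coprime t N"
  shows "(\<Sum>v\<in>zbox N. F (smul t v)) = (\<Sum>v\<in>zbox N. F v)"
proof -
  obtain s where s: "[t * s = 1] (mod N)"
    using cong_solve_coprime_int[OF assms(3)] by auto
  have st: "N dvd t * s - 1"
    using s by (simp add: cong_iff_dvd_diff)
  have *: "vmod N (smul (t * s) v) = vmod N v" for v
  proof (cases v)
    case (Pair x y)
    have "t * s * x - x = (t * s - 1) * x" "t * s * y - y = (t * s - 1) * y"
      by (simp_all add: algebra_simps)
    then show ?thesis using st Pair by (simp add: vmod_eq_iff)
  qed
  have "smul t (smul s v) = smul (t * s) v" "smul s (smul t v) = smul (t * s) v" for v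
    by (cases v; simp)+
  then show ?thesis
    using assms compat_smul * by (intro sum_zbox_reindex[where k = "smul s"]) auto
qed

lemma prim_cong:
  assumes "vmod N u = vmod N v"
  shows "prim N u \<longleftrightarrow> prim N v"
proof -
  have *: "c dvd fst u \<longleftrightarrow> c dvd fst v" "c dvd snd u \<longleftrightarrow> c dvd snd v" if "c dvd N" for c
    using assms that by (metis vmod_def dvd_mod_iff prod.inject)+
  show ?thesis
    unfolding prim_def coprime_def gcd_greatest_iff using * by blast
qed

lemma prim_act_imp: "mdet g = 1 \<Longrightarrow> prim N (act g v) \<Longrightarrow> prim N v"
proof -
  assume "prim N (act g v)"
  obtain a b c d where g: "g = (a, b, c, d)" by (cases g)
  have "gcd (fst v) (snd v) dvd gcd (fst (act g v)) (snd (act g v))"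
    by (cases v) (simp add: g)
  then show ?thesis
    using \<open>prim N (act g v)\<close> unfolding prim_def by (meson coprime_divisors dvd_refl)
qed

lemma prim_act: "mdet g = 1 \<Longrightarrow> prim N (act g v) \<longleftrightarrow> prim N v"
  using prim_act_imp[of g N v] prim_act_imp[of "madj g" N "act g v"] by auto

lemma prim_smul: "coprime t N \<Longrightarrow> prim N (smul t v) \<longleftrightarrow> prim N v"
  by (cases v) (simp add: prim_def gcd_mult_left)

lemma nsq_nonneg: "nsq N f \<ge> 0"
  by (simp add: nsq_def sum_nonneg)

lemma defect_nonneg: "defect N f \<ge> 0"
  by (simp add: defect_def nsq_nonneg)

lemma nsq_act: "N > 0 \<Longrightarrow> periodic N f \<Longrightarrow> mdet g = 1 \<Longrightarrow> nsq N (\<lambda>v. f (act g v)) = nsq N f"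
  unfolding nsq_def by (rule sum_zbox_act) (auto simp: periodic_def)

lemma nsq_smul: "N > 0 \<Longrightarrow> periodic N f \<Longrightarrow> coprime t N \<Longrightarrow> nsq N (\<lambda>v. f (smul t v)) = nsq N f"
  unfolding nsq_def by (rule sum_zbox_smul) (auto simp: periodic_def)

section \<open>The divisor bound\<close>

definition ndiv :: "nat \<Rightarrow> nat" where "ndiv n = card {k. k dvd n}"

lemma ndiv_prime_power_mult:
  assumes "prime p" "m > 0"
  shows "ndiv (p ^ a * m) \<le> (a + 1) * ndiv m"
proof -
  have "{k. k dvd p ^ a * m} \<subseteq> (\<lambda>(i, k). p ^ i * k) ` ({..a} \<times> {k. k dvd m})"
  proof
    fix k assume "k \<in> {k. k dvd p ^ a * m}"
    then obtain b c where bc: "k = b * c" "b dvd p ^ a" "c dvd m"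
      using division_decomp by blast
    then obtain i where "i \<le> a" "b = p ^ i"
      using divides_primepow_nat[OF assms(1)] by blast
    then show "k \<in> (\<lambda>(i, k). p ^ i * k) ` ({..a} \<times> {k. k dvd m})"
      using bc by force
  qed
  moreover have fin: "finite {k. k dvd m}"
    using assms(2) by simp
  ultimately have "ndiv (p ^ a * m) \<le> card ((\<lambda>(i, k). p ^ i * k) ` ({..a} \<times> {k. k dvd m}))"
    unfolding ndiv_def by (intro card_mono) auto
  also have "\<dots> \<le> card ({..a} \<times> {k. k dvd m})"
    using fin by (intro card_image_le) auto
  also have "\<dots> = (a + 1) * ndiv m"
    by (simp add: card_cartesian_product ndiv_def)
  finally show ?thesis .
qed

lemma Suc_le_two_powr:
  fixes \<epsilon> :: real
  assumes "\<epsilon> > 0"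
  obtains C :: real where "C \<ge> 1" "\<And>a :: nat. real a + 1 \<le> C * 2 powr (\<epsilon> * a)"
proof
  define C where "C = max 1 (1 / (\<epsilon> * ln 2))"
  show "C \<ge> 1" by (simp add: C_def)
  fix a :: nat
  have pos: "\<epsilon> * ln 2 > 0" using assms by simp
  have "real a + 1 \<le> C * (1 + \<epsilon> * a * ln 2)"
  proof -
    have "1 \<le> C * (\<epsilon> * ln 2)"
    proof -
      have "1 = (1 / (\<epsilon> * ln 2)) * (\<epsilon> * ln 2)" using assms by simp
      also have "\<dots> \<le> C * (\<epsilon> * ln 2)"
        using pos by (intro mult_right_mono) (auto simp: C_def)
      finally show ?thesis .
    qed
    then have "real a * 1 \<le> real a * (C * (\<epsilon> * ln 2))"
      by (intro mult_left_mono) auto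
    moreover have "1 \<le> C" by (simp add: C_def)
    ultimately show ?thesis by (simp add: algebra_simps)
  qed
  also have "\<dots> \<le> C * exp (\<epsilon> * a * ln 2)"
    using exp_ge_add_one_self[of "\<epsilon> * a * ln 2"] by (intro mult_left_mono) (auto simp: C_def)
  also have "exp (\<epsilon> * a * ln 2) = 2 powr (\<epsilon> * a)"
    by (simp add: powr_def)
  finally show "real a + 1 \<le> C * 2 powr (\<epsilon> * a)" .
qed

text \<open>One whole prime power \<open>p^a\<close> is split off at a time, which multiplies the
  count by at most \<open>a + 1\<close>. For \<open>p > B\<close> one has
  \<open>p^\<epsilon> \<ge> 2\<close>, so \<open>a + 1 \<le> 2^a\<close> is absorbed by
  \<open>(p^a)^\<epsilon>\<close>; only the boundedly many primes up to \<open>B\<close> cost a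
  factor \<open>C\<close>.\<close>

lemma ndiv_le_powr_aux:
  fixes \<epsilon> C :: real and B :: nat
  assumes "\<epsilon> > 0" "C \<ge> 1" and C: "\<And>a :: nat. real a + 1 \<le> C * 2 powr (\<epsilon> * a)"
    and B: "2 powr (1 / \<epsilon>) \<le> B" and "n > 0"
  shows "real (ndiv n) \<le> C ^ card {p. prime p \<and> p dvd n \<and> p \<le> B} * n powr \<epsilon>"
  using \<open>n > 0\<close>
proof (induction n rule: less_induct)
  case (less n)
  show ?case
  proof (cases "n = 1")
    case True
    have "{k :: nat. k dvd 1} = {1}" by auto
    then show ?thesis using True assms(2) by (simp add: ndiv_def one_le_power)
  next
    case False
    then obtain p where p: "prime p" "p dvd n"
      using prime_factor_nat by blast
    obtain a m where "\<not> p dvd m" "n = m * p ^ a"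
      using prime_power_canonical[OF p(1) less.prems] by blast
    then have nm: "n = p ^ a * m" "\<not> p dvd m" by simp_all
    have a: "a > 0" using nm p by (cases a) auto
    have m: "m > 0" using nm less.prems by (cases m) auto
    have "p ^ a > 1" using one_less_power[OF prime_gt_1_nat[OF p(1)] a] .
    then have "m < n" using nm m by simp
    let ?S = "\<lambda>n. {p. prime p \<and> p dvd n \<and> p \<le> B}"
    have IH: "real (ndiv m) \<le> C ^ card (?S m) * m powr \<epsilon>"
      using less.IH[OF \<open>m < n\<close> m] .
    have fin: "finite (?S n)" for n by (rule finite_subset[of _ "{..B}"]) auto
    have p2: "p \<ge> 2" using p(1) by (simp add: prime_ge_2_nat)
    have pa: "real (p ^ a) powr \<epsilon> = real p powr (\<epsilon> * real a)"
    proof -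
      have "real (p ^ a) = real p powr real a" using p2 by (simp add: powr_realpow)
      then show ?thesis by (simp add: powr_powr mult.commute)
    qed
    have le: "(real a + 1) * C ^ card (?S m) \<le> C ^ card (?S n) * (p ^ a) powr \<epsilon>"
    proof (cases "p \<le> B")
      case True
      have "?S n \<supseteq> insert p (?S m)" using True p nm by auto
      then have "card (insert p (?S m)) \<le> card (?S n)"
        using fin by (intro card_mono) auto
      moreover have "card (insert p (?S m)) = Suc (card (?S m))"
        using fin nm(2) by simp
      ultimately have "C ^ Suc (card (?S m)) \<le> C ^ card (?S n)"
        using assms(2) by (intro power_increasing) auto
      moreover have "real a + 1 \<le> C * (p ^ a) powr \<epsilon>"
      proof -
        have "2 powr (\<epsilon> * a) \<le> p powr (\<epsilon> * a)"
          using p2 assms(1) by (intro powr_mono2) auto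
        also have "\<dots> = (p ^ a) powr \<epsilon>"
          using pa by simp
        finally have "C * 2 powr (\<epsilon> * a) \<le> C * (p ^ a) powr \<epsilon>"
          using assms(2) by (intro mult_left_mono) auto
        then show ?thesis using C[of a] by linarith
      qed
      ultimately have "(real a + 1) * C ^ card (?S m) \<le> (C * (p ^ a) powr \<epsilon>) * C ^ card (?S m)"
        using assms(2) by (intro mult_right_mono) auto
      also have "\<dots> = C ^ Suc (card (?S m)) * (p ^ a) powr \<epsilon>" by simp
      also have "\<dots> \<le> C ^ card (?S n) * (p ^ a) powr \<epsilon>"
        using \<open>C ^ Suc (card (?S m)) \<le> C ^ card (?S n)\<close> by (intro mult_right_mono) auto
      finally show ?thesis .
    next
      case False
      then have "real p > 2 powr (1 / \<epsilon>)" using B by linarith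
      then have "real p powr \<epsilon> \<ge> (2 powr (1 / \<epsilon>)) powr \<epsilon>"
        using assms(1) by (intro powr_mono2) auto
      then have "real p powr \<epsilon> \<ge> 2" using assms(1) by (simp add: powr_powr)
      then have "(real p powr \<epsilon>) ^ a \<ge> 2 ^ a"
        by (intro power_mono) auto
      moreover have "(real p powr \<epsilon>) ^ a = (p ^ a) powr \<epsilon>"
      proof -
        have "(real p powr \<epsilon>) ^ a = real p powr (\<epsilon> * real a)"
          using p2 by (simp add: powr_powr flip: powr_realpow)
        then show ?thesis using pa by simp
      qed
      moreover have "real a + 1 \<le> 2 ^ a"
      proof -
        have "Suc a \<le> 2 ^ a" by (simp add: Suc_leI)
        then have "real (Suc a) \<le> real (2 ^ a)" by (rule of_nat_mono)
        then show ?thesis by simp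
      qed
      ultimately have *: "real a + 1 \<le> (p ^ a) powr \<epsilon>" by linarith
      have "card (?S m) \<le> card (?S n)"
        using fin nm by (intro card_mono) auto
      then have "C ^ card (?S m) \<le> C ^ card (?S n)"
        using assms(2) by (intro power_increasing) auto
      then have "(real a + 1) * C ^ card (?S m) \<le> (p ^ a) powr \<epsilon> * C ^ card (?S n)"
        using * assms(2) by (intro mult_mono) auto
      then show ?thesis by (simp add: mult.commute)
    qed
    have "real (ndiv n) \<le> (real a + 1) * real (ndiv m)"
    proof -
      have "ndiv n \<le> (a + 1) * ndiv m"
        using ndiv_prime_power_mult[OF p(1) m, of a] nm by simp
      then have "real (ndiv n) \<le> real ((a + 1) * ndiv m)" by (rule of_nat_mono)
      then show ?thesis by (simp add: algebra_simps)
    qed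
    also have "\<dots> \<le> (real a + 1) * (C ^ card (?S m) * m powr \<epsilon>)"
      using IH by (intro mult_left_mono) auto
    also have "\<dots> = (real a + 1) * C ^ card (?S m) * m powr \<epsilon>" by simp
    also have "\<dots> \<le> C ^ card (?S n) * (p ^ a) powr \<epsilon> * m powr \<epsilon>"
      using le by (intro mult_right_mono) auto
    also have "\<dots> = C ^ card (?S n) * n powr \<epsilon>"
      using nm by (simp add: powr_mult)
    finally show ?thesis .
  qed
qed

lemma ndiv_le_powr:
  fixes \<epsilon> :: real
  assumes "\<epsilon> > 0"
  obtains C :: real where "C \<ge> 1" "\<And>n. n > 0 \<Longrightarrow> real (ndiv n) \<le> C * n powr \<epsilon>"
proof -
  obtain C :: real where C: "C \<ge> 1" "\<And>a :: nat. real a + 1 \<le> C * 2 powr (\<epsilon> * a)"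
    using Suc_le_two_powr[OF assms] by blast
  obtain B :: nat where B: "2 powr (1 / \<epsilon>) \<le> B"
    using real_arch_simple by blast
  show ?thesis
  proof (rule that[of "C ^ (B + 1)"])
    fix n :: nat assume n: "n > 0"
    have "card {p. prime p \<and> p dvd n \<and> p \<le> B} \<le> card {..B}"
      by (intro card_mono) auto
    then have "C ^ card {p. prime p \<and> p dvd n \<and> p \<le> B} \<le> C ^ (B + 1)"
      using C(1) by (intro power_increasing) auto
    then have "C ^ card {p. prime p \<and> p dvd n \<and> p \<le> B} * n powr \<epsilon> \<le> C ^ (B + 1) * n powr \<epsilon>"
      by (intro mult_right_mono) auto
    then show "real (ndiv n) \<le> C ^ (B + 1) * n powr \<epsilon>"
      using ndiv_le_powr_aux[OF assms C B n] by linarith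
  qed (rule one_le_power[OF C(1)])
qed

lemma le_ndiv_mult_totient:
  assumes "n > 0"
  shows "n \<le> ndiv n * totient n"
proof -
  have "n = (\<Sum>d | d dvd n. totient d)"
    by (simp add: totient_divisor_sum)
  also have "\<dots> \<le> (\<Sum>d | d dvd n. totient n)"
    using assms by (intro sum_mono dvd_imp_le totient_dvd) auto
  also have "\<dots> = ndiv n * totient n"
    by (simp add: ndiv_def)
  finally show ?thesis .
qed

section \<open>Correlations of new forms\<close>

text \<open>Orthogonality to all functions of level \<open>N div p\<close>: the sum runs over the
  fibre of \<open>z\<close> under reduction modulo \<open>N div p\<close>. Primes suffice, as they
  give the maximal proper divisors.\<close>

definition new_form :: "int \<Rightarrow> (ivec \<Rightarrow> complex) \<Rightarrow> bool" where
  "new_form N f \<longleftrightarrow>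
     (\<forall>p z. prime p \<longrightarrow> p dvd N \<longrightarrow> (\<Sum>w\<in>zbox p. f (z + smul (N div p) w)) = 0)"

lemma smul_add_right: "smul k (u + v) = smul k u + smul k v"
  by (cases u; cases v) (simp add: algebra_simps)

lemma smul_smul: "smul k (smul l v) = smul (k * l) v"
  by (cases v) simp

text \<open>With \<open>g = gcd d N\<close>, some prime \<open>p\<close> divides
  \<open>N div g\<close>. Translating the summation variable by \<open>smul m w\<close> moves along
  a fibre modulo \<open>N div p\<close>, up to the factor \<open>d'\<close>, which is a unit modulo
  \<open>p\<close>; averaging over \<open>w\<close> gives zero.\<close>

lemma new_form_sum_zero:
  assumes N: "N > 0" and per: "periodic N f" and new: "new_form N f" and d: "\<not> N dvd d"
  shows "(\<Sum>w\<in>zbox N. f (z + smul d w)) = 0"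
proof -
  define g where "g = gcd d N"
  have g: "g > 0" using N by (simp add: g_def)
  define d' n where "d' = d div g" and "n = N div g"
  have dg: "d = g * d'" and Ng: "N = g * n"
    by (simp_all add: d'_def n_def g_def)
  have cop: "coprime d' n"
    unfolding d'_def n_def g_def using N by (intro div_gcd_coprime) auto
  have "n > 0" using N g Ng by (simp add: zero_less_mult_iff)
  moreover have "n \<noteq> 1" using Ng dg d by auto
  ultimately obtain p where p: "prime p" "p dvd n"
    using prime_factor_int[of n] by auto
  then obtain m where m: "n = p * m" by auto
  have p0: "p > 0" using p(1) by (simp add: prime_gt_0_int)
  have Np: "N div p = g * m"
    using p0 by (simp add: Ng m)
  have pd: "coprime d' p" using cop p(2) by (meson coprime_divisors dvd_refl)
  define S where "S = (\<Sum>u\<in>zbox N. f (z + smul d u))"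
  have S_shift: "S = (\<Sum>u\<in>zbox N. f (z + smul d u + smul (N div p) (smul d' w)))" for w
  proof -
    have "periodic N (\<lambda>u. f (z + smul d u))"
      by (intro periodic_comp[OF per] compat_comp[OF compat_plus_left compat_smul])
    then have "S = (\<Sum>u\<in>zbox N. f (z + smul d (u + smul m w)))"
      unfolding S_def using N by (subst sum_zbox_shift) auto
    also have "\<dots> = (\<Sum>u\<in>zbox N. f (z + smul d u + smul (N div p) (smul d' w)))"
      by (simp add: smul_add_right smul_smul Np dg add.assoc mult_ac)
    finally show ?thesis .
  qed
  have "of_nat (card (zbox p)) * S = (\<Sum>w\<in>zbox p. S)"
    by simp
  also have "\<dots> = (\<Sum>w\<in>zbox p. \<Sum>u\<in>zbox N. f (z + smul d u + smul (N div p) (smul d' w)))"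
    by (rule sum.cong[OF refl S_shift])
  also have "\<dots> = (\<Sum>u\<in>zbox N. \<Sum>w\<in>zbox p. f (z + smul d u + smul (N div p) (smul d' w)))"
    by (rule sum.swap)
  also have "\<dots> = (\<Sum>u\<in>zbox N. \<Sum>w\<in>zbox p. f (z + smul d u + smul (N div p) w))"
  proof (rule sum.cong[OF refl])
    fix u
    have "periodic p (\<lambda>w. f (z + smul d u + smul (N div p) w))"
    proof (rule periodicI)
      fix w w' assume "vmod p w = vmod p w'"
      then have "p dvd fst w - fst w'" "p dvd snd w - snd w'"
        by (simp_all add: vmod_eq_iff)
      then have "g * m * p dvd g * m * (fst w - fst w')" "g * m * p dvd g * m * (snd w - snd w')"
        by (simp_all only: mult_dvd_mono dvd_refl)
      moreover have "g * m * p = N" using Ng m by simp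
      ultimately have "vmod N (z + smul d u + smul (N div p) w) = vmod N (z + smul d u + smul (N div p) w')"
        by (cases w; cases w'; simp add: vmod_eq_iff Np algebra_simps)
      then show "f (z + smul d u + smul (N div p) w) = f (z + smul d u + smul (N div p) w')"
        by (rule periodicD[OF per])
    qed
    then show "(\<Sum>w\<in>zbox p. f (z + smul d u + smul (N div p) (smul d' w))) =
        (\<Sum>w\<in>zbox p. f (z + smul d u + smul (N div p) w))"
      using sum_zbox_smul[OF p0 _ pd] by blast
  qed
  also have "\<dots> = 0"
  proof -
    have "p dvd N" using p(2) Ng by simp
    then have "(\<Sum>w\<in>zbox p. f (x + smul (N div p) w)) = 0" for x
      using new p(1) unfolding new_form_def by blast
    then show ?thesis by simp
  qed
  finally have "S = 0"
    using p0 card_zbox[of p] by simp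
  then show ?thesis by (simp add: S_def)
qed

section \<open>Sums of squared correlations over all matrices modulo \<open>N\<close>\<close>

fun dot :: "ivec \<Rightarrow> ivec \<Rightarrow> int" where "dot (a, b) (x, y) = a * x + b * y"

text \<open>The inner product with \<open>g\<close> of \<open>f\<close> composed with the matrix
  whose rows are \<open>r\<close> and \<open>s\<close>.\<close>

definition corr :: "int \<Rightarrow> (ivec \<Rightarrow> complex) \<Rightarrow> (ivec \<Rightarrow> complex) \<Rightarrow> ivec \<Rightarrow> ivec \<Rightarrow> complex" where
  "corr N f g r s = (\<Sum>u\<in>zbox N. f (dot r u, dot s u) * cnj (g u))"

text \<open>The kernel that appears when squared correlations are expanded and the sum over all
  matrices, singular ones included, is carried out first.\<close>

definition kern :: "int \<Rightarrow> (ivec \<Rightarrow> complex) \<Rightarrow> ivec \<Rightarrow> ivec \<Rightarrow> complex" where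
  "kern N f u v =
     (\<Sum>r\<in>zbox N. \<Sum>s\<in>zbox N. f (dot r u, dot s u) * cnj (f (dot r v, dot s v)))"

text \<open>Passes from the rows of a 2 by 2 matrix to its columns.\<close>

lemma zbox_sum_swap:
  fixes F :: "int \<Rightarrow> int \<Rightarrow> int \<Rightarrow> int \<Rightarrow> 'a :: comm_monoid_add"
  shows "(\<Sum>r\<in>zbox N. \<Sum>s\<in>zbox N. F (fst r) (fst s) (snd r) (snd s)) =
         (\<Sum>k\<in>zbox N. \<Sum>l\<in>zbox N. F (fst k) (snd k) (fst l) (snd l))"
proof -
  let ?I = "{0..<N}"
  have "(\<Sum>r\<in>zbox N. \<Sum>s\<in>zbox N. F (fst r) (fst s) (snd r) (snd s)) =
        (\<Sum>a\<in>?I. \<Sum>b\<in>?I. \<Sum>c\<in>?I. \<Sum>d\<in>?I. F a c b d)"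
    by (simp add: zbox_def sum.cartesian_product' case_prod_unfold)
  also have "\<dots> = (\<Sum>a\<in>?I. \<Sum>c\<in>?I. \<Sum>b\<in>?I. \<Sum>d\<in>?I. F a c b d)"
    by (intro sum.cong refl sum.swap)
  also have "\<dots> = (\<Sum>k\<in>zbox N. \<Sum>l\<in>zbox N. F (fst k) (snd k) (fst l) (snd l))"
    by (simp add: zbox_def sum.cartesian_product' case_prod_unfold)
  finally show ?thesis .
qed

lemma prim_complement:
  assumes "prim N u"
  obtains y z where "N dvd fst u * z - snd u * y - 1"
proof -
  define g where "g = gcd (fst u) (snd u)"
  obtain p q where pq: "g = p * fst u + q * snd u"
    unfolding g_def using bezout_int[of "fst u" "snd u"] by metis
  have "coprime g N" using assms by (simp add: prim_def g_def)
  then obtain s where "[g * s = 1] (mod N)"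
    using cong_solve_coprime_int by blast
  then have "N dvd g * s - 1" by (simp add: cong_iff_dvd_diff)
  moreover have "g * s - 1 = fst u * (p * s) - snd u * (- q * s) - 1"
    by (simp add: pq algebra_simps)
  ultimately show ?thesis using that by metis
qed

text \<open>Completing \<open>u\<close> to a basis modulo \<open>N\<close> and substituting in both
  rows makes \<open>u\<close> the first basis vector, so the kernel sees \<open>v\<close> only
  through its coordinates \<open>t\<close> and \<open>d\<close>, where \<open>d\<close> is the
  determinant of \<open>u\<close> and \<open>v\<close>. The columns of the transformed matrix become
  the summation variables \<open>k\<close> and \<open>l\<close>.\<close>

lemma kern_coordinates:
  assumes N: "N > 0" and per: "periodic N f" and u: "prim N u"
  obtains t d w where "vmod N v = vmod N (smul t u + smul d w)"
    "kern N f u v = (\<Sum>k\<in>zbox N. f k * (\<Sum>l\<in>zbox N. cnj (f (smul t k + smul d l))))"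
proof -
  obtain y z where yz: "N dvd fst u * z - snd u * y - 1"
    using prim_complement[OF u] by blast
  define a b where "a = fst u" and "b = snd u"
  define t d where "t = z * fst v - y * snd v" and "d = - b * fst v + a * snd v"
  \<comment> \<open>Chosen so that \<open>dot (act M r) u\<close> is congruent to
    \<open>fst r\<close>.\<close>
  define M where "M = (z, - b, - y, a)"
  have detM: "N dvd mdet M - 1"
    using yz by (simp add: M_def a_def b_def algebra_simps)
  let ?F = "\<lambda>r s. f (dot r u, dot s u) * cnj (f (dot r v, dot s v))"
  have dot_cong: "N dvd dot r x - dot r' x" if "vmod N r = vmod N r'" for r r' x
  proof -
    have "dot r x - dot r' x = (fst r - fst r') * fst x + (snd r - snd r') * snd x"
      by (cases r; cases r'; cases x) (simp add: algebra_simps)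
    then show ?thesis using that by (simp add: vmod_eq_iff)
  qed
  have p1: "periodic N (\<lambda>r. ?F r s)" for s
    by (rule periodicI, rule arg_cong2[where f = "\<lambda>x y. x * cnj y"])
      (rule periodicD[OF per], simp add: vmod_eq_iff dot_cong)+
  have p2: "periodic N (\<lambda>s. ?F r s)" for r
    by (rule periodicI, rule arg_cong2[where f = "\<lambda>x y. x * cnj y"])
      (rule periodicD[OF per], simp add: vmod_eq_iff dot_cong)+
  have p3: "periodic N (\<lambda>r. \<Sum>s\<in>zbox N. ?F r s)"
    using p1 by (intro periodicI sum.cong refl) (rule periodicD)
  have du: "N dvd dot (act M r) u - fst r" for r
  proof -
    obtain p q where r: "r = (p, q)" by (cases r)
    have "dot (act M r) u - fst r = (fst u * z - snd u * y - 1) * p"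
      by (cases u) (simp add: r M_def a_def b_def algebra_simps)
    then show ?thesis using yz by simp
  qed
  have dv: "dot (act M r) v = t * fst r + d * snd r" for r
    by (cases r; cases v) (simp add: M_def t_def d_def algebra_simps)
  have "kern N f u v = (\<Sum>r\<in>zbox N. \<Sum>s\<in>zbox N. ?F (act M r) s)"
    unfolding kern_def using sum_zbox_act[OF N p3 detM] by simp
  also have "\<dots> = (\<Sum>r\<in>zbox N. \<Sum>s\<in>zbox N. ?F (act M r) (act M s))"
    using sum_zbox_act[OF N p2 detM] by simp
  also have "\<dots> = (\<Sum>r\<in>zbox N. \<Sum>s\<in>zbox N.
      f (fst r, fst s) * cnj (f (t * fst r + d * snd r, t * fst s + d * snd s)))"
  proof (intro sum.cong refl)
    fix r s
    have "f (dot (act M r) u, dot (act M s) u) = f (fst r, fst s)"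
      by (rule periodicD[OF per]) (simp add: vmod_eq_iff du)
    then show "?F (act M r) (act M s) =
        f (fst r, fst s) * cnj (f (t * fst r + d * snd r, t * fst s + d * snd s))"
      by (simp add: dv)
  qed
  also have "\<dots> = (\<Sum>k\<in>zbox N. \<Sum>l\<in>zbox N.
      f (fst k, snd k) * cnj (f (t * fst k + d * fst l, t * snd k + d * snd l)))"
    by (rule zbox_sum_swap[where F = "\<lambda>a c b e. f (a, c) * cnj (f (t * a + d * b, t * c + d * e))"])
  also have "\<dots> = (\<Sum>k\<in>zbox N. f k * (\<Sum>l\<in>zbox N. cnj (f (smul t k + smul d l))))"
    unfolding sum_distrib_left
    by (intro sum.cong refl) (auto simp: plus_prod_def split: prod.splits)
  finally have K: "kern N f u v = (\<Sum>k\<in>zbox N. f k * (\<Sum>l\<in>zbox N. cnj (f (smul t k + smul d l))))" .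
  have "vmod N v = vmod N (smul t u + smul d (y, z))"
  proof -
    have "fst v - fst (smul t u + smul d (y, z)) = - (fst u * z - snd u * y - 1) * fst v"
      "snd v - snd (smul t u + smul d (y, z)) = - (fst u * z - snd u * y - 1) * snd v"
      by (cases u; cases v; simp add: t_def d_def a_def b_def algebra_simps)+
    then show ?thesis unfolding vmod_eq_iff using yz by (metis dvd_minus_iff dvd_mult2)
  qed
  then show ?thesis using K that by blast
qed

lemma prim_smul_imp_coprime: "prim N (smul t u) \<Longrightarrow> coprime t N"
  unfolding prim_def by (cases u) (metis coprime_mult_left_iff fst_conv gcd_mult_left normalize_mult
      snd_conv smul.simps coprime_normalize_left_iff)

lemma mult_le_half_squares: "x * y \<le> (x\<^sup>2 + y\<^sup>2) / (2 :: real)"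
  using sum_squares_bound[of x y] by simp

lemma norm_sum_mult_le:
  fixes f g :: "'a \<Rightarrow> complex"
  shows "norm (\<Sum>x\<in>A. f x * g x) \<le> ((\<Sum>x\<in>A. (norm (f x))\<^sup>2) + (\<Sum>x\<in>A. (norm (g x))\<^sup>2)) / 2"
proof -
  have "norm (\<Sum>x\<in>A. f x * g x) \<le> (\<Sum>x\<in>A. norm (f x) * norm (g x))"
    by (rule order_trans[OF norm_sum]) (simp add: norm_mult)
  also have "\<dots> \<le> (\<Sum>x\<in>A. ((norm (f x))\<^sup>2 + (norm (g x))\<^sup>2) / 2)"
    by (intro sum_mono mult_le_half_squares)
  finally show ?thesis by (simp add: sum.distrib sum_divide_distrib[symmetric])
qed

text \<open>Unless \<open>N\<close> divides \<open>d\<close>, newness kills the inner sum over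
  \<open>l\<close>. If it does, \<open>v\<close> is congruent to \<open>t\<close> times
  \<open>u\<close>, primitivity makes \<open>t\<close> a unit, and the \<open>N^2\<close> equal
  inner terms leave a correlation of \<open>f\<close> with its scaling by \<open>t\<close>.\<close>

lemma norm_kern_le:
  assumes N: "N > 0" and per: "periodic N f" and new: "new_form N f"
    and u: "prim N u" and v: "prim N v"
  shows "norm (kern N f u v) \<le>
    (if \<exists>t\<in>{0..<N}. coprime t N \<and> vmod N v = vmod N (smul t u) then (real_of_int N)\<^sup>2 * nsq N f else 0)"
proof -
  obtain t d w where vt: "vmod N v = vmod N (smul t u + smul d w)"
    and K: "kern N f u v = (\<Sum>k\<in>zbox N. f k * (\<Sum>l\<in>zbox N. cnj (f (smul t k + smul d l))))"
    using kern_coordinates[OF N per u] by blast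
  show ?thesis
  proof (cases "N dvd d")
    case False
    have "(\<Sum>l\<in>zbox N. cnj (f (smul t k + smul d l))) = 0" for k
      using new_form_sum_zero[OF N per new False] by (simp flip: cnj_sum)
    then show ?thesis using K by (simp add: nsq_nonneg)
  next
    case True
    have drop: "vmod N (x + smul d l) = vmod N x" for x l
      using True by (cases l) (simp add: vmod_eq_iff)
    then have vt': "vmod N v = vmod N (smul t u)" using vt by simp
    then have "prim N (smul t u)" using v prim_cong by blast
    then have t: "coprime t N" by (rule prim_smul_imp_coprime)
    have "vmod N (smul (t mod N) u) = vmod N (smul t u)"
      by (cases u) (simp add: vmod_def mod_mult_left_eq)
    moreover have "coprime (t mod N) N" using t N by simp
    ultimately have ex: "\<exists>t\<in>{0..<N}. coprime t N \<and> vmod N v = vmod N (smul t u)"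
      using vt' N by (intro bexI[of _ "t mod N"]) auto
    have "kern N f u v = (\<Sum>k\<in>zbox N. f k * (\<Sum>l\<in>zbox N. cnj (f (smul t k))))"
      unfolding K by (intro sum.cong refl arg_cong2[where f = "(*)"] arg_cong[where f = cnj]
          periodicD[OF per] drop)
    also have "\<dots> = of_int N ^ 2 * (\<Sum>k\<in>zbox N. f k * cnj (f (smul t k)))"
      using N by (simp add: card_zbox sum_distrib_left mult_ac)
    finally have "norm (kern N f u v) = (real_of_int N)\<^sup>2 * norm (\<Sum>k\<in>zbox N. f k * cnj (f (smul t k)))"
      using N by (simp add: norm_mult norm_power)
    also have "norm (\<Sum>k\<in>zbox N. f k * cnj (f (smul t k))) \<le> nsq N f"
    proof -
      have "norm (\<Sum>k\<in>zbox N. f k * cnj (f (smul t k))) \<le> (nsq N f + nsq N (\<lambda>k. f (smul t k))) / 2"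
        using norm_sum_mult_le[of f "\<lambda>k. cnj (f (smul t k))" "zbox N"] by (simp add: nsq_def)
      then show ?thesis using nsq_smul[OF N per t] by simp
    qed
    finally show ?thesis using ex by (auto intro: mult_left_mono)
  qed
qed

lemma sum_rotate:
  fixes F :: "'a \<Rightarrow> 'b \<Rightarrow> 'c \<Rightarrow> 'd :: comm_monoid_add"
  shows "(\<Sum>s\<in>A. \<Sum>u\<in>B. \<Sum>v\<in>C. F s u v) = (\<Sum>u\<in>B. \<Sum>v\<in>C. \<Sum>s\<in>A. F s u v)"
proof -
  have "(\<Sum>s\<in>A. \<Sum>u\<in>B. \<Sum>v\<in>C. F s u v) = (\<Sum>u\<in>B. \<Sum>s\<in>A. \<Sum>v\<in>C. F s u v)"
    by (rule sum.swap)
  also have "\<dots> = (\<Sum>u\<in>B. \<Sum>v\<in>C. \<Sum>s\<in>A. F s u v)"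
    by (rule sum.cong[OF refl], rule sum.swap)
  finally show ?thesis .
qed

text \<open>Each \<open>u\<close> pairs only with the at most \<open>N\<close> vectors
  \<open>smul t u\<close>, and each such pair is worth at most \<open>N^2 * nsq N f\<close>; hence
  the exponent 3.\<close>

lemma sum_corr_sq_le:
  assumes N: "N > 0" and f: "periodic N f" "new_form N f"
    and g: "periodic N g" "\<And>v. g v \<noteq> 0 \<Longrightarrow> prim N v"
  shows "(\<Sum>r\<in>zbox N. \<Sum>s\<in>zbox N. (norm (corr N f g r s))\<^sup>2) \<le> real_of_int N ^ 3 * nsq N f * nsq N g"
proof -
  let ?B = "zbox N" and ?T = "{t\<in>{0..<N}. coprime t N}"
  let ?P = "\<lambda>u v. \<exists>t\<in>{0..<N}. coprime t N \<and> vmod N v = vmod N (smul t u)"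
  have finT: "finite ?T" by (rule finite_subset[of _ "{0..<N}"]) auto
  have inner: "(\<Sum>u\<in>?B. norm (g u) * (\<Sum>t\<in>?T. norm (g (smul t u)))) \<le> real_of_int N * nsq N g"
  proof -
    have "(\<Sum>u\<in>?B. norm (g u) * (\<Sum>t\<in>?T. norm (g (smul t u)))) =
        (\<Sum>t\<in>?T. \<Sum>u\<in>?B. norm (g u) * norm (g (smul t u)))"
      unfolding sum_distrib_left by (rule sum.swap)
    also have "\<dots> \<le> (\<Sum>t\<in>?T. nsq N g)"
    proof (intro sum_mono)
      fix t assume t: "t \<in> ?T"
      have "(\<Sum>u\<in>?B. norm (g u) * norm (g (smul t u))) \<le> (\<Sum>u\<in>?B. ((norm (g u))\<^sup>2 + (norm (g (smul t u)))\<^sup>2) / 2)"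
        by (intro sum_mono mult_le_half_squares)
      also have "\<dots> = (nsq N g + nsq N (\<lambda>u. g (smul t u))) / 2"
        by (simp add: nsq_def sum.distrib sum_divide_distrib[symmetric])
      also have "\<dots> = nsq N g" using nsq_smul[OF N g(1)] t by simp
      finally show "(\<Sum>u\<in>?B. norm (g u) * norm (g (smul t u))) \<le> nsq N g" .
    qed
    also have "(\<Sum>t\<in>?T. nsq N g) \<le> real_of_int N * nsq N g"
    proof -
      have "card ?T \<le> card {0..<N}" by (intro card_mono) auto
      then have "real (card ?T) \<le> real_of_int N" using N by simp
      then show ?thesis by (simp add: mult_right_mono nsq_nonneg)
    qed
    finally show ?thesis .
  qed
  have "complex_of_real (\<Sum>r\<in>?B. \<Sum>s\<in>?B. (norm (corr N f g r s))\<^sup>2) =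
      (\<Sum>r\<in>?B. \<Sum>s\<in>?B. corr N f g r s * cnj (corr N f g r s))"
    by (simp only: of_real_sum complex_norm_square)
  also have "\<dots> = (\<Sum>r\<in>?B. \<Sum>s\<in>?B. \<Sum>u\<in>?B. \<Sum>v\<in>?B.
      cnj (g u) * g v * (f (dot r u, dot s u) * cnj (f (dot r v, dot s v))))"
    unfolding corr_def cnj_sum sum_product by (simp add: mult_ac)
  also have "\<dots> = (\<Sum>r\<in>?B. \<Sum>u\<in>?B. \<Sum>v\<in>?B. \<Sum>s\<in>?B.
      cnj (g u) * g v * (f (dot r u, dot s u) * cnj (f (dot r v, dot s v))))"
    by (rule sum.cong[OF refl], rule sum_rotate)
  also have "\<dots> = (\<Sum>u\<in>?B. \<Sum>v\<in>?B. \<Sum>r\<in>?B. \<Sum>s\<in>?B.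
      cnj (g u) * g v * (f (dot r u, dot s u) * cnj (f (dot r v, dot s v))))"
    by (rule sum_rotate)
  also have "\<dots> = (\<Sum>u\<in>?B. \<Sum>v\<in>?B. cnj (g u) * g v * kern N f u v)"
    by (simp add: kern_def sum_distrib_left)
  finally have "(\<Sum>r\<in>?B. \<Sum>s\<in>?B. (norm (corr N f g r s))\<^sup>2) =
      norm (\<Sum>u\<in>?B. \<Sum>v\<in>?B. cnj (g u) * g v * kern N f u v)"
    by (metis (no_types, lifting) abs_of_nonneg norm_of_real sum_nonneg zero_le_power2)
  also have "\<dots> \<le> (\<Sum>u\<in>?B. \<Sum>v\<in>?B. norm (g u) * norm (g v) * norm (kern N f u v))"
    by (rule order_trans[OF norm_sum], intro sum_mono, rule order_trans[OF norm_sum])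
      (simp add: norm_mult)
  also have "\<dots> \<le> (\<Sum>u\<in>?B. \<Sum>v\<in>?B. norm (g u) * norm (g v) *
      (if ?P u v then (real_of_int N)\<^sup>2 * nsq N f else 0))"
  proof (intro sum_mono)
    fix u v
    show "norm (g u) * norm (g v) * norm (kern N f u v) \<le> norm (g u) * norm (g v) *
        (if ?P u v then (real_of_int N)\<^sup>2 * nsq N f else 0)"
    proof (cases "g u = 0 \<or> g v = 0")
      case False
      then show ?thesis
        using norm_kern_le[OF N f, of u v] g(2) by (intro mult_left_mono) auto
    qed auto
  qed
  also have "\<dots> = (real_of_int N)\<^sup>2 * nsq N f * (\<Sum>u\<in>?B. norm (g u) * (\<Sum>v\<in>{v\<in>?B. ?P u v}. norm (g v)))"
    by (simp add: sum_distrib_left mult_ac sum.inter_filter if_distrib cong: if_cong)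
  also have "\<dots> \<le> (real_of_int N)\<^sup>2 * nsq N f * (\<Sum>u\<in>?B. norm (g u) * (\<Sum>t\<in>?T. norm (g (smul t u))))"
  proof (intro mult_left_mono sum_mono)
    fix u
    have "{v\<in>?B. ?P u v} \<subseteq> (\<lambda>t. vmod N (smul t u)) ` ?T"
      using vmod_zbox by fastforce
    then have "(\<Sum>v\<in>{v\<in>?B. ?P u v}. norm (g v)) \<le> (\<Sum>v\<in>(\<lambda>t. vmod N (smul t u)) ` ?T. norm (g v))"
      using finT by (intro sum_mono2) auto
    also have "\<dots> \<le> (\<Sum>t\<in>?T. norm (g (vmod N (smul t u))))"
      using finT sum_image_le[of ?T "\<lambda>v. norm (g v)" "\<lambda>t. vmod N (smul t u)"] by (simp add: o_def)
    also have "\<dots> = (\<Sum>t\<in>?T. norm (g (smul t u)))"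
      using g(1) unfolding periodic_def by metis
    finally show "(\<Sum>v\<in>{v\<in>?B. ?P u v}. norm (g v)) \<le> (\<Sum>t\<in>?T. norm (g (smul t u)))" .
  qed (auto simp: nsq_nonneg)
  also have "\<dots> \<le> (real_of_int N)\<^sup>2 * nsq N f * (real_of_int N * nsq N g)"
    by (intro mult_left_mono inner) (auto simp: nsq_nonneg)
  finally show ?thesis
    by (simp add: power3_eq_cube power2_eq_square mult_ac)
qed

section \<open>Counting the squares of units modulo \<open>N\<close>\<close>

definition unit_squares :: "int \<Rightarrow> int set" where
  "unit_squares N = (\<lambda>t. t\<^sup>2 mod N) ` {t\<in>{0..<N}. coprime t N}"

lemma gcd_diff_add_dvd_2:
  fixes N t s :: int
  assumes "coprime s N" "g dvd N" "g dvd t - s" "k dvd N" "k dvd t + s"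
  shows "gcd g k dvd 2"
proof -
  have "gcd g k dvd t + s" "gcd g k dvd t - s"
    using dvd_trans[OF gcd_dvd2 assms(5)] dvd_trans[OF gcd_dvd1 assms(3)] by simp_all
  then have "gcd g k dvd (t + s) - (t - s)" by (rule dvd_diff)
  then have "gcd g k dvd 2 * s" by simp
  moreover have "coprime (gcd g k) s"
  proof -
    have "gcd g k dvd N" by (rule dvd_trans[OF gcd_dvd1 assms(2)])
    then have "coprime s (gcd g k)" using assms(1) coprime_divisors[OF dvd_refl] by blast
    then show ?thesis by (simp only: coprime_commute)
  qed
  ultimately show ?thesis
    by (simp add: coprime_dvd_mult_left_iff)
qed

text \<open>From \<open>N dvd (t - s) * (t + s)\<close> it follows, with
  \<open>g = gcd (t - s) N\<close>, that the cofactor \<open>N div g\<close> divides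
  \<open>t + s\<close>. As \<open>gcd g (N div g)\<close> divides 2, the value of \<open>g\<close>
  fixes \<open>2 * t\<close> modulo \<open>N\<close>, and the carry \<open>2 * t div N\<close>,
  which is 0 or 1, then fixes \<open>t\<close>. The carry is the factor 2 of the bound.\<close>

lemma card_same_square_le:
  assumes N: "N > 0" and s: "coprime s N"
  shows "card {t\<in>{0..<N}. t\<^sup>2 mod N = s\<^sup>2 mod N} \<le> 2 * ndiv (nat N)"
proof -
  let ?A = "{t\<in>{0..<N}. t\<^sup>2 mod N = s\<^sup>2 mod N}"
  let ?h = "\<lambda>t. (nat (gcd (t - s) N), nat (2 * t div N))"
  have key: "t = t'" if t: "t \<in> ?A" and t': "t' \<in> ?A" and eq: "?h t = ?h t'" for t t'
  proof -
    define g where "g = gcd (t - s) N"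
    have g': "g = gcd (t' - s) N"
    proof -
      have "nat (gcd (t - s) N) = nat (gcd (t' - s) N)" using eq by simp
      then show ?thesis by (simp add: g_def eq_nat_nat_iff)
    qed
    have g0: "g > 0" using N by (simp add: g_def)
    define k where "k = N div g"
    have Ngk: "N = g * k" by (simp add: k_def g_def)
    have k0: "k > 0" using N g0 Ngk by (simp add: zero_less_mult_iff)
    have kdvd: "k dvd x + s" if x: "x \<in> ?A" and gx: "g = gcd (x - s) N" for x
    proof -
      have "N dvd x\<^sup>2 - s\<^sup>2" using x by (simp add: mod_eq_dvd_iff)
      moreover have "x\<^sup>2 - s\<^sup>2 = (x - s) * (x + s)" by (simp add: power2_eq_square algebra_simps)
      moreover obtain y where y: "x - s = g * y" unfolding gx using gcd_dvd1[of "x - s" N] by (elim dvdE)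
      ultimately have "g * k dvd g * (y * (x + s))" using Ngk by (simp add: mult.assoc)
      then have "k dvd y * (x + s)" using g0 by simp
      moreover have "coprime k y"
      proof -
        have "coprime ((x - s) div g) (N div g)"
          unfolding gx using N by (intro div_gcd_coprime) auto
        then show ?thesis using y g0 by (simp add: k_def coprime_commute)
      qed
      ultimately show ?thesis by (simp add: coprime_dvd_mult_right_iff)
    qed
    have gt: "g dvd t - s" unfolding g_def by (rule gcd_dvd1)
    have gt': "g dvd t' - s" unfolding g' by (rule gcd_dvd1)
    have "g dvd (t - s) - (t' - s)" using gt gt' by (rule dvd_diff)
    then have d1: "g dvd t - t'" by simp
    have "k dvd (t + s) - (t' + s)"
      by (rule dvd_diff[OF kdvd[OF t g_def] kdvd[OF t' g']])
    then have d2: "k dvd t - t'" by simp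
    have "gcd g k dvd 2"
      using gcd_diff_add_dvd_2[OF s _ gt _ kdvd[OF t g_def]] Ngk by simp
    then have "gcd g k * lcm g k dvd 2 * (t - t')"
      by (rule mult_dvd_mono[OF _ lcm_least[OF d1 d2]])
    moreover have "gcd g k * lcm g k = N"
      using g0 k0 Ngk prod_gcd_lcm_int[of g k] by (simp add: abs_mult)
    ultimately have "N dvd 2 * t - 2 * t'" by (simp add: algebra_simps)
    then have "2 * t mod N = 2 * t' mod N" by (simp add: mod_eq_dvd_iff)
    moreover have "2 * t div N = 2 * t' div N"
    proof -
      have "2 * t div N \<ge> 0" "2 * t' div N \<ge> 0"
        using t t' N by (auto intro!: pos_imp_zdiv_nonneg_iff[THEN iffD2])
      moreover have "nat (2 * t div N) = nat (2 * t' div N)" using eq by simp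
      ultimately show ?thesis using eq_nat_nat_iff by blast
    qed
    ultimately have "N * (2 * t div N) + 2 * t mod N = N * (2 * t' div N) + 2 * t' mod N"
      by (simp only:)
    then have "2 * t = 2 * t'" unfolding mult_div_mod_eq .
    then show "t = t'" by simp
  qed
  have inj: "inj_on ?h ?A"
    by (rule inj_onI) (rule key)
  have sub: "?h ` ?A \<subseteq> {k. k dvd nat N} \<times> {0, 1}"
  proof
    fix y assume "y \<in> ?h ` ?A"
    then obtain t where t: "t \<in> ?A" "y = ?h t" by (rule imageE)
    have "2 * t div N < 2"
    proof (rule ccontr)
      assume "\<not> ?thesis"
      then have "N * 2 \<le> N * (2 * t div N)" using N by (intro mult_left_mono) auto
      also have "\<dots> \<le> 2 * t" using N by (simp add: minus_mod_eq_mult_div[symmetric])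
      finally show False using t N by auto
    qed
    moreover have "2 * t div N \<ge> 0" using t N by (simp add: pos_imp_zdiv_nonneg_iff)
    ultimately have "nat (2 * t div N) \<in> {0, 1}" by auto
    moreover have "nat (gcd (t - s) N) dvd nat N"
      using N by (simp add: nat_dvd_iff)
    ultimately show "y \<in> {k. k dvd nat N} \<times> {0, 1}" using t by auto
  qed
  have "finite {k. k dvd nat N}" using N by simp
  then have "card ?A \<le> card ({k. k dvd nat N} \<times> {0, 1 :: nat})"
    by (intro card_inj_on_le[OF inj sub] finite_cartesian_product) simp_all
  then show ?thesis by (simp add: card_cartesian_product ndiv_def)
qed

text \<open>The number of units is at least \<open>N\<close> over the number of divisors, and
  squaring is at most \<open>2 * ndiv (nat N)\<close> to one on them.\<close>

lemma card_unit_squares_ge: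
  assumes N: "N > 0"
  shows "nat N \<le> 2 * (ndiv (nat N))\<^sup>2 * card (unit_squares N)"
proof -
  let ?U = "{t\<in>{0..<N}. coprime t N}"
  have fin: "finite ?U" by (rule finite_subset[of _ "{0..<N}"]) auto
  have "totient (nat N) \<le> card ?U"
  proof -
    have "coprime (int x) N" if "coprime x (nat N)" for x
      using that N coprime_int_iff[of x "nat N"] by simp
    then have "(\<lambda>k. int k mod N) ` totatives (nat N) \<subseteq> ?U"
      using N by (auto simp: totatives_def)
    moreover have "inj_on (\<lambda>k. int k mod N) (totatives (nat N))"
    proof (rule inj_onI)
      fix x y assume xy: "x \<in> totatives (nat N)" "y \<in> totatives (nat N)" "int x mod N = int y mod N"
      then have "N dvd int x - int y" by (simp add: mod_eq_dvd_iff)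
      moreover have "\<bar>int x - int y\<bar> < N"
        using xy N by (auto simp: totatives_def)
      ultimately have "int x - int y = 0" using zdvd_not_zless[of "\<bar>int x - int y\<bar>" N] by force
      then show "x = y" by simp
    qed
    ultimately have "card (totatives (nat N)) \<le> card ?U"
      using fin by (intro card_inj_on_le)
    then show ?thesis by (simp add: totient_def)
  qed
  also have "card ?U \<le> card (unit_squares N) * (2 * ndiv (nat N))"
  proof -
    have "card ?U = (\<Sum>y\<in>unit_squares N. card {t\<in>?U. t\<^sup>2 mod N = y})"
      unfolding unit_squares_def card_eq_sum using fin by (rule sum.image_gen)
    also have "\<dots> \<le> (\<Sum>y\<in>unit_squares N. 2 * ndiv (nat N))"
    proof (rule sum_mono)
      fix y assume "y \<in> unit_squares N"
      then obtain s where s: "y = s\<^sup>2 mod N" "coprime s N" by (auto simp: unit_squares_def)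
      have "card {t\<in>?U. t\<^sup>2 mod N = y} \<le> card {t\<in>{0..<N}. t\<^sup>2 mod N = s\<^sup>2 mod N}"
        using s by (intro card_mono finite_Collect_conjI disjI1) auto
      also have "\<dots> \<le> 2 * ndiv (nat N)" by (rule card_same_square_le[OF N s(2)])
      finally show "card {t\<in>?U. t\<^sup>2 mod N = y} \<le> 2 * ndiv (nat N)" .
    qed
    finally show ?thesis by simp
  qed
  finally have "totient (nat N) \<le> card (unit_squares N) * (2 * ndiv (nat N))" .
  then have "ndiv (nat N) * totient (nat N) \<le> ndiv (nat N) * (card (unit_squares N) * (2 * ndiv (nat N)))"
    by (rule mult_left_mono) simp
  also have "\<dots> = 2 * (ndiv (nat N))\<^sup>2 * card (unit_squares N)"
    by (simp add: power2_eq_square)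
  finally show ?thesis
    using le_ndiv_mult_totient[of "nat N"] N by linarith
qed

text \<open>\<open>f\<close> has a unitary central character, so that replacing a matrix by a unit
  multiple changes a correlation only by a factor of modulus one.\<close>

definition eigen_form :: "int \<Rightarrow> (ivec \<Rightarrow> complex) \<Rightarrow> bool" where
  "eigen_form N f \<longleftrightarrow> (\<forall>t. coprime t N \<longrightarrow> (\<exists>c. cmod c = 1 \<and> (\<forall>v. f (smul t v) = c * f v)))"

text \<open>The group \<open>SL_2\<close> over the integers modulo \<open>N\<close>, each matrix
  given by its two rows.\<close>

definition SLbox :: "int \<Rightarrow> (ivec \<times> ivec) set" where
  "SLbox N = {(r, s). r \<in> zbox N \<and> s \<in> zbox N \<and> N dvd fst r * snd s - snd r * fst s - 1}"

lemma finite_SLbox [simp]: "finite (SLbox N)"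
  by (rule finite_subset[of _ "zbox N \<times> zbox N"]) (auto simp: SLbox_def)

lemma smul_mod_cancel:
  assumes "coprime t N" "vmod N (smul t u) = vmod N (smul t v)"
  shows "vmod N u = vmod N v"
proof -
  obtain s where "[t * s = 1] (mod N)"
    using cong_solve_coprime_int[OF assms(1)] by auto
  then have st: "N dvd t * s - 1" by (simp add: cong_iff_dvd_diff)
  have "N dvd x - y" if "N dvd t * x - t * y" for x y
  proof -
    have "N dvd t * (x - y)" using that by (simp add: algebra_simps)
    then show ?thesis using assms(1) by (simp add: coprime_commute coprime_dvd_mult_right_iff)
  qed
  then show ?thesis using assms(2) by (cases u; cases v) (simp add: vmod_eq_iff)
qed

text \<open>The determinant-one matrices and their multiples by units \<open>t\<close>, which have determinant
  \<open>t\<^sup>2\<close>, contribute equally, so the bound for all matrices is divided by the number of squares.\<close>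

lemma sum_corr_sq_SL_le:
  assumes N: "N > 0" and f: "periodic N f" "new_form N f" "\<And>v. f v \<noteq> 0 \<Longrightarrow> prim N v"
    and eig: "eigen_form N f"
  shows "real (card (unit_squares N)) * (\<Sum>(r, s)\<in>SLbox N. (norm (corr N f f r s))\<^sup>2) \<le>
    real_of_int N ^ 3 * (nsq N f)\<^sup>2"
proof -
  let ?G = "\<lambda>(r, s). (norm (corr N f f r s))\<^sup>2"
  have "\<forall>y\<in>unit_squares N. \<exists>t. coprime t N \<and> t\<^sup>2 mod N = y"
    by (auto simp: unit_squares_def)
  \<comment> \<open>One square root per unit square: running over all units instead would repeat
    determinants and destroy injectivity.\<close>
  then obtain \<tau> where \<tau>: "\<And>y. y \<in> unit_squares N \<Longrightarrow> coprime (\<tau> y) N \<and> (\<tau> y)\<^sup>2 mod N = y"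
    by metis
  let ?m = "\<lambda>(y, r, s). (vmod N (smul (\<tau> y) r), vmod N (smul (\<tau> y) s))"
  have norm_eq: "?G (?m (y, r, s)) = ?G (r, s)" if y: "y \<in> unit_squares N" for y r s
  proof -
    obtain c where c: "cmod c = 1" "\<And>v. f (smul (\<tau> y) v) = c * f v"
      using eig \<tau>[OF y] unfolding eigen_form_def by blast
    have dt: "N dvd dot (vmod N (smul t r)) u - t * dot r u" for t r u
    proof -
      obtain p q where r: "r = (p, q)" by (cases r)
      obtain a b where u: "u = (a, b)" by (cases u)
      have "dot (vmod N (smul t r)) u - t * dot r u =
          ((t * p) mod N - t * p) * a + ((t * q) mod N - t * q) * b"
        by (simp add: r u vmod_def algebra_simps)
      moreover have "N dvd (t * p) mod N - t * p" "N dvd (t * q) mod N - t * q"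
        by (simp_all add: mod_eq_dvd_iff[symmetric])
      ultimately show ?thesis by simp
    qed
    have "corr N f f (vmod N (smul (\<tau> y) r)) (vmod N (smul (\<tau> y) s)) = c * corr N f f r s"
      unfolding corr_def sum_distrib_left
    proof (rule sum.cong[OF refl])
      fix u
      have "f (dot (vmod N (smul (\<tau> y) r)) u, dot (vmod N (smul (\<tau> y) s)) u) =
          f (smul (\<tau> y) (dot r u, dot s u))"
        by (rule periodicD[OF f(1)]) (simp add: vmod_eq_iff dt)
      then show "f (dot (vmod N (smul (\<tau> y) r)) u, dot (vmod N (smul (\<tau> y) s)) u) * cnj (f u) =
          c * (f (dot r u, dot s u) * cnj (f u))"
        by (simp only: c mult.assoc)
    qed
    then show ?thesis using c by (simp add: norm_mult)
  qed
  \<comment> \<open>The determinant of the scaled matrix modulo \<open>N\<close> is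
    \<open>y\<close>, so \<open>y\<close> can be read off; then the unit \<open>\<tau> y\<close> is
    cancelled.\<close>
  have inj: "inj_on ?m (unit_squares N \<times> SLbox N)"
  proof (rule inj_onI)
    fix x x' assume x: "x \<in> unit_squares N \<times> SLbox N" and x': "x' \<in> unit_squares N \<times> SLbox N"
      and eq: "?m x = ?m x'"
    obtain y r s where [simp]: "x = (y, r, s)" by (cases x)
    obtain y' r' s' where [simp]: "x' = (y', r', s')" by (cases x')
    have y: "y \<in> unit_squares N" and y': "y' \<in> unit_squares N" using x x' by auto
    have e1: "vmod N (smul (\<tau> y) r) = vmod N (smul (\<tau> y') r')"
      and e2: "vmod N (smul (\<tau> y) s) = vmod N (smul (\<tau> y') s')"
      using eq by auto
    have det: "(fst (smul t a) * snd (smul t b) - snd (smul t a) * fst (smul t b)) =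
        t\<^sup>2 * (fst a * snd b - snd a * fst b)" for t a b
      by (cases a; cases b) (simp add: power2_eq_square algebra_simps)
    have md: "(\<tau> z)\<^sup>2 * (fst a * snd b - snd a * fst b) mod N = z"
      if "z \<in> unit_squares N" "(a, b) \<in> SLbox N" for z a b
    proof -
      have "N dvd (\<tau> z)\<^sup>2 * (fst a * snd b - snd a * fst b - 1)"
        using that(2) by (simp add: SLbox_def)
      then have "(\<tau> z)\<^sup>2 * (fst a * snd b - snd a * fst b) mod N = (\<tau> z)\<^sup>2 mod N"
        by (simp add: mod_eq_dvd_iff algebra_simps)
      then show ?thesis using \<tau>[OF that(1)] by simp
    qed
    have dmod: "(fst a * snd b - snd a * fst b) mod N =
       (fst (vmod N a) * snd (vmod N b) - snd (vmod N a) * fst (vmod N b)) mod N" for a b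
      unfolding vmod_def fst_conv snd_conv
      by (rule mod_diff_cong; rule mod_mult_eq[symmetric])
    have "(r, s) \<in> SLbox N" "(r', s') \<in> SLbox N" using x x' by auto
    then have "y = (fst (smul (\<tau> y) r) * snd (smul (\<tau> y) s) - snd (smul (\<tau> y) r) * fst (smul (\<tau> y) s)) mod N"
      "y' = (fst (smul (\<tau> y') r') * snd (smul (\<tau> y') s') - snd (smul (\<tau> y') r') * fst (smul (\<tau> y') s')) mod N"
      using md y y' by (simp_all only: det)
    then have "y = y'"
      unfolding dmod[of "smul _ _"] e1 e2 by (rule trans[OF _ sym])
    then have "vmod N r = vmod N r'" "vmod N s = vmod N s'"
      using e1 e2 smul_mod_cancel \<tau>[OF y] by blast+
    then show "x = x'" using x x' \<open>y = y'\<close> by (auto simp: SLbox_def)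
  qed
  have "real (card (unit_squares N)) * (\<Sum>x\<in>SLbox N. ?G x) = (\<Sum>y\<in>unit_squares N. \<Sum>x\<in>SLbox N. ?G x)"
    by simp
  also have "\<dots> = (\<Sum>y\<in>unit_squares N. \<Sum>x\<in>SLbox N. ?G (?m (y, x)))"
    using norm_eq by (intro sum.cong refl) auto
  also have "\<dots> = (\<Sum>z\<in>unit_squares N \<times> SLbox N. ?G (?m z))"
    by (simp add: sum.cartesian_product case_prod_unfold)
  also have "\<dots> = (\<Sum>z\<in>?m ` (unit_squares N \<times> SLbox N). ?G z)"
    using inj by (simp add: sum.reindex)
  also have "\<dots> \<le> (\<Sum>z\<in>zbox N \<times> zbox N. ?G z)"
    using N by (intro sum_mono2) (auto intro: vmod_in_zbox)
  also have "\<dots> = (\<Sum>r\<in>zbox N. \<Sum>s\<in>zbox N. (norm (corr N f f r s))\<^sup>2)"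
    by (simp add: sum.cartesian_product)
  also have "\<dots> \<le> real_of_int N ^ 3 * nsq N f * nsq N f"
    by (rule sum_corr_sq_le[OF N f(1,2) f(1,3)])
  finally show ?thesis by (simp add: power2_eq_square mult.assoc)
qed

section \<open>A supersolution for the random walk\<close>

definition vnorm :: "ivec \<Rightarrow> int" where "vnorm v = max \<bar>fst v\<bar> \<bar>snd v\<bar>"

fun mnorm :: "imat \<Rightarrow> int" where "mnorm (a, b, c, d) = max (max \<bar>a\<bar> \<bar>b\<bar>) (max \<bar>c\<bar> \<bar>d\<bar>)"

text \<open>Row vector times matrix: under right multiplication of matrices each row evolves by
  itself, see \<open>rows_mmul\<close>.\<close>

fun rmul :: "ivec \<Rightarrow> imat \<Rightarrow> ivec" where "rmul (x, y) (a, b, c, d) = (x * a + y * c, x * b + y * d)"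

text \<open>The lower bound on the norm makes some column longer than \<open>Q / 2\<close>, which
  leaves only boundedly many determinant-one completions of that column.\<close>

definition shell :: "int \<Rightarrow> imat set" where
  "shell Q = {w. mdet w = 1 \<and> mnorm w \<le> Q \<and> Q < 2 * mnorm w}"

lemma less_twice_max_iff: "Q < 2 * max x y \<longleftrightarrow> Q < 2 * x \<or> Q < 2 * (y :: int)"
  by (auto simp: max_def)

lemma finite_shell [simp]: "finite (shell Q)"
proof (rule finite_subset)
  show "shell Q \<subseteq> {-Q..Q} \<times> {-Q..Q} \<times> {-Q..Q} \<times> {-Q..Q}"
    by (auto simp: shell_def abs_le_iff)
qed simp

lemma vnorm_nonneg: "vnorm v \<ge> 0" by (simp add: vnorm_def)

lemma vnorm_pos: "v \<noteq> 0 \<Longrightarrow> vnorm v > 0"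
  by (cases v) (auto simp: vnorm_def zero_prod_def)

lemma vnorm_rmul_le: "vnorm (rmul x w) \<le> 2 * mnorm w * vnorm x"
proof -
  obtain p q where x: "x = (p, q)" by (cases x)
  obtain a b c d where w: "w = (a, b, c, d)" by (cases w)
  have *: "\<bar>p * e + q * f\<bar> \<le> 2 * mnorm w * vnorm x" if "\<bar>e\<bar> \<le> mnorm w" "\<bar>f\<bar> \<le> mnorm w" for e f
  proof -
    have "\<bar>p * e + q * f\<bar> \<le> \<bar>p\<bar> * \<bar>e\<bar> + \<bar>q\<bar> * \<bar>f\<bar>"
      by (metis abs_mult abs_triangle_ineq)
    also have "\<dots> \<le> vnorm x * mnorm w + vnorm x * mnorm w"
      using that by (intro add_mono mult_mono) (auto simp: x vnorm_def)
    finally show ?thesis by (simp add: algebra_simps)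
  qed
  have "\<bar>a\<bar> \<le> mnorm w" "\<bar>b\<bar> \<le> mnorm w" "\<bar>c\<bar> \<le> mnorm w" "\<bar>d\<bar> \<le> mnorm w"
    by (simp_all add: w le_max_iff_disj)
  then have "max \<bar>p * a + q * c\<bar> \<bar>p * b + q * d\<bar> \<le> 2 * mnorm w * vnorm x"
    by (intro max.boundedI *)
  moreover have "vnorm (rmul x w) = max \<bar>p * a + q * c\<bar> \<bar>p * b + q * d\<bar>"
    by (simp add: x w vnorm_def)
  ultimately show ?thesis by simp
qed

lemma mnorm_madj [simp]: "mnorm (madj w) = mnorm w"
  by (cases w) (simp add: max.commute max.left_commute max.assoc)

lemma rmul_madj: "mdet w = 1 \<Longrightarrow> rmul (rmul x w) (madj w) = x"
proof -
  assume *: "mdet w = 1"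
  obtain p q where x: "x = (p, q)" by (cases x)
  obtain a b c d where w: "w = (a, b, c, d)" by (cases w)
  have "rmul (rmul x w) (madj w) = (p * mdet w, q * mdet w)"
    by (simp add: x w algebra_simps)
  then show ?thesis using * x by simp
qed

lemma vnorm_le_rmul:
  assumes "mdet w = 1" "mnorm w \<le> Q"
  shows "vnorm x \<le> 2 * Q * vnorm (rmul x w)"
proof -
  have "vnorm x \<le> 2 * mnorm w * vnorm (rmul x w)"
    using vnorm_rmul_le[of "rmul x w" "madj w"] rmul_madj[OF assms(1)] by simp
  also have "\<dots> \<le> 2 * Q * vnorm (rmul x w)"
    using assms(2) by (intro mult_right_mono) (auto simp: vnorm_nonneg)
  finally show ?thesis .
qed

text \<open>Two solutions of the determinant equation differ by an integer multiple of
  \<open>y\<close>. Along the larger coordinate \<open>e\<close> of \<open>y\<close>, where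
  \<open>\<bar>e\<bar> > Q / 2\<close>, the quotient by \<open>e\<close> tells them apart and lies
  in \<open>{-2..2}\<close>.\<close>

lemma card_complements_le:
  assumes "vnorm y \<le> Q" "Q < 2 * vnorm y"
  shows "card {z. fst y * snd z - snd y * fst z = 1 \<and> vnorm z \<le> Q} \<le> 5"
proof -
  let ?Z = "{z. fst y * snd z - snd y * fst z = 1 \<and> vnorm z \<le> Q}"
  obtain a b where y: "y = (a, b)" by (cases y)
  define \<pi> :: "ivec \<Rightarrow> int" where "\<pi> = (if \<bar>a\<bar> \<ge> \<bar>b\<bar> then fst else snd)"
  define e where "e = \<pi> y"
  have e: "\<bar>e\<bar> = vnorm y" by (auto simp: e_def \<pi>_def y vnorm_def)
  have e0: "e \<noteq> 0" using assms e by auto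
  have "inj_on (\<lambda>z. \<pi> z div e) ?Z"
  proof (rule inj_onI)
    fix z z' assume z: "z \<in> ?Z" and z': "z' \<in> ?Z" and eq: "\<pi> z div e = \<pi> z' div e"
    define u v where "u = fst z - fst z'" and "v = snd z - snd z'"
    have det: "a * v = b * u" using z z' by (simp add: y u_def v_def algebra_simps)
    have cop: "coprime a b"
    proof (rule coprimeI)
      fix c assume "c dvd a" "c dvd b"
      then have "c dvd a * snd z - b * fst z" by simp
      then show "is_unit c" using z by (simp add: y)
    qed
    have "a dvd b * u" using det by (metis dvd_triv_left)
    then have "a dvd u" using cop by (simp add: coprime_dvd_mult_right_iff)
    moreover have "b dvd a * v" using det by simp
    then have "b dvd v" using cop by (simp add: coprime_dvd_mult_right_iff coprime_commute)
    ultimately have dvd: "e dvd \<pi> (u, v)" by (auto simp: e_def \<pi>_def y)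
    have "\<pi> (u, v) = \<pi> z - \<pi> z'" by (auto simp: \<pi>_def u_def v_def)
    also have "\<dots> = \<pi> z mod e - \<pi> z' mod e"
      using eq by (simp add: minus_div_mult_eq_mod[symmetric])
    finally have "\<bar>\<pi> (u, v)\<bar> < \<bar>e\<bar>"
      using e0 by (smt (verit) neg_mod_bound neg_mod_sign pos_mod_bound pos_mod_sign)
    then have 0: "\<pi> (u, v) = 0" using dvd by (meson dvd_imp_le_int not_less)
    have "u = 0 \<and> v = 0"
    proof (cases "\<bar>a\<bar> \<ge> \<bar>b\<bar>")
      case True
      then have "u = 0" "a \<noteq> 0" using 0 e0 by (auto simp: \<pi>_def e_def y)
      then show ?thesis using det by simp
    next
      case False
      then have "v = 0" "b \<noteq> 0" using 0 e0 by (auto simp: \<pi>_def e_def y)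
      then show ?thesis using det by simp
    qed
    then show "z = z'" by (simp add: u_def v_def prod_eq_iff)
  qed
  moreover have "(\<lambda>z. \<pi> z div e) ` ?Z \<subseteq> {-2..2}"
  proof
    fix k assume "k \<in> (\<lambda>z. \<pi> z div e) ` ?Z"
    then obtain z where z: "vnorm z \<le> Q" "k = \<pi> z div e" by auto
    have "\<bar>\<pi> z\<bar> \<le> vnorm z" by (auto simp: \<pi>_def vnorm_def)
    then have "\<bar>\<pi> z\<bar> < 2 * \<bar>e\<bar>" using z assms e by linarith
    moreover have "\<pi> z = e * k + \<pi> z mod e" using z by simp
    moreover have "\<bar>\<pi> z mod e\<bar> < \<bar>e\<bar>" using e0 by (simp add: abs_mod_less)
    ultimately have "\<bar>e * k\<bar> < 3 * \<bar>e\<bar>" by linarith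
    then have "\<bar>e\<bar> * \<bar>k\<bar> < \<bar>e\<bar> * 3" by (simp add: abs_mult)
    then have "\<bar>k\<bar> < 3" using e0 by simp
    then show "k \<in> {-2..2}" by auto
  qed
  ultimately have "card ?Z \<le> card {-2..2 :: int}"
    by (intro card_inj_on_le) auto
  then show ?thesis by simp
qed

definition lattice_shell :: "int \<Rightarrow> ivec set" where
  "lattice_shell Q = {y. coprime (fst y) (snd y) \<and> vnorm y \<le> Q \<and> Q < 2 * vnorm y}"

lemma finite_lattice_shell [simp]: "finite (lattice_shell Q)"
proof (rule finite_subset)
  show "lattice_shell Q \<subseteq> {-Q..Q} \<times> {-Q..Q}"
    by (auto simp: lattice_shell_def vnorm_def abs_le_iff)
qed simp

text \<open>An upper bound for \<open>1 / vnorm (rmul x w)\<close> in terms of the first column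
  \<open>y\<close> of \<open>w\<close> alone: \<open>dot x y\<close> is an entry of
  \<open>rmul x w\<close>, and the other bound comes from undoing \<open>w\<close>, whose inverse
  has the same norm. A zero product is treated separately because \<open>1 / 0 = 0\<close>.\<close>

definition shell_wt :: "int \<Rightarrow> ivec \<Rightarrow> ivec \<Rightarrow> real" where
  "shell_wt Q x y = (if dot x y = 0 then 2 * Q / vnorm x else min (2 * Q / vnorm x) (1 / \<bar>dot x y\<bar>))"

lemma shell_wt_nonneg: "Q \<ge> 0 \<Longrightarrow> shell_wt Q x y \<ge> 0"
  by (simp add: shell_wt_def vnorm_nonneg)

lemma sum_inverse_le: "(\<Sum>k=1..n. 1 / real k) \<le> 1 + ln n" if "n \<ge> 1" for n :: nat
  using that
proof (induction n rule: dec_induct)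
  case (step n)
  have "1 / real (Suc n) \<le> ln (real (Suc n)) - ln (real n)"
  proof -
    have "ln (real n / real (Suc n)) \<le> real n / real (Suc n) - 1"
      using step by (intro ln_le_minus_one) auto
    also have "\<dots> = - (1 / real (Suc n))" by (simp add: field_simps)
    finally show ?thesis using step by (simp add: ln_div)
  qed
  then show ?case using step by simp
qed simp

lemma sum_Un_le:
  fixes f :: "'a \<Rightarrow> real"
  assumes "finite A" "finite B" "\<And>x. f x \<ge> 0"
  shows "sum f (A \<union> B) \<le> sum f A + sum f B"
proof -
  have "sum f (A \<inter> B) \<ge> 0" using assms(3) by (simp add: sum_nonneg)
  then show ?thesis using sum.union_inter[OF assms(1,2), of f] by linarith
qed

text \<open>Distinct primitive \<open>y\<close> have slopes differing by at least \<open>1 / Q\<^sup>2\<close>, so the values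
  \<open>\<bar>dot x y\<bar>\<close> are spread out and the sum of their inverses is harmonic.\<close>

lemma sum_shell_wt_upper_le:
  assumes Q: "Q \<ge> 1" and x: "fst x \<noteq> 0" "\<bar>snd x\<bar> \<le> \<bar>fst x\<bar>"
  shows "(\<Sum>y\<in>{y\<in>lattice_shell Q. 8 * snd y > Q}. shell_wt Q x y) \<le> Q / vnorm x * (164 + 32 * ln Q)"
proof -
  let ?Y = "{y\<in>lattice_shell Q. 8 * snd y > Q}"
  define X where "X = real_of_int (vnorm x)"
  have X: "X > 0" "X = \<bar>real_of_int (fst x)\<bar>" using x by (auto simp: X_def vnorm_def)
  \<comment> \<open>The slope of \<open>y\<close>, shifted so that
    \<open>dot x y = fst x * snd y * s y\<close>. Distinct fractions with denominators at most
    \<open>Q\<close> are \<open>1 / Q^2\<close> apart, so the integer parts \<open>n y\<close> of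
    \<open>Q^2 * s y\<close> are distinct.\<close>
  define s where "s y = real_of_int (dot x y) / (real_of_int (fst x) * real_of_int (snd y))" for y
  define n where "n y = \<lfloor>(real_of_int Q)\<^sup>2 * s y\<rfloor>" for y
  \<comment> \<open>\<open>\<bar>s y\<bar> \<le> 9\<close>: at most 8 because
    \<open>snd y > Q / 8\<close>, and at most 1 from \<open>x\<close>; the floor costs at most 1
    more.\<close>
  define m where "m = nat (10 * Q\<^sup>2)"
  \<comment> \<open>For \<open>n y = k \<ge> 1\<close> the number \<open>Q^2 * s y\<close> is at
    least \<open>k\<close>; for \<open>k \<le> -2\<close> its modulus is at least
    \<open>- k - 1\<close>; the two cells around zero get the bound \<open>2 * Q / vnorm x\<close>.
    The factor 8 is again \<open>snd y > Q / 8\<close>.\<close>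
  define H :: "int \<Rightarrow> real" where
    "H k = Q / X * (if k \<ge> 1 then 8 / k else if k \<le> -2 then 8 / (- k - 1) else 2)" for k
  have y2: "snd y > 0" "snd y \<le> Q" "\<bar>fst y\<bar> \<le> Q" "coprime (fst y) (snd y)" "8 * snd y > Q" if "y \<in> ?Y" for y
    using that Q by (auto simp: lattice_shell_def vnorm_def)
  have s_eq: "s y = real_of_int (fst y) / real_of_int (snd y) + real_of_int (snd x) / real_of_int (fst x)" if "y \<in> ?Y" for y
    using y2[OF that] x by (cases x; cases y) (simp add: s_def field_simps)
  have inj: "inj_on n ?Y"
  proof (rule inj_onI, rule ccontr)
    fix y z assume y: "y \<in> ?Y" and z: "z \<in> ?Y" and eq: "n y = n z" and ne: "y \<noteq> z"
    have "fst y * snd z - fst z * snd y \<noteq> 0"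
    proof
      assume "fst y * snd z - fst z * snd y = 0"
      then have *: "fst y * snd z = fst z * snd y" by simp
      have "snd y dvd snd z" using y2(4)[OF y] *
        by (metis coprime_commute coprime_dvd_mult_right_iff dvd_triv_right)
      moreover have "snd z dvd snd y" using y2(4)[OF z] *
        by (metis coprime_commute coprime_dvd_mult_right_iff dvd_triv_right)
      ultimately have "snd y = snd z" using y2(1)[OF y] y2(1)[OF z] by (simp add: zdvd_antisym_nonneg)
      then show False using * ne y2(1)[OF z] by (simp add: prod_eq_iff)
    qed
    then have "1 \<le> \<bar>fst y * snd z - fst z * snd y\<bar>" by linarith
    then have one: "1 \<le> \<bar>real_of_int (fst y) * snd z - real_of_int (fst z) * snd y\<bar>"
      by (metis (mono_tags) of_int_1_le_iff of_int_abs of_int_diff of_int_mult)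
    have pos: "real_of_int (snd y) > 0" "real_of_int (snd z) > 0" using y2(1) y z by auto
    have "\<bar>s y - s z\<bar> = \<bar>real_of_int (fst y) * snd z - real_of_int (fst z) * snd y\<bar> / (snd y * snd z)"
      using pos by (simp add: s_eq[OF y] s_eq[OF z] diff_divide_eq_iff divide_diff_eq_iff abs_mult field_simps)
    also have "\<dots> \<ge> 1 / (snd y * snd z)"
      using one pos by (intro divide_right_mono) auto
    finally have "1 / (real_of_int (snd y) * snd z) \<le> \<bar>s y - s z\<bar>" by simp
    moreover have "1 / (real_of_int Q)\<^sup>2 \<le> 1 / (real_of_int (snd y) * snd z)"
      using pos y2(2)[OF y] y2(2)[OF z] unfolding power2_eq_square
      by (intro divide_left_mono mult_mono mult_pos_pos) auto
    ultimately have "1 / (real_of_int Q)\<^sup>2 \<le> \<bar>s y - s z\<bar>" by linarith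
    then have "1 \<le> (real_of_int Q)\<^sup>2 * \<bar>s y - s z\<bar>" using Q by (simp add: field_simps)
    then have "1 \<le> \<bar>(real_of_int Q)\<^sup>2 * s y - (real_of_int Q)\<^sup>2 * s z\<bar>"
      by (simp add: abs_mult flip: right_diff_distrib)
    then show False using eq unfolding n_def by linarith
  qed
  have range: "n ` ?Y \<subseteq> {- int m..int m}"
  proof
    fix k assume "k \<in> n ` ?Y"
    then obtain y where y: "y \<in> ?Y" "k = n y" by auto
    have pos: "real_of_int (snd y) > 0" using y2(1)[OF y(1)] by simp
    have "\<bar>fst y\<bar> \<le> 8 * snd y" using y2[OF y(1)] by linarith
    then have "\<bar>real_of_int (fst y)\<bar> \<le> 8 * real_of_int (snd y)" by linarith
    then have "\<bar>real_of_int (fst y) / snd y\<bar> \<le> 8"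
      using pos by (simp add: abs_divide divide_le_eq)
    moreover have "\<bar>real_of_int (snd x) / fst x\<bar> \<le> 1"
      using x by (simp add: abs_divide divide_le_eq)
    ultimately have "\<bar>s y\<bar> \<le> 9" unfolding s_eq[OF y(1)] by linarith
    then have "(real_of_int Q)\<^sup>2 * \<bar>s y\<bar> \<le> (real_of_int Q)\<^sup>2 * 9" by (intro mult_left_mono) auto
    then have "\<bar>(real_of_int Q)\<^sup>2 * s y\<bar> \<le> 9 * real_of_int (Q\<^sup>2)" by (simp add: abs_mult)
    moreover have "Q\<^sup>2 \<ge> 1" using Q by (simp add: one_le_power)
    ultimately have "\<bar>k\<bar> \<le> 10 * Q\<^sup>2" unfolding y(2) n_def by linarith
    then show "k \<in> {- int m..int m}" by (auto simp: m_def)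
  qed
  have wt: "shell_wt Q x y \<le> H (n y)" if y: "y \<in> ?Y" for y
  proof -
    have le2: "shell_wt Q x y \<le> Q / X * 2"
      by (simp add: shell_wt_def X_def mult.commute)
    have big: "shell_wt Q x y \<le> Q / X * (8 / k)" if k: "k \<ge> 1" "(real_of_int Q)\<^sup>2 * \<bar>s y\<bar> \<ge> k" for k :: real
    proof -
      have pos: "real_of_int (snd y) > 0" "8 * real_of_int (snd y) > Q" using y2[OF y] by linarith+
      have "\<bar>real_of_int (dot x y)\<bar> = X * real_of_int (snd y) * \<bar>s y\<bar>"
        using pos x X by (simp add: s_def abs_mult abs_divide)
      also have "\<dots> \<ge> X * (Q / 8) * (k / (real_of_int Q)\<^sup>2)"
        using pos X k Q by (intro mult_mono) (auto simp: field_simps)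
      finally have lb: "X * k / (8 * Q) \<le> \<bar>real_of_int (dot x y)\<bar>"
        using Q by (simp add: power2_eq_square field_simps)
      have lb0: "0 < X * k / (8 * Q)" using X k Q by simp
      have "1 / \<bar>real_of_int (dot x y)\<bar> \<le> 1 / (X * k / (8 * Q))"
        using lb lb0 by (intro divide_left_mono mult_pos_pos) auto
      moreover have "shell_wt Q x y \<le> 1 / \<bar>real_of_int (dot x y)\<bar>"
        using lb lb0 by (auto simp: shell_wt_def)
      ultimately show ?thesis by (simp add: field_simps)
    qed
    consider "n y \<ge> 1" | "n y \<le> -2" | "n y = 0 \<or> n y = -1" by linarith
    then show ?thesis
    proof cases
      case 1
      have "real_of_int (n y) \<le> (real_of_int Q)\<^sup>2 * s y" by (simp add: n_def)
      also have "\<dots> \<le> (real_of_int Q)\<^sup>2 * \<bar>s y\<bar>" by (intro mult_left_mono) auto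
      finally show ?thesis using big[of "n y"] 1 by (simp add: H_def)
    next
      case 2
      have "(real_of_int Q)\<^sup>2 * s y < n y + 1" unfolding n_def by linarith
      moreover have "- ((real_of_int Q)\<^sup>2 * s y) \<le> (real_of_int Q)\<^sup>2 * \<bar>s y\<bar>"
        by (metis abs_ge_minus_self abs_mult abs_power2)
      ultimately show ?thesis using big[of "- n y - 1"] 2 by (simp add: H_def)
    next
      case 3
      then show ?thesis using le2 by (auto simp: H_def)
    qed
  qed
  have "1 \<le> 10 * Q\<^sup>2" using one_le_power[OF Q, of 2] by linarith
  then have Qm: "m \<ge> 1" by (simp add: m_def le_nat_iff)
  have H0: "H k \<ge> 0" for k using Q X by (auto simp: H_def)
  have "(\<Sum>y\<in>?Y. shell_wt Q x y) \<le> (\<Sum>y\<in>?Y. H (n y))" by (intro sum_mono wt)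
  also have "\<dots> = (\<Sum>k\<in>n ` ?Y. H k)" using inj by (simp add: sum.reindex)
  also have "\<dots> \<le> (\<Sum>k\<in>{- int m..int m}. H k)"
    using range H0 by (intro sum_mono2) auto
  also have "\<dots> \<le> (\<Sum>k\<in>{-1, 0} \<union> int ` {1..m} \<union> (\<lambda>j. - int j - 1) ` {1..m}. H k)"
  proof (intro sum_mono2 H0)
    show "{- int m..int m} \<subseteq> {-1, 0} \<union> int ` {1..m} \<union> (\<lambda>j. - int j - 1) ` {1..m}"
    proof
      fix k assume k: "k \<in> {- int m..int m}"
      consider "k \<ge> 1" | "k \<le> -2" | "k = 0 \<or> k = -1" by linarith
      then show "k \<in> {-1, 0} \<union> int ` {1..m} \<union> (\<lambda>j. - int j - 1) ` {1..m}"
      proof cases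
        case 1
        then have "k = int (nat k)" "nat k \<in> {1..m}" using k by auto
        then show ?thesis by blast
      next
        case 2
        then have "k = - int (nat (- k - 1)) - 1" "nat (- k - 1) \<in> {1..m}" using k by auto
        then show ?thesis by blast
      qed auto
    qed
  qed auto
  also have "\<dots> \<le> (\<Sum>k\<in>{-1, 0}. H k) + (\<Sum>k\<in>int ` {1..m}. H k) + (\<Sum>k\<in>(\<lambda>j. - int j - 1) ` {1..m}. H k)"
    by (rule order_trans[OF sum_Un_le add_mono[OF sum_Un_le order_refl]]) (auto intro: H0)
  also have "(\<Sum>k\<in>int ` {1..m}. H k) = Q / X * (8 * (\<Sum>j=1..m. 1 / real j))"
    by (subst sum.reindex) (auto simp: H_def sum_distrib_left intro!: sum.cong)
  also have "(\<Sum>k\<in>(\<lambda>j. - int j - 1) ` {1..m}. H k) = Q / X * (8 * (\<Sum>j=1..m. 1 / real j))"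
    by (subst sum.reindex) (auto simp: H_def sum_distrib_left inj_on_def intro!: sum.cong)
  also have "(\<Sum>k\<in>{-1, 0}. H k) = Q / X * 4" by (simp add: H_def)
  also have "Q / X * 4 + Q / X * (8 * (\<Sum>j=1..m. 1 / real j)) + Q / X * (8 * (\<Sum>j=1..m. 1 / real j)) =
      Q / X * (4 + 16 * (\<Sum>j=1..m. 1 / real j))"
    by (simp add: algebra_simps)
  also have "\<dots> \<le> Q / X * (164 + 32 * ln Q)"
  proof (intro mult_left_mono)
    have "(\<Sum>j=1..m. 1 / real j) \<le> 1 + ln m" by (rule sum_inverse_le[OF Qm])
    also have "ln (real m) = ln 10 + 2 * ln Q"
      using Q by (simp add: m_def ln_mult ln_realpow)
    also have "ln (10 :: real) \<le> 9"
      using ln_le_minus_one[of 10] by simp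
    finally show "4 + 16 * (\<Sum>j=1..m. 1 / real j) \<le> 164 + 32 * ln Q" by simp
  qed (use Q X in auto)
  finally show ?thesis by (simp add: X_def)
qed

text \<open>Here \<open>\<bar>fst y\<bar> > Q / 2\<close> dominates and \<open>dot x y\<close>
  cannot cancel: its modulus is at least \<open>Q * vnorm x / 4\<close>, so the trivial count
  \<open>9 * Q^2\<close> of points suffices.\<close>

lemma sum_shell_wt_lower_le:
  assumes Q: "Q \<ge> 1" and x: "fst x \<noteq> 0" "\<bar>snd x\<bar> \<le> \<bar>fst x\<bar>"
  shows "(\<Sum>y\<in>{y\<in>lattice_shell Q. 8 * \<bar>snd y\<bar> \<le> Q}. shell_wt Q x y) \<le> Q / vnorm x * 36"
proof -
  let ?Y = "{y\<in>lattice_shell Q. 8 * \<bar>snd y\<bar> \<le> Q}"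
  define X where "X = real_of_int (vnorm x)"
  have X: "X > 0" "vnorm x = \<bar>fst x\<bar>" using x by (auto simp: X_def vnorm_def)
  have "shell_wt Q x y \<le> 4 / (Q * X)" if y: "y \<in> ?Y" for y
  proof -
    have *: "8 * \<bar>snd y\<bar> \<le> Q" "2 * \<bar>fst y\<bar> > Q"
      using y Q by (auto simp: lattice_shell_def vnorm_def)
    have "\<bar>fst x\<bar> * \<bar>fst y\<bar> - \<bar>snd x\<bar> * \<bar>snd y\<bar> \<le> \<bar>dot x y\<bar>"
    proof -
      have "\<bar>fst x * fst y\<bar> - \<bar>snd x * snd y\<bar> \<le> \<bar>fst x * fst y + snd x * snd y\<bar>" by linarith
      then show ?thesis by (cases x; cases y) (simp add: abs_mult)
    qed
    moreover have "\<bar>snd x\<bar> * \<bar>snd y\<bar> \<le> \<bar>fst x\<bar> * \<bar>snd y\<bar>"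
      using x by (intro mult_right_mono) auto
    moreover have "\<bar>fst x\<bar> * Q \<le> \<bar>fst x\<bar> * (4 * (\<bar>fst y\<bar> - \<bar>snd y\<bar>))"
      using * by (intro mult_left_mono) auto
    ultimately have "vnorm x * Q \<le> 4 * \<bar>dot x y\<bar>"
      unfolding X by (simp add: algebra_simps)
    then have "real_of_int (vnorm x * Q) \<le> real_of_int (4 * \<bar>dot x y\<bar>)" by (simp only: of_int_le_iff)
    then have lb: "X * Q \<le> 4 * \<bar>real_of_int (dot x y)\<bar>" by (simp add: X_def)
    have XQ: "X * Q > 0" using X Q by simp
    then have "shell_wt Q x y \<le> 1 / \<bar>real_of_int (dot x y)\<bar>"
      using lb by (auto simp: shell_wt_def)
    also have "\<dots> \<le> 1 / (X * Q / 4)"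
      using lb XQ by (intro divide_left_mono mult_pos_pos) auto
    finally show ?thesis by (simp add: mult.commute)
  qed
  then have "(\<Sum>y\<in>?Y. shell_wt Q x y) \<le> (\<Sum>y\<in>?Y. 4 / (Q * X))" by (rule sum_mono)
  also have "\<dots> = real (card ?Y) * (4 / (Q * X))" by simp
  also have "\<dots> \<le> (9 * (real_of_int Q)\<^sup>2) * (4 / (Q * X))"
  proof (rule mult_right_mono)
    have "?Y \<subseteq> {-Q..Q} \<times> {-Q..Q}"
      by (auto simp: lattice_shell_def vnorm_def abs_le_iff)
    then have "card ?Y \<le> card ({-Q..Q} \<times> {-Q..Q})" by (intro card_mono) auto
    also have "\<dots> = (nat (2 * Q + 1))\<^sup>2" by (simp add: card_cartesian_product power2_eq_square)
    also have "\<dots> \<le> (nat (3 * Q))\<^sup>2" using Q by (intro power_mono) auto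
    finally have "real (card ?Y) \<le> real ((nat (3 * Q))\<^sup>2)" by (rule of_nat_mono)
    then show "real (card ?Y) \<le> 9 * (real_of_int Q)\<^sup>2" using Q by (simp add: power_mult_distrib)
  qed (use Q X in auto)
  also have "\<dots> = Q / X * 36" using Q X by (simp add: power2_eq_square)
  finally show ?thesis by (simp add: X_def)
qed

text \<open>Symmetries reduce to the two preceding estimates: swapping coordinates makes the first
  coordinate of \<open>x\<close> the larger one, and negating \<open>y\<close> carries
  \<open>snd y < - Q / 8\<close> to the upper part.\<close>

lemma sum_shell_wt_le:
  assumes Q: "Q \<ge> 1" and x: "x \<noteq> 0"
  shows "(\<Sum>y\<in>lattice_shell Q. shell_wt Q x y) \<le> Q / vnorm x * (364 + 64 * ln Q)"
proof -
  have main: "(\<Sum>y\<in>lattice_shell Q. shell_wt Q x y) \<le> Q / vnorm x * (364 + 64 * ln Q)"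
    if x: "fst x \<noteq> 0" "\<bar>snd x\<bar> \<le> \<bar>fst x\<bar>" for x
  proof -
    let ?U = "{y\<in>lattice_shell Q. 8 * snd y > Q}" and ?L = "{y\<in>lattice_shell Q. 8 * \<bar>snd y\<bar> \<le> Q}"
      and ?D = "{y\<in>lattice_shell Q. 8 * snd y < - Q}"
    have "lattice_shell Q = ?U \<union> ?L \<union> ?D" by auto
    then have "(\<Sum>y\<in>lattice_shell Q. shell_wt Q x y) = (\<Sum>y\<in>?U \<union> ?L \<union> ?D. shell_wt Q x y)" by simp
    also have "\<dots> = (\<Sum>y\<in>?U. shell_wt Q x y) + (\<Sum>y\<in>?L. shell_wt Q x y) + (\<Sum>y\<in>?D. shell_wt Q x y)"
      using Q by (subst sum.union_disjoint; (subst sum.union_disjoint)?) auto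
    also have "(\<Sum>y\<in>?D. shell_wt Q x y) = (\<Sum>y\<in>?U. shell_wt Q x y)"
    proof (rule sum.reindex_bij_witness[of _ uminus uminus])
      fix y
      have "dot x (- y) = - dot x y" by (cases x; cases y) simp
      then show "shell_wt Q x (- y) = shell_wt Q x y" by (simp add: shell_wt_def)
    qed (auto simp: lattice_shell_def vnorm_def)
    finally have "(\<Sum>y\<in>lattice_shell Q. shell_wt Q x y) =
        (\<Sum>y\<in>?U. shell_wt Q x y) + (\<Sum>y\<in>?L. shell_wt Q x y) + (\<Sum>y\<in>?U. shell_wt Q x y)" .
    moreover have "Q / vnorm x * (364 + 64 * ln Q) =
        Q / vnorm x * (164 + 32 * ln Q) + Q / vnorm x * 36 + Q / vnorm x * (164 + 32 * ln Q)"
      by (simp only: distrib_left[symmetric]) simp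
    ultimately show ?thesis
      using sum_shell_wt_upper_le[OF Q x] sum_shell_wt_lower_le[OF Q x] by linarith
  qed
  show ?thesis
  proof (cases "\<bar>snd x\<bar> \<le> \<bar>fst x\<bar>")
    case True
    then have "fst x \<noteq> 0" using x by (auto simp: prod_eq_iff)
    then show ?thesis using main True by blast
  next
    case False
    have "(\<Sum>y\<in>lattice_shell Q. shell_wt Q x y) = (\<Sum>y\<in>lattice_shell Q. shell_wt Q (prod.swap x) y)"
    proof (rule sum.reindex_bij_witness[of _ prod.swap prod.swap])
      fix y
      have "dot (prod.swap x) (prod.swap y) = dot x y" by (cases x; cases y) simp
      then show "shell_wt Q (prod.swap x) (prod.swap y) = shell_wt Q x y"
        by (simp add: shell_wt_def vnorm_def max.commute)
    qed (auto simp: lattice_shell_def vnorm_def coprime_commute max.commute)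
    also have "\<dots> \<le> Q / vnorm (prod.swap x) * (364 + 64 * ln Q)"
      using False by (intro main) auto
    finally show ?thesis by (simp add: vnorm_def max.commute)
  qed
qed

lemma inverse_rmul_le_shell_wt:
  assumes Q: "Q \<ge> 1" and x: "x \<noteq> 0" and w: "mdet (a, b, c, d) = 1" "mnorm (a, b, c, d) \<le> Q"
  shows "1 / real_of_int (vnorm (rmul x (a, b, c, d))) \<le> shell_wt Q x (a, c)"
proof -
  let ?w = "(a, b, c, d)"
  have X: "vnorm x > 0" by (rule vnorm_pos[OF x])
  have le: "vnorm x \<le> 2 * Q * vnorm (rmul x ?w)" by (rule vnorm_le_rmul[OF w])
  have pos: "vnorm (rmul x ?w) > 0"
  proof (rule ccontr)
    assume "\<not> ?thesis"
    then have "vnorm (rmul x ?w) = 0" using vnorm_nonneg[of "rmul x ?w"] by linarith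
    then show False using le X by simp
  qed
  have "real_of_int (vnorm x) \<le> real_of_int (2 * Q * vnorm (rmul x ?w))" using le by (simp only: of_int_le_iff)
  then have 1: "1 / real_of_int (vnorm (rmul x ?w)) \<le> 2 * Q / vnorm x"
    using X pos by (simp add: field_simps)
  have 2: "1 / real_of_int (vnorm (rmul x ?w)) \<le> 1 / \<bar>dot x (a, c)\<bar>" if "dot x (a, c) \<noteq> 0"
  proof -
    have "\<bar>dot x (a, c)\<bar> \<le> vnorm (rmul x ?w)" by (cases x) (simp add: vnorm_def)
    then have "real_of_int \<bar>dot x (a, c)\<bar> \<le> real_of_int (vnorm (rmul x ?w))" by (simp only: of_int_le_iff)
    then show ?thesis using that pos by (intro divide_left_mono) auto
  qed
  show ?thesis using 1 2 by (simp add: shell_wt_def)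
qed

text \<open>The constant \<open>K\<close> of the overview. The factor 4000 dominates
  \<open>10 * 364\<close>, where 10 is two columns times the 5 completions of each.\<close>

definition shell_const :: "int \<Rightarrow> real" where "shell_const Q = 4000 * Q * (1 + ln Q)"

text \<open>One of the two columns of \<open>w\<close> is long. A quarter turn on the right
  exchanges the columns up to sign without changing any norm, so a long first column may be assumed;
  each such column \<open>y\<close> has at most 5 completions, all bounded by
  \<open>shell_wt Q x y\<close>.\<close>

lemma sum_shell_inverse_le:
  assumes Q: "Q \<ge> 1" and x: "x \<noteq> 0"
  shows "(\<Sum>w\<in>shell Q. 1 / real_of_int (vnorm (rmul x w))) \<le> shell_const Q / vnorm x"
proof -
  let ?F = "\<lambda>w. 1 / real_of_int (vnorm (rmul x w))"
  define S where "S = {w\<in>shell Q. (case w of (a, b, c, d) \<Rightarrow> Q < 2 * vnorm (a, c))}"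
  define T where "T = {w\<in>shell Q. (case w of (a, b, c, d) \<Rightarrow> Q < 2 * vnorm (b, d))}"
  define col :: "imat \<Rightarrow> ivec" where "col = (\<lambda>(a, b, c, d). (a, c))"
  have fin: "finite S" "finite T" by (simp_all add: S_def T_def)
  have ST: "shell Q \<subseteq> S \<union> T" by (auto simp: S_def T_def shell_def vnorm_def less_twice_max_iff)
  have F0: "?F w \<ge> 0" for w by (simp add: vnorm_nonneg)
  have TS: "(\<Sum>w\<in>T. ?F w) = (\<Sum>w\<in>S. ?F w)"
  proof (rule sum.reindex_bij_witness[of _ "\<lambda>(a, b, c, d). (- b, a, - d, c)" "\<lambda>(a, b, c, d). (b, - a, d, - c)"])
    fix w
    show "1 / real_of_int (vnorm (rmul x ((\<lambda>(a, b, c, d). (b, - a, d, - c)) w))) = ?F w"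
      by (cases w; cases x) (simp add: vnorm_def abs_minus_commute max.commute)
  qed (auto simp: S_def T_def shell_def vnorm_def algebra_simps less_twice_max_iff)
  have "(\<Sum>w\<in>S. ?F w) \<le> (\<Sum>w\<in>S. shell_wt Q x (col w))"
    by (rule sum_mono) (auto simp: S_def shell_def col_def simp del: mnorm.simps mdet.simps
        intro!: inverse_rmul_le_shell_wt[OF Q x])
  also have "\<dots> = (\<Sum>y\<in>col ` S. \<Sum>w\<in>{w\<in>S. col w = y}. shell_wt Q x (col w))"
    by (rule sum.image_gen[OF fin(1)])
  also have "\<dots> = (\<Sum>y\<in>col ` S. real (card {w\<in>S. col w = y}) * shell_wt Q x y)"
    by (intro sum.cong refl) simp
  also have "\<dots> \<le> (\<Sum>y\<in>col ` S. 5 * shell_wt Q x y)"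
  proof (intro sum_mono mult_right_mono)
    fix y assume "y \<in> col ` S"
    then have y: "vnorm y \<le> Q" "Q < 2 * vnorm y"
      by (auto simp: S_def col_def shell_def vnorm_def less_twice_max_iff)
    let ?Z = "{z. fst y * snd z - snd y * fst z = 1 \<and> vnorm z \<le> Q}"
    have "?Z \<subseteq> {-Q..Q} \<times> {-Q..Q}" by (auto simp: vnorm_def abs_le_iff)
    then have finZ: "finite ?Z" by (rule finite_subset) simp
    have "card {w\<in>S. col w = y} \<le> card ?Z"
    proof (rule card_inj_on_le[OF _ _ finZ])
      show "inj_on (\<lambda>(a, b, c, d). (b, d)) {w\<in>S. col w = y}"
        by (auto simp: inj_on_def col_def)
      show "(\<lambda>(a, b, c, d). (b, d)) ` {w\<in>S. col w = y} \<subseteq> ?Z"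
        by (auto simp: S_def col_def shell_def vnorm_def algebra_simps less_twice_max_iff)
    qed
    also have "\<dots> \<le> 5" by (rule card_complements_le[OF y])
    finally show "real (card {w\<in>S. col w = y}) \<le> 5" by simp
  qed (use Q shell_wt_nonneg in auto)
  also have "\<dots> \<le> (\<Sum>y\<in>lattice_shell Q. 5 * shell_wt Q x y)"
  proof (rule sum_mono2)
    show "col ` S \<subseteq> lattice_shell Q"
    proof
      fix y assume "y \<in> col ` S"
      then obtain a b c d where w: "(a, b, c, d) \<in> S" "y = (a, c)" by (auto simp: col_def)
      have "coprime a c"
      proof (rule coprimeI)
        fix e assume "e dvd a" "e dvd c"
        then have "e dvd a * d - b * c" by simp
        then show "is_unit e" using w by (simp add: S_def shell_def)
      qed
      then show "y \<in> lattice_shell Q" using w by (auto simp: S_def shell_def lattice_shell_def vnorm_def less_twice_max_iff)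
    qed
  qed (use Q shell_wt_nonneg in auto)
  also have "\<dots> \<le> 5 * (Q / vnorm x * (364 + 64 * ln Q))"
    using sum_shell_wt_le[OF Q x] by (simp flip: sum_distrib_left)
  finally have S_le: "(\<Sum>w\<in>S. ?F w) \<le> 5 * (Q / vnorm x * (364 + 64 * ln Q))" .
  have "(\<Sum>w\<in>shell Q. ?F w) \<le> (\<Sum>w\<in>S \<union> T. ?F w)"
    using ST F0 fin by (intro sum_mono2) auto
  also have "\<dots> \<le> (\<Sum>w\<in>S. ?F w) + (\<Sum>w\<in>T. ?F w)"
    using F0 fin by (intro sum_Un_le) auto
  also have "\<dots> \<le> Q / vnorm x * (10 * (364 + 64 * ln Q))"
  proof -
    have "Q / vnorm x * (10 * (364 + 64 * ln Q)) = 2 * (5 * (Q / vnorm x * (364 + 64 * ln Q)))"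
      by (simp only: mult_ac)
    then show ?thesis unfolding TS using add_mono[OF S_le S_le] by (simp only: mult_2)
  qed
  also have "\<dots> \<le> Q / vnorm x * (4000 * (1 + ln Q))"
    using Q vnorm_pos[OF x] by (intro mult_left_mono) auto
  finally show ?thesis by (simp add: shell_const_def mult_ac)
qed

text \<open>Matrices are exhibited with first column \<open>(n, j)\<close>, where
  \<open>Q / 2 < n \<le> Q\<close> and \<open>j\<close> is a unit modulo \<open>n\<close>. Distinct
  pairs give distinct matrices, so the count is a sum of about \<open>Q / 2\<close> totients, each
  at least \<open>Q / 2\<close> over the divisor bound.\<close>

lemma card_shell_ge:
  assumes Q: "Q \<ge> 2" and nd: "\<And>n. n > 0 \<Longrightarrow> real (ndiv n) \<le> C * n powr \<epsilon>" and "\<epsilon> > 0" "C > 0"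
  shows "real (card (shell Q)) \<ge> Q powr (2 - \<epsilon>) / (4 * C)"
proof -
  define q where "q = nat Q"
  have Qq: "Q = int q" "q \<ge> 2" using Q by (simp_all add: q_def)
  let ?P = "SIGMA n:{q div 2 + 1..q}. totatives n"
  have ex: "\<exists>w\<in>shell Q. \<exists>b d. w = (int n, b, int j, d)" if "n \<in> {q div 2 + 1..q}" "j \<in> totatives n" for n j
  proof -
    have n: "n \<ge> 2" "n \<le> q" "q < 2 * n" using that Qq by auto
    have j: "0 < j" "j \<le> n" "coprime j n" using that by (auto simp: totatives_def)
    obtain e where "[int j * e = 1] (mod int n)"
      using cong_solve_coprime_int[of "int j" "int n"] j(3) by auto
    then have e: "int n dvd int j * e - 1" by (simp add: cong_iff_dvd_diff)
    \<comment> \<open>With \<open>b\<close> reduced modulo \<open>n\<close>, the determinant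
      equation forces \<open>0 \<le> d \<le> n\<close>, so all entries stay within the
      shell.\<close>
    define b where "b = (- e) mod int n"
    have b: "0 \<le> b" "b < int n" using n by (simp_all add: b_def)
    have "int n dvd int j * b + 1"
    proof -
      have "b mod int n = (- e) mod int n" by (simp add: b_def)
      then have "int n dvd b - (- e)" by (simp only: mod_eq_dvd_iff)
      then have "int n dvd int j * (b - (- e)) - (int j * e - 1)" using e by simp
      then show ?thesis by (simp add: algebra_simps)
    qed
    then obtain d where d: "int j * b + 1 = int n * d" by auto
    have "int n * d \<le> int n * (int n - 1) + 1"
      using b j mult_mono[of "int j" "int n" b "int n - 1"] d by simp
    also have "\<dots> \<le> int n * int n" using n by (simp add: algebra_simps)
    finally have "d \<le> int n" using n by simp
    moreover have "d \<ge> 0"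
    proof -
      have "int n * d \<ge> 0" using d b by (metis add_nonneg_nonneg mult_nonneg_nonneg of_nat_0_le_iff zero_le_one)
      then show ?thesis using n by (simp add: zero_le_mult_iff)
    qed
    ultimately have "(int n, b, int j, d) \<in> shell Q"
      using b j n d Qq by (auto simp: shell_def algebra_simps less_twice_max_iff)
    then show ?thesis by blast
  qed
  have "?P \<subseteq> (\<lambda>(a, b, c, d). (nat a, nat c)) ` shell Q"
  proof
    fix z assume "z \<in> ?P"
    then obtain n j where z: "z = (n, j)" "n \<in> {q div 2 + 1..q}" "j \<in> totatives n" by auto
    then obtain b d where "(int n, b, int j, d) \<in> shell Q" using ex by blast
    then show "z \<in> (\<lambda>(a, b, c, d). (nat a, nat c)) ` shell Q" using z by force
  qed
  then have "card ?P \<le> card (shell Q)"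
    by (meson card_image_le card_mono finite_imageI finite_shell le_trans)
  have "Q powr (2 - \<epsilon>) / (4 * C) = (Q / 2) * (Q / 2 / (C * Q powr \<epsilon>))"
    using Q by (simp add: powr_diff powr_numeral power2_eq_square)
  also have "\<dots> \<le> (\<Sum>n\<in>{q div 2 + 1..q}. Q / 2 / (C * Q powr \<epsilon>))"
  proof -
    have "real_of_int Q / 2 \<le> real (card {q div 2 + 1..q})" using Qq by simp
    then have "Q / 2 * (Q / 2 / (C * Q powr \<epsilon>)) \<le> real (card {q div 2 + 1..q}) * (Q / 2 / (C * Q powr \<epsilon>))"
      using Q assms by (intro mult_right_mono) auto
    then show ?thesis by (simp only: sum_constant)
  qed
  also have "\<dots> \<le> (\<Sum>n\<in>{q div 2 + 1..q}. real (totient n))"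
  proof (rule sum_mono)
    fix n assume "n \<in> {q div 2 + 1..q}"
    then have n: "n > 0" "n \<le> q" "q \<le> 2 * n" by auto
    have "real n \<le> real (ndiv n * totient n)" using le_ndiv_mult_totient[OF n(1)] by (rule of_nat_mono)
    also have "\<dots> \<le> (C * n powr \<epsilon>) * totient n"
      using nd[OF n(1)] by (simp add: mult_right_mono)
    also have "\<dots> \<le> (C * Q powr \<epsilon>) * totient n"
      using n assms Qq by (intro mult_right_mono mult_left_mono powr_mono2) auto
    finally have "Q / 2 \<le> (C * Q powr \<epsilon>) * totient n" using n Qq by simp
    then show "Q / 2 / (C * Q powr \<epsilon>) \<le> real (totient n)"
      using Q assms by (simp add: divide_le_eq mult_ac)
  qed
  also have "\<dots> = real (card ?P)" by (simp add: totient_def)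
  also have "\<dots> \<le> real (card (shell Q))" using \<open>card ?P \<le> card (shell Q)\<close> by (simp only: of_nat_le_iff)
  finally show ?thesis .
qed

section \<open>Matrices congruent to the identity\<close>

definition cong_ball :: "int \<Rightarrow> int \<Rightarrow> imat set" where
  "cong_ball N R = {(a, b, c, d). a * d - b * c = 1 \<and> N dvd a - 1 \<and> N dvd b \<and> N dvd c \<and> N dvd d - 1 \<and>
     \<bar>a\<bar> \<le> R \<and> \<bar>b\<bar> \<le> R \<and> \<bar>c\<bar> \<le> R \<and> \<bar>d\<bar> \<le> R}"

lemma finite_cong_ball [simp]: "finite (cong_ball N R)"
proof (rule finite_subset)
  show "cong_ball N R \<subseteq> {-R..R} \<times> {-R..R} \<times> {-R..R} \<times> {-R..R}"
    by (auto simp: cong_ball_def abs_le_iff)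
qed simp

lemma mnorm_nonneg: "mnorm k \<ge> 0"
  by (cases k) (simp add: le_max_iff_disj)

lemma card_factorizations_le:
  fixes n :: int
  assumes "n \<noteq> 0"
  shows "card {(b, c). b * c = n} \<le> 2 * ndiv (nat \<bar>n\<bar>)" "finite {(b, c). b * c = n}"
proof -
  let ?D = "{k. k dvd nat \<bar>n\<bar>}"
  have "{(b, c). b * c = n} \<subseteq> (\<lambda>(s, k). (s * int k, n div (s * int k))) ` ({-1, 1} \<times> ?D)"
  proof
    fix z assume "z \<in> {(b, c). b * c = n}"
    then obtain b c where z: "z = (b, c)" "b * c = n" by auto
    have b: "b \<noteq> 0" using z assms by auto
    have "nat \<bar>b\<bar> dvd nat \<bar>n\<bar>" using z by (auto simp: nat_abs_mult_distrib)
    moreover have "b = sgn b * int (nat \<bar>b\<bar>)" by (simp add: sgn_mult_abs)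
    moreover have "c = n div b" using z b by auto
    moreover have "sgn b \<in> {-1, 1}" using b by (auto simp: sgn_if)
    ultimately show "z \<in> (\<lambda>(s, k). (s * int k, n div (s * int k))) ` ({-1, 1} \<times> ?D)"
      using z(1) by (intro image_eqI[of _ _ "(sgn b, nat \<bar>b\<bar>)"]) auto
  qed
  moreover have fin: "finite ?D" using assms by (intro finite_divisors_nat) simp
  ultimately have "card {(b, c). b * c = n} \<le> card ((\<lambda>(s, k). (s * int k, n div (s * int k))) ` ({-1, 1} \<times> ?D))"
    by (intro card_mono) auto
  also have "\<dots> \<le> card ({-1, 1 :: int} \<times> ?D)" using fin by (intro card_image_le) auto
  also have "\<dots> = 2 * ndiv (nat \<bar>n\<bar>)" by (simp add: card_cartesian_product ndiv_def)
  finally show "card {(b, c). b * c = n} \<le> 2 * ndiv (nat \<bar>n\<bar>)" .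
  show "finite {(b, c). b * c = n}"
    by (rule finite_subset[OF \<open>_ \<subseteq> _\<close>]) (use fin in auto)
qed

text \<open>An element \<open>1 + N (a', b'; c', d')\<close> of determinant one has \<open>N dvd a' + d'\<close>.\<close>

lemma card_diagonals_le:
  assumes N: "N > 0" and m: "m \<ge> 0"
  shows "card {(a, d). max \<bar>a\<bar> \<bar>d\<bar> = m \<and> N dvd a + d} \<le> 4 * nat (2 * m div N + 1)"
    "finite {(a, d). max \<bar>a\<bar> \<bar>d\<bar> = (m :: int) \<and> N dvd a + d}"
proof -
  let ?S = "{(a, d). max \<bar>a\<bar> \<bar>d\<bar> = m \<and> N dvd a + d}"
  have *: "card {d \<in> {-m..m}. N dvd a + d} \<le> nat (2 * m div N + 1)" for a
  proof -
    \<comment> \<open>Members of one residue class modulo \<open>N\<close> lie in different blocks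
      of length \<open>N\<close>.\<close>
    have inj: "inj_on (\<lambda>d. (d + m) div N) {d \<in> {-m..m}. N dvd a + d}"
    proof (rule inj_onI)
      fix x y assume xy: "x \<in> {d \<in> {-m..m}. N dvd a + d}" "y \<in> {d \<in> {-m..m}. N dvd a + d}"
        and eq: "(x + m) div N = (y + m) div N"
      have "N dvd (a + x) - (a + y)" using xy by (intro dvd_diff) auto
      then have "(x + m) mod N = (y + m) mod N" by (simp add: mod_eq_dvd_iff)
      then have "N * ((x + m) div N) + (x + m) mod N = N * ((y + m) div N) + (y + m) mod N"
        using eq by (simp only:)
      then show "x = y" unfolding mult_div_mod_eq by simp
    qed
    have "(\<lambda>d. (d + m) div N) ` {d \<in> {-m..m}. N dvd a + d} \<subseteq> {0..2 * m div N}"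
      using N by (auto simp: pos_imp_zdiv_nonneg_iff intro!: zdiv_mono1)
    then have "card {d \<in> {-m..m}. N dvd a + d} \<le> card {0..2 * m div N}"
      by (intro card_inj_on_le[OF inj]) auto
    then show ?thesis by simp
  qed
  let ?h = "\<lambda>a. {d \<in> {-m..m}. N dvd a + d}"
  \<comment> \<open>One of the two entries is \<open>m\<close> or \<open>- m\<close>; the swapped
    copy covers the case that it is \<open>d\<close>. This gives \<open>2 * 2\<close>
    families.\<close>
  have sub: "?S \<subseteq> (Sigma {-m, m} ?h) \<union> prod.swap ` (Sigma {-m, m} ?h)"
  proof
    fix z assume "z \<in> ?S"
    then obtain a d where z: "z = (a, d)" "max \<bar>a\<bar> \<bar>d\<bar> = m" "N dvd a + d" by auto
    then have "\<bar>a\<bar> \<le> m" "\<bar>d\<bar> \<le> m" by auto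
    then have ad: "a \<in> {-m..m}" "d \<in> {-m..m}" by auto
    have da: "N dvd d + a" using z(3) by (simp add: add.commute)
    consider "\<bar>a\<bar> = m" | "\<bar>d\<bar> = m" using z(2) by linarith
    then show "z \<in> (Sigma {-m, m} ?h) \<union> prod.swap ` (Sigma {-m, m} ?h)"
    proof cases
      case 1
      then have "a \<in> {-m, m}" by auto
      then show ?thesis using z ad by auto
    next
      case 2
      then have "(d, a) \<in> Sigma {-m, m} ?h" using ad da by auto
      then have "prod.swap (d, a) \<in> prod.swap ` Sigma {-m, m} ?h" by (rule imageI)
      then show ?thesis using z by simp
    qed
  qed
  have fina: "finite (?h a)" for a by (rule finite_subset[of _ "{-m..m}"]) auto
  then have finh: "finite (Sigma {-m, m} ?h)" by (intro finite_SigmaI) auto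
  have c: "card (Sigma {-m, m} ?h) \<le> 2 * nat (2 * m div N + 1)"
  proof -
    have "card (Sigma {-m, m} ?h) = (\<Sum>a\<in>{-m, m}. card (?h a))" using fina by (intro card_SigmaI) auto
    also have "\<dots> \<le> (\<Sum>a\<in>{-m, m}. nat (2 * m div N + 1))" by (intro sum_mono *)
    also have "\<dots> = card {-m, m} * nat (2 * m div N + 1)" by simp
    also have "card {-m, m} \<le> 2" by (simp add: card_insert_if)
    finally show ?thesis by (simp add: mult_right_mono)
  qed
  have "card ?S \<le> card ((Sigma {-m, m} ?h) \<union> prod.swap ` (Sigma {-m, m} ?h))"
    using finh by (intro card_mono[OF _ sub]) auto
  also have "\<dots> \<le> card (Sigma {-m, m} ?h) + card (prod.swap ` (Sigma {-m, m} ?h))"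
    by (rule card_Un_le)
  also have "\<dots> \<le> card (Sigma {-m, m} ?h) + card (Sigma {-m, m} ?h)"
    using finh by (intro add_left_mono card_image_le)
  finally show "card ?S \<le> 4 * nat (2 * m div N + 1)" using c by linarith
  show "finite ?S" by (rule finite_subset[OF sub]) (use finh in auto)
qed

lemma card_le_fibres:
  assumes "finite A" "finite B" "f ` A \<subseteq> B" "\<And>y. y \<in> B \<Longrightarrow> real (card {x\<in>A. f x = y}) \<le> K"
  shows "real (card A) \<le> real (card B) * K"
proof -
  have "real (card A) = (\<Sum>x\<in>A. 1)" by simp
  also have "\<dots> = (\<Sum>y\<in>B. \<Sum>x\<in>{x\<in>A. f x = y}. 1)"
    by (rule sum.group[OF assms(1-3), symmetric])
  also have "\<dots> \<le> (\<Sum>y\<in>B. K)"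
    using assms(4) by (intro sum_mono) simp
  finally show ?thesis by simp
qed

lemma sum_unipotent_le:
  fixes R :: int
  assumes R: "R \<ge> 1"
  shows "(\<Sum>b\<in>{b. b \<noteq> 0 \<and> \<bar>b\<bar> \<le> R}. 1 / \<bar>real_of_int b\<bar>) \<le> 2 * (1 + ln R)"
proof -
  define r where "r = nat R"
  have r: "R = int r" "r \<ge> 1" using R by (simp_all add: r_def)
  have "{b. b \<noteq> 0 \<and> \<bar>b\<bar> \<le> R} \<subseteq> int ` {1..r} \<union> (\<lambda>j. - int j) ` {1..r}"
  proof
    fix b assume b: "b \<in> {b. b \<noteq> 0 \<and> \<bar>b\<bar> \<le> R}"
    show "b \<in> int ` {1..r} \<union> (\<lambda>j. - int j) ` {1..r}"
    proof (cases "b > 0")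
      case True
      then have "b = int (nat b)" "nat b \<in> {1..r}" using b r by auto
      then show ?thesis by blast
    next
      case False
      then have "b = - int (nat (- b))" "nat (- b) \<in> {1..r}" using b r by auto
      then show ?thesis by blast
    qed
  qed
  then have "(\<Sum>b\<in>{b. b \<noteq> 0 \<and> \<bar>b\<bar> \<le> R}. 1 / \<bar>real_of_int b\<bar>) \<le>
      (\<Sum>b\<in>int ` {1..r} \<union> (\<lambda>j. - int j) ` {1..r}. 1 / \<bar>real_of_int b\<bar>)"
    by (intro sum_mono2) auto
  also have "\<dots> \<le> (\<Sum>b\<in>int ` {1..r}. 1 / \<bar>real_of_int b\<bar>) + (\<Sum>b\<in>(\<lambda>j. - int j) ` {1..r}. 1 / \<bar>real_of_int b\<bar>)"
    by (intro sum_Un_le) auto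
  also have "\<dots> = 2 * (\<Sum>j=1..r. 1 / real j)"
    by (simp add: sum.reindex inj_on_def)
  also have "\<dots> \<le> 2 * (1 + ln R)"
    using sum_inverse_le[OF r(2)] r by simp
  finally show ?thesis .
qed

text \<open>With \<open>b * c = 0\<close> the diagonal is \<open>1, 1\<close> or
  \<open>-1, -1\<close>, and \<open>N \<ge> 3\<close> excludes the latter. What remains is the
  identity and two families of unipotent matrices, whose inverse norms form harmonic sums.\<close>

lemma sum_cong_ball_parabolic_le:
  assumes N: "N \<ge> 3" and R: "R \<ge> 1"
  shows "(\<Sum>k\<in>{(a, b, c, d)\<in>cong_ball N R. b * c = 0}. 1 / real_of_int (mnorm k)) \<le> 5 + 4 * ln R"
proof -
  let ?B = "{b. b \<noteq> 0 \<and> \<bar>b\<bar> \<le> R}"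
  have finB: "finite ?B" by (rule finite_subset[of _ "{-R..R}"]) (auto simp: abs_le_iff)
  have "{(a, b, c, d)\<in>cong_ball N R. b * c = 0} \<subseteq>
      {mone} \<union> (\<lambda>b. (1, b, 0, 1)) ` ?B \<union> (\<lambda>c. (1, 0, c, 1)) ` ?B"
  proof
    fix k assume "k \<in> {(a, b, c, d)\<in>cong_ball N R. b * c = 0}"
    then obtain a b c d where k: "k = (a, b, c, d)" "k \<in> cong_ball N R" "b * c = 0" by auto
    then have "a * d = 1" by (simp add: cong_ball_def)
    then have "a = 1 \<and> d = 1 \<or> a = -1 \<and> d = -1"
      by (simp add: zmult_eq_1_iff)
    moreover have "a \<noteq> -1"
    proof
      assume "a = -1"
      then have "N dvd 2" using k by (simp add: cong_ball_def)
      then show False using N zdvd_imp_le[of N 2] by simp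
    qed
    ultimately have ad: "a = 1" "d = 1" by auto
    have bc: "\<bar>b\<bar> \<le> R" "\<bar>c\<bar> \<le> R" "b = 0 \<or> c = 0" using k by (auto simp: cong_ball_def)
    then show "k \<in> {mone} \<union> (\<lambda>b. (1, b, 0, 1)) ` ?B \<union> (\<lambda>c. (1, 0, c, 1)) ` ?B"
      unfolding k(1) ad mone_def by (cases "b = 0"; cases "c = 0") auto
  qed
  then have "(\<Sum>k\<in>{(a, b, c, d)\<in>cong_ball N R. b * c = 0}. 1 / real_of_int (mnorm k)) \<le>
      (\<Sum>k\<in>{mone} \<union> (\<lambda>b. (1, b, 0, 1)) ` ?B \<union> (\<lambda>c. (1, 0, c, 1)) ` ?B. 1 / real_of_int (mnorm k))"
    using finB by (intro sum_mono2) (simp_all add: mnorm_nonneg del: mnorm.simps)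
  also have "\<dots> \<le> (\<Sum>k\<in>{mone}. 1 / real_of_int (mnorm k)) + (\<Sum>k\<in>(\<lambda>b. (1, b, 0, 1)) ` ?B. 1 / real_of_int (mnorm k)) +
      (\<Sum>k\<in>(\<lambda>c. (1, 0, c, 1)) ` ?B. 1 / real_of_int (mnorm k))"
    by (rule order_trans[OF sum_Un_le add_mono[OF sum_Un_le order_refl]])
      (use finB in \<open>simp_all add: mnorm_nonneg del: mnorm.simps\<close>)
  also have "(\<Sum>k\<in>{mone}. 1 / real_of_int (mnorm k)) = 1" by (simp add: mone_def)
  also have "(\<Sum>k\<in>(\<lambda>b. (1, b, 0, 1)) ` ?B. 1 / real_of_int (mnorm k)) = (\<Sum>b\<in>?B. 1 / \<bar>real_of_int b\<bar>)"
    by (subst sum.reindex) (auto simp: inj_on_def max_def intro!: sum.cong)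
  also have "(\<Sum>k\<in>(\<lambda>c. (1, 0, c, 1)) ` ?B. 1 / real_of_int (mnorm k)) = (\<Sum>b\<in>?B. 1 / \<bar>real_of_int b\<bar>)"
    by (subst sum.reindex) (auto simp: inj_on_def max_def intro!: sum.cong)
  also have "1 + (\<Sum>b\<in>?B. 1 / \<bar>real_of_int b\<bar>) + (\<Sum>b\<in>?B. 1 / \<bar>real_of_int b\<bar>) \<le>
      1 + 2 * (1 + ln R) + 2 * (1 + ln R)"
    by (intro add_mono order_refl sum_unipotent_le[OF R])
  finally show ?thesis by simp
qed

text \<open>Sort by \<open>m\<close>, the larger modulus of \<open>a'\<close> and \<open>d'\<close>
  in \<open>a = 1 + N a'\<close>, \<open>d = 1 + N d'\<close>. The norm is at least
  \<open>N m / 2\<close>, there are at most \<open>4 (2 m / N + 1)\<close> diagonals, and each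
  leaves at most \<open>2 D\<close> factorizations of the nonzero number \<open>a d - 1\<close> into
  \<open>b\<close> and \<open>c\<close>. Summing over \<open>m \<le> 2 R / N\<close> gives the term
  \<open>R / N^3\<close> and a harmonic sum.\<close>

lemma sum_cong_ball_generic_le:
  assumes N: "N \<ge> 3" and R: "R \<ge> 1"
    and D: "\<And>n. 0 < n \<Longrightarrow> n \<le> nat (2 * R\<^sup>2) \<Longrightarrow> real (ndiv n) \<le> D"
  shows "(\<Sum>k\<in>{(a, b, c, d)\<in>cong_ball N R. b * c \<noteq> 0}. 1 / real_of_int (mnorm k)) \<le>
    2 * D * (32 * R / real_of_int N ^ 3 + 8 * (1 + ln (2 * R)))"
proof -
  let ?A = "{(a, b, c, d)\<in>cong_ball N R. b * c \<noteq> 0}"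
  define \<pi> :: "imat \<Rightarrow> ivec" where "\<pi> = (\<lambda>(a, b, c, d). ((a - 1) div N, (d - 1) div N))"
  define m where "m k = max \<bar>fst (\<pi> k)\<bar> \<bar>snd (\<pi> k)\<bar>" for k
  define M where "M = nat (2 * R div N)"
  let ?S = "\<lambda>j. {(a, d). max \<bar>a\<bar> \<bar>d\<bar> = j \<and> N dvd a + d}"
  have finA: "finite ?A" by (rule finite_subset[of _ "cong_ball N R"]) auto
  have D0: "D \<ge> 0"
  proof -
    have "1 \<le> 2 * R\<^sup>2" using one_le_power[OF R, of 2] by linarith
    then have "real (ndiv 1) \<le> D" by (intro D) (auto simp: le_nat_iff)
    then show ?thesis by linarith
  qed
  have A: "\<exists>a b c d a' d'. k = (a, b, c, d) \<and> a = 1 + N * a' \<and> d = 1 + N * d' \<and> \<pi> k = (a', d') \<and>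
      b * c = a * d - 1 \<and> b * c \<noteq> 0 \<and> N dvd a' + d' \<and> 1 \<le> m k \<and> N * m k \<le> 2 * R \<and> \<bar>a\<bar> \<le> R \<and> \<bar>d\<bar> \<le> R \<and>
      N * m k \<le> 2 * mnorm k" if "k \<in> ?A" for k
  proof -
    obtain a b c d where k: "k = (a, b, c, d)" by (cases k)
    have kk: "a * d - b * c = 1" "N dvd a - 1" "N dvd b" "N dvd c" "N dvd d - 1" "\<bar>a\<bar> \<le> R" "\<bar>d\<bar> \<le> R" "b * c \<noteq> 0"
      using that by (auto simp: k cong_ball_def)
    obtain a' where "a - 1 = N * a'" using kk(2) by (elim dvdE)
    then have a': "a = 1 + N * a'" by simp
    obtain d' where "d - 1 = N * d'" using kk(5) by (elim dvdE)
    then have d': "d = 1 + N * d'" by simp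
    have pk: "\<pi> k = (a', d')" using N by (simp add: \<pi>_def k a' d')
    have bc: "b * c = a * d - 1" using kk(1) by simp
    \<comment> \<open>Both off-diagonal entries are divisible by \<open>N\<close>, so the
      determinant equation modulo \<open>N^2\<close> forces \<open>N\<close> to divide its linear
      term \<open>a' + d'\<close>.\<close>
    have "N * N dvd b * c" using kk(3,4) by (rule mult_dvd_mono)
    moreover have "b * c = N * (a' + d' + N * (a' * d'))"
      by (simp add: bc a' d' algebra_simps)
    ultimately have "N dvd a' + d' + N * (a' * d')" using N by simp
    then have dv: "N dvd a' + d'" by (simp add: dvd_add_left_iff)
    have ne: "a' \<noteq> 0 \<or> d' \<noteq> 0" using kk(8) bc a' d' by auto
    have m1: "m k \<ge> 1" using ne by (auto simp: m_def pk)
    have "\<bar>N * a'\<bar> \<le> R + 1" "\<bar>N * d'\<bar> \<le> R + 1" using kk(6,7) a' d' by linarith+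
    then have Na: "N * \<bar>a'\<bar> \<le> R + 1" "N * \<bar>d'\<bar> \<le> R + 1" using N by (simp_all add: abs_mult)
    have mk: "m k = \<bar>a'\<bar> \<or> m k = \<bar>d'\<bar>" by (auto simp: m_def pk max_def)
    have up: "N * m k \<le> 2 * R" using mk Na R by auto
    have "N * 1 \<le> N * m k" using m1 N by (intro mult_left_mono) auto
    then have N2: "N * m k \<ge> 2" using N by linarith
    have "\<bar>N * a'\<bar> - 1 \<le> \<bar>a\<bar>" "\<bar>N * d'\<bar> - 1 \<le> \<bar>d\<bar>" using a' d' by linarith+
    then have "N * \<bar>a'\<bar> - 1 \<le> \<bar>a\<bar>" "N * \<bar>d'\<bar> - 1 \<le> \<bar>d\<bar>" using N by (simp_all add: abs_mult)
    moreover have "\<bar>a\<bar> \<le> mnorm k" "\<bar>d\<bar> \<le> mnorm k" by (simp_all add: k le_max_iff_disj)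
    ultimately have "N * m k - 1 \<le> mnorm k" using mk by auto
    then have "N * m k \<le> 2 * mnorm k" using N2 by linarith
    then show ?thesis using k a' d' pk bc kk dv m1 up by blast
  qed
  have "(\<Sum>k\<in>?A. 1 / real_of_int (mnorm k)) \<le> (\<Sum>k\<in>?A. 2 / (N * real (nat (m k))))"
  proof (rule sum_mono)
    fix k assume "k \<in> ?A"
    then have mk: "1 \<le> m k" "N * m k \<le> 2 * mnorm k" using A by blast+
    have pos: "N * m k > 0" using mk N by simp
    have inv: "1 / y \<le> 2 / x" if "0 < x" "x \<le> 2 * y" for x y :: real
      using that by (simp add: field_simps)
    have "real_of_int (N * m k) \<le> real_of_int (2 * mnorm k)" using mk(2) by (simp only: of_int_le_iff)
    then have "1 / real_of_int (mnorm k) \<le> 2 / real_of_int (N * m k)"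
      by (intro inv of_int_0_less_iff[THEN iffD2] pos) simp
    then show "1 / real_of_int (mnorm k) \<le> 2 / (N * real (nat (m k)))" using mk by simp
  qed
  also have "\<dots> = (\<Sum>j\<in>{1..M}. \<Sum>k\<in>{k\<in>?A. nat (m k) = j}. 2 / (N * real (nat (m k))))"
  proof (rule sum.group[symmetric])
    show "(\<lambda>k. nat (m k)) ` ?A \<subseteq> {1..M}"
    proof
      fix j assume "j \<in> (\<lambda>k. nat (m k)) ` ?A"
      then obtain k where k: "k \<in> ?A" "j = nat (m k)" by (rule imageE)
      have mk: "1 \<le> m k" "N * m k \<le> 2 * R" using A[OF k(1)] by blast+
      have "m k = N * m k div N" using N by simp
      also have "\<dots> \<le> 2 * R div N" using mk N by (intro zdiv_mono1) auto
      finally show "j \<in> {1..M}" using mk k by (simp add: M_def nat_mono le_nat_iff)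
    qed
  qed (use finA in auto)
  also have "\<dots> = (\<Sum>j\<in>{1..M}. real (card {k\<in>?A. nat (m k) = j}) * (2 / (N * real j)))"
    by (intro sum.cong refl) simp
  also have "\<dots> \<le> (\<Sum>j\<in>{1..M}. (4 * (2 * j / N + 1) * (2 * D)) * (2 / (N * real j)))"
  proof (intro sum_mono mult_right_mono)
    fix j assume j: "j \<in> {1..M}"
    have j0: "int j \<ge> 0" by simp
    have "real (card {k\<in>?A. nat (m k) = j}) \<le> real (card (?S (int j))) * (2 * D)"
    proof (rule card_le_fibres[of _ _ \<pi>])
      show "finite {k\<in>?A. nat (m k) = j}" using finA by simp
      show "finite (?S (int j))" by (rule card_diagonals_le(2)) (use N in auto)
      show "\<pi> ` {k\<in>?A. nat (m k) = j} \<subseteq> ?S (int j)"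
      proof
        fix z assume "z \<in> \<pi> ` {k\<in>?A. nat (m k) = j}"
        then obtain k where k: "k \<in> ?A" "nat (m k) = j" "z = \<pi> k" by auto
        then obtain a' d' where *: "\<pi> k = (a', d')" "N dvd a' + d'" "1 \<le> m k" using A[OF k(1)] by blast
        then have "m k = int j" using k by auto
        then show "z \<in> ?S (int j)" using * k by (simp add: m_def)
      qed
      fix z assume "z \<in> ?S (int j)"
      obtain a' d' where z: "z = (a', d')" by (cases z)
      define n where "n = (1 + N * a') * (1 + N * d') - 1"
      let ?F = "{k \<in> {k\<in>?A. nat (m k) = j}. \<pi> k = z}"
      show "real (card ?F) \<le> 2 * D"
      proof (cases "?F = {}")
        case False
        then obtain k where kA: "k \<in> ?A" and kz: "\<pi> k = z" by auto
        obtain a b c d a1 d1 where k': "k = (a, b, c, d)" "a = 1 + N * a1" "d = 1 + N * d1" "\<pi> k = (a1, d1)"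
            "b * c = a * d - 1" "b * c \<noteq> 0" "\<bar>a\<bar> \<le> R" "\<bar>d\<bar> \<le> R"
          using A[OF kA] by blast
        then have k: "a = 1 + N * a'" "d = 1 + N * d'" "b * c = a * d - 1" "b * c \<noteq> 0"
            "\<bar>a\<bar> \<le> R" "\<bar>d\<bar> \<le> R"
          using kz z by simp_all
        have n: "n = a * d - 1" "n \<noteq> 0" using k(3,4) by (simp_all add: n_def k(1,2))
        have "\<bar>n\<bar> \<le> \<bar>a * d\<bar> + 1" unfolding n by linarith
        also have "\<dots> \<le> R * R + 1"
          unfolding abs_mult using k R by (intro add_right_mono mult_mono) auto
        also have "\<dots> \<le> 2 * R\<^sup>2"
          using R mult_mono[of 1 R 1 R] by (simp add: power2_eq_square)
        finally have nD: "nat \<bar>n\<bar> \<le> nat (2 * R\<^sup>2)" by (rule nat_mono)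
        have "card ?F \<le> card {(b, c). b * c = n}"
        proof (rule card_inj_on_le[OF _ _ card_factorizations_le(2)[OF n(2)]])
          show "(\<lambda>(a, b, c, d). (b, c)) ` ?F \<subseteq> {(b, c). b * c = n}"
          proof
            fix y assume "y \<in> (\<lambda>(a, b, c, d). (b, c)) ` ?F"
            then obtain k where k: "k \<in> ?A" "\<pi> k = z" "y = (\<lambda>(a, b, c, d). (b, c)) k" by auto
            then show "y \<in> {(b, c). b * c = n}"
              using A[OF k(1)] z by (auto simp: n_def)
          qed
          show "inj_on (\<lambda>(a, b, c, d). (b, c)) ?F"
          proof (rule inj_onI)
            fix k k' assume k: "k \<in> ?F" and k': "k' \<in> ?F"
              and eq: "(\<lambda>(a, b, c, d). (b, c)) k = (\<lambda>(a, b, c, d). (b, c)) k'"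
            have "k \<in> ?A" "k' \<in> ?A" "\<pi> k = z" "\<pi> k' = z" using k k' by auto
            then show "k = k'" using A[of k] A[of k'] z eq by auto
          qed
        qed
        also have "\<dots> \<le> 2 * ndiv (nat \<bar>n\<bar>)" by (rule card_factorizations_le(1)[OF n(2)])
        finally have "real (card ?F) \<le> real (2 * ndiv (nat \<bar>n\<bar>))" by (rule of_nat_mono)
        also have "\<dots> \<le> 2 * D" using D[of "nat \<bar>n\<bar>"] nD n(2) by simp
        finally show ?thesis .
      next
        case True
        show ?thesis unfolding True using D0 by simp
      qed
    qed
    also have "\<dots> \<le> (4 * (2 * j / N + 1)) * (2 * D)"
    proof (rule mult_right_mono)
      have "real (card (?S (int j))) \<le> real (4 * nat (2 * int j div N + 1))"
        using card_diagonals_le(1)[of N "int j"] N by (intro of_nat_mono) auto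
      also have "\<dots> = 4 * (real_of_int (2 * int j div N) + 1)"
        using N by (simp add: pos_imp_zdiv_nonneg_iff)
      also have "\<dots> \<le> 4 * (2 * j / N + 1)"
        using real_of_int_div4[of "2 * int j" N] by simp
      finally show "real (card (?S (int j))) \<le> 4 * (2 * j / N + 1)" .
    qed (use D0 in simp)
    finally show "real (card {k\<in>?A. nat (m k) = j}) \<le> 4 * (2 * j / N + 1) * (2 * D)" .
  qed (use N in auto)
  also have "\<dots> = 2 * D * (\<Sum>j\<in>{1..M}. 16 / (real_of_int N)\<^sup>2 + 8 / N * (1 / real j))"
    unfolding sum_distrib_left
    by (rule sum.cong) (use N in \<open>auto simp: field_simps power2_eq_square\<close>)
  also have "\<dots> = 2 * D * (real M * (16 / (real_of_int N)\<^sup>2) + 8 / N * (\<Sum>j\<in>{1..M}. 1 / real j))"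
    by (simp add: sum.distrib sum_distrib_left)
  also have "\<dots> \<le> 2 * D * (32 * R / real_of_int N ^ 3 + 8 * (1 + ln (2 * R)))"
  proof (intro mult_left_mono add_mono)
    have "real M = real_of_int (2 * R div N)" using N R by (simp add: M_def pos_imp_zdiv_nonneg_iff)
    also have "\<dots> \<le> 2 * R / N" using real_of_int_div4[of "2 * R" N] by simp
    finally have MR: "real M \<le> 2 * R / N" .
    then have "real M * (16 / (real_of_int N)\<^sup>2) \<le> 2 * R / N * (16 / (real_of_int N)\<^sup>2)"
      by (intro mult_right_mono) auto
    then show "real M * (16 / (real_of_int N)\<^sup>2) \<le> 32 * R / real_of_int N ^ 3"
      by (simp add: power2_eq_square power3_eq_cube)
    have ln0: "ln (2 * real_of_int R) \<ge> 0" using R by simp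
    have "(\<Sum>j\<in>{1..M}. 1 / real j) \<le> 1 + ln (2 * R)"
    proof (cases "M \<ge> 1")
      case True
      have "2 * R / N \<le> 2 * real_of_int R" using N R by (simp add: divide_le_eq mult_le_cancel_left1)
      then have "ln (real M) \<le> ln (2 * R)" using True MR R by simp
      then show ?thesis using sum_inverse_le[OF True] by linarith
    qed (use ln0 in auto)
    moreover have "8 / real_of_int N \<le> 8" using N by (simp add: divide_le_eq)
    ultimately show "8 / N * (\<Sum>j\<in>{1..M}. 1 / real j) \<le> 8 * (1 + ln (2 * R))"
      by (intro mult_mono sum_nonneg) auto
  qed (use D0 in auto)
  finally show ?thesis by (simp only: of_int_mult of_int_numeral)
qed

lemma sum_cong_ball_le:
  assumes N: "N \<ge> 3" and R: "R \<ge> 1"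
    and D: "\<And>n. 0 < n \<Longrightarrow> n \<le> nat (2 * R\<^sup>2) \<Longrightarrow> real (ndiv n) \<le> D"
  shows "(\<Sum>k\<in>cong_ball N R. 1 / real_of_int (mnorm k)) \<le>
    5 + 4 * ln R + 2 * D * (32 * R / real_of_int N ^ 3 + 8 * (1 + ln (2 * R)))"
proof -
  let ?f = "\<lambda>k. 1 / real_of_int (mnorm k)"
  let ?P = "{(a, b, c, d)\<in>cong_ball N R. b * c = 0}" and ?A = "{(a, b, c, d)\<in>cong_ball N R. b * c \<noteq> 0}"
  have "finite ?P" "finite ?A" by (rule finite_subset[of _ "cong_ball N R"]; auto)+
  then have "sum ?f (?P \<union> ?A) = sum ?f ?P + sum ?f ?A" by (intro sum.union_disjoint) auto
  moreover have "?P \<union> ?A = cong_ball N R" by auto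
  ultimately show ?thesis
    using sum_cong_ball_parabolic_le[OF N R] sum_cong_ball_generic_le[OF N R D] by simp
qed

section \<open>Words of matrices\<close>

text \<open>The head of the list acts first on vectors, so that words of length \<open>n\<close>
  expand the \<open>n\<close>-th power of \<open>avg_op\<close>.\<close>

fun wprod :: "imat list \<Rightarrow> imat" where
  "wprod [] = mone"
| "wprod (w # ws) = mmul (wprod ws) w"

definition shell_words :: "int \<Rightarrow> nat \<Rightarrow> imat list set" where
  "shell_words Q n = {ws. set ws \<subseteq> shell Q \<and> length ws = n}"

lemma finite_shell_words [simp]: "finite (shell_words Q n)"
  unfolding shell_words_def by (rule finite_lists_length_eq) simp

lemma shell_words_Suc: "shell_words Q (Suc n) = (\<lambda>(w, ws). w # ws) ` (shell Q \<times> shell_words Q n)"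
  by (auto simp: shell_words_def length_Suc_conv image_iff)

lemma wprod_append: "wprod (us @ ws) = mmul (wprod ws) (wprod us)"
  by (induction us) (simp_all add: mmul_assoc)

lemma wprod_rev_madj: "wprod (rev (map madj ws)) = madj (wprod ws)"
  by (induction ws) (simp_all add: wprod_append madj_mmul, simp add: mone_def)

lemma madj_in_shell [simp]: "madj w \<in> shell Q \<longleftrightarrow> w \<in> shell Q"
  by (simp add: shell_def)

lemma mdet_shell: "w \<in> shell Q \<Longrightarrow> mdet w = 1"
  by (simp add: shell_def)

lemma mdet_wprod: "ws \<in> shell_words Q n \<Longrightarrow> mdet (wprod ws) = 1"
proof (induction ws arbitrary: n)
  case (Cons w ws)
  then have "w \<in> shell Q" "ws \<in> shell_words Q (n - 1)" by (simp_all add: shell_words_def) auto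
  then show ?case using Cons.IH by (simp add: mdet_mmul mdet_shell)
qed simp

definition row1 :: "imat \<Rightarrow> ivec" where "row1 = (\<lambda>(a, b, c, d). (a, b))"
definition row2 :: "imat \<Rightarrow> ivec" where "row2 = (\<lambda>(a, b, c, d). (c, d))"

lemma act_rows: "act g x = (dot (row1 g) x, dot (row2 g) x)"
  by (cases g; cases x) (simp add: row1_def row2_def)

lemma mnorm_rows: "mnorm g = max (vnorm (row1 g)) (vnorm (row2 g))"
  by (cases g) (simp add: row1_def row2_def vnorm_def)

lemma rows_mmul: "row1 (mmul g h) = rmul (row1 g) h" "row2 (mmul g h) = rmul (row2 g) h"
  by (cases g; cases h; simp add: row1_def row2_def)+

lemma mnorm_mmul_le: "mnorm (mmul g h) \<le> 2 * mnorm h * mnorm g"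
proof -
  have "2 * mnorm h * vnorm (row1 g) \<le> 2 * mnorm h * mnorm g"
    "2 * mnorm h * vnorm (row2 g) \<le> 2 * mnorm h * mnorm g"
    by (intro mult_left_mono; simp add: mnorm_rows[of g] mnorm_nonneg)+
  then show ?thesis
    using vnorm_rmul_le[of "row1 g" h] vnorm_rmul_le[of "row2 g" h]
    unfolding mnorm_rows[of "mmul g h"] rows_mmul by (intro max.boundedI) linarith+
qed

lemma mnorm_wprod_le:
  assumes "Q \<ge> 1" "ws \<in> shell_words Q n"
  shows "mnorm (wprod ws) \<le> (2 * Q) ^ n"
  using assms(2)
proof (induction ws arbitrary: n)
  case Nil
  then show ?case by (simp add: shell_words_def mone_def)
next
  case (Cons w ws)
  then obtain m where n: "n = Suc m" and ws: "ws \<in> shell_words Q m" and w: "w \<in> shell Q"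
    by (auto simp: shell_words_def)
  have "mnorm (wprod (w # ws)) \<le> 2 * mnorm w * mnorm (wprod ws)"
    using mnorm_mmul_le by simp
  also have "\<dots> \<le> 2 * Q * (2 * Q) ^ m"
    using Cons.IH[OF ws] w assms(1) by (intro mult_mono) (auto simp: shell_def mnorm_nonneg)
  finally show ?case by (simp add: n)
qed

lemma mnorm_pos: "mdet g = 1 \<Longrightarrow> mnorm g > 0"
  by (cases g) (auto simp: less_max_iff_disj)

text \<open>It is enough to follow the row of \<open>g\<close> that attains its norm, which is
  multiplied from the right as a vector. The inverse is harmless because \<open>shell Q\<close> is
  closed under \<open>madj\<close>.\<close>

lemma sum_shell_inverse_mnorm_le:
  assumes Q: "Q \<ge> 1" and g: "mdet g = 1"
  shows "(\<Sum>w\<in>shell Q. 1 / real_of_int (mnorm (mmul g (madj w)))) \<le> shell_const Q / mnorm g"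
proof -
  obtain x where x: "x = row1 g \<or> x = row2 g" "vnorm x = mnorm g"
    unfolding mnorm_rows[of g] by (metis max_def)
  have x0: "x \<noteq> 0" using x mnorm_pos[OF g] by (auto simp: vnorm_def)
  have "(\<Sum>w\<in>shell Q. 1 / real_of_int (mnorm (mmul g (madj w)))) =
      (\<Sum>w\<in>shell Q. 1 / real_of_int (mnorm (mmul g w)))"
    by (rule sum.reindex_bij_witness[of _ madj madj]) auto
  also have "\<dots> \<le> (\<Sum>w\<in>shell Q. 1 / real_of_int (vnorm (rmul x w)))"
  proof (rule sum_mono)
    fix w assume w: "w \<in> shell Q"
    have "vnorm (rmul x w) \<le> mnorm (mmul g w)"
      using x(1) unfolding mnorm_rows[of "mmul g w"] rows_mmul by auto
    moreover have "vnorm (rmul x w) > 0"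
    proof -
      have "vnorm x \<le> 2 * mnorm w * vnorm (rmul x w)"
        using vnorm_le_rmul[OF mdet_shell[OF w] order_refl] .
      then have "vnorm (rmul x w) \<noteq> 0" using vnorm_pos[OF x0] by auto
      then show ?thesis using vnorm_nonneg[of "rmul x w"] by linarith
    qed
    ultimately show "1 / real_of_int (mnorm (mmul g w)) \<le> 1 / real_of_int (vnorm (rmul x w))"
      by (intro divide_left_mono) auto
  qed
  also have "\<dots> \<le> shell_const Q / vnorm x" by (rule sum_shell_inverse_le[OF Q x0])
  finally show ?thesis using x by simp
qed

lemma shell_const_nonneg: "Q \<ge> 1 \<Longrightarrow> shell_const Q \<ge> 0"
  by (simp add: shell_const_def)

text \<open>The function \<open>1 / mnorm\<close> is a supersolution for the random walk on the modular group.\<close>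

lemma card_words_le:
  assumes Q: "Q \<ge> 1" and g: "mdet g = 1"
  shows "real (card {ws\<in>shell_words Q n. wprod ws = g}) \<le> shell_const Q ^ n / mnorm g"
  using g
proof (induction n arbitrary: g)
  case 0
  show ?case
  proof (cases "g = mone")
    case True
    have "{ws\<in>shell_words Q 0. wprod ws = g} = {[]}" using True by (auto simp: shell_words_def)
    then show ?thesis using True by (simp add: mone_def)
  next
    case False
    then have "{ws\<in>shell_words Q 0. wprod ws = g} = {}" by (auto simp: shell_words_def)
    then show ?thesis using mnorm_pos[OF 0] by (simp only: card.empty) simp
  qed
next
  case (Suc n)
  let ?C = "\<lambda>w. {ws\<in>shell_words Q n. wprod ws = mmul g (madj w)}"
  have "{ws\<in>shell_words Q (Suc n). wprod ws = g} \<subseteq> (\<Union>w\<in>shell Q. (#) w ` ?C w)"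
  proof
    fix us assume "us \<in> {ws\<in>shell_words Q (Suc n). wprod ws = g}"
    then obtain w ws where us: "us = w # ws" "w \<in> shell Q" "ws \<in> shell_words Q n" "mmul (wprod ws) w = g"
      by (auto simp: shell_words_Suc)
    then have "wprod ws = mmul g (madj w)"
      by (metis mdet_shell mmul_assoc mmul_madj(1) mmul_mone(2))
    then show "us \<in> (\<Union>w\<in>shell Q. (#) w ` ?C w)" using us by auto
  qed
  then have "card {ws\<in>shell_words Q (Suc n). wprod ws = g} \<le> card (\<Union>w\<in>shell Q. (#) w ` ?C w)"
    by (intro card_mono) auto
  also have "\<dots> \<le> (\<Sum>w\<in>shell Q. card ((#) w ` ?C w))" by (intro card_UN_le) simp
  also have "\<dots> \<le> (\<Sum>w\<in>shell Q. card (?C w))" by (intro sum_mono card_image_le) simp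
  finally have "real (card {ws\<in>shell_words Q (Suc n). wprod ws = g}) \<le> (\<Sum>w\<in>shell Q. real (card (?C w)))"
    by (simp only: of_nat_sum[symmetric] of_nat_le_iff)
  also have "\<dots> \<le> (\<Sum>w\<in>shell Q. shell_const Q ^ n / mnorm (mmul g (madj w)))"
    using Suc by (intro sum_mono Suc.IH) (simp add: mdet_mmul mdet_shell)
  also have "\<dots> = shell_const Q ^ n * (\<Sum>w\<in>shell Q. 1 / real_of_int (mnorm (mmul g (madj w))))"
    by (simp add: sum_distrib_left)
  also have "\<dots> \<le> shell_const Q ^ n * (shell_const Q / mnorm g)"
    using shell_const_nonneg[OF Q]
    by (intro mult_left_mono sum_shell_inverse_mnorm_le[OF Q Suc.prems]) auto
  finally show ?case by (simp add: mult.commute)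
qed

lemma card_congruent_words_le:
  assumes Q: "Q \<ge> 1"
  shows "real (card {ws\<in>shell_words Q n. case wprod ws of (a, b, c, d) \<Rightarrow> N dvd a - 1 \<and> N dvd b \<and> N dvd c \<and> N dvd d - 1})
    \<le> shell_const Q ^ n * (\<Sum>k\<in>cong_ball N ((2 * Q) ^ n). 1 / real_of_int (mnorm k))"
proof -
  let ?W = "{ws\<in>shell_words Q n. case wprod ws of (a, b, c, d) \<Rightarrow> N dvd a - 1 \<and> N dvd b \<and> N dvd c \<and> N dvd d - 1}"
  let ?B = "cong_ball N ((2 * Q) ^ n)"
  have "?W \<subseteq> (\<Union>k\<in>?B. {ws\<in>shell_words Q n. wprod ws = k})"
  proof
    fix ws assume ws: "ws \<in> ?W"
    obtain a b c d where k: "wprod ws = (a, b, c, d)" by (cases "wprod ws")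
    have "mdet (wprod ws) = 1" "mnorm (wprod ws) \<le> (2 * Q) ^ n"
      using ws mdet_wprod mnorm_wprod_le[OF Q] by blast+
    then have "wprod ws \<in> ?B" using ws by (auto simp: cong_ball_def k)
    then show "ws \<in> (\<Union>k\<in>?B. {ws\<in>shell_words Q n. wprod ws = k})" using ws by blast
  qed
  then have "card ?W \<le> card (\<Union>k\<in>?B. {ws\<in>shell_words Q n. wprod ws = k})"
    by (intro card_mono) auto
  also have "\<dots> \<le> (\<Sum>k\<in>?B. card {ws\<in>shell_words Q n. wprod ws = k})" by (intro card_UN_le) simp
  finally have "real (card ?W) \<le> (\<Sum>k\<in>?B. real (card {ws\<in>shell_words Q n. wprod ws = k}))"
    by (simp only: of_nat_sum[symmetric] of_nat_le_iff)
  also have "\<dots> \<le> (\<Sum>k\<in>?B. shell_const Q ^ n / mnorm k)"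
    by (intro sum_mono card_words_le[OF Q]) (auto simp: cong_ball_def)
  finally show ?thesis by (simp add: sum_distrib_left)
qed

section \<open>The averaging operator over a shell and its powers\<close>

definition avg_op :: "int \<Rightarrow> (ivec \<Rightarrow> complex) \<Rightarrow> ivec \<Rightarrow> complex" where
  "avg_op Q f x = (\<Sum>w\<in>shell Q. f (act w x))"

definition iprod :: "int \<Rightarrow> (ivec \<Rightarrow> complex) \<Rightarrow> (ivec \<Rightarrow> complex) \<Rightarrow> complex" where
  "iprod N f g = (\<Sum>x\<in>zbox N. f x * cnj (g x))"

lemma avg_op_funpow: "(avg_op Q ^^ n) f x = (\<Sum>ws\<in>shell_words Q n. f (act (wprod ws) x))"
proof (induction n arbitrary: x)
  case 0
  have "shell_words Q 0 = {[]}" by (auto simp: shell_words_def)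
  then show ?case by simp
next
  case (Suc n)
  have "(avg_op Q ^^ Suc n) f x = (\<Sum>w\<in>shell Q. \<Sum>ws\<in>shell_words Q n. f (act (wprod ws) (act w x)))"
    by (simp add: avg_op_def Suc.IH)
  also have "\<dots> = (\<Sum>(w, ws)\<in>shell Q \<times> shell_words Q n. f (act (wprod (w # ws)) x))"
    by (simp add: sum.cartesian_product act_mmul)
  also have "\<dots> = (\<Sum>us\<in>shell_words Q (Suc n). f (act (wprod us) x))"
    unfolding shell_words_Suc by (subst sum.reindex) (auto simp: inj_on_def case_prod_unfold)
  finally show ?case .
qed

lemma periodic_avg_op: "periodic N f \<Longrightarrow> periodic N (avg_op Q f)"
  unfolding avg_op_def by (rule periodicI, rule sum.cong[OF refl], erule periodicD, rule compatD[OF compat_act])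

lemma periodic_funpow_avg_op: "periodic N f \<Longrightarrow> periodic N ((avg_op Q ^^ n) f)"
  by (induction n) (simp_all add: periodic_avg_op)

lemma iprod_act:
  assumes "N > 0" "periodic N f" "periodic N g" "mdet w = 1"
  shows "iprod N (\<lambda>x. f (act w x)) g = iprod N f (\<lambda>x. g (act (madj w) x))"
proof -
  have "periodic N (\<lambda>x. f x * cnj (g (act (madj w) x)))"
  proof (rule periodicI)
    fix u v assume uv: "vmod N u = vmod N v"
    have "f u = f v" by (rule periodicD[OF assms(2) uv])
    moreover have "g (act (madj w) u) = g (act (madj w) v)"
      by (rule periodicD[OF assms(3) compatD[OF compat_act uv]])
    ultimately show "f u * cnj (g (act (madj w) u)) = f v * cnj (g (act (madj w) v))" by simp
  qed
  then show ?thesis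
    unfolding iprod_def
    using sum_zbox_act[of N "\<lambda>x. f x * cnj (g (act (madj w) x))" w] assms(1,4) by simp
qed

lemma iprod_sum_left: "iprod N (\<lambda>x. \<Sum>i\<in>I. F i x) g = (\<Sum>i\<in>I. iprod N (F i) g)"
  unfolding iprod_def sum_distrib_right by (rule sum.swap)

lemma iprod_sum_right: "iprod N f (\<lambda>x. \<Sum>i\<in>I. F i x) = (\<Sum>i\<in>I. iprod N f (F i))"
  unfolding iprod_def cnj_sum sum_distrib_left by (rule sum.swap)

text \<open>Closure of \<open>shell Q\<close> under inverses makes the operator
  self-adjoint.\<close>

lemma iprod_avg_op:
  assumes "N > 0" "periodic N f" "periodic N g"
  shows "iprod N (avg_op Q f) g = iprod N f (avg_op Q g)"
proof -
  have "iprod N (avg_op Q f) g = (\<Sum>w\<in>shell Q. iprod N (\<lambda>x. f (act w x)) g)"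
    unfolding avg_op_def by (rule iprod_sum_left)
  also have "\<dots> = (\<Sum>w\<in>shell Q. iprod N f (\<lambda>x. g (act (madj w) x)))"
    using assms by (intro sum.cong refl iprod_act) (auto simp: mdet_shell)
  also have "\<dots> = (\<Sum>w\<in>shell Q. iprod N f (\<lambda>x. g (act w x)))"
    by (rule sum.reindex_bij_witness[of _ madj madj]) auto
  also have "\<dots> = iprod N f (avg_op Q g)"
    unfolding avg_op_def by (rule iprod_sum_right[symmetric])
  finally show ?thesis .
qed

lemma iprod_funpow_avg_op:
  assumes "N > 0" "periodic N f" "periodic N g"
  shows "iprod N ((avg_op Q ^^ n) f) g = iprod N f ((avg_op Q ^^ n) g)"
  using assms(2,3)
proof (induction n arbitrary: f g)
  case (Suc n)
  have "iprod N ((avg_op Q ^^ Suc n) f) g = iprod N ((avg_op Q ^^ n) f) (avg_op Q g)"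
    using Suc.prems assms(1) by (simp add: iprod_avg_op periodic_funpow_avg_op)
  also have "\<dots> = iprod N f ((avg_op Q ^^ n) (avg_op Q g))"
    using Suc by (simp add: periodic_avg_op)
  finally show ?case by (simp add: funpow_swap1)
qed simp

lemma iprod_self: "iprod N f f = complex_of_real (nsq N f)"
  by (simp add: iprod_def nsq_def complex_norm_square del: of_real_power)

lemma iprod_Cauchy_Schwarz: "(cmod (iprod N f g))\<^sup>2 \<le> nsq N f * nsq N g"
proof -
  have "cmod (iprod N f g) \<le> (\<Sum>x\<in>zbox N. cmod (f x) * cmod (g x))"
    unfolding iprod_def by (rule order_trans[OF norm_sum]) (simp add: norm_mult)
  then have "(cmod (iprod N f g))\<^sup>2 \<le> (\<Sum>x\<in>zbox N. cmod (f x) * cmod (g x))\<^sup>2"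
    by (intro power_mono) auto
  also have "\<dots> \<le> nsq N f * nsq N g"
    unfolding nsq_def by (rule Cauchy_Schwarz_ineq_sum)
  finally show ?thesis .
qed

text \<open>Replaces the spectral theorem: with \<open>h\<close> the image of \<open>f\<close> under
  the power \<open>2^j\<close>, Cauchy-Schwarz bounds the square of \<open>iprod N h f\<close> by
  \<open>nsq N h * nsq N f\<close>, and self-adjointness turns \<open>nsq N h\<close> into the
  pairing at exponent \<open>2^(j+1)\<close>. Hence only powers of two occur.\<close>

lemma iprod_avg_op_power_ge:
  assumes N: "N > 0" and f: "periodic N f" and \<alpha>: "\<alpha> \<ge> 0" "\<alpha> * nsq N f \<le> Re (iprod N (avg_op Q f) f)"
  shows "\<alpha> ^ (2 ^ j) * nsq N f \<le> Re (iprod N ((avg_op Q ^^ (2 ^ j)) f) f)"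
proof (cases "nsq N f = 0")
  case True
  then have "(cmod (iprod N ((avg_op Q ^^ (2 ^ j)) f) f))\<^sup>2 \<le> 0"
    using iprod_Cauchy_Schwarz[of N "(avg_op Q ^^ (2 ^ j)) f" f] by simp
  then show ?thesis using True by simp
next
  case False
  then have pos: "nsq N f > 0" using nsq_nonneg[of N f] by linarith
  show ?thesis
  proof (induction j)
    case (Suc j)
    let ?h = "(avg_op Q ^^ (2 ^ j)) f"
    have "(\<alpha> ^ (2 ^ j) * nsq N f)\<^sup>2 \<le> (Re (iprod N ?h f))\<^sup>2"
      using Suc \<alpha> pos by (intro power_mono) auto
    also have "\<dots> \<le> (cmod (iprod N ?h f))\<^sup>2"
      by (simp add: abs_le_square_iff[symmetric] abs_Re_le_cmod)
    also have "\<dots> \<le> nsq N ?h * nsq N f" by (rule iprod_Cauchy_Schwarz)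
    finally have "\<alpha> ^ (2 ^ Suc j) * nsq N f * nsq N f \<le> nsq N ?h * nsq N f"
      by (simp add: power_mult_distrib power2_eq_square mult_2 power_add mult_ac)
    then have "\<alpha> ^ (2 ^ Suc j) * nsq N f \<le> nsq N ?h" using pos by simp
    also have "nsq N ?h = Re (iprod N ?h ?h)" by (simp add: iprod_self)
    also have "iprod N ?h ?h = iprod N ((avg_op Q ^^ (2 ^ j)) ?h) f"
      using iprod_funpow_avg_op[OF N periodic_funpow_avg_op[OF f] f] by simp
    also have "(avg_op Q ^^ (2 ^ j)) ?h = (avg_op Q ^^ (2 ^ Suc j)) f"
      by (simp add: funpow_add mult_2)
    finally show ?case .
  qed (use \<alpha> in simp)
qed

definition residue_rows :: "int \<Rightarrow> imat \<Rightarrow> ivec \<times> ivec" where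
  "residue_rows N g = (vmod N (row1 g), vmod N (row2 g))"

lemma residue_rows_in_SLbox: "N > 0 \<Longrightarrow> mdet g = 1 \<Longrightarrow> residue_rows N g \<in> SLbox N"
proof -
  assume N: "N > 0" and g: "mdet g = 1"
  obtain a b c d where k: "g = (a, b, c, d)" by (cases g)
  have "(a mod N * (d mod N) - b mod N * (c mod N)) mod N = (a * d - b * c) mod N"
    by (rule mod_diff_cong; rule mod_mult_eq)
  then have "N dvd (a mod N * (d mod N) - b mod N * (c mod N)) - 1"
    using g by (simp add: k mod_eq_dvd_iff)
  then show ?thesis
    using N by (simp add: residue_rows_def SLbox_def vmod_in_zbox) (simp add: k row1_def row2_def vmod_def)
qed

lemma iprod_act_residue:
  assumes "periodic N f"
  shows "iprod N (\<lambda>x. f (act g x)) f = (case residue_rows N g of (r, s) \<Rightarrow> corr N f f r s)"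
proof -
  have *: "N dvd dot r x - dot (vmod N r) x" for r x
  proof -
    obtain p q where r: "r = (p, q)" by (cases r)
    obtain y z where x: "x = (y, z)" by (cases x)
    have "dot r x - dot (vmod N r) x = (p - p mod N) * y + (q - q mod N) * z"
      by (simp add: r x vmod_def algebra_simps)
    moreover have "N dvd p - p mod N" "N dvd q - q mod N" by simp_all
    ultimately show ?thesis by simp
  qed
  have "f (act g x) = f (dot (vmod N (row1 g)) x, dot (vmod N (row2 g)) x)" for x
    unfolding act_rows by (rule periodicD[OF assms]) (simp add: vmod_eq_iff *)
  then show ?thesis by (simp add: iprod_def residue_rows_def corr_def)
qed

lemma residue_rows_eq_imp:
  assumes "residue_rows N g = residue_rows N h" "mdet g = 1" "mdet h = 1"
  shows "case mmul (madj g) h of (a, b, c, d) \<Rightarrow> N dvd a - 1 \<and> N dvd b \<and> N dvd c \<and> N dvd d - 1"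
proof -
  obtain a b c d where g: "g = (a, b, c, d)" by (cases g)
  obtain a' b' c' d' where h: "h = (a', b', c', d')" by (cases h)
  have dvd: "N dvd a' - a" "N dvd b' - b" "N dvd c' - c" "N dvd d' - d"
    using assms(1) by (auto simp: residue_rows_def row1_def row2_def g h vmod_eq_iff dvd_diff_commute)
  have det: "a * d - b * c = 1" using assms(2) by (simp add: g)
  have "d * a' + - b * c' - 1 = d * (a' - a) - b * (c' - c) + (a * d - b * c - 1)"
    "d * b' + - b * d' = d * (b' - b) - b * (d' - d)"
    "- c * a' + a * c' = - c * (a' - a) + a * (c' - c)"
    "- c * b' + a * d' - 1 = - c * (b' - b) + a * (d' - d) + (a * d - b * c - 1)"
    by (simp_all add: algebra_simps)
  then show ?thesis
    using dvd det by (simp add: g h del: minus_mult_left)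
qed

text \<open>Words of length \<open>n\<close> are grouped by their product modulo \<open>N\<close>,
  and Cauchy-Schwarz separates multiplicities from correlations. The squared multiplicities count
  pairs of words with congruent products; reversing and inverting one member turns a pair into a
  single word of length \<open>2 * n\<close> congruent to the identity.\<close>

lemma cmod_iprod_power_sq_le:
  assumes N: "N > 0" and Q: "Q \<ge> 1" and f: "periodic N f"
  shows "(cmod (iprod N ((avg_op Q ^^ n) f) f))\<^sup>2 \<le>
    shell_const Q ^ (2 * n) * (\<Sum>k\<in>cong_ball N ((2 * Q) ^ (2 * n)). 1 / real_of_int (mnorm k)) *
    (\<Sum>(r, s)\<in>SLbox N. (norm (corr N f f r s))\<^sup>2)"
proof -
  let ?W = "shell_words Q n"
  let ?\<kappa> = "\<lambda>ws. residue_rows N (wprod ws)"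
  let ?\<Phi> = "\<lambda>(r, s). corr N f f r s"
  let ?C = "\<lambda>h. {ws\<in>?W. ?\<kappa> ws = h}"
  let ?V = "{us\<in>shell_words Q (2 * n). case wprod us of (a, b, c, d) \<Rightarrow> N dvd a - 1 \<and> N dvd b \<and> N dvd c \<and> N dvd d - 1}"
  have \<kappa>: "?\<kappa> ` ?W \<subseteq> SLbox N"
    using residue_rows_in_SLbox[OF N mdet_wprod] by blast
  have "iprod N ((avg_op Q ^^ n) f) f = iprod N (\<lambda>x. \<Sum>ws\<in>?W. f (act (wprod ws) x)) f"
    by (simp add: iprod_def avg_op_funpow)
  also have "\<dots> = (\<Sum>ws\<in>?W. ?\<Phi> (?\<kappa> ws))"
    by (simp add: iprod_sum_left iprod_act_residue[OF f])
  also have "\<dots> = (\<Sum>h\<in>SLbox N. \<Sum>ws\<in>?C h. ?\<Phi> (?\<kappa> ws))"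
    by (rule sum.group[OF _ _ \<kappa>, symmetric]) auto
  also have "\<dots> = (\<Sum>h\<in>SLbox N. of_nat (card (?C h)) * ?\<Phi> h)"
    by (intro sum.cong refl) simp
  finally have "cmod (iprod N ((avg_op Q ^^ n) f) f) \<le> (\<Sum>h\<in>SLbox N. real (card (?C h)) * norm (?\<Phi> h))"
    using norm_sum[of "\<lambda>h. of_nat (card (?C h)) * ?\<Phi> h" "SLbox N"] by (simp add: norm_mult)
  then have "(cmod (iprod N ((avg_op Q ^^ n) f) f))\<^sup>2 \<le> (\<Sum>h\<in>SLbox N. real (card (?C h)) * norm (?\<Phi> h))\<^sup>2"
    by (intro power_mono) auto
  also have "\<dots> \<le> (\<Sum>h\<in>SLbox N. (real (card (?C h)))\<^sup>2) * (\<Sum>h\<in>SLbox N. (norm (?\<Phi> h))\<^sup>2)"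
    by (rule Cauchy_Schwarz_ineq_sum)
  finally have 1: "(cmod (iprod N ((avg_op Q ^^ n) f) f))\<^sup>2 \<le>
    (\<Sum>h\<in>SLbox N. (real (card (?C h)))\<^sup>2) * (\<Sum>h\<in>SLbox N. (norm (?\<Phi> h))\<^sup>2)" .
  have "(\<Sum>h\<in>SLbox N. (card (?C h))\<^sup>2) = (\<Sum>h\<in>SLbox N. \<Sum>ws\<in>?C h. card (?C (?\<kappa> ws)))"
    by (intro sum.cong refl) (simp add: power2_eq_square)
  also have "\<dots> = (\<Sum>ws\<in>?W. card (?C (?\<kappa> ws)))"
    by (rule sum.group[OF _ _ \<kappa>]) auto
  also have "\<dots> = card (SIGMA ws:?W. ?C (?\<kappa> ws))"
    by (rule card_SigmaI[symmetric]) auto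
  also have "\<dots> \<le> card ?V"
  proof (rule card_inj_on_le)
    show "inj_on (\<lambda>(ws, vs). vs @ rev (map madj ws)) (SIGMA ws:?W. ?C (?\<kappa> ws))"
    proof (rule inj_onI)
      fix p p' assume p: "p \<in> (SIGMA ws:?W. ?C (?\<kappa> ws))" and p': "p' \<in> (SIGMA ws:?W. ?C (?\<kappa> ws))"
        and eq: "(\<lambda>(ws, vs). vs @ rev (map madj ws)) p = (\<lambda>(ws, vs). vs @ rev (map madj ws)) p'"
      obtain ws vs where [simp]: "p = (ws, vs)" by (cases p)
      obtain ws' vs' where [simp]: "p' = (ws', vs')" by (cases p')
      have "length vs = length vs'" using p p' by (auto simp: shell_words_def)
      then have "vs = vs'" "rev (map madj ws) = rev (map madj ws')" using eq by auto
      moreover have "inj madj" by (rule inj_on_inverseI[of _ madj]) simp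
      ultimately show "p = p'" by (simp add: inj_map_eq_map)
    qed
    show "(\<lambda>(ws, vs). vs @ rev (map madj ws)) ` (SIGMA ws:?W. ?C (?\<kappa> ws)) \<subseteq> ?V"
    proof
      fix us assume "us \<in> (\<lambda>(ws, vs). vs @ rev (map madj ws)) ` (SIGMA ws:?W. ?C (?\<kappa> ws))"
      then obtain ws vs where us: "us = vs @ rev (map madj ws)" "ws \<in> ?W" "vs \<in> ?W" "?\<kappa> vs = ?\<kappa> ws" by auto
      have "madj ` set ws \<subseteq> shell Q"
        using us(2) unfolding shell_words_def image_subset_iff madj_in_shell by blast
      then have "us \<in> shell_words Q (2 * n)" using us by (simp add: shell_words_def)
      moreover have "wprod us = mmul (madj (wprod ws)) (wprod vs)"
        by (simp only: us wprod_append wprod_rev_madj)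
      ultimately show "us \<in> ?V"
        using residue_rows_eq_imp[OF us(4)[symmetric] mdet_wprod[OF us(2)] mdet_wprod[OF us(3)]] by simp
    qed
  qed simp
  finally have "real (\<Sum>h\<in>SLbox N. (card (?C h))\<^sup>2) \<le> real (card ?V)" by (rule of_nat_mono)
  also have "\<dots> \<le> shell_const Q ^ (2 * n) * (\<Sum>k\<in>cong_ball N ((2 * Q) ^ (2 * n)). 1 / real_of_int (mnorm k))"
    by (rule card_congruent_words_le[OF Q])
  finally have 2: "(\<Sum>h\<in>SLbox N. (real (card (?C h)))\<^sup>2) \<le>
      shell_const Q ^ (2 * n) * (\<Sum>k\<in>cong_ball N ((2 * Q) ^ (2 * n)). 1 / real_of_int (mnorm k))"
    by simp
  have "(\<Sum>h\<in>SLbox N. (norm (?\<Phi> h))\<^sup>2) = (\<Sum>(r, s)\<in>SLbox N. (norm (corr N f f r s))\<^sup>2)"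
    by (intro sum.cong refl) auto
  then show ?thesis
    using order_trans[OF 1 mult_right_mono[OF 2]] by (simp add: sum_nonneg case_prod_unfold)
qed

section \<open>Fixing the parameters \<open>Q\<close>, \<open>n\<close> and \<open>R\<close>\<close>

lemma exists_shell_const_le:
  fixes C :: real
  assumes C: "C \<ge> 1" and nd: "\<And>n. n > 0 \<Longrightarrow> real (ndiv n) \<le> C * n powr (1/100)"
  shows "\<exists>Q\<ge>2. shell_const Q \<le> real (card (shell Q)) * (2 * Q) powr (-49/50)"
proof -
  \<comment> \<open>\<open>32000 = 4000 * 2 * 4\<close>: from \<open>shell_const\<close>, from
    \<open>2 powr (49/50) \<le> 2\<close>, and from \<open>4 * C\<close> in
    \<open>card_shell_ge\<close>. The power \<open>1/100\<close> available for the logarithm is what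
    \<open>2 - 1/100\<close> leaves after \<open>1 + 49/50\<close>.\<close>
  have "eventually (\<lambda>x :: real. 32000 * C * (1 + ln x) \<le> x powr (1/100)) at_top"
    using C by real_asymp
  then obtain B where B: "\<And>x :: real. x \<ge> B \<Longrightarrow> 32000 * C * (1 + ln x) \<le> x powr (1/100)"
    by (auto simp: eventually_at_top_linorder)
  define Q where "Q = max 2 \<lceil>B\<rceil>"
  have Q: "Q \<ge> 2" "real_of_int Q \<ge> B" unfolding Q_def by linarith+
  have q0: "real_of_int Q > 0" using Q by simp
  have "shell_const Q * (2 * Q) powr (49/50) \<le> shell_const Q * (2 * Q powr (49/50))"
  proof (rule mult_left_mono)
    have "(2 * real_of_int Q) powr (49/50) = 2 powr (49/50) * Q powr (49/50)"
      using q0 by (simp add: powr_mult)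
    also have "\<dots> \<le> 2 powr 1 * Q powr (49/50)" by (intro mult_right_mono powr_mono) auto
    finally show "(2 * Q) powr (49/50) \<le> 2 * Q powr (49/50)" by simp
  qed (use Q in \<open>simp add: shell_const_nonneg\<close>)
  also have "\<dots> = 32000 * C * (1 + ln Q) * (Q powr 1 * Q powr (49/50)) / (4 * C)"
    using C q0 by (simp add: shell_const_def)
  also have "Q powr 1 * Q powr (49/50) = Q powr (99/50)"
    by (simp only: powr_add[symmetric]) simp
  also have "32000 * C * (1 + ln Q) * Q powr (99/50) / (4 * C) \<le> Q powr (1/100) * Q powr (99/50) / (4 * C)"
    using B[OF Q(2)] C by (intro divide_right_mono mult_right_mono) auto
  also have "Q powr (1/100) * Q powr (99/50) = Q powr (2 - 1/100)"
    by (simp add: powr_add[symmetric])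
  also have "\<dots> / (4 * C) \<le> real (card (shell Q))"
    using card_shell_ge[OF Q(1), of C "1/100"] nd C by simp
  finally have "shell_const Q * (2 * Q) powr (49/50) \<le> real (card (shell Q))" .
  then have "shell_const Q * (2 * Q) powr (49/50) * (2 * Q) powr (-49/50) \<le> real (card (shell Q)) * (2 * Q) powr (-49/50)"
    by (rule mult_right_mono) simp
  moreover have "real_of_int (2 * Q) powr (49/50) * real_of_int (2 * Q) powr (-49/50) = 1"
    using q0 by (simp add: powr_add[symmetric])
  ultimately have "shell_const Q \<le> real (card (shell Q)) * (2 * Q) powr (-49/50)"
    by (simp only: mult.assoc mult_1_right)
  then show ?thesis by (intro exI[of _ Q] conjI Q(1)) simp
qed

text \<open>The share of congruent words times the correlation bound, as a function of
  \<open>x = N\<close>, after \<open>R\<close> has been replaced by the ends of its range: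
  \<open>-49/20\<close> is \<open>-49/50\<close> of \<open>5/2\<close>; one \<open>1/10\<close> is
  \<open>1/50\<close> of 5, the other comes from the divisor bound. The leading exponent is
  \<open>1/10 - 49/20 + 101/50 = -33/100\<close>, below \<open>-1/20\<close>.\<close>

definition error_bound :: "real \<Rightarrow> real \<Rightarrow> real" where
  "error_bound C x = (x powr (-49/20) * (5 + 20 * ln x) +
     4 * C * x powr (1/10) * (32 * x powr (1/10) * x powr (-3) + x powr (-49/20) * (16 + 40 * ln x))) *
     (2 * C\<^sup>2 * x powr (101/50))"

lemma error_bound_eventually:
  assumes "C \<ge> 1"
  shows "eventually (\<lambda>x. error_bound C x < x powr (-1/20)) at_top"
  unfolding error_bound_def using assms by real_asymp

text \<open>Passing from \<open>j\<close> to \<open>j + 1\<close> squares the quantity, so the least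
  \<open>j\<close> reaching \<open>N^(5/2)\<close> stays within \<open>N^5\<close>, provided it is
  not 0; this is what the hypothesis on \<open>(2 * Q)^2\<close> ensures.\<close>

lemma exists_exponent:
  fixes Q N :: int
  assumes Q: "Q \<ge> 2" and N: "N > 1" "real_of_int ((2 * Q)\<^sup>2) < N powr (5/2)"
  obtains j :: nat where "N powr (5/2) \<le> real_of_int ((2 * Q) ^ (2 * 2 ^ j))"
    "real_of_int ((2 * Q) ^ (2 * 2 ^ j)) \<le> N powr 5"
proof -
  let ?P = "\<lambda>j. N powr (5/2) \<le> real_of_int ((2 * Q) ^ (2 * 2 ^ j))"
  have "\<exists>j. ?P j"
  proof -
    obtain k where k: "N powr (5/2) < 2 ^ k" using real_arch_pow[of 2] by auto
    have "k \<le> 2 * 2 ^ k" using less_exp[of k] by linarith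
    then have "(2 :: real) ^ k \<le> 2 ^ (2 * 2 ^ k)" by (rule power_increasing) simp
    also have "\<dots> \<le> (2 * real_of_int Q) ^ (2 * 2 ^ k)" using Q by (intro power_mono) auto
    finally show ?thesis using k by (intro exI[of _ k]) simp
  qed
  define j where "j = (LEAST j. ?P j)"
  have Pj: "?P j" unfolding j_def by (rule LeastI_ex) fact
  have "j \<noteq> 0" using Pj N(2) by (intro notI) simp
  then obtain i where i: "j = Suc i" by (cases j) auto
  have "\<not> ?P i" using not_less_Least[of i ?P] i by (simp add: j_def)
  then have lt: "real_of_int ((2 * Q) ^ (2 * 2 ^ i)) \<le> N powr (5/2)" by simp
  have "2 * 2 ^ j = 2 * 2 ^ i * (2 :: nat)" by (simp add: i)
  then have "(2 * Q) ^ (2 * 2 ^ j) = ((2 * Q) ^ (2 * 2 ^ i))\<^sup>2"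
    by (simp only: power_mult)
  then have "real_of_int ((2 * Q) ^ (2 * 2 ^ j)) = (real_of_int ((2 * Q) ^ (2 * 2 ^ i)))\<^sup>2" by simp
  also have "\<dots> \<le> (N powr (5/2))\<^sup>2" using lt Q by (intro power_mono) auto
  also have "\<dots> = N powr 5" using N by (simp add: power2_eq_square powr_add[symmetric])
  finally show ?thesis using Pj that by blast
qed

text \<open>Since \<open>2 * Q \<ge> 4\<close> and \<open>ln 4 \<ge> 1.3\<close>, the length
  \<open>2 * n\<close> is at most \<open>5 / 1.3\<close> times \<open>ln x\<close>, hence at most
  \<open>4 * ln x\<close>. With \<open>ln (99/100) \<ge> - 1/99\<close> the power is at least
  \<open>x^(-4/99)\<close>, and \<open>4/99 < 1/20\<close>.\<close>

lemma power_99_ge: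
  assumes R: "R = real_of_int (2 * Q) ^ (2 * n)" and Q: "Q \<ge> (2 :: int)" and x: "x > 1" "R \<le> x powr 5"
  shows "x powr (-1/20) \<le> (99/100 :: real) ^ (2 * n)"
proof -
  have ln4: "ln (4 :: real) \<ge> 1.3"
  proof -
    have "ln (4 :: real) = 2 * ln 2" using ln_realpow[of 2 2] by simp
    then show ?thesis using ln2_ge_two_thirds by simp
  qed
  have "real (2 * n) * ln 4 \<le> real (2 * n) * ln (real_of_int (2 * Q))"
    using Q by (intro mult_left_mono) auto
  also have "\<dots> = ln R" using Q unfolding R by (subst ln_realpow) auto
  also have "\<dots> \<le> ln (x powr 5)" using x R Q by (intro ln_mono) auto
  also have "\<dots> = 5 * ln x" using x by (subst ln_powr) auto
  finally have "real (2 * n) * 1.3 \<le> 5 * ln x"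
    using mult_left_mono[OF ln4, of "real (2 * n)"] by simp
  then have n: "real (2 * n) \<le> 4 * ln x" by simp
  have "- (1/99) \<le> ln (99/100 :: real)"
  proof -
    have "ln (100/99 :: real) \<le> 100/99 - 1" by (rule ln_le_minus_one) simp
    moreover have "ln (99/100 :: real) = - ln (100/99)" by (simp add: ln_div)
    ultimately show ?thesis by simp
  qed
  then have "real (2 * n) * - (1/99) \<le> real (2 * n) * ln (99/100 :: real)"
    by (intro mult_left_mono) auto
  moreover have "- (1/20) * ln x \<le> real (2 * n) * - (1/99)"
    using n x ln_gt_zero[OF x(1)] by simp
  ultimately have "- (1/20) * ln x \<le> real (2 * n) * ln (99/100)" by linarith
  then have "exp (- (1/20) * ln x) \<le> exp (real (2 * n) * ln (99/100))" by simp
  moreover have "exp (real (2 * n) * ln (99/100)) = (99/100 :: real) ^ (2 * n)"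
    by (subst exp_of_nat_mult) simp
  ultimately have "exp (- (1/20) * ln x) \<le> (99/100) ^ (2 * n)" by (simp only:)
  then show ?thesis using x by (simp add: powr_def)
qed

lemma cong_ball_error_le:
  fixes N Q R :: int
  assumes C: "C \<ge> 1" and nd: "\<And>n. n > 0 \<Longrightarrow> real (ndiv n) \<le> C * n powr (1/100)"
    and N: "N \<ge> 3" and R: "N powr (5/2) \<le> real_of_int R" "real_of_int R \<le> N powr 5"
  shows "R powr (-49/50) * (\<Sum>k\<in>cong_ball N R. 1 / real_of_int (mnorm k)) * (2 * C\<^sup>2 * N powr (101/50)) \<le> error_bound C N"
proof -
  let ?x = "real_of_int N"
  have x: "?x > 1" using N by simp
  have "1 \<le> ?x powr (5/2)" using x by (simp add: ge_one_powr_ge_zero)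
  then have R1: "R \<ge> 1" using R(1) by linarith
  \<comment> \<open>Divisor counts are needed up to \<open>2 * R^2 \<le> 2 * N^10\<close>, and the
    power \<open>1/100\<close> of \<open>N^10\<close> is \<open>N^(1/10)\<close>.\<close>
  define D where "D = 2 * C * ?x powr (1/10)"
  have D: "real (ndiv n) \<le> D" if "0 < n" "n \<le> nat (2 * R\<^sup>2)" for n
  proof -
    have "real n \<le> 2 * (real_of_int R)\<^sup>2"
    proof -
      have "int n \<le> 2 * R\<^sup>2" using that by (simp add: le_nat_iff)
      then have "real_of_int (int n) \<le> real_of_int (2 * R\<^sup>2)" by (simp only: of_int_le_iff)
      then show ?thesis by simp
    qed
    also have "\<dots> \<le> 2 * (?x powr 5)\<^sup>2" using R R1 by (intro mult_left_mono power_mono) auto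
    also have "\<dots> = 2 * ?x powr 10" using x by (simp add: power2_eq_square powr_add[symmetric])
    finally have "real n powr (1/100) \<le> (2 * ?x powr 10) powr (1/100)" by (intro powr_mono2) auto
    also have "\<dots> = 2 powr (1/100) * ?x powr (1/10)" using x by (simp add: powr_mult powr_powr del: powr_numeral)
    also have "\<dots> \<le> 2 powr 1 * ?x powr (1/10)" by (intro mult_right_mono powr_mono) auto
    finally have "C * real n powr (1/100) \<le> C * (2 * ?x powr (1/10))" using C by (intro mult_left_mono) auto
    then show ?thesis using nd[OF that(1)] by (simp add: D_def)
  qed
  have D0: "D \<ge> 0" using C by (simp add: D_def)
  have lnR: "ln (real_of_int R) \<le> 5 * ln ?x"
  proof -
    have "ln (real_of_int R) \<le> ln (?x powr 5)" using R R1 x by (intro ln_mono) auto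
    then show ?thesis using x by (simp add: ln_powr del: powr_numeral)
  qed
  have ln2R: "ln (2 * real_of_int R) \<le> 1 + 5 * ln ?x"
    using lnR R1 ln_le_minus_one[of 2] by (simp add: ln_mult)
  have lnx: "ln ?x > 0" using x by simp
  have "(\<Sum>k\<in>cong_ball N R. 1 / real_of_int (mnorm k)) \<le>
      5 + 4 * ln R + 2 * D * (32 * R / ?x ^ 3 + 8 * (1 + ln (2 * R)))"
    using sum_cong_ball_le[OF N R1, of D] D by simp
  also have "\<dots> \<le> (5 + 20 * ln ?x) + 2 * D * (32 * R * ?x powr (-3) + (16 + 40 * ln ?x))"
  proof -
    have "32 * real_of_int R / ?x ^ 3 \<le> 32 * R * ?x powr (-3)"
      using x by (simp add: powr_minus powr_numeral field_simps)
    then have "32 * real_of_int R / ?x ^ 3 + 8 * (1 + ln (2 * R)) \<le> 32 * R * ?x powr (-3) + (16 + 40 * ln ?x)"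
      using ln2R by simp
    then have le: "2 * D * (32 * real_of_int R / ?x ^ 3 + 8 * (1 + ln (2 * R))) \<le>
        2 * D * (32 * R * ?x powr (-3) + (16 + 40 * ln ?x))"
      using D0 by (intro mult_left_mono) auto
    have "5 + 4 * ln (real_of_int R) \<le> 5 + 20 * ln ?x" using lnR by simp
    then show ?thesis using add_mono[OF _ le] by simp
  qed
  finally have G: "(\<Sum>k\<in>cong_ball N R. 1 / real_of_int (mnorm k)) \<le>
      (5 + 20 * ln ?x) + 2 * D * (32 * R * ?x powr (-3) + (16 + 40 * ln ?x))" .
  \<comment> \<open>The lower end of the range of \<open>R\<close> is used here, the upper end in
    \<open>Rq\<close>.\<close>
  have Rp: "R powr (-49/50) \<le> ?x powr (-49/20)"
  proof -
    have "R powr (-49/50) \<le> (?x powr (5/2)) powr (-49/50)" using R x by (intro powr_mono2') auto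
    then show ?thesis by (simp add: powr_powr)
  qed
  have Rq: "R powr (-49/50) * R \<le> ?x powr (1/10)"
  proof -
    have "R powr (-49/50) * R = R powr (-49/50) * R powr 1" using R1 by simp
    also have "\<dots> = R powr (1/50)" by (simp only: powr_add[symmetric]) simp
    also have "\<dots> \<le> (?x powr 5) powr (1/50)" using R R1 by (intro powr_mono2) auto
    finally show ?thesis by (simp add: powr_powr)
  qed
  have "R powr (-49/50) * (\<Sum>k\<in>cong_ball N R. 1 / real_of_int (mnorm k)) \<le>
      R powr (-49/50) * ((5 + 20 * ln ?x) + 2 * D * (32 * R * ?x powr (-3) + (16 + 40 * ln ?x)))"
    by (intro mult_left_mono G) auto
  also have "\<dots> = R powr (-49/50) * (5 + 20 * ln ?x) +
      2 * D * (32 * (R powr (-49/50) * R) * ?x powr (-3) + R powr (-49/50) * (16 + 40 * ln ?x))"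
    by (simp add: algebra_simps)
  also have "\<dots> \<le> ?x powr (-49/20) * (5 + 20 * ln ?x) +
      2 * D * (32 * ?x powr (1/10) * ?x powr (-3) + ?x powr (-49/20) * (16 + 40 * ln ?x))"
    using D0 lnx by (intro add_mono mult_right_mono mult_left_mono Rp Rq) auto
  finally have "R powr (-49/50) * (\<Sum>k\<in>cong_ball N R. 1 / real_of_int (mnorm k)) * (2 * C\<^sup>2 * ?x powr (101/50)) \<le>
      (?x powr (-49/20) * (5 + 20 * ln ?x) +
      2 * D * (32 * ?x powr (1/10) * ?x powr (-3) + ?x powr (-49/20) * (16 + 40 * ln ?x))) * (2 * C\<^sup>2 * ?x powr (101/50))"
    by (intro mult_right_mono) auto
  then show ?thesis by (simp add: error_bound_def D_def mult_ac)
qed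

text \<open>\<open>101/50\<close> is \<open>3 - 1\<close> plus twice \<open>1/100\<close>: the bound
  with \<open>N^3\<close> is divided by the number of unit squares, which is at least
  \<open>N\<close> over twice the squared divisor function.\<close>

lemma sum_corr_sq_SL_le_powr:
  assumes C: "C \<ge> 1" and nd: "\<And>n. n > 0 \<Longrightarrow> real (ndiv n) \<le> C * n powr (1/100)"
    and N: "N > 0" and f: "periodic N f" "new_form N f" "\<And>v. f v \<noteq> 0 \<Longrightarrow> prim N v" "eigen_form N f"
  shows "(\<Sum>(r, s)\<in>SLbox N. (norm (corr N f f r s))\<^sup>2) \<le> 2 * C\<^sup>2 * N powr (101/50) * (nsq N f)\<^sup>2"
proof -
  let ?S = "\<Sum>(r, s)\<in>SLbox N. (norm (corr N f f r s))\<^sup>2" and ?x = "real_of_int N"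
  let ?u = "real (card (unit_squares N))" and ?d = "real (ndiv (nat N))"
  have x: "?x > 0" using N by simp
  have S0: "?S \<ge> 0" by (intro sum_nonneg) auto
  have "real (nat N) \<le> real (2 * (ndiv (nat N))\<^sup>2 * card (unit_squares N))"
    using card_unit_squares_ge[OF N] by (rule of_nat_mono)
  then have 1: "?x \<le> 2 * ?d\<^sup>2 * ?u" using N by simp
  have 2: "?u * ?S \<le> ?x ^ 3 * (nsq N f)\<^sup>2"
    by (rule sum_corr_sq_SL_le[OF N f])
  have "?x * ?S \<le> 2 * ?d\<^sup>2 * ?u * ?S" using 1 S0 by (rule mult_right_mono)
  also have "\<dots> = 2 * ?d\<^sup>2 * (?u * ?S)" by simp
  also have "\<dots> \<le> 2 * ?d\<^sup>2 * (?x ^ 3 * (nsq N f)\<^sup>2)" using 2 by (intro mult_left_mono) auto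
  also have "\<dots> = ?x * (2 * ?d\<^sup>2 * (?x\<^sup>2 * (nsq N f)\<^sup>2))" by (simp add: power2_eq_square power3_eq_cube)
  finally have "?S \<le> 2 * ?d\<^sup>2 * (?x\<^sup>2 * (nsq N f)\<^sup>2)" using x by simp
  also have "\<dots> \<le> 2 * (C * ?x powr (1/100))\<^sup>2 * (?x\<^sup>2 * (nsq N f)\<^sup>2)"
    using nd[of "nat N"] N by (intro mult_right_mono mult_left_mono power_mono) auto
  also have "\<dots> = 2 * C\<^sup>2 * (?x powr (1/100) * ?x powr (1/100) * ?x powr 2) * (nsq N f)\<^sup>2"
    using x by (simp add: power2_eq_square powr_numeral)
  also have "?x powr (1/100) * ?x powr (1/100) * ?x powr 2 = ?x powr (101/50)"
    by (simp add: powr_add[symmetric])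
  finally show ?thesis .
qed

text \<open>By contradiction: an \<open>f\<close> that is hardly moved keeps the share
  \<open>(99/100)^(2 * n)\<close> of the maximum under powers, while counting congruent words bounds
  the same share by \<open>error_bound C N\<close>, which is smaller.\<close>

lemma avg_op_contracts:
  "\<exists>Q\<ge>2. \<exists>N1. \<forall>N\<ge>N1. \<forall>f. periodic N f \<longrightarrow> new_form N f \<longrightarrow> (\<forall>v. f v \<noteq> 0 \<longrightarrow> prim N v) \<longrightarrow> eigen_form N f \<longrightarrow>
     Re (iprod N (avg_op Q f) f) \<le> 99/100 * real (card (shell Q)) * nsq N f"
proof -
  obtain C :: real where C: "C \<ge> 1" and nd: "\<And>n. n > 0 \<Longrightarrow> real (ndiv n) \<le> C * n powr (1/100)"
    using ndiv_le_powr[of "1/100"] by auto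
  obtain Q where Q: "Q \<ge> 2" and K: "shell_const Q \<le> real (card (shell Q)) * (2 * Q) powr (-49/50)"
    using exists_shell_const_le[OF C nd] by auto
  have "eventually (\<lambda>x :: real. error_bound C x < x powr (-1/20) \<and> (2 * real_of_int Q)\<^sup>2 < x powr (5/2)) at_top"
  proof (rule eventually_conj[OF error_bound_eventually[OF C]])
    show "eventually (\<lambda>x :: real. (2 * real_of_int Q)\<^sup>2 < x powr (5/2)) at_top" by real_asymp
  qed
  then obtain B where B: "\<And>x :: real. x \<ge> B \<Longrightarrow> error_bound C x < x powr (-1/20) \<and> (2 * real_of_int Q)\<^sup>2 < x powr (5/2)"
    by (auto simp: eventually_at_top_linorder)
  have "Re (iprod N (avg_op Q f) f) \<le> 99/100 * real (card (shell Q)) * nsq N f"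
    if N: "N \<ge> max 3 \<lceil>B\<rceil>" and f: "periodic N f" "new_form N f" "\<And>v. f v \<noteq> 0 \<Longrightarrow> prim N v" "eigen_form N f" for N f
  proof (rule ccontr)
    assume "\<not> ?thesis"
    then have big: "99/100 * real (card (shell Q)) * nsq N f < Re (iprod N (avg_op Q f) f)" by simp
    let ?x = "real_of_int N" and ?F = "real (card (shell Q))"
    have N3: "N \<ge> 3" and xB: "?x \<ge> B" using N by linarith+
    have x: "?x > 1" using N3 by simp
    have "nsq N f \<noteq> 0"
    proof
      assume 0: "nsq N f = 0"
      then have "(cmod (iprod N (avg_op Q f) f))\<^sup>2 \<le> 0"
        using iprod_Cauchy_Schwarz[of N "avg_op Q f" f] by simp
      then show False using big 0 by simp
    qed
    then have pos: "nsq N f > 0" using nsq_nonneg[of N f] by linarith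
    obtain j where j: "?x powr (5/2) \<le> real_of_int ((2 * Q) ^ (2 * 2 ^ j))"
      "real_of_int ((2 * Q) ^ (2 * 2 ^ j)) \<le> ?x powr 5"
      using exists_exponent[OF Q, of N] x B[OF xB] by auto
    define n where "n = (2 :: nat) ^ j"
    define R where "R = (2 * Q) ^ (2 * n)"
    have R: "?x powr (5/2) \<le> real_of_int R" "real_of_int R \<le> ?x powr 5" using j by (simp_all add: R_def n_def)
    let ?G = "\<Sum>k\<in>cong_ball N R. 1 / real_of_int (mnorm k)"
    have G0: "?G \<ge> 0" by (intro sum_nonneg) (simp add: mnorm_nonneg)
    have "((2 * real_of_int Q) powr (-49/50)) ^ (2 * n) = R powr (-49/50)"
    proof -
      have "((2 * real_of_int Q) powr (-49/50)) ^ (2 * n) = (2 * real_of_int Q) powr (-49/50 * real (2 * n))"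
        using Q by (subst powr_realpow[symmetric]) (auto simp: powr_powr)
      also have "\<dots> = ((2 * real_of_int Q) powr real (2 * n)) powr (-49/50)"
        by (simp add: powr_powr mult.commute)
      also have "(2 * real_of_int Q) powr real (2 * n) = R"
        using Q by (subst powr_realpow) (auto simp: R_def)
      finally show ?thesis .
    qed
    moreover have "shell_const Q ^ (2 * n) \<le> (?F * (2 * real_of_int Q) powr (-49/50)) ^ (2 * n)"
      using K Q shell_const_nonneg[of Q] by (intro power_mono) auto
    ultimately have KF: "shell_const Q ^ (2 * n) \<le> ?F ^ (2 * n) * R powr (-49/50)"
      by (simp only: power_mult_distrib)
    have sq: "((a * b) ^ n * z)\<^sup>2 = a ^ (2 * n) * (b ^ (2 * n) * z\<^sup>2)" for a b z :: real
      by (simp add: power_mult_distrib power_even_eq mult.assoc)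
    have "(99/100 * ?F) ^ n * nsq N f \<le> Re (iprod N ((avg_op Q ^^ n) f) f)"
      unfolding n_def using big N3 f(1) by (intro iprod_avg_op_power_ge) auto
    also have "\<dots> \<le> cmod (iprod N ((avg_op Q ^^ n) f) f)" by (rule complex_Re_le_cmod)
    finally have "((99/100 * ?F) ^ n * nsq N f)\<^sup>2 \<le> (cmod (iprod N ((avg_op Q ^^ n) f) f))\<^sup>2"
      using pos by (intro power_mono) auto
    also have "\<dots> \<le> shell_const Q ^ (2 * n) * ?G * (\<Sum>(r, s)\<in>SLbox N. (norm (corr N f f r s))\<^sup>2)"
      unfolding R_def using cmod_iprod_power_sq_le[of N Q f n] N3 Q f(1) by simp
    also have "\<dots> \<le> (?F ^ (2 * n) * R powr (-49/50)) * ?G * (2 * C\<^sup>2 * ?x powr (101/50) * (nsq N f)\<^sup>2)"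
    proof (intro mult_mono KF order_refl)
      show "(\<Sum>(r, s)\<in>SLbox N. (norm (corr N f f r s))\<^sup>2) \<le> 2 * C\<^sup>2 * ?x powr (101/50) * (nsq N f)\<^sup>2"
        using sum_corr_sq_SL_le_powr[OF C nd _ f] N3 by simp
    qed (use G0 in \<open>auto intro!: sum_nonneg\<close>)
    also have "\<dots> = (R powr (-49/50) * ?G * (2 * C\<^sup>2 * ?x powr (101/50))) * (?F ^ (2 * n) * (nsq N f)\<^sup>2)"
      by (simp add: mult_ac)
    also have "\<dots> \<le> error_bound C ?x * (?F ^ (2 * n) * (nsq N f)\<^sup>2)"
      by (intro mult_right_mono cong_ball_error_le[OF C nd N3 R]) auto
    also have "((99/100 * ?F) ^ n * nsq N f)\<^sup>2 = (99/100) ^ (2 * n) * (?F ^ (2 * n) * (nsq N f)\<^sup>2)"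
      by (simp only: sq)
    finally have le: "(99/100) ^ (2 * n) * (?F ^ (2 * n) * (nsq N f)\<^sup>2) \<le> error_bound C ?x * (?F ^ (2 * n) * (nsq N f)\<^sup>2)" .
    have "?F > 0"
    proof (rule ccontr)
      assume "\<not> ?F > 0"
      then have "shell_const Q \<le> 0" using K by simp
      moreover have "shell_const Q > 0"
        unfolding shell_const_def using Q by (intro mult_pos_pos add_pos_nonneg) auto
      ultimately show False by simp
    qed
    then have "?F ^ (2 * n) * (nsq N f)\<^sup>2 > 0" using pos by simp
    with le have "(99/100) ^ (2 * n) \<le> error_bound C ?x" by (rule mult_right_le_imp_le)
    moreover have "?x powr (-1/20) \<le> (99/100) ^ (2 * n)"
      using power_99_ge[of "real_of_int R" Q n ?x] R x Q by (simp add: R_def)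
    ultimately show False using B[OF xB] by simp
  qed
  then show ?thesis using Q by blast
qed

section \<open>The spectral gap\<close>

text \<open>The order of quantifiers is the point: the constant depends on \<open>g\<close> alone
  and serves every level \<open>N\<close>.\<close>

definition movable :: "imat \<Rightarrow> bool" where
  "movable g \<longleftrightarrow> mdet g = 1 \<and>
     (\<exists>m\<ge>0. \<forall>N>0. \<forall>f. periodic N f \<longrightarrow> nsq N (\<lambda>v. f (act g v) - f v) \<le> m * defect N f)"

lemma periodic_act: "periodic N f \<Longrightarrow> periodic N (\<lambda>v. f (act g v))"
  by (rule periodic_comp[OF _ compat_act])

lemma periodic_diff:
  fixes f h :: "ivec \<Rightarrow> complex"
  shows "periodic N f \<Longrightarrow> periodic N h \<Longrightarrow> periodic N (\<lambda>v. f v - h v)"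
  unfolding periodic_def by metis

lemma cmod_add_sq_le: "(cmod (a + b))\<^sup>2 \<le> 2 * (cmod a)\<^sup>2 + 2 * (cmod b)\<^sup>2"
proof -
  have "(cmod (a + b))\<^sup>2 \<le> (cmod a + cmod b)\<^sup>2"
    by (intro power_mono norm_triangle_ineq) simp
  also have "\<dots> \<le> 2 * (cmod a)\<^sup>2 + 2 * (cmod b)\<^sup>2"
    using sum_squares_bound[of "cmod a" "cmod b"] by (simp add: power2_sum)
  finally show ?thesis .
qed

lemma nsq_add_le: "nsq N (\<lambda>v. f v + h v) \<le> 2 * nsq N f + 2 * nsq N h"
proof -
  have "nsq N (\<lambda>v. f v + h v) \<le> (\<Sum>v\<in>zbox N. 2 * (cmod (f v))\<^sup>2 + 2 * (cmod (h v))\<^sup>2)"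
    unfolding nsq_def by (intro sum_mono cmod_add_sq_le)
  then show ?thesis by (simp add: nsq_def sum.distrib sum_distrib_left)
qed

lemma nsq_diff_commute: "nsq N (\<lambda>v. f v - h v) = nsq N (\<lambda>v. h v - f v)"
  by (simp add: nsq_def norm_minus_commute)

lemma movable_mmul:
  assumes "movable g" "movable h"
  shows "movable (mmul g h)"
proof -
  obtain m where m: "m \<ge> 0" "\<And>N f. N > 0 \<Longrightarrow> periodic N f \<Longrightarrow> nsq N (\<lambda>v. f (act g v) - f v) \<le> m * defect N f"
    using assms(1) unfolding movable_def by blast
  obtain k where k: "k \<ge> 0" "\<And>N f. N > 0 \<Longrightarrow> periodic N f \<Longrightarrow> nsq N (\<lambda>v. f (act h v) - f v) \<le> k * defect N f"
    using assms(2) unfolding movable_def by blast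
  have h: "mdet h = 1" and g: "mdet g = 1" using assms by (simp_all add: movable_def)
  have "nsq N (\<lambda>v. f (act (mmul g h) v) - f v) \<le> (2 * m + 2 * k) * defect N f" if N: "N > 0" and f: "periodic N f" for N f
  proof -
    have "nsq N (\<lambda>v. f (act (mmul g h) v) - f v) =
        nsq N (\<lambda>v. (f (act g (act h v)) - f (act h v)) + (f (act h v) - f v))"
      by (simp add: act_mmul)
    also have "\<dots> \<le> 2 * nsq N (\<lambda>v. f (act g (act h v)) - f (act h v)) + 2 * nsq N (\<lambda>v. f (act h v) - f v)"
      by (rule nsq_add_le)
    also have "nsq N (\<lambda>v. f (act g (act h v)) - f (act h v)) = nsq N (\<lambda>v. f (act g v) - f v)"
      by (rule nsq_act[OF N periodic_diff[OF periodic_act[OF f] f] h])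
    also have "2 * nsq N (\<lambda>v. f (act g v) - f v) + 2 * nsq N (\<lambda>v. f (act h v) - f v) \<le>
        2 * (m * defect N f) + 2 * (k * defect N f)"
      using m(2)[OF N f] k(2)[OF N f] by simp
    finally show ?thesis by (simp add: algebra_simps)
  qed
  then show ?thesis
    using m(1) k(1) g h by (auto simp: movable_def mdet_mmul intro!: exI[of _ "2 * m + 2 * k"])
qed

lemma movable_madj:
  assumes "movable g"
  shows "movable (madj g)"
proof -
  have g: "mdet g = 1" using assms by (simp add: movable_def)
  have "nsq N (\<lambda>v. f (act (madj g) v) - f v) = nsq N (\<lambda>v. f (act g v) - f v)" if "N > 0" "periodic N f" for N f
  proof -
    have "nsq N (\<lambda>v. f (act (madj g) v) - f v) = nsq N (\<lambda>v. f (act (madj g) v) - f (act g (act (madj g) v)))"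
      using g by simp
    also have "\<dots> = nsq N (\<lambda>v. f v - f (act g v))"
      by (rule nsq_act[OF that(1) periodic_diff[OF that(2) periodic_act[OF that(2)]]]) (simp add: g)
    finally show ?thesis by (simp add: nsq_diff_commute)
  qed
  then show ?thesis using assms by (simp add: movable_def)
qed

lemma movable_left_cancel: "movable h \<Longrightarrow> movable (mmul h g) \<Longrightarrow> movable g"
  using movable_mmul[of "madj h" "mmul h g"] movable_madj[of h]
  by (simp add: mmul_assoc[symmetric] mmul_madj movable_def)

lemma movable_mA: "movable mA" and movable_mD: "movable mD"
  unfolding movable_def
  by (auto simp: defect_def nsq_nonneg intro!: exI[of _ 1])

lemma movable_upper: "movable (1, k, 0, 1)"
proof -
  have *: "movable (1, int n, 0, 1)" for n
  proof (induction n)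
    case 0
    show ?case
      by (auto simp: movable_def defect_nonneg nsq_def mone_def[symmetric] intro!: exI[of _ 0])
  next
    case (Suc n)
    have "mmul mA (1, int n, 0, 1) = (1, int (Suc n), 0, 1)" by (simp add: mA_def)
    then show ?case using movable_mmul[OF movable_mA Suc] by simp
  qed
  show ?thesis
  proof (cases "k \<ge> 0")
    case True
    then show ?thesis using *[of "nat k"] by simp
  next
    case False
    then show ?thesis using movable_madj[OF *[of "nat (- k)"]] by simp
  qed
qed

lemma movable_minus_one: "movable (-1, 0, 0, -1)"
proof -
  \<comment> \<open>\<open>?J\<close> is the quarter turn \<open>(0, 1, -1, 0)\<close>.\<close>
  let ?J = "mmul (madj mD) (mmul mA (madj mD))"
  have J: "movable ?J" by (intro movable_mmul movable_madj movable_mA movable_mD)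
  have "mmul ?J ?J = (-1, 0, 0, -1)" by (simp add: mA_def mD_def)
  then show ?thesis using movable_mmul[OF J J] by simp
qed

lemma movable_upper_triangular:
  assumes "a * d = 1"
  shows "movable (a, b, 0, d)"
proof -
  have "a = 1 \<and> d = 1 \<or> a = -1 \<and> d = -1"
    using assms by (simp add: zmult_eq_1_iff)
  then show ?thesis
  proof
    assume "a = -1 \<and> d = -1"
    then have "mmul (-1, 0, 0, -1) (a, b, 0, d) = (1, - b, 0, 1)" by simp
    then show ?thesis
      using movable_left_cancel[OF movable_minus_one] movable_upper by metis
  qed (use movable_upper in simp)
qed

text \<open>Euclid's algorithm on the first column.\<close>

lemma movable_SL2: "mdet g = 1 \<Longrightarrow> movable g"
proof (induction "nat (\<bar>fst g\<bar> + \<bar>fst (snd (snd g))\<bar>)" arbitrary: g rule: less_induct)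
  case less
  obtain a b c d where g: "g = (a, b, c, d)" by (cases g)
  have det: "a * d - b * c = 1" using less.prems by (simp add: g)
  have IH: "movable g"
    if "mmul h g = (a', b', c', d')" "nat (\<bar>a'\<bar> + \<bar>c'\<bar>) < nat (\<bar>a\<bar> + \<bar>c\<bar>)" "movable h" for h a' b' c' d'
  proof -
    have "mdet (mmul h g) = 1" using that(3) less.prems by (simp add: mdet_mmul movable_def)
    then have "movable (mmul h g)" using less.hyps[of "mmul h g"] that by (simp add: g)
    then show ?thesis by (rule movable_left_cancel[OF that(3)])
  qed
  have A': "movable (madj mA)" and D': "movable (madj mD)"
    by (intro movable_madj movable_mA movable_mD)+
  consider "c = 0" | "a = 0" | "c \<noteq> 0" "\<bar>a\<bar> \<ge> \<bar>c\<bar>" | "a \<noteq> 0" "\<bar>a\<bar> < \<bar>c\<bar>" by linarith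
  then show ?case
  proof cases
    case 1
    then show ?thesis using movable_upper_triangular[of a d b] det g by simp
  next
    case 2
    \<comment> \<open>With \<open>a = 0\<close>, these two generators copy \<open>c\<close> to the
      diagonal and then clear the lower left entry.\<close>
    have "mmul (madj mD) (mmul mA g) = (c, b + d, 0, - b)"
      using 2 by (simp add: g mA_def mD_def)
    moreover have "movable (c, b + d, 0, - b)"
      using det 2 by (intro movable_upper_triangular) (simp add: mult.commute)
    ultimately have "movable (mmul mA g)" using movable_left_cancel[OF D'] by simp
    then show ?thesis by (rule movable_left_cancel[OF movable_mA])
  next
    case 3
    show ?thesis
    proof (cases "(a > 0) = (c > 0)")
      case True
      show ?thesis using 3 True by (intro IH[of "madj mA", OF _ _ A']) (auto simp: g mA_def)
    next
      case False
      show ?thesis using 3 False by (intro IH[of mA, OF _ _ movable_mA]) (auto simp: g mA_def)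
    qed
  next
    case 4
    show ?thesis
    proof (cases "(a > 0) = (c > 0)")
      case True
      show ?thesis using 4 True by (intro IH[of "madj mD", OF _ _ D']) (auto simp: g mD_def)
    next
      case False
      show ?thesis using 4 False by (intro IH[of mD, OF _ _ movable_mD]) (auto simp: g mD_def)
    qed
  qed
qed

definition gap :: "real \<Rightarrow> int \<Rightarrow> (ivec \<Rightarrow> complex) \<Rightarrow> bool" where
  "gap \<kappa> N f \<longleftrightarrow> \<kappa> * nsq N f \<le> defect N f"

lemma gap_mono: "gap \<kappa> N f \<Longrightarrow> \<kappa>' \<le> \<kappa> \<Longrightarrow> gap \<kappa>' N f"
  unfolding gap_def using mult_right_mono[OF _ nsq_nonneg] order_trans by blast

lemma nsq_act_diff:
  assumes "N > 0" "periodic N f" "mdet w = 1"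
  shows "nsq N (\<lambda>v. f (act w v) - f v) = 2 * nsq N f - 2 * Re (iprod N (\<lambda>x. f (act w x)) f)"
proof -
  have "(cmod (a - b))\<^sup>2 = (cmod a)\<^sup>2 + (cmod b)\<^sup>2 - 2 * Re (a * cnj b)" for a b
    by (simp add: cmod_power2 power2_diff)
  then have "nsq N (\<lambda>v. f (act w v) - f v) = nsq N (\<lambda>v. f (act w v)) + nsq N f - 2 * Re (iprod N (\<lambda>x. f (act w x)) f)"
    by (simp add: nsq_def iprod_def sum.distrib sum_subtractf sum_distrib_left)
  then show ?thesis using nsq_act[OF assms] by simp
qed

text \<open>Summing \<open>nsq_act_diff\<close> over the shell turns the contraction by
  \<open>99/100\<close> into a total displacement of at least \<open>card (shell Q) / 50\<close>
  times \<open>nsq N f\<close>. The shell is fixed, so these displacements are bounded by the defect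
  with one constant \<open>M\<close> for all levels.\<close>

lemma gap_new_eigen:
  "\<exists>\<kappa>>0. \<exists>N1. \<forall>N\<ge>N1. \<forall>f. N > 0 \<longrightarrow> periodic N f \<longrightarrow> new_form N f \<longrightarrow> (\<forall>v. f v \<noteq> 0 \<longrightarrow> prim N v) \<longrightarrow> eigen_form N f \<longrightarrow>
     gap \<kappa> N f"
proof -
  obtain Q N1 where Q: "Q \<ge> 2" and contr: "\<And>N f. N \<ge> N1 \<Longrightarrow> periodic N f \<Longrightarrow> new_form N f \<Longrightarrow>
      (\<forall>v. f v \<noteq> 0 \<longrightarrow> prim N v) \<Longrightarrow> eigen_form N f \<Longrightarrow>
      Re (iprod N (avg_op Q f) f) \<le> 99/100 * real (card (shell Q)) * nsq N f"
    using avg_op_contracts by blast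
  have "\<forall>w\<in>shell Q. \<exists>m\<ge>0. \<forall>N>0. \<forall>f. periodic N f \<longrightarrow> nsq N (\<lambda>v. f (act w v) - f v) \<le> m * defect N f"
    using movable_SL2 mdet_shell unfolding movable_def by blast
  then obtain m where m: "\<And>w. w \<in> shell Q \<Longrightarrow> m w \<ge> 0"
    "\<And>w N f. w \<in> shell Q \<Longrightarrow> N > 0 \<Longrightarrow> periodic N f \<Longrightarrow> nsq N (\<lambda>v. f (act w v) - f v) \<le> m w * defect N f"
    by metis
  define M where "M = (\<Sum>w\<in>shell Q. m w)"
  have M: "M \<ge> 0" unfolding M_def using m(1) by (intro sum_nonneg) auto
  let ?F = "real (card (shell Q))"
  have "(1, Q, 0, 1) \<in> shell Q" using Q by (simp add: shell_def less_twice_max_iff)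
  then have F: "?F > 0" by (auto simp: card_gt_0_iff)
  define \<kappa> where "\<kappa> = ?F / 50 / (M + 1)"
  have \<kappa>: "\<kappa> > 0" using F M by (simp add: \<kappa>_def)
  have "gap \<kappa> N f" if N: "N \<ge> N1" "N > 0" and f: "periodic N f" "new_form N f" "\<forall>v. f v \<noteq> 0 \<longrightarrow> prim N v" "eigen_form N f" for N f
  proof -
    have "?F / 50 * nsq N f \<le> 2 * ?F * nsq N f - 2 * Re (iprod N (avg_op Q f) f)"
      using contr[OF N(1) f] by (simp add: mult_ac)
    also have "iprod N (avg_op Q f) f = (\<Sum>w\<in>shell Q. iprod N (\<lambda>x. f (act w x)) f)"
      unfolding avg_op_def by (rule iprod_sum_left)
    also have "2 * ?F * nsq N f - 2 * Re (\<Sum>w\<in>shell Q. iprod N (\<lambda>x. f (act w x)) f) =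
        (\<Sum>w\<in>shell Q. nsq N (\<lambda>v. f (act w v) - f v))"
      using nsq_act_diff[OF N(2) f(1) mdet_shell] by (simp add: sum_subtractf sum_distrib_left)
    also have "\<dots> \<le> (\<Sum>w\<in>shell Q. m w * defect N f)"
      using m(2) N f by (intro sum_mono) auto
    also have "\<dots> = M * defect N f" by (simp add: M_def sum_distrib_right)
    also have "\<dots> \<le> (M + 1) * defect N f" by (intro mult_right_mono defect_nonneg) simp
    finally have "?F / 50 * nsq N f \<le> (M + 1) * defect N f" .
    moreover have "x / (M + 1) \<le> y" if "x \<le> (M + 1) * y" for x y
      using that M by (simp add: divide_le_eq mult.commute)
    ultimately have "(?F / 50 * nsq N f) / (M + 1) \<le> defect N f" by blast
    then show ?thesis by (simp add: gap_def \<kappa>_def)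
  qed
  then show ?thesis using \<kappa> by blast
qed

section \<open>The gap at a fixed level\<close>

definition cuspidal :: "int \<Rightarrow> (ivec \<Rightarrow> complex) \<Rightarrow> bool" where
  "cuspidal N f \<longleftrightarrow> periodic N f \<and> (\<forall>v. f v \<noteq> 0 \<longrightarrow> prim N v) \<and> (\<Sum>v\<in>zbox N. f v) = 0"

text \<open>The constant may depend on \<open>N\<close> and \<open>v\<close>: this serves only the
  finitely many small levels.\<close>

definition near_base :: "int \<Rightarrow> ivec \<Rightarrow> bool" where
  "near_base N v \<longleftrightarrow> (\<exists>m\<ge>0. \<forall>f. periodic N f \<longrightarrow> (cmod (f v - f (1, 0)))\<^sup>2 \<le> m * defect N f)"

lemma near_base_cong: "vmod N u = vmod N v \<Longrightarrow> near_base N u \<longleftrightarrow> near_base N v"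
  unfolding near_base_def using periodicD by metis

text \<open>A single squared value is at most the whole of \<open>nsq\<close>, so the bound on the
  displacement under \<open>g\<close> holds pointwise at \<open>v\<close>.\<close>

lemma near_base_act_imp:
  assumes N: "N > 0" and g: "mdet g = 1" and v: "near_base N (act g v)"
  shows "near_base N v"
proof -
  obtain m where m: "m \<ge> 0" "\<And>f. periodic N f \<Longrightarrow> nsq N (\<lambda>v. f (act g v) - f v) \<le> m * defect N f"
    using movable_SL2[OF g] N unfolding movable_def by blast
  obtain k where k: "k \<ge> 0" "\<And>f. periodic N f \<Longrightarrow> (cmod (f (act g v) - f (1, 0)))\<^sup>2 \<le> k * defect N f"
    using v unfolding near_base_def by blast
  have "(cmod (f v - f (1, 0)))\<^sup>2 \<le> (2 * m + 2 * k) * defect N f" if f: "periodic N f" for f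
  proof -
    let ?h = "\<lambda>v. f (act g v) - f v"
    have "?h (vmod N v) = ?h v"
      using periodic_diff[OF periodic_act[OF f] f] unfolding periodic_def by blast
    then have "(cmod (?h v))\<^sup>2 = (cmod (?h (vmod N v)))\<^sup>2" by simp
    also have "\<dots> \<le> nsq N ?h"
      unfolding nsq_def using N by (intro member_le_sum) (auto intro: vmod_in_zbox)
    also have "\<dots> \<le> m * defect N f" by (rule m(2)[OF f])
    finally have 1: "(cmod (f v - f (act g v)))\<^sup>2 \<le> m * defect N f" by (simp add: norm_minus_commute)
    have "(cmod (f v - f (1, 0)))\<^sup>2 = (cmod ((f v - f (act g v)) + (f (act g v) - f (1, 0))))\<^sup>2" by simp
    also have "\<dots> \<le> 2 * (cmod (f v - f (act g v)))\<^sup>2 + 2 * (cmod (f (act g v) - f (1, 0)))\<^sup>2"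
      by (rule cmod_add_sq_le)
    also have "\<dots> \<le> 2 * (m * defect N f) + 2 * (k * defect N f)"
      using 1 k(2)[OF f] by simp
    finally show ?thesis by (simp add: algebra_simps)
  qed
  then show ?thesis unfolding near_base_def using m(1) k(1) by (intro exI[of _ "2 * m + 2 * k"]) auto
qed

text \<open>\<open>v\<close> is joined to \<open>(1, 0)\<close> through \<open>(g, 0)\<close>,
  \<open>(g, 1)\<close> and \<open>(1, 1)\<close>, with \<open>g\<close> the gcd of its coordinates.
  Bezout gives the first step; the second works only modulo \<open>N\<close>, with \<open>k\<close>
  inverse to \<open>g\<close>.\<close>

lemma near_base_prim:
  assumes N: "N > 0" and v: "prim N v"
  shows "near_base N v"
proof -
  have base: "near_base N (1, 0)"
    unfolding near_base_def by (auto intro!: exI[of _ 0])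
  obtain x y where xy: "v = (x, y)" by (cases v)
  define g where "g = gcd x y"
  have gN: "coprime g N" using v by (simp add: prim_def xy g_def)
  then obtain k where "[g * k = 1] (mod N)" using cong_solve_coprime_int by blast
  then have k: "N dvd g * k - 1" by (simp add: cong_iff_dvd_diff)
  have "near_base N (1, 1)"
    by (rule near_base_act_imp[OF N, of "(1, 0, -1, 1)"]) (simp_all add: base)
  then have "near_base N (g, 1)"
    by - (rule near_base_act_imp[OF N, where g = "(1, 1 - g, 0, 1)" and v = "(g, 1)"], simp_all)
  moreover have "vmod N (act (1, 0, k, 1) (g, 0)) = vmod N (g, 1)"
    using k by (simp add: vmod_eq_iff mult.commute)
  ultimately have "near_base N (act (1, 0, k, 1) (g, 0))" using near_base_cong by blast
  then have g0: "near_base N (g, 0)"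
    by - (rule near_base_act_imp[OF N, of "(1, 0, k, 1)"], simp_all)
  show ?thesis
  proof (cases "g = 0")
    case True
    then have "v = (g, 0)" by (simp add: xy g_def)
    then show ?thesis using g0 by simp
  next
    case False
    obtain p q where pq: "p * x + q * y = g"
      unfolding g_def using bezout_int by blast
    obtain x' y' where x': "x = g * x'" and y': "y = g * y'"
      unfolding g_def by (meson dvdE gcd_dvd1 gcd_dvd2)
    have "g * (p * x' + q * y') = g * 1" using pq x' y' by (simp add: algebra_simps)
    then have "p * x' + q * y' = 1" using False by simp
    then have "mdet (p, q, - y', x') = 1" by simp
    moreover have "act (p, q, - y', x') v = (g, 0)"
      using pq by (simp add: xy) (simp add: x' y')
    ultimately show ?thesis using near_base_act_imp[OF N, of "(p, q, - y', x')" v] g0 by simp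
  qed
qed

text \<open>On primitive vectors all values of \<open>f\<close> are within the square root of
  \<open>M * defect N f\<close> of \<open>f (1, 0)\<close>, and mean zero makes
  \<open>f (1, 0)\<close> itself that small.\<close>

lemma gap_fixed_level:
  assumes N: "N > 0"
  shows "\<exists>\<kappa>>0. \<forall>f. cuspidal N f \<longrightarrow> gap \<kappa> N f"
proof -
  have "\<forall>v\<in>{v\<in>zbox N. prim N v}. \<exists>m\<ge>0. \<forall>f. periodic N f \<longrightarrow> (cmod (f v - f (1, 0)))\<^sup>2 \<le> m * defect N f"
    using near_base_prim[OF N] unfolding near_base_def by blast
  then obtain m where m: "\<And>v. v \<in> zbox N \<Longrightarrow> prim N v \<Longrightarrow> m v \<ge> 0"
    "\<And>v f. v \<in> zbox N \<Longrightarrow> prim N v \<Longrightarrow> periodic N f \<Longrightarrow> (cmod (f v - f (1, 0)))\<^sup>2 \<le> m v * defect N f"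
    by (metis (mono_tags, lifting) mem_Collect_eq)
  let ?P = "{v\<in>zbox N. prim N v}"
  define M where "M = (\<Sum>v\<in>?P. m v)"
  have M: "M \<ge> 0" unfolding M_def using m(1) by (intro sum_nonneg) auto
  have Mv: "(cmod (f v - f (1, 0)))\<^sup>2 \<le> M * defect N f" if "v \<in> ?P" "periodic N f" for v f
  proof -
    have "m v \<le> M" unfolding M_def using that(1) m(1) by (intro member_le_sum) auto
    then have "m v * defect N f \<le> M * defect N f" by (intro mult_right_mono defect_nonneg)
    then show ?thesis using m(2)[of v f] that by auto
  qed
  have "prim N (vmod N (1, 0))"
    using prim_cong[of N "vmod N (1, 0)" "(1, 0)"] by (simp add: prim_def)
  then have "vmod N (1, 0) \<in> ?P" using N by (auto intro: vmod_in_zbox)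
  then have "?P \<noteq> {}" by blast
  then have P0: "card ?P > 0" by (simp only: card_gt_0_iff) simp
  define \<kappa> where "\<kappa> = 1 / (4 * card (zbox N) * M + 1)"
  have \<kappa>: "\<kappa> > 0" using M by (simp add: \<kappa>_def add_nonneg_pos)
  have "gap \<kappa> N f" if f: "cuspidal N f" for f
  proof -
    let ?\<delta> = "M * defect N f"
    have per: "periodic N f" and supp: "\<And>v. f v \<noteq> 0 \<Longrightarrow> prim N v" and zero: "(\<Sum>v\<in>zbox N. f v) = 0"
      using f by (auto simp: cuspidal_def)
    have \<delta>: "?\<delta> \<ge> 0" using M defect_nonneg by simp
    have le: "cmod (f v - f (1, 0)) \<le> sqrt ?\<delta>" if "v \<in> ?P" for v
      using Mv[OF that per] by (intro real_le_rsqrt)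
    have "(\<Sum>v\<in>?P. f v) = (\<Sum>v\<in>zbox N. f v)"
      using supp by (intro sum.mono_neutral_left) auto
    then have "of_nat (card ?P) * f (1, 0) = - (\<Sum>v\<in>?P. f v - f (1, 0))"
      using zero by (simp add: sum_subtractf)
    then have "cmod (of_nat (card ?P) * f (1, 0)) = cmod (\<Sum>v\<in>?P. f v - f (1, 0))"
      by (simp only: norm_minus_cancel)
    then have "real (card ?P) * cmod (f (1, 0)) = cmod (\<Sum>v\<in>?P. f v - f (1, 0))"
      by (simp only: norm_mult norm_of_nat)
    also have "\<dots> \<le> (\<Sum>v\<in>?P. sqrt ?\<delta>)"
      using le by (intro order_trans[OF norm_sum] sum_mono) auto
    finally have "real (card ?P) * cmod (f (1, 0)) \<le> real (card ?P) * sqrt ?\<delta>" by simp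
    then have base: "cmod (f (1, 0)) \<le> sqrt ?\<delta>" using P0 by simp
    have "(cmod (f v))\<^sup>2 \<le> 4 * ?\<delta>" if v: "v \<in> zbox N" for v
    proof (cases "prim N v")
      case True
      have "cmod (f v) \<le> cmod (f v - f (1, 0)) + cmod (f (1, 0))"
        using norm_triangle_ineq[of "f v - f (1, 0)" "f (1, 0)"] by simp
      also have "\<dots> \<le> 2 * sqrt ?\<delta>" using le[of v] base v True by simp
      finally have "(cmod (f v))\<^sup>2 \<le> (2 * sqrt ?\<delta>)\<^sup>2" by (intro power_mono) auto
      then show ?thesis using \<delta> by (simp add: power_mult_distrib)
    next
      case False
      then have "f v = 0" using supp[of v] by blast
      then show ?thesis using \<delta> by simp
    qed
    then have "nsq N f \<le> (\<Sum>v\<in>zbox N. 4 * ?\<delta>)" unfolding nsq_def by (intro sum_mono)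
    also have "\<dots> = (4 * card (zbox N) * M) * defect N f" by simp
    also have "\<dots> \<le> (4 * card (zbox N) * M + 1) * defect N f"
      by (intro mult_right_mono defect_nonneg) simp
    finally have "nsq N f \<le> (4 * card (zbox N) * M + 1) * defect N f" .
    moreover have "x / (K + 1) \<le> y" if "x \<le> (K + 1) * y" "K \<ge> 0" for x y K :: real
      using that by (simp add: divide_le_eq mult.commute)
    ultimately have "nsq N f / (4 * card (zbox N) * M + 1) \<le> defect N f" using M by simp
    then show ?thesis by (simp add: gap_def \<kappa>_def)
  qed
  then show ?thesis using \<kappa> by blast
qed

section \<open>Fourier decomposition under unit scalars\<close>

lemma cis_root_sum:
  fixes m :: nat and k :: int
  assumes "m > 0"
  shows "(\<Sum>j<m. cis (2 * pi * real j * real_of_int k / real m)) = (if int m dvd k then of_nat m else 0)"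
proof -
  define z where "z = cis (2 * pi * real_of_int k / real m)"
  have pow: "cis (2 * pi * real j * real_of_int k / real m) = z ^ j" for j
    by (simp add: z_def Complex.DeMoivre mult_ac)
  have zm: "z ^ m = 1"
  proof -
    have "z ^ m = cis (2 * pi * real_of_int k)" using assms by (simp add: z_def Complex.DeMoivre)
    also have "\<dots> = 1" by (simp add: cis_multiple_2pi)
    finally show ?thesis .
  qed
  show ?thesis
  proof (cases "int m dvd k")
    case True
    then obtain l where l: "k = int m * l" by auto
    have "2 * pi * real_of_int k / real m = 2 * pi * real_of_int l" using assms by (simp add: l)
    then have "z = 1" unfolding z_def by (simp only: cis_multiple_2pi Ints_of_int)
    then show ?thesis using True by (simp add: pow)
  next
    case False
    have "z \<noteq> 1"
    proof
      assume "z = 1"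
      then have "cos (2 * pi * real_of_int k / real m) = 1" by (auto simp: z_def complex_eq_iff)
      then obtain l :: int where l: "2 * pi * real_of_int k / real m = real_of_int l * 2 * pi"
        by (auto simp: cos_one_2pi_int)
      then have "real_of_int k = real_of_int (l * int m)" using assms by (simp add: field_simps)
      then have "k = l * int m" by (simp only: of_int_eq_iff)
      then show False using False by simp
    qed
    have "(\<Sum>j<m. z ^ j) = (z ^ m - 1) / (z - 1)" by (rule geometric_sum) fact
    then show ?thesis using False zm by (simp add: pow)
  qed
qed

lemma DFT_Parseval:
  fixes a :: "nat \<Rightarrow> complex"
  assumes "m > 0"
  shows "(\<Sum>j<m. (cmod (\<Sum>i<m. cis (2 * pi * real j / real m) ^ i * a i))\<^sup>2) = real m * (\<Sum>i<m. (cmod (a i))\<^sup>2)"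
proof -
  let ?e = "\<lambda>j. cis (2 * pi * real j / real m)"
  have ee: "?e j ^ i * cnj (?e j ^ k) = cis (2 * pi * real j * real_of_int (int i - int k) / real m)" for i j k
    by (simp add: Complex.DeMoivre cis_cnj cis_mult algebra_simps diff_divide_distrib)
  have "complex_of_real (\<Sum>j<m. (cmod (\<Sum>i<m. ?e j ^ i * a i))\<^sup>2) =
      (\<Sum>j<m. (\<Sum>i<m. ?e j ^ i * a i) * cnj (\<Sum>k<m. ?e j ^ k * a k))"
    by (simp only: of_real_sum complex_norm_square)
  also have "\<dots> = (\<Sum>j<m. \<Sum>i<m. \<Sum>k<m. (a i * cnj (a k)) * (?e j ^ i * cnj (?e j ^ k)))"
    unfolding cnj_sum sum_product by (simp add: mult_ac)
  also have "\<dots> = (\<Sum>i<m. \<Sum>k<m. \<Sum>j<m. (a i * cnj (a k)) * (?e j ^ i * cnj (?e j ^ k)))"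
    by (rule sum_rotate)
  also have "\<dots> = (\<Sum>i<m. \<Sum>k<m. (a i * cnj (a k)) * (if int m dvd int i - int k then of_nat m else 0))"
    by (simp only: ee sum_distrib_left[symmetric] cis_root_sum[OF assms])
  also have "\<dots> = (\<Sum>i<m. \<Sum>k<m. if k = i then (a i * cnj (a i)) * of_nat m else 0)"
  proof (intro sum.cong refl)
    fix i k assume "i \<in> {..<m}" "k \<in> {..<m}"
    then have "int m dvd int i - int k \<longleftrightarrow> k = i"
      by (auto simp: mod_eq_dvd_iff[symmetric])
    then show "(a i * cnj (a k)) * (if int m dvd int i - int k then of_nat m else 0) =
        (if k = i then (a i * cnj (a i)) * of_nat m else 0)" by simp
  qed
  also have "\<dots> = (\<Sum>i<m. complex_of_real ((cmod (a i))\<^sup>2) * of_nat m)"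
    by (simp add: complex_norm_square del: of_real_power)
  also have "\<dots> = complex_of_real (real m * (\<Sum>i<m. (cmod (a i))\<^sup>2))"
    by (simp add: sum_distrib_left mult.commute)
  finally show ?thesis by (simp only: of_real_eq_iff)
qed

text \<open>The unnormalized \<open>j\<close>-th Fourier component of \<open>f\<close> under
  multiplication by \<open>t\<close>, where \<open>m\<close> will be a period of \<open>t\<close>
  modulo \<open>N\<close>.\<close>

definition twist :: "int \<Rightarrow> nat \<Rightarrow> nat \<Rightarrow> (ivec \<Rightarrow> complex) \<Rightarrow> ivec \<Rightarrow> complex" where
  "twist t m j f v = (\<Sum>i<m. cis (2 * pi * real j / real m) ^ i * f (smul (t ^ i) v))"

lemma sum_nsq_twist:
  assumes N: "N > 0" and m: "m > 0" and f: "periodic N f" and t: "coprime t N"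
  shows "(\<Sum>j<m. nsq N (twist t m j f)) = (real m)\<^sup>2 * nsq N f"
proof -
  have "(\<Sum>j<m. nsq N (twist t m j f)) = (\<Sum>v\<in>zbox N. \<Sum>j<m. (cmod (twist t m j f v))\<^sup>2)"
    unfolding nsq_def by (rule sum.swap)
  also have "\<dots> = (\<Sum>v\<in>zbox N. real m * (\<Sum>i<m. (cmod (f (smul (t ^ i) v)))\<^sup>2))"
    unfolding twist_def by (intro sum.cong refl DFT_Parseval m)
  also have "\<dots> = real m * (\<Sum>i<m. nsq N (\<lambda>v. f (smul (t ^ i) v)))"
    unfolding nsq_def sum_distrib_left[symmetric] by (subst sum.swap) (rule refl)
  also have "\<dots> = real m * (\<Sum>i<m. nsq N f)"
    using nsq_smul[OF N f] t by simp
  finally show ?thesis by (simp add: power2_eq_square)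
qed

text \<open>Scalars commute with matrices; therefore \<open>defect\<close> splits over the
  components with the same Parseval factor as \<open>nsq\<close>.\<close>

lemma twist_act_diff:
  "twist t m j f (act g v) - twist t m j f v = twist t m j (\<lambda>v. f (act g v) - f v) v"
  by (simp add: twist_def act_smul sum_subtractf[symmetric] algebra_simps)

lemma sum_defect_twist:
  assumes N: "N > 0" and m: "m > 0" and f: "periodic N f" and t: "coprime t N"
  shows "(\<Sum>j<m. defect N (twist t m j f)) = (real m)\<^sup>2 * defect N f"
  unfolding defect_def twist_act_diff sum.distrib
  using sum_nsq_twist[OF N m _ t] periodic_diff[OF periodic_act[OF f] f] by (simp add: algebra_simps)

lemma twist_eigen:
  assumes m: "m > 0" and tm: "[t ^ m = 1] (mod N)" and f: "periodic N f"
  shows "cis (2 * pi * real j / real m) * twist t m j f (smul t v) = twist t m j f v"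
proof -
  let ?e = "cis (2 * pi * real j / real m)"
  let ?F = "\<lambda>i. ?e ^ i * f (smul (t ^ i) v)"
  have "?e * twist t m j f (smul t v) = (\<Sum>i<m. ?F (Suc i))"
    by (simp add: twist_def sum_distrib_left smul_smul mult_ac)
  also have "\<dots> = (\<Sum>i<Suc m. ?F i) - ?F 0"
    by (simp only: sum.lessThan_Suc_shift) simp
  also have "\<dots> = twist t m j f v + (?F m - ?F 0)"
    by (simp add: twist_def)
  also have "?F m = ?F 0"
  proof -
    have "?e ^ m = cis (2 * pi * real_of_int (int j))" using m by (simp add: Complex.DeMoivre)
    also have "\<dots> = 1" using cis_multiple_2pi[of "real_of_int (int j)"] by (simp add: mult_ac)
    finally have 1: "?e ^ m = 1" .
    have "N dvd t ^ m - 1" using tm by (simp add: cong_iff_dvd_diff)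
    then have dv: "N dvd (t ^ m - 1) * x" for x by simp
    have "vmod N (smul (t ^ m) v) = vmod N (smul (t ^ 0) v)"
      using dv by (cases v) (simp add: vmod_eq_iff algebra_simps)
    then have "f (smul (t ^ m) v) = f (smul (t ^ 0) v)" by (rule periodicD[OF f])
    then show ?thesis using 1 by simp
  qed
  finally show ?thesis by simp
qed

definition eigen_at :: "int \<Rightarrow> (ivec \<Rightarrow> complex) \<Rightarrow> bool" where
  "eigen_at t f \<longleftrightarrow> (\<exists>c. cmod c = 1 \<and> (\<forall>v. f (smul t v) = c * f v))"

lemma periodic_fibre:
  assumes "p > 0" "p dvd N" "periodic N f"
  shows "periodic p (\<lambda>w. f (z + smul (N div p) w))"
proof (rule periodicI)
  fix w w' assume "vmod p w = vmod p w'"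
  then have "p dvd fst w - fst w'" "p dvd snd w - snd w'"
    by (simp_all add: vmod_eq_iff)
  then have "N div p * p dvd N div p * (fst w - fst w')" "N div p * p dvd N div p * (snd w - snd w')"
    by (simp_all only: mult_dvd_mono dvd_refl)
  moreover have "N div p * p = N" using assms(2) by simp
  ultimately have "vmod N (z + smul (N div p) w) = vmod N (z + smul (N div p) w')"
    by (cases w; cases w'; simp add: vmod_eq_iff algebra_simps)
  then show "f (z + smul (N div p) w) = f (z + smul (N div p) w')"
    by (rule periodicD[OF assms(3)])
qed

lemma periodic_twist: "periodic N f \<Longrightarrow> periodic N (twist t m j f)"
  unfolding twist_def
  by (rule periodicI, rule sum.cong[OF refl], rule arg_cong[where f = "(*) _"], erule periodicD, rule compatD[OF compat_smul])

lemma new_form_twist: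
  assumes "new_form N f" "periodic N f" "coprime t N"
  shows "new_form N (twist t m j f)"
  unfolding new_form_def
proof (intro allI impI)
  fix p z assume p: "prime p" "p dvd N"
  have p0: "p > 0" using p(1) by (simp add: prime_gt_0_int)
  have cop: "coprime (t ^ i) p" for i
    using assms(3) p(2) by (meson coprime_divisors coprime_power_left_iff dvd_refl)
  have inner: "(\<Sum>w\<in>zbox p. f (smul (t ^ i) (z + smul (N div p) w))) = 0" for i
  proof -
    have "(\<Sum>w\<in>zbox p. f (smul (t ^ i) (z + smul (N div p) w))) =
        (\<Sum>w\<in>zbox p. f (smul (t ^ i) z + smul (N div p) (smul (t ^ i) w)))"
      by (simp add: smul_add_right smul_smul mult.commute)
    also have "\<dots> = (\<Sum>w\<in>zbox p. f (smul (t ^ i) z + smul (N div p) w))"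
      by (rule sum_zbox_smul[OF p0 periodic_fibre[OF p0 p(2) assms(2)] cop])
    also have "\<dots> = 0" using assms(1) p unfolding new_form_def by blast
    finally show ?thesis .
  qed
  have "(\<Sum>w\<in>zbox p. twist t m j f (z + smul (N div p) w)) =
      (\<Sum>i<m. cis (2 * pi * real j / real m) ^ i * (\<Sum>w\<in>zbox p. f (smul (t ^ i) (z + smul (N div p) w))))"
    unfolding twist_def sum_distrib_left by (rule sum.swap)
  then show "(\<Sum>w\<in>zbox p. twist t m j f (z + smul (N div p) w)) = 0" by (simp add: inner)
qed

lemma exists_power_cong_1:
  fixes t N :: int
  assumes "N > 0" "coprime t N"
  obtains m where "m > 0" "[t ^ m = 1] (mod N)"
proof -
  have "\<not> inj_on (\<lambda>i. t ^ i mod N) {..nat N}"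
  proof
    assume "inj_on (\<lambda>i. t ^ i mod N) {..nat N}"
    then have "card {..nat N} \<le> card {0..<N}"
      using assms(1) by (intro card_inj_on_le[of "\<lambda>i. t ^ i mod N"]) auto
    then show False by simp
  qed
  then obtain a b where ab: "a \<noteq> b" "t ^ a mod N = t ^ b mod N" unfolding inj_on_def by blast
  have "\<exists>m>0. [t ^ m = 1] (mod N)" if "a < b" "t ^ a mod N = t ^ b mod N" for a b
  proof -
    have "[t ^ a * t ^ (b - a) = t ^ a * 1] (mod N)"
      using that by (simp add: cong_def flip: power_add)
    then have "[t ^ (b - a) = 1] (mod N)"
      using assms(2) by (metis cong_mult_lcancel coprime_commute coprime_power_left_iff)
    then show ?thesis using that by (intro exI[of _ "b - a"]) auto
  qed
  then show ?thesis using ab that by (metis linorder_neqE_nat)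
qed

lemma gap_twist:
  assumes "N > 0" "m > 0" "periodic N f" "coprime t N" "\<And>j. j < m \<Longrightarrow> gap \<kappa> N (twist t m j f)"
  shows "gap \<kappa> N f"
proof -
  have "(\<Sum>j<m. \<kappa> * nsq N (twist t m j f)) \<le> (\<Sum>j<m. defect N (twist t m j f))"
    using assms(5) by (intro sum_mono) (auto simp: gap_def)
  then have "(real m)\<^sup>2 * (\<kappa> * nsq N f) \<le> (real m)\<^sup>2 * defect N f"
    unfolding sum_distrib_left[symmetric] sum_nsq_twist[OF assms(1-4)] sum_defect_twist[OF assms(1-4)]
    by (simp add: mult_ac)
  then show ?thesis using assms(2) by (simp add: gap_def)
qed

text \<open>One unit \<open>t\<close> is diagonalized at a time. As scalars commute, twisting by
  \<open>t\<close> preserves the eigenvalue equations for the other units, and it also preserves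
  periodicity, newness and support.\<close>

lemma gap_from_eigen:
  assumes N: "N > 0" and T: "finite T" "\<And>t. t \<in> T \<Longrightarrow> coprime t N"
    and gap: "\<And>f. periodic N f \<Longrightarrow> new_form N f \<Longrightarrow> (\<forall>v. f v \<noteq> 0 \<longrightarrow> prim N v) \<Longrightarrow>
      (\<forall>t\<in>T. eigen_at t f) \<Longrightarrow> gap \<kappa> N f"
    and f: "periodic N f" "new_form N f" "\<forall>v. f v \<noteq> 0 \<longrightarrow> prim N v"
  shows "gap \<kappa> N f"
  using T gap f
proof (induction T arbitrary: f rule: finite_induct)
  case empty
  then show ?case by simp
next
  case (insert t T)
  have t: "coprime t N" using insert.prems(1) by simp
  obtain m where m: "m > 0" "[t ^ m = 1] (mod N)" using exists_power_cong_1[OF N t] .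
  show ?case
  proof (rule insert.IH)
    show "coprime s N" if "s \<in> T" for s using insert.prems(1) that by simp
    show "periodic N f" "new_form N f" "\<forall>v. f v \<noteq> 0 \<longrightarrow> prim N v" by fact+
    fix f assume f: "periodic N f" "new_form N f" "\<forall>v. f v \<noteq> 0 \<longrightarrow> prim N v" and eig: "\<forall>s\<in>T. eigen_at s f"
    show "gap \<kappa> N f"
    proof (rule gap_twist[OF N m(1) f(1) t])
      fix j
      let ?h = "twist t m j f" and ?e = "cis (2 * pi * real j / real m)"
      show "gap \<kappa> N ?h"
      proof (rule insert.prems(2))
        show "periodic N ?h" by (rule periodic_twist[OF f(1)])
        show "new_form N ?h" by (rule new_form_twist[OF f(2,1) t])
        show "\<forall>v. ?h v \<noteq> 0 \<longrightarrow> prim N v"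
        proof (intro allI impI)
          fix v assume "?h v \<noteq> 0"
          then obtain i where "f (smul (t ^ i) v) \<noteq> 0"
            unfolding twist_def by (metis (mono_tags, lifting) mult_zero_right sum.neutral)
          then have "prim N (smul (t ^ i) v)" using f(3) by blast
          then show "prim N v" using t prim_smul by (metis coprime_power_left_iff)
        qed
        show "\<forall>s\<in>insert t T. eigen_at s ?h"
        proof
          fix s assume s: "s \<in> insert t T"
          show "eigen_at s ?h"
          proof (cases "s = t")
            case True
            have "?h (smul t v) = cnj ?e * ?h v" for v
            proof -
              have "cnj ?e * (?e * ?h (smul t v)) = cnj ?e * ?h v"
                by (simp only: twist_eigen[OF m f(1)])
              moreover have "cnj ?e * ?e = 1" by (simp add: cis_cnj cis_mult)
              ultimately show ?thesis by (simp flip: mult.assoc)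
            qed
            then show ?thesis unfolding True eigen_at_def by (intro exI[of _ "cnj ?e"]) auto
          next
            case False
            then obtain c where c: "cmod c = 1" "\<And>v. f (smul s v) = c * f v"
              using eig s unfolding eigen_at_def by blast
            have "?h (smul s v) = c * ?h v" for v
            proof -
              have "smul (t ^ i) (smul s v) = smul s (smul (t ^ i) v)" for i
                by (simp add: smul_smul mult.commute)
              then show ?thesis by (simp add: twist_def c sum_distrib_left mult_ac)
            qed
            then show ?thesis unfolding eigen_at_def using c(1) by blast
          qed
        qed
      qed
    qed
  qed
qed

lemma gap_new:
  "\<exists>\<kappa>>0. \<exists>N1. \<forall>N\<ge>N1. \<forall>f. N > 0 \<longrightarrow> periodic N f \<longrightarrow> new_form N f \<longrightarrow> (\<forall>v. f v \<noteq> 0 \<longrightarrow> prim N v) \<longrightarrow> gap \<kappa> N f"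
proof -
  obtain \<kappa> N1 where \<kappa>: "\<kappa> > 0" and gap: "\<And>N f. N \<ge> N1 \<Longrightarrow> N > 0 \<Longrightarrow> periodic N f \<Longrightarrow> new_form N f \<Longrightarrow>
      (\<forall>v. f v \<noteq> 0 \<longrightarrow> prim N v) \<Longrightarrow> eigen_form N f \<Longrightarrow> gap \<kappa> N f"
    using gap_new_eigen by blast
  have "gap \<kappa> N f" if N: "N \<ge> N1" "N > 0" and f: "periodic N f" "new_form N f" "\<forall>v. f v \<noteq> 0 \<longrightarrow> prim N v" for N f
  proof (rule gap_from_eigen[OF N(2) _ _ _ f, of "{t\<in>{0..<N}. coprime t N}"])
    show "finite {t\<in>{0..<N}. coprime t N}" by (rule finite_subset[of _ "{0..<N}"]) auto
    fix f assume f: "periodic N f" "new_form N f" "\<forall>v. f v \<noteq> 0 \<longrightarrow> prim N v"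
      and eig: "\<forall>t\<in>{t\<in>{0..<N}. coprime t N}. eigen_at t f"
    have "eigen_form N f"
      unfolding eigen_form_def
    proof (intro allI impI)
      fix t assume t: "coprime t N"
      have "coprime (t mod N) N" using t N by simp
      then have "eigen_at (t mod N) f" using eig N by simp
      moreover have "f (smul (t mod N) v) = f (smul t v)" for v
        by (rule periodicD[OF f(1)]) (cases v, simp add: vmod_def mod_mult_left_eq)
      ultimately show "\<exists>c. cmod c = 1 \<and> (\<forall>v. f (smul t v) = c * f v)"
        unfolding eigen_at_def by simp
    qed
    then show "gap \<kappa> N f" using gap N f by blast
  qed auto
  then show ?thesis using \<kappa> by blast
qed

section \<open>Splitting off functions of lower level\<close>

definition fibre_sum :: "int \<Rightarrow> int \<Rightarrow> (ivec \<Rightarrow> complex) \<Rightarrow> ivec \<Rightarrow> complex" where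
  "fibre_sum N q f v = (\<Sum>w\<in>zbox q. f (v + smul (N div q) w))"

text \<open>The number of primitive lifts of a primitive vector from level \<open>N div q\<close> to
  level \<open>N\<close>: all \<open>q^2\<close> lifts if \<open>q\<close> still divides
  \<open>N div q\<close>; otherwise exactly one lift is divisible by \<open>q\<close> and drops
  out.\<close>

definition fibre_size :: "int \<Rightarrow> int \<Rightarrow> real" where
  "fibre_size N q = (if q dvd N div q then (real_of_int q)\<^sup>2 else (real_of_int q)\<^sup>2 - 1)"

text \<open>On functions supported on primitive vectors this is the orthogonal projection onto those
  that come from level \<open>N div q\<close>, cut off to primitive vectors.\<close>

definition proj :: "int \<Rightarrow> int \<Rightarrow> (ivec \<Rightarrow> complex) \<Rightarrow> ivec \<Rightarrow> complex" where
  "proj N q f v = (if prim N v then fibre_sum N q f v / fibre_size N q else 0)"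

lemma prim_iff_primes:
  assumes "N > 0"
  shows "prim N v \<longleftrightarrow> (\<forall>p. prime p \<longrightarrow> p dvd N \<longrightarrow> \<not> (p dvd fst v \<and> p dvd snd v))"
proof
  assume v: "prim N v"
  show "\<forall>p. prime p \<longrightarrow> p dvd N \<longrightarrow> \<not> (p dvd fst v \<and> p dvd snd v)"
  proof (intro allI impI notI)
    fix p assume p: "prime p" "p dvd N" "p dvd fst v \<and> p dvd snd v"
    then have "p dvd gcd (fst v) (snd v)" by simp
    then have "is_unit p" using v p(2) coprime_common_divisor unfolding prim_def by blast
    then show False using p(1) not_prime_unit by blast
  qed
next
  assume *: "\<forall>p. prime p \<longrightarrow> p dvd N \<longrightarrow> \<not> (p dvd fst v \<and> p dvd snd v)"
  let ?g = "gcd (gcd (fst v) (snd v)) N"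
  have "?g = 1"
  proof (rule ccontr)
    assume "?g \<noteq> 1"
    moreover have "?g \<ge> 0" by simp
    ultimately obtain p where p: "prime p" "p dvd ?g" using prime_factor_int[of ?g] by auto
    then show False using * unfolding gcd_greatest_iff by blast
  qed
  then show "prim N v" by (simp add: prim_def coprime_iff_gcd_eq_1)
qed

context
  fixes N q M :: int
  assumes N: "N > 0" and q: "prime q" "q dvd N" and M: "M = N div q"
begin

lemma q_pos: "q > 0" using q(1) by (simp add: prime_gt_0_int)

lemma NMq: "N = M * q" using q(2) by (simp add: M)

lemma M_pos: "M > 0" using N q_pos NMq by (simp add: zero_less_mult_iff)

text \<open>\<open>v\<close> and \<open>w\<close> are the two base-\<open>M\<close> digits of the
  coordinates of \<open>u\<close>.\<close>

lemma sum_fibres: "(\<Sum>v\<in>zbox M. \<Sum>w\<in>zbox q. G (v + smul M w)) = (\<Sum>u\<in>zbox N. G u)"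
  for G :: "ivec \<Rightarrow> 'a :: comm_monoid_add"
proof -
  have "(\<Sum>v\<in>zbox M. \<Sum>w\<in>zbox q. G (v + smul M w)) = (\<Sum>(v, w)\<in>zbox M \<times> zbox q. G (v + smul M w))"
    by (rule sum.cartesian_product)
  also have "\<dots> = (\<Sum>u\<in>zbox N. G u)"
  proof (rule sum.reindex_bij_witness[of _ "\<lambda>u. (vmod M u, (fst u div M, snd u div M))" "\<lambda>(v, w). v + smul M w"])
    have bound: "0 \<le> x + M * y \<and> x + M * y < N" if "0 \<le> x" "x < M" "0 \<le> y" "y < q" for x y
    proof -
      have "M * y \<le> M * (q - 1)" using that M_pos by (intro mult_left_mono) auto
      then have "x + M * y < M + M * (q - 1)" using that by linarith
      then show ?thesis using that M_pos NMq by (simp add: algebra_simps)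
    qed
    have div_bound: "0 \<le> x div M \<and> x div M < q" if "0 \<le> x" "x < N" for x
    proof -
      have "M * (x div M) \<le> x" using M_pos by (simp add: minus_mod_eq_mult_div[symmetric])
      then have "M * (x div M) < M * q" using that NMq by linarith
      then show ?thesis using that M_pos by (simp add: pos_imp_zdiv_nonneg_iff)
    qed
    show "(\<lambda>(v, w). v + smul M w) ((\<lambda>u. (vmod M u, (fst u div M, snd u div M))) u) = u" if "u \<in> zbox N" for u
      by (cases u) (simp add: vmod_def)
    show "(\<lambda>u. (vmod M u, (fst u div M, snd u div M))) u \<in> zbox M \<times> zbox q" if "u \<in> zbox N" for u
      using that M_pos by (auto simp: vmod_in_zbox) (auto simp: zbox_def div_bound)
    show "(\<lambda>u. (vmod M u, (fst u div M, snd u div M))) ((\<lambda>(v, w). v + smul M w) z) = z"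
      if "z \<in> zbox M \<times> zbox q" for z
      using that M_pos by (auto simp: zbox_def vmod_def div_add_self1)
    show "(\<lambda>(v, w). v + smul M w) z \<in> zbox N" if "z \<in> zbox M \<times> zbox q" for z
      using that bound by (auto simp: zbox_def)
    show "G ((\<lambda>(v, w). v + smul M w) z) = (case z of (v, w) \<Rightarrow> G (v + smul M w))" for z
      by (cases z) simp
  qed
  finally show ?thesis .
qed

lemma prim_fibre: "prim N (v + smul M w) \<Longrightarrow> prim M v"
proof -
  assume "prim N (v + smul M w)"
  then have "prim M (v + smul M w)"
    unfolding prim_def using NMq by simp
  moreover have "vmod M (v + smul M w) = vmod M v"
    by (cases v; cases w) (simp add: vmod_eq_iff)
  ultimately show "prim M v" using prim_cong by blast
qed

lemma fibre_size_pos: "fibre_size N q > 0"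
proof -
  have "q \<ge> 2" using q(1) by (simp add: prime_ge_2_int)
  then have "(real_of_int q)\<^sup>2 \<ge> 2\<^sup>2" by (intro power_mono) auto
  then show ?thesis using q_pos by (simp add: fibre_size_def)
qed

lemma card_prim_fibre:
  assumes v: "prim M v"
  shows "real (card {w\<in>zbox q. prim N (v + smul M w)}) = fibre_size N q"
proof -
  have prim_eq: "prim N u \<longleftrightarrow> prim M u \<and> \<not> (q dvd fst u \<and> q dvd snd u)" for u
    unfolding prim_iff_primes[OF N] prim_iff_primes[OF M_pos]
  proof -
    have "p dvd N \<longleftrightarrow> p dvd M \<or> p = q" if "prime p" for p
      using that q NMq prime_dvd_mult_iff[OF that, of M q] primes_dvd_imp_eq[OF that q(1)] by auto
    then show "(\<forall>p. prime p \<longrightarrow> p dvd N \<longrightarrow> \<not> (p dvd fst u \<and> p dvd snd u)) \<longleftrightarrow>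
        (\<forall>p. prime p \<longrightarrow> p dvd M \<longrightarrow> \<not> (p dvd fst u \<and> p dvd snd u)) \<and> \<not> (q dvd fst u \<and> q dvd snd u)"
      using q(1) by blast
  qed
  have cM: "prim M (v + smul M w)" for w
  proof -
    have "vmod M (v + smul M w) = vmod M v"
      by (cases v; cases w) (simp add: vmod_eq_iff)
    then show ?thesis using prim_cong v by blast
  qed
  have cardq: "real (card (zbox q)) = (real_of_int q)\<^sup>2" using q_pos by (simp add: card_zbox)
  show ?thesis
  proof (cases "q dvd M")
    case True
    have "\<not> (q dvd fst (v + smul M w) \<and> q dvd snd (v + smul M w))" for w
      using cM[of w] True q(1) unfolding prim_iff_primes[OF M_pos] by blast
    then have "{w\<in>zbox q. prim N (v + smul M w)} = zbox q" using prim_eq cM by blast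
    then show ?thesis using True cardq by (simp add: fibre_size_def M[symmetric])
  next
    case False
    then have "coprime M q" using prime_imp_coprime[OF q(1)] coprime_commute by blast
    then obtain k where "[M * k = 1] (mod q)" using cong_solve_coprime_int by blast
    then have k: "q dvd M * k - 1" by (simp add: cong_iff_dvd_diff)
    \<comment> \<open>\<open>k\<close> inverts \<open>M\<close> modulo \<open>q\<close>, so
      \<open>w0\<close> indexes the one lift of \<open>v\<close> with both coordinates divisible by
      \<open>q\<close>.\<close>
    define w0 where "w0 = vmod q (smul (- k) v)"
    have *: "q dvd x + M * y \<longleftrightarrow> y mod q = (- k * x) mod q" for x y
    proof
      assume "q dvd x + M * y"
      then have "q dvd k * (x + M * y) - (M * k - 1) * y" using k by simp
      then show "y mod q = (- k * x) mod q" by (simp add: mod_eq_dvd_iff algebra_simps)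
    next
      assume "y mod q = (- k * x) mod q"
      then have "q dvd y + k * x" by (simp add: mod_eq_dvd_iff)
      then have "q dvd M * (y + k * x) - (M * k - 1) * x" using k by simp
      then show "q dvd x + M * y" by (simp add: algebra_simps)
    qed
    have "(q dvd fst (v + smul M w) \<and> q dvd snd (v + smul M w)) \<longleftrightarrow> w = w0" if "w \<in> zbox q" for w
    proof -
      have "(q dvd fst (v + smul M w) \<and> q dvd snd (v + smul M w)) \<longleftrightarrow> vmod q w = w0"
        by (cases v; cases w) (simp add: * w0_def vmod_def)
      then show ?thesis using that by simp
    qed
    then have "{w\<in>zbox q. prim N (v + smul M w)} = zbox q - {w0}" using prim_eq cM by blast
    moreover have "w0 \<in> zbox q" using q_pos by (simp add: w0_def vmod_in_zbox)
    moreover have "card (zbox q) \<ge> 1" using q_pos by (simp add: card_zbox)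
    ultimately show ?thesis using False cardq by (simp add: fibre_size_def M[symmetric] of_nat_diff)
  qed
qed

lemma fibre_periodic:
  assumes f: "periodic N f"
  shows "periodic M (fibre_sum N q f)"
proof (rule periodicI)
  fix u v assume "vmod M u = vmod M v"
  then obtain a b where ab: "fst u - fst v = M * a" "snd u - snd v = M * b"
    unfolding vmod_eq_iff by (auto elim!: dvdE)
  then have u: "u = v + smul M (a, b)" by (simp add: prod_eq_iff)
  have "fibre_sum N q f u = (\<Sum>w\<in>zbox q. f (v + smul (N div q) (w + (a, b))))"
    unfolding fibre_sum_def u M[symmetric] by (simp add: smul_add_right add_ac)
  also have "\<dots> = fibre_sum N q f v"
    unfolding fibre_sum_def by (rule sum_zbox_shift[OF q_pos periodic_fibre[OF q_pos q(2) f]])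
  finally show "fibre_sum N q f u = fibre_sum N q f v" .
qed

lemma fibre_supp:
  assumes "\<forall>v. f v \<noteq> 0 \<longrightarrow> prim N v" "fibre_sum N q f v \<noteq> 0"
  shows "prim M v"
proof -
  obtain w where "f (v + smul M w) \<noteq> 0"
    using assms(2) unfolding fibre_sum_def M[symmetric] by (meson sum.neutral)
  then show ?thesis using assms(1) prim_fibre by blast
qed

lemma fibre_act:
  assumes f: "periodic N f" and g: "mdet g = 1"
  shows "fibre_sum N q (\<lambda>v. f (act g v)) v = fibre_sum N q f (act g v)"
proof -
  have "fibre_sum N q (\<lambda>v. f (act g v)) v = (\<Sum>w\<in>zbox q. f (act g v + smul (N div q) (act g w)))"
    by (simp add: fibre_sum_def act_add act_smul)
  also have "\<dots> = fibre_sum N q f (act g v)"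
    unfolding fibre_sum_def by (rule sum_zbox_act[OF q_pos periodic_fibre[OF q_pos q(2) f]]) (simp add: g)
  finally show ?thesis .
qed

lemma proj_act:
  assumes f: "periodic N f" and g: "mdet g = 1"
  shows "proj N q (\<lambda>v. f (act g v)) v = proj N q f (act g v)"
  using fibre_act[OF assms] by (simp add: proj_def prim_act[OF g])

lemma proj_diff: "proj N q (\<lambda>v. f v - h v) v = proj N q f v - proj N q h v"
  by (simp add: proj_def fibre_sum_def sum_subtractf diff_divide_distrib)

lemma proj_periodic:
  assumes f: "periodic N f"
  shows "periodic N (proj N q f)"
proof (rule periodicI)
  fix u v assume uv: "vmod N u = vmod N v"
  have "vmod M u = vmod M v" using vmod_dvd[OF _ uv, of M] NMq by simp
  then have "fibre_sum N q f u = fibre_sum N q f v" by (rule periodicD[OF fibre_periodic[OF f]])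
  then show "proj N q f u = proj N q f v" using prim_cong[OF uv] by (simp add: proj_def)
qed

lemma fibre_shift:
  assumes f: "periodic N f"
  shows "fibre_sum N q f (v + smul M w) = fibre_sum N q f v"
  by (rule periodicD[OF fibre_periodic[OF f]]) (cases v; cases w; simp add: vmod_eq_iff)

lemma proj_supp: "\<forall>v. proj N q f v \<noteq> 0 \<longrightarrow> prim N v"
  by (auto simp: proj_def)

text \<open>\<open>proj\<close> is constant on the primitive members of a fibre, and
  \<open>fibre_size\<close> is their number, so the division cancels. This is idempotence of the
  projection in disguise.\<close>

lemma fibre_proj:
  assumes f: "periodic N f" and supp: "\<forall>v. f v \<noteq> 0 \<longrightarrow> prim N v"
  shows "fibre_sum N q (proj N q f) v = fibre_sum N q f v"
proof (cases "prim M v")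
  case True
  let ?c = "fibre_sum N q f v / of_real (fibre_size N q)"
  have "fibre_sum N q (proj N q f) v = (\<Sum>w\<in>zbox q. if prim N (v + smul M w) then ?c else 0)"
    unfolding fibre_sum_def[of N q "proj N q f"] M[symmetric] by (simp add: proj_def fibre_shift[OF f] cong: if_cong)
  also have "\<dots> = (\<Sum>w\<in>{w\<in>zbox q. prim N (v + smul M w)}. ?c)"
    by (rule sum.inter_filter[symmetric]) simp
  also have "\<dots> = of_real (real (card {w\<in>zbox q. prim N (v + smul M w)})) * ?c" by simp
  also have "\<dots> = fibre_sum N q f v"
    unfolding card_prim_fibre[OF True] using fibre_size_pos by simp
  finally show ?thesis .
next
  case False
  then have "fibre_sum N q f v = 0" "fibre_sum N q (proj N q f) v = 0"
    using fibre_supp[OF supp] fibre_supp[OF proj_supp] by blast+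
  then show ?thesis by simp
qed

lemma iprod_proj:
  assumes f: "periodic N f" and supp: "\<forall>v. f v \<noteq> 0 \<longrightarrow> prim N v"
    and h: "periodic N h" and supp_h: "\<forall>v. h v \<noteq> 0 \<longrightarrow> prim N v"
  shows "iprod N h (proj N q f) = iprod M (fibre_sum N q h) (fibre_sum N q f) / of_real (fibre_size N q)"
proof -
  have "iprod N h (proj N q f) = (\<Sum>u\<in>zbox N. h u * cnj (fibre_sum N q f u) / of_real (fibre_size N q))"
    unfolding iprod_def using supp_h by (intro sum.cong refl) (auto simp: proj_def)
  also have "\<dots> = (\<Sum>v\<in>zbox M. \<Sum>w\<in>zbox q. h (v + smul M w) * cnj (fibre_sum N q f (v + smul M w)) / of_real (fibre_size N q))"
    by (rule sum_fibres[symmetric])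
  also have "\<dots> = (\<Sum>v\<in>zbox M. fibre_sum N q h v * cnj (fibre_sum N q f v) / of_real (fibre_size N q))"
    by (simp add: fibre_shift[OF f] fibre_sum_def[of N q h] M[symmetric] sum_distrib_right sum_divide_distrib)
  finally show ?thesis by (simp add: iprod_def sum_divide_distrib)
qed

lemma nsq_proj:
  assumes f: "periodic N f" and supp: "\<forall>v. f v \<noteq> 0 \<longrightarrow> prim N v"
  shows "nsq N (proj N q f) = nsq M (fibre_sum N q f) / fibre_size N q"
proof -
  have "complex_of_real (nsq N (proj N q f)) = iprod M (fibre_sum N q (proj N q f)) (fibre_sum N q f) / of_real (fibre_size N q)"
    unfolding iprod_self[symmetric] by (rule iprod_proj[OF f supp proj_periodic[OF f] proj_supp])
  also have "fibre_sum N q (proj N q f) = fibre_sum N q f" using fibre_proj[OF f supp] by (simp add: fun_eq_iff)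
  also have "iprod M (fibre_sum N q f) (fibre_sum N q f) / of_real (fibre_size N q) = complex_of_real (nsq M (fibre_sum N q f) / fibre_size N q)"
    by (simp add: iprod_self)
  finally show ?thesis by (simp only: of_real_eq_iff)
qed

lemma nsq_Pythagoras:
  assumes f: "periodic N f" and supp: "\<forall>v. f v \<noteq> 0 \<longrightarrow> prim N v"
  shows "nsq N f = nsq M (fibre_sum N q f) / fibre_size N q + nsq N (\<lambda>v. f v - proj N q f v)"
proof -
  have "(cmod (a - b))\<^sup>2 = (cmod a)\<^sup>2 + (cmod b)\<^sup>2 - 2 * Re (a * cnj b)" for a b
    by (simp add: cmod_power2 power2_diff)
  then have "nsq N (\<lambda>v. f v - proj N q f v) = nsq N f + nsq N (proj N q f) - 2 * Re (iprod N f (proj N q f))"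
    by (simp add: nsq_def iprod_def sum.distrib sum_subtractf sum_distrib_left)
  moreover have "iprod N f (proj N q f) = complex_of_real (nsq M (fibre_sum N q f) / fibre_size N q)"
    using iprod_proj[OF f supp f supp] by (simp add: iprod_self)
  ultimately show ?thesis using nsq_proj[OF f supp] by simp
qed

text \<open>Fibre sums and projection commute with matrices of determinant one, so the orthogonal
  splitting applies to each displacement \<open>f (act g v) - f v\<close>. The weight
  \<open>1 / fibre_size N q\<close> is the same as for \<open>nsq\<close>, hence no constant is
  lost.\<close>

lemma defect_Pythagoras:
  assumes f: "periodic N f" and supp: "\<forall>v. f v \<noteq> 0 \<longrightarrow> prim N v"
  shows "defect N f = defect M (fibre_sum N q f) / fibre_size N q + defect N (\<lambda>v. f v - proj N q f v)"
proof -
  have *: "nsq N (\<lambda>v. f (act g v) - f v) = nsq M (\<lambda>v. fibre_sum N q f (act g v) - fibre_sum N q f v) / fibre_size N q +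
      nsq N (\<lambda>v. (f (act g v) - proj N q f (act g v)) - (f v - proj N q f v))" if g: "mdet g = 1" for g
  proof -
    let ?h = "\<lambda>v. f (act g v) - f v"
    have h: "periodic N ?h" by (rule periodic_diff[OF periodic_act[OF f] f])
    have hs: "\<forall>v. ?h v \<noteq> 0 \<longrightarrow> prim N v"
      using supp prim_act[OF g, of N] by (metis diff_self)
    have e1: "fibre_sum N q ?h = (\<lambda>v. fibre_sum N q f (act g v) - fibre_sum N q f v)"
      using fibre_act[OF f g] by (simp add: fun_eq_iff fibre_sum_def sum_subtractf)
    have e2: "(\<lambda>v. ?h v - proj N q ?h v) = (\<lambda>v. (f (act g v) - proj N q f (act g v)) - (f v - proj N q f v))"
      unfolding proj_diff proj_act[OF f g] by (simp add: fun_eq_iff algebra_simps)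
    show ?thesis using nsq_Pythagoras[OF h hs] unfolding e1 e2 .
  qed
  show ?thesis unfolding defect_def by (simp add: * add_divide_distrib)
qed

lemma gap_remove_fibre:
  assumes f: "periodic N f" and supp: "\<forall>v. f v \<noteq> 0 \<longrightarrow> prim N v"
    and g1: "gap \<kappa> M (fibre_sum N q f)" and g2: "gap \<kappa> N (\<lambda>v. f v - proj N q f v)"
  shows "gap \<kappa> N f"
proof -
  have "\<kappa> * nsq M (fibre_sum N q f) / fibre_size N q \<le> defect M (fibre_sum N q f) / fibre_size N q"
    using g1 fibre_size_pos unfolding gap_def by (intro divide_right_mono) auto
  then show ?thesis
    using g2 nsq_Pythagoras[OF f supp] defect_Pythagoras[OF f supp]
    unfolding gap_def by (simp add: algebra_simps)
qed

lemma cuspidal_fib: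
  assumes "cuspidal N f"
  shows "cuspidal M (fibre_sum N q f)"
  unfolding cuspidal_def
proof (intro conjI)
  show "periodic M (fibre_sum N q f)" using assms by (simp add: cuspidal_def fibre_periodic)
  show "\<forall>v. fibre_sum N q f v \<noteq> 0 \<longrightarrow> prim M v" using assms fibre_supp unfolding cuspidal_def by blast
  show "(\<Sum>v\<in>zbox M. fibre_sum N q f v) = 0"
    using assms sum_fibres[of f] by (simp add: cuspidal_def fibre_sum_def M[symmetric])
qed

lemma cuspidal_diff_proj:
  assumes "cuspidal N f"
  shows "cuspidal N (\<lambda>v. f v - proj N q f v)"
proof -
  have f: "periodic N f" and supp: "\<forall>v. f v \<noteq> 0 \<longrightarrow> prim N v" and zero: "(\<Sum>v\<in>zbox N. f v) = 0"
    using assms by (simp_all add: cuspidal_def)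
  have "(\<Sum>v\<in>zbox N. proj N q f v) = (\<Sum>v\<in>zbox M. fibre_sum N q (proj N q f) v)"
    using sum_fibres[of "proj N q f"] by (simp add: fibre_sum_def M[symmetric])
  also have "\<dots> = (\<Sum>v\<in>zbox M. fibre_sum N q f v)" using fibre_proj[OF f supp] by simp
  also have "\<dots> = 0" using cuspidal_fib[OF assms] by (simp add: cuspidal_def)
  finally have "(\<Sum>v\<in>zbox N. f v - proj N q f v) = 0" using zero by (simp add: sum_subtractf)
  moreover have "\<forall>v. f v - proj N q f v \<noteq> 0 \<longrightarrow> prim N v"
    using supp proj_supp by (metis diff_self)
  ultimately show ?thesis
    using periodic_diff[OF f proj_periodic[OF f]] by (simp add: cuspidal_def)
qed

lemma fibre_diff_proj:
  assumes "periodic N f" "\<forall>v. f v \<noteq> 0 \<longrightarrow> prim N v"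
  shows "fibre_sum N q (\<lambda>v. f v - proj N q f v) v = 0"
  using fibre_proj[OF assms, of v] by (simp add: fibre_sum_def sum_subtractf)

end

text \<open>Removing level \<open>N div q\<close> must not spoil the vanishing already obtained at
  \<open>p\<close>. The two fibre sums commute except for the primitivity cut-off in
  \<open>proj\<close>. Shifts by multiples of \<open>N div q\<close> do not affect divisibility by
  the other primes of \<open>N\<close>, and shifts by multiples of \<open>N div p\<close> do not
  affect divisibility by \<open>q\<close>; so on the support of \<open>f\<close> the cut-off depends
  on \<open>v\<close> alone.\<close>

lemma fibre_proj_other_prime:
  assumes N: "N > 0" and q: "prime q" "q dvd N" and p: "prime p" "p dvd N" "p \<noteq> q"
    and supp: "\<forall>v. f v \<noteq> 0 \<longrightarrow> prim N v" and fp: "\<And>v. fibre_sum N p f v = 0"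
  shows "fibre_sum N p (proj N q f) v = 0"
proof -
  let ?P = "smul (N div p)" and ?Q = "smul (N div q)"
  have qP: "q dvd N div p"
  proof -
    have "N = p * (N div p)" using p(2) by simp
    then have "q dvd p * (N div p)" using q(2) by simp
    then have "q dvd p \<or> q dvd N div p" using prime_dvd_mult_iff[OF q(1)] by blast
    then show ?thesis using p q primes_dvd_imp_eq by blast
  qed
  have rQ: "r dvd N div q" if "prime r" "r dvd N" "r \<noteq> q" for r
  proof -
    have "N = q * (N div q)" using q(2) by simp
    then have "r dvd q * (N div q)" using that(2) by simp
    then have "r dvd q \<or> r dvd N div q" using prime_dvd_mult_iff[OF that(1)] by blast
    then show ?thesis using that q primes_dvd_imp_eq by blast
  qed
  have key: "(if prim N (v + ?P w) then f (v + ?P w + ?Q u) else 0) =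
      (if q dvd fst v \<and> q dvd snd v then 0 else f (v + ?P w + ?Q u))" for w u
  proof (cases "f (v + ?P w + ?Q u) = 0")
    case False
    then have y: "prim N (v + ?P w + ?Q u)" using supp by blast
    have qv: "q dvd fst (v + ?P w) \<longleftrightarrow> q dvd fst v" "q dvd snd (v + ?P w) \<longleftrightarrow> q dvd snd v"
      using qP by (cases v; cases w; simp add: dvd_add_left_iff)+
    have r: "r dvd fst (v + ?P w + ?Q u) \<longleftrightarrow> r dvd fst (v + ?P w)"
      "r dvd snd (v + ?P w + ?Q u) \<longleftrightarrow> r dvd snd (v + ?P w)" if "prime r" "r dvd N" "r \<noteq> q" for r
      using rQ[OF that] by (cases u; simp add: dvd_add_left_iff)+
    have "prim N (v + ?P w) \<longleftrightarrow> \<not> (q dvd fst v \<and> q dvd snd v)"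
    proof
      assume "prim N (v + ?P w)"
      then show "\<not> (q dvd fst v \<and> q dvd snd v)"
        using q qv unfolding prim_iff_primes[OF N] by blast
    next
      assume *: "\<not> (q dvd fst v \<and> q dvd snd v)"
      show "prim N (v + ?P w)"
        unfolding prim_iff_primes[OF N]
      proof (intro allI impI)
        fix r assume r': "prime r" "r dvd N"
        show "\<not> (r dvd fst (v + ?P w) \<and> r dvd snd (v + ?P w))"
        proof (cases "r = q")
          case True
          then show ?thesis using * qv by blast
        next
          case False
          then show ?thesis using y r[OF r' False] r' unfolding prim_iff_primes[OF N] by blast
        qed
      qed
    qed
    then show ?thesis by simp
  qed auto
  have if_out: "(\<Sum>w\<in>A. (\<Sum>u\<in>B. if b then 0 else G w u) / c) = (if b then 0 else (\<Sum>w\<in>A. \<Sum>u\<in>B. G w u) / c)"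
    for A B :: "ivec set" and G :: "ivec \<Rightarrow> ivec \<Rightarrow> complex" and b c
    by (cases b) (simp_all add: sum_divide_distrib)
  have "fibre_sum N p (proj N q f) v = (\<Sum>w\<in>zbox p. (\<Sum>u\<in>zbox q. if prim N (v + ?P w) then f (v + ?P w + ?Q u) else 0) / fibre_size N q)"
    unfolding fibre_sum_def[of N p] proj_def fibre_sum_def[of N q] by (intro sum.cong refl) auto
  also have "\<dots> = (\<Sum>w\<in>zbox p. (\<Sum>u\<in>zbox q. if q dvd fst v \<and> q dvd snd v then 0 else f (v + ?P w + ?Q u)) / fibre_size N q)"
    by (simp only: key)
  also have "\<dots> = (if q dvd fst v \<and> q dvd snd v then 0 else (\<Sum>w\<in>zbox p. \<Sum>u\<in>zbox q. f (v + ?P w + ?Q u)) / fibre_size N q)"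
    by (rule if_out)
  also have "(\<Sum>w\<in>zbox p. \<Sum>u\<in>zbox q. f (v + ?P w + ?Q u)) = (\<Sum>u\<in>zbox q. fibre_sum N p f (v + ?Q u))"
    unfolding fibre_sum_def by (subst sum.swap) (simp add: add_ac)
  also have "\<dots> = 0" by (simp add: fp)
  finally show ?thesis by simp
qed

text \<open>The primes are removed one by one. Subtracting \<open>proj N q f\<close> makes the fibre
  sums at \<open>q\<close> vanish and keeps those at the other treated primes zero; what is removed
  amounts to a cuspidal function of level \<open>N div q\<close>, covered by
  \<open>lower\<close>.\<close>

lemma gap_from_new:
  assumes N: "N > 0" and P: "finite P" "\<And>p. p \<in> P \<Longrightarrow> prime p \<and> p dvd N"
    and lower: "\<And>p F. prime p \<Longrightarrow> p dvd N \<Longrightarrow> cuspidal (N div p) F \<Longrightarrow> gap \<kappa> (N div p) F"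
    and gap: "\<And>f. cuspidal N f \<Longrightarrow> (\<forall>p\<in>P. \<forall>v. fibre_sum N p f v = 0) \<Longrightarrow> gap \<kappa> N f"
    and f: "cuspidal N f"
  shows "gap \<kappa> N f"
  using P gap f
proof (induction P arbitrary: f rule: finite_induct)
  case empty
  then show ?case by simp
next
  case (insert q P)
  have q: "prime q" "q dvd N" using insert.prems(1) by auto
  show ?case
  proof (rule insert.IH)
    show "prime p \<and> p dvd N" if "p \<in> P" for p using insert.prems(1) that by simp
    show "cuspidal N f" by fact
    fix f assume f: "cuspidal N f" and fz: "\<forall>p\<in>P. \<forall>v. fibre_sum N p f v = 0"
    have per: "periodic N f" and supp: "\<forall>v. f v \<noteq> 0 \<longrightarrow> prim N v" using f by (simp_all add: cuspidal_def)
    show "gap \<kappa> N f"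
    proof (rule gap_remove_fibre[OF N q refl per supp])
      show "gap \<kappa> (N div q) (fibre_sum N q f)" by (rule lower[OF q cuspidal_fib[OF N q refl f]])
      show "gap \<kappa> N (\<lambda>v. f v - proj N q f v)"
      proof (rule insert.prems(2)[OF cuspidal_diff_proj[OF N q refl f]], intro ballI allI)
        fix p v assume p: "p \<in> insert q P"
        show "fibre_sum N p (\<lambda>v. f v - proj N q f v) v = 0"
        proof (cases "p = q")
          case True
          then show ?thesis using fibre_diff_proj[OF N q refl per supp] by simp
        next
          case False
          then have "p \<in> P" "prime p" "p dvd N" using p insert.prems(1) by auto
          then have "fibre_sum N p (proj N q f) v = 0"
            using fibre_proj_other_prime[OF N q _ _ False supp] fz by blast
          moreover have "fibre_sum N p f v = 0" using fz \<open>p \<in> P\<close> by blast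
          ultimately show ?thesis by (simp add: fibre_sum_def sum_subtractf)
        qed
      qed
    qed
  qed
qed

text \<open>Strong induction on \<open>N\<close>, with one \<open>\<kappa>\<close> for all levels
  because the splitting is orthogonal for both \<open>nsq\<close> and \<open>defect\<close>. The
  minimum is over the constant for new forms and those of the finitely many levels below
  \<open>N1\<close>.\<close>

theorem uniform_gap: "\<exists>\<kappa>>0. \<forall>N>0. \<forall>f. cuspidal N f \<longrightarrow> gap \<kappa> N f"
proof -
  obtain \<kappa>1 N1 where \<kappa>1: "\<kappa>1 > 0" and new: "\<And>N f. N \<ge> N1 \<Longrightarrow> N > 0 \<Longrightarrow> periodic N f \<Longrightarrow> new_form N f \<Longrightarrow>
      (\<forall>v. f v \<noteq> 0 \<longrightarrow> prim N v) \<Longrightarrow> gap \<kappa>1 N f"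
    using gap_new by blast
  have "\<forall>N\<in>{0<..<N1}. \<exists>\<kappa>>0. \<forall>f. cuspidal N f \<longrightarrow> gap \<kappa> N f"
    using gap_fixed_level by simp
  then obtain k where k: "\<And>N. N \<in> {0<..<N1} \<Longrightarrow> k N > 0"
    "\<And>N f. N \<in> {0<..<N1} \<Longrightarrow> cuspidal N f \<Longrightarrow> gap (k N) N f"
    by metis
  define \<kappa> where "\<kappa> = Min (insert \<kappa>1 (k ` {0<..<N1}))"
  have \<kappa>: "\<kappa> > 0" unfolding \<kappa>_def using \<kappa>1 k(1) by (subst Min_gr_iff) auto
  have le1: "\<kappa> \<le> \<kappa>1" and lek: "\<And>N. N \<in> {0<..<N1} \<Longrightarrow> \<kappa> \<le> k N"
    unfolding \<kappa>_def by (auto intro: Min_le)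
  have "gap \<kappa> N f" if "N > 0" "cuspidal N f" for N f
    using that
  proof (induction "nat N" arbitrary: N f rule: less_induct)
    case less
    show ?case
    proof (cases "N < N1")
      case True
      then show ?thesis using less.prems k(2)[of N f] lek[of N] gap_mono by auto
    next
      case False
      let ?P = "{p. prime p \<and> p dvd N}"
      have fin: "finite ?P"
        using less.prems(1) by (intro finite_subset[OF _ finite_divisors_int[of N]]) auto
      show ?thesis
      proof (rule gap_from_new[OF less.prems(1) fin])
        fix p F assume p: "prime p" "p dvd N" and F: "cuspidal (N div p) F"
        have "N div p > 0" using M_pos[OF less.prems(1) p refl] .
        moreover have "N div p < N" using p less.prems(1) prime_gt_1_int[OF p(1)] by (intro int_div_less_self) auto
        ultimately show "gap \<kappa> (N div p) F" using less.hyps F by simp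
      next
        fix f assume f: "cuspidal N f" and fz: "\<forall>p\<in>?P. \<forall>v. fibre_sum N p f v = 0"
        have "new_form N f" using fz unfolding new_form_def fibre_sum_def by blast
        then have "gap \<kappa>1 N f" using new[of N f] f False less.prems(1) by (simp add: cuspidal_def)
        then show "gap \<kappa> N f" by (rule gap_mono[OF _ le1])
      qed (use less.prems in auto)
    qed
  qed
  then show ?thesis using \<kappa> by blast
qed

section \<open>Words in \<open>A D\<close> and \<open>A\<^sup>2 D\<close>\<close>

text \<open>The matrices \<open>A D\<close> and \<open>A^2 D\<close>. The else branch also answers
  for other indices, so that facts such as \<open>mdet_mAD\<close> hold for every
  \<open>i\<close>.\<close>

definition mAD :: "nat \<Rightarrow> imat" where "mAD i = (if i = 1 then (2, 1, 1, 1) else (3, 2, 1, 1))"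

definition half_sum :: "(ivec \<Rightarrow> complex) \<Rightarrow> ivec \<Rightarrow> complex" where
  "half_sum f v = (f (act (mAD 1) v) + f (act (mAD 2) v)) / 2"

lemma mdet_mAD [simp]: "mdet (mAD i) = 1"
  by (simp add: mAD_def)

lemma act_mAD: "act (mAD (Suc 0)) v = act mA (act mD v)" "act (mAD 2) v = act mA (act mA (act mD v))"
  by (cases v; simp add: mAD_def mA_def mD_def)+

lemma periodic_half_sum:
  assumes "periodic N f"
  shows "periodic N (half_sum f)"
proof (rule periodicI)
  fix u v assume uv: "vmod N u = vmod N v"
  show "half_sum f u = half_sum f v"
    unfolding half_sum_def
    using periodicD[OF periodic_act[OF assms, of "mAD 1"] uv] periodicD[OF periodic_act[OF assms, of "mAD 2"] uv]
    by simp
qed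

lemma cuspidal_half_sum:
  assumes N: "N > 0" and f: "cuspidal N f"
  shows "cuspidal N (half_sum f)"
proof -
  have per: "periodic N f" and supp: "\<forall>v. f v \<noteq> 0 \<longrightarrow> prim N v" and zero: "(\<Sum>v\<in>zbox N. f v) = 0"
    using f by (simp_all add: cuspidal_def)
  have "\<forall>v. half_sum f v \<noteq> 0 \<longrightarrow> prim N v"
  proof (intro allI impI)
    fix v assume "half_sum f v \<noteq> 0"
    then have "f (act (mAD 1) v) \<noteq> 0 \<or> f (act (mAD 2) v) \<noteq> 0" by (auto simp: half_sum_def)
    then have "prim N (act (mAD 1) v) \<or> prim N (act (mAD 2) v)" using supp by blast
    then show "prim N v" by (simp add: prim_act)
  qed
  moreover have "(\<Sum>v\<in>zbox N. half_sum f v) = 0"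
    using zero sum_zbox_act[OF N per]
    by (simp add: half_sum_def sum.distrib flip: sum_divide_distrib)
  ultimately show ?thesis using periodic_half_sum[OF per] by (simp add: cuspidal_def)
qed

definition shiftA :: "int \<Rightarrow> (ivec \<Rightarrow> complex) \<Rightarrow> real" where
  "shiftA N f = nsq N (\<lambda>v. f (act mA v) - f v)"

text \<open>Parallelogram identity: the two images of \<open>v\<close> differ by one application of
  \<open>A\<close>, so the loss in a step is a quarter of the displacement under
  \<open>A\<close>.\<close>

lemma nsq_half_sum:
  assumes N: "N > 0" and f: "periodic N f"
  shows "nsq N (half_sum f) = nsq N f - shiftA N f / 4"
proof -
  have par: "(cmod ((a + b) / 2))\<^sup>2 = ((cmod a)\<^sup>2 + (cmod b)\<^sup>2) / 2 - (cmod (b - a))\<^sup>2 / 4" for a b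
    by (simp add: norm_divide cmod_power2 power_divide power2_sum power2_diff field_simps)
  have "nsq N (half_sum f) = (nsq N (\<lambda>v. f (act (mAD 1) v)) + nsq N (\<lambda>v. f (act (mAD 2) v))) / 2 -
      nsq N (\<lambda>v. f (act (mAD 2) v) - f (act (mAD 1) v)) / 4"
    unfolding nsq_def half_sum_def par
    by (simp add: sum_subtractf sum.distrib flip: sum_divide_distrib)
  also have "nsq N (\<lambda>v. f (act (mAD 1) v)) = nsq N f" by (rule nsq_act[OF N f]) simp
  also have "nsq N (\<lambda>v. f (act (mAD 2) v)) = nsq N f" by (rule nsq_act[OF N f]) simp
  also have "nsq N (\<lambda>v. f (act (mAD 2) v) - f (act (mAD 1) v)) = nsq N (\<lambda>v. f (act mA v) - f v)"
    using nsq_act[OF N periodic_diff[OF periodic_act[OF f] f], of "mmul mA mD"]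
    by (simp add: act_mAD act_mmul mdet_mmul)
  finally show ?thesis by (simp add: shiftA_def)
qed

lemma nsq_diff_le: "nsq N (\<lambda>v. f v - h v) \<le> 2 * nsq N f + 2 * nsq N h"
  using nsq_add_le[of N f "\<lambda>v. - h v"] by (simp add: nsq_def)

lemma nsq_act_diff_le:
  assumes "N > 0" "periodic N f" "mdet g = 1"
  shows "nsq N (\<lambda>v. f (act g v) - f v) \<le> 4 * nsq N f"
  using nsq_diff_le[of N "\<lambda>v. f (act g v)" f] nsq_act[OF assms] by simp

text \<open>The displacement under \<open>D\<close> is recovered from those under \<open>A\<close> and \<open>D A D\<^sup>-\<^sup>1 = A D\<^sup>-\<^sup>1 A\<^sup>-\<^sup>1\<close>.\<close>

lemma defect_le_shiftA:
  assumes N: "N > 0" and f: "periodic N f"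
  shows "defect N f \<le> 49 * (shiftA N f + shiftA N (half_sum f))"
proof -
  define F where "F = half_sum f"
  define d where "d = (\<lambda>v. f (act mA v) - f v)"
  \<comment> \<open>\<open>half_sum f\<close> equals \<open>f\<close> after \<open>D\<close> up to
    displacements under \<open>A\<close>; its own displacement under \<open>A\<close> therefore
    reveals that of \<open>f\<close> under the conjugate of \<open>A\<close> by
    \<open>D\<close>.\<close>
  define r where "r = (\<lambda>v. F v - f (act mD v))"
  let ?a = "shiftA N f"
  have perF: "periodic N F" unfolding F_def by (rule periodic_half_sum[OF f])
  have perd: "periodic N d" unfolding d_def by (rule periodic_diff[OF periodic_act[OF f] f])
  have perr: "periodic N r" unfolding r_def by (rule periodic_diff[OF perF periodic_act[OF f]])
  have perDA: "periodic N (\<lambda>v. f (act mD v))" by (rule periodic_act[OF f])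
  have nd: "nsq N d = ?a" by (simp add: d_def shiftA_def)
  have "r = (\<lambda>v. d (act mD v) + d (act mA (act mD v)) / 2)"
    by (simp add: fun_eq_iff r_def d_def F_def half_sum_def act_mAD field_simps)
  then have "nsq N r \<le> 2 * nsq N (\<lambda>v. d (act mD v)) + 2 * nsq N (\<lambda>v. d (act (mmul mA mD) v) / 2)"
    using nsq_add_le[of N "\<lambda>v. d (act mD v)" "\<lambda>v. d (act (mmul mA mD) v) / 2"] by (simp add: act_mmul)
  also have "nsq N (\<lambda>v. d (act mD v)) = ?a" using nsq_act[OF N perd, of mD] nd by simp
  also have "nsq N (\<lambda>v. d (act (mmul mA mD) v) / 2) = nsq N (\<lambda>v. d (act (mmul mA mD) v)) / 4"
    by (simp add: nsq_def norm_divide power_divide sum_divide_distrib)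
  also have "nsq N (\<lambda>v. d (act (mmul mA mD) v)) = ?a" using nsq_act[OF N perd, of "mmul mA mD"] nd by (simp add: mdet_mmul)
  finally have nr: "nsq N r \<le> 5 / 2 * ?a" by simp
  define e where "e = nsq N (\<lambda>v. f (act mD (act mA v)) - f (act mD v))"
  have "e = nsq N (\<lambda>v. (F (act mA v) - F v) - (r (act mA v) - r v))"
    by (simp add: e_def r_def algebra_simps)
  also have "\<dots> \<le> 2 * shiftA N F + 2 * nsq N (\<lambda>v. r (act mA v) - r v)"
    unfolding shiftA_def by (rule nsq_diff_le)
  also have "\<dots> \<le> 2 * shiftA N F + 2 * (4 * (5 / 2 * ?a))"
    using nsq_act_diff_le[OF N perr, of mA] nr by simp
  finally have e: "e \<le> 2 * shiftA N F + 20 * ?a" by simp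
  \<comment> \<open>After two substitutions only \<open>f (A D^-1 v) - f (A v)\<close> remains, and
    dropping the outer \<open>A\<close> costs a displacement of \<open>d\<close>, which is small
    since \<open>d\<close> itself is.\<close>
  have "act mD (act mA v) = act mA (act (madj mD) (act (madj mA) (act mD v)))" for v
    by (cases v) (simp add: mA_def mD_def)
  then have "e = nsq N (\<lambda>v. f (act mA (act (madj mD) (act (madj mA) (act mD v)))) - f (act mD v))"
    by (simp add: e_def)
  also have "\<dots> = nsq N (\<lambda>v. f (act mA (act (madj mD) (act (madj mA) v))) - f v)"
    by (rule nsq_act[OF N periodic_diff[OF periodic_act[OF periodic_act[OF periodic_act[OF f]]] f]]) simp
  also have "\<dots> = nsq N (\<lambda>v. f (act mA (act (madj mD) (act (madj mA) (act mA v)))) - f (act mA v))"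
    by (rule nsq_act[OF N periodic_diff[OF periodic_act[OF periodic_act[OF periodic_act[OF f]]] f], symmetric]) simp
  also have "\<dots> = nsq N (\<lambda>v. f (act mA (act (madj mD) v)) - f (act mA v))" by simp
  finally have e': "e = nsq N (\<lambda>v. f (act mA (act (madj mD) v)) - f (act mA v))" .
  have "nsq N (\<lambda>v. f (act mD v) - f v) = nsq N (\<lambda>v. f (act mD (act (madj mD) v)) - f (act (madj mD) v))"
    by (rule nsq_act[OF N periodic_diff[OF periodic_act[OF f] f], symmetric]) simp
  also have "\<dots> = nsq N (\<lambda>v. f (act (madj mD) v) - f v)" by (simp add: nsq_diff_commute)
  also have "\<dots> = nsq N (\<lambda>v. (f (act mA (act (madj mD) v)) - f (act mA v)) - (d (act (madj mD) v) - d v))"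
    by (simp add: d_def algebra_simps)
  also have "\<dots> \<le> 2 * e + 2 * nsq N (\<lambda>v. d (act (madj mD) v) - d v)"
    unfolding e' by (rule nsq_diff_le)
  also have "\<dots> \<le> 2 * (2 * shiftA N F + 20 * ?a) + 2 * (4 * ?a)"
    using e nsq_act_diff_le[OF N perd, of "madj mD"] nd by simp
  finally have "nsq N (\<lambda>v. f (act mD v) - f v) \<le> 4 * shiftA N F + 48 * ?a" by simp
  moreover have "shiftA N F \<ge> 0" by (simp add: shiftA_def nsq_nonneg)
  ultimately show ?thesis by (simp add: defect_def shiftA_def F_def)
qed

text \<open>One step is not enough, since an \<open>f\<close> invariant under \<open>A\<close> loses
  no norm in it; two steps see the displacements under \<open>A\<close> of both \<open>f\<close> and
  \<open>half_sum f\<close>. The constant 196 is \<open>4 * 49\<close>.\<close>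

lemma half_sum_contracts:
  "\<exists>\<rho>. 0 < \<rho> \<and> \<rho> < 1 \<and> (\<forall>N>0. \<forall>f. cuspidal N f \<longrightarrow> nsq N (half_sum (half_sum f)) \<le> (1 - \<rho>) * nsq N f)"
proof -
  obtain \<kappa> where \<kappa>: "\<kappa> > 0" and gap: "\<And>N f. N > 0 \<Longrightarrow> cuspidal N f \<Longrightarrow> gap \<kappa> N f"
    using uniform_gap by blast
  define \<rho> where "\<rho> = min (\<kappa> / 196) (1 / 2)"
  have \<rho>: "0 < \<rho>" "\<rho> < 1" "\<rho> \<le> \<kappa> / 196" using \<kappa> by (auto simp: \<rho>_def)
  have "nsq N (half_sum (half_sum f)) \<le> (1 - \<rho>) * nsq N f" if N: "N > 0" and f: "cuspidal N f" for N f
  proof -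
    have per: "periodic N f" using f by (simp add: cuspidal_def)
    have "nsq N (half_sum (half_sum f)) = nsq N f - (shiftA N f + shiftA N (half_sum f)) / 4"
      using nsq_half_sum[OF N per] nsq_half_sum[OF N periodic_half_sum[OF per]]
      by (simp add: add_divide_distrib)
    also have "\<dots> \<le> nsq N f - defect N f / 196" using defect_le_shiftA[OF N per] by simp
    also have "\<dots> \<le> nsq N f - \<kappa> / 196 * nsq N f" using gap[OF N f] by (simp add: gap_def)
    also have "\<dots> \<le> nsq N f - \<rho> * nsq N f" using mult_right_mono[OF \<rho>(3) nsq_nonneg] by (intro diff_left_mono)
    finally show ?thesis by (simp add: algebra_simps)
  qed
  then show ?thesis using \<rho> by blast
qed

fun wordm :: "nat list \<Rightarrow> imat" where
  "wordm [] = mone"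
| "wordm (i # is) = mmul (mAD i) (wordm is)"

lemma half_sum_funpow_nonzero:
  "(half_sum ^^ n) f v \<noteq> 0 \<Longrightarrow> \<exists>is. length is = n \<and> set is \<subseteq> {1, 2} \<and> f (act (wordm is) v) \<noteq> 0"
proof (induction n arbitrary: f)
  case 0
  then show ?case by (intro exI[of _ "[]"]) simp
next
  case (Suc n)
  have "(half_sum ^^ n) (half_sum f) v \<noteq> 0" using Suc.prems by (simp add: funpow_swap1)
  then obtain "is" where w: "length is = n" "set is \<subseteq> {1, 2}" "half_sum f (act (wordm is) v) \<noteq> 0"
    using Suc.IH by blast
  then have "f (act (mAD 1) (act (wordm is) v)) \<noteq> 0 \<or> f (act (mAD 2) (act (wordm is) v)) \<noteq> 0"
    by (auto simp: half_sum_def)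
  then obtain i where "i \<in> {1, 2}" "f (act (mAD i) (act (wordm is) v)) \<noteq> 0" by blast
  then show ?case using w by (intro exI[of _ "i # is"]) (simp add: act_mmul)
qed

text \<open>Lets the uniform distribution be split off, since the walk fixes it.\<close>

lemma half_sum_funpow_add_invariant:
  assumes "\<And>i v. h (act (mAD i) v) = h v"
  shows "(half_sum ^^ n) (\<lambda>v. f v + h v) v = (half_sum ^^ n) f v + h v"
proof (induction n arbitrary: v)
  case (Suc n)
  have *: "(half_sum ^^ Suc n) g v = ((half_sum ^^ n) g (act (mAD 1) v) + (half_sum ^^ n) g (act (mAD 2) v)) / 2" for g
    by (simp add: half_sum_def[of "(half_sum ^^ n) g"])
  show ?case unfolding * Suc.IH assms by (simp add: field_simps)
qed simp

lemma nsq_half_sum_funpow_le: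
  assumes \<rho>: "0 < \<rho>" "\<rho> < 1"
    and c: "\<And>f. cuspidal N f \<Longrightarrow> nsq N (half_sum (half_sum f)) \<le> (1 - \<rho>) * nsq N f"
    and N: "N > 0" and f: "cuspidal N f"
  shows "nsq N ((half_sum ^^ (2 * m)) f) \<le> (1 - \<rho>) ^ m * nsq N f"
proof -
  have "cuspidal N ((half_sum ^^ n) f)" for n
    by (induction n) (simp_all add: f cuspidal_half_sum[OF N])
  note cusp = this
  show ?thesis
  proof (induction m)
    case (Suc m)
    have "nsq N ((half_sum ^^ (2 * Suc m)) f) \<le> (1 - \<rho>) * nsq N ((half_sum ^^ (2 * m)) f)"
      using c[OF cusp] by simp
    also have "\<dots> \<le> (1 - \<rho>) * ((1 - \<rho>) ^ m * nsq N f)" using Suc \<rho> by (intro mult_left_mono) auto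
    finally show ?case by (simp add: mult.assoc)
  qed simp
qed

text \<open>The indicator of the class of \<open>u\<close> is the uniform distribution
  \<open>one\<close> on primitive vectors plus a function \<open>f\<close> of mean zero. After
  \<open>2 * m\<close> steps the second part has modulus below \<open>1 / ?p\<close> at
  \<open>(1, 0)\<close>, while the first is still \<open>1 / ?p\<close>. The iterated indicator is
  thus nonzero there, which yields a word.\<close>

lemma exists_word:
  "\<exists>C. \<forall>N :: nat. N \<ge> 2 \<longrightarrow> (\<forall>u. prim (int N) u \<longrightarrow> (\<exists>is. 1 \<le> length is \<and> real (length is) \<le> C * log 2 N \<and>
      set is \<subseteq> {1, 2} \<and> vmod (int N) (act (wordm is) (1, 0)) = vmod (int N) u))"
proof -
  obtain \<rho> where \<rho>: "0 < \<rho>" "\<rho> < 1" and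
    c: "\<And>N f. N > 0 \<Longrightarrow> cuspidal N f \<Longrightarrow> nsq N (half_sum (half_sum f)) \<le> (1 - \<rho>) * nsq N f"
    using half_sum_contracts by blast
  have "\<exists>is. 1 \<le> length is \<and> real (length is) \<le> (12 / \<rho> + 4) * log 2 N \<and>
      set is \<subseteq> {1, 2} \<and> vmod (int N) (act (wordm is) (1, 0)) = vmod (int N) u"
    if N: "N \<ge> 2" and u: "prim (int N) u" for N :: nat and u
  proof -
    have N0: "int N > 0" using N by simp
    \<comment> \<open>This gives \<open>(1 - \<rho>)^m < 1 / N^6\<close>, and
      \<open>4 / N^6 \<le> 1 / ?p^2\<close> because \<open>?p \<le> N^2\<close> and
      \<open>N \<ge> 2\<close>. The successor makes the inequality strict and the word
      nonempty.\<close>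
    define m where "m = Suc (nat \<lceil>6 * ln N / \<rho>\<rceil>)"
    have lnN: "ln (real N) > 0" using N by simp
    have m: "6 * ln N / \<rho> < real m" "real m \<le> 6 * ln N / \<rho> + 2"
    proof -
      have "6 * ln N / \<rho> \<ge> 0" using lnN \<rho> by simp
      then show "6 * ln N / \<rho> < real m" "real m \<le> 6 * ln N / \<rho> + 2"
        unfolding m_def by linarith+
    qed
    let ?P = "{v\<in>zbox (int N). prim (int N) v}"
    let ?p = "real (card ?P)"
    define ind where "ind = (\<lambda>v. if vmod (int N) v = vmod (int N) u then 1 else 0 :: complex)"
    define one where "one = (\<lambda>v. if prim (int N) v then 1 / of_real ?p else 0 :: complex)"
    define f where "f = (\<lambda>v. ind v - one v)"
    have primu: "prim (int N) (vmod (int N) u)"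
      using u prim_cong[of "int N" "vmod (int N) u" u] by simp
    then have "vmod (int N) u \<in> ?P" using N0 by (auto intro: vmod_in_zbox)
    then have "?P \<noteq> {}" by blast
    then have p1: "?p \<ge> 1" using card_gt_0_iff[of ?P] by (simp add: Suc_leI flip: One_nat_def)
    have "card ?P \<le> card (zbox (int N))" by (intro card_mono) auto
    then have "card ?P \<le> N\<^sup>2" by (simp add: card_zbox)
    then have "real (card ?P) \<le> real (N\<^sup>2)" by (rule of_nat_mono)
    then have pN: "?p \<le> (real N)\<^sup>2" by simp
    have sum_ind: "(\<Sum>v\<in>zbox (int N). g (ind v)) = (\<Sum>v\<in>zbox (int N). if v = vmod (int N) u then g 1 else g 0)"
      for g :: "complex \<Rightarrow> 'b :: comm_monoid_add"
      by (intro sum.cong refl) (auto simp: ind_def)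
    have sum_one: "(\<Sum>v\<in>zbox (int N). g (one v)) = (\<Sum>v\<in>?P. g (1 / of_real ?p))"
      if "g 0 = 0" for g :: "complex \<Rightarrow> 'b :: comm_monoid_add"
    proof -
      have "(\<Sum>v\<in>zbox (int N). g (one v)) = (\<Sum>v\<in>zbox (int N). if prim (int N) v then g (1 / of_real ?p) else 0)"
        by (intro sum.cong refl) (simp add: one_def that)
      also have "\<dots> = (\<Sum>v\<in>?P. g (1 / of_real ?p))" by (rule sum.inter_filter[symmetric]) simp
      finally show ?thesis .
    qed
    have f: "cuspidal (int N) f"
      unfolding cuspidal_def
    proof (intro conjI)
      show "periodic (int N) f"
      proof (rule periodicI)
        fix x y assume xy: "vmod (int N) x = vmod (int N) y"
        show "f x = f y" unfolding f_def ind_def one_def xy prim_cong[OF xy] ..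
      qed
      show "\<forall>v. f v \<noteq> 0 \<longrightarrow> prim (int N) v"
      proof (intro allI impI, rule ccontr)
        fix v assume v: "f v \<noteq> 0" "\<not> prim (int N) v"
        then have "vmod (int N) v \<noteq> vmod (int N) u" using prim_cong u by blast
        then show False using v by (simp add: f_def ind_def one_def)
      qed
      have "(\<Sum>v\<in>zbox (int N). ind v) = 1"
        using sum_ind[of "\<lambda>z. z"] N0 by (simp add: sum.delta vmod_in_zbox)
      moreover have "(\<Sum>v\<in>zbox (int N). one v) = 1"
      proof -
        have c: "of_nat c * (1 / complex_of_real (real c)) = 1" if "real c \<ge> 1" for c
          using that by simp
        have "(\<Sum>v\<in>zbox (int N). one v) = (\<Sum>v\<in>?P. 1 / of_real ?p)" by (rule sum_one) (rule refl)
        also have "\<dots> = of_nat (card ?P) * (1 / of_real ?p)" by (rule sum_constant)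
        also have "\<dots> = 1" by (rule c[OF p1])
        finally show ?thesis .
      qed
      ultimately show "(\<Sum>v\<in>zbox (int N). f v) = 0" by (simp add: f_def sum_subtractf)
    qed
    have "nsq (int N) ind = (\<Sum>v\<in>zbox (int N). if v = vmod (int N) u then (cmod 1)\<^sup>2 else (cmod 0)\<^sup>2)"
      unfolding nsq_def by (rule sum_ind)
    also have "\<dots> = (\<Sum>v\<in>zbox (int N). if v = vmod (int N) u then 1 else 0)"
      by (intro sum.cong refl) simp
    also have "\<dots> = 1" using N0 by (simp add: vmod_in_zbox)
    finally have "nsq (int N) ind = 1" .
    moreover have "nsq (int N) one \<le> 1"
    proof -
      have c: "real c * (cmod (1 / complex_of_real (real c)))\<^sup>2 \<le> 1" if "real c \<ge> 1" for c
        using that by (simp add: norm_divide power2_eq_square)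
      have "nsq (int N) one = (\<Sum>v\<in>?P. (cmod (1 / of_real ?p))\<^sup>2)"
        unfolding nsq_def by (rule sum_one) simp
      also have "\<dots> = ?p * (cmod (1 / of_real ?p))\<^sup>2" by (rule sum_constant)
      also have "\<dots> \<le> 1" by (rule c[OF p1])
      finally show ?thesis .
    qed
    ultimately have nf: "nsq (int N) f \<le> 4"
      using nsq_diff_le[of "int N" ind one] by (simp add: f_def)
    define F where "F = (half_sum ^^ (2 * m)) f"
    have "nsq (int N) F \<le> (1 - \<rho>) ^ m * nsq (int N) f"
      unfolding F_def by (rule nsq_half_sum_funpow_le[OF \<rho> c[OF N0] N0 f])
    also have "\<dots> \<le> (1 - \<rho>) ^ m * 4" using nf \<rho> by (intro mult_left_mono) auto
    also have "\<dots> \<le> exp (- \<rho>) ^ m * 4"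
      using \<rho> exp_ge_add_one_self[of "- \<rho>"] by (intro mult_right_mono power_mono) auto
    also have "exp (- \<rho>) ^ m = exp (real m * - \<rho>)" by (rule exp_of_nat_mult[symmetric])
    also have "exp (real m * - \<rho>) * 4 < exp (- (6 * ln N)) * 4"
      using m(1) \<rho> by (simp add: divide_less_eq mult.commute)
    also have "exp (- (6 * ln N)) = 1 / real N ^ 6"
    proof -
      have "exp (6 * ln (real N)) = real N ^ 6"
        using N exp_of_nat_mult[of 6 "ln (real N)"] by simp
      then show ?thesis by (simp add: exp_minus inverse_eq_divide)
    qed
    also have "1 / real N ^ 6 * 4 \<le> 1 / ?p\<^sup>2"
    proof -
      have "4 * ?p\<^sup>2 \<le> (real N)\<^sup>2 * ((real N)\<^sup>2)\<^sup>2"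
        using N pN p1 power_mono[of 2 "real N" 2] by (intro mult_mono power_mono) auto
      also have "\<dots> = real N ^ 6" by (simp flip: power_mult power_add)
      finally have "4 * ?p\<^sup>2 \<le> real N ^ 6" .
      moreover have "1 / y * 4 \<le> 1 / x" if "4 * x \<le> y" "x > 0" for x y :: real
        using that by (simp add: field_simps)
      moreover have "?p\<^sup>2 > 0" using p1 by (intro zero_less_power) linarith
      ultimately show ?thesis by blast
    qed
    finally have nF: "nsq (int N) F < (1 / ?p)\<^sup>2" by (simp add: power_divide)
    have "(cmod (F (vmod (int N) (1, 0))))\<^sup>2 \<le> nsq (int N) F"
      unfolding nsq_def using N0 by (intro member_le_sum) (auto intro: vmod_in_zbox)
    moreover have perF: "periodic (int N) F"
    proof -
      have "periodic (int N) ((half_sum ^^ n) f)" for n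
        by (induction n) (use f in \<open>simp_all add: cuspidal_def periodic_half_sum\<close>)
      then show ?thesis by (simp add: F_def)
    qed
    have "F (vmod (int N) (1, 0)) = F (1, 0)" by (rule periodicD[OF perF]) simp
    ultimately have "(cmod (F (1, 0)))\<^sup>2 < (1 / ?p)\<^sup>2" using nF by simp
    then have Fsmall: "cmod (F (1, 0)) < 1 / ?p" using p1 by (simp add: power2_less_imp_less)
    have "(half_sum ^^ (2 * m)) ind (1, 0) = F (1, 0) + one (1, 0)"
    proof -
      have "ind = (\<lambda>v. f v + one v)" by (simp add: f_def fun_eq_iff)
      moreover have "one (act (mAD i) v) = one v" for i v by (simp add: one_def prim_act)
      ultimately show ?thesis
        unfolding F_def using half_sum_funpow_add_invariant[of one "2 * m" f "(1, 0)"] by simp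
    qed
    moreover have "one (1, 0) = 1 / of_real ?p" by (simp add: one_def prim_def)
    moreover have "F (1, 0) + 1 / of_real ?p \<noteq> 0"
    proof
      assume "F (1, 0) + 1 / of_real ?p = 0"
      then have "F (1, 0) = - (1 / of_real ?p)" by (simp only: add_eq_0_iff2)
      then have "cmod (F (1, 0)) = 1 / ?p" by (simp add: norm_divide)
      then show False using Fsmall by simp
    qed
    ultimately have "(half_sum ^^ (2 * m)) ind (1, 0) \<noteq> 0" by simp
    then obtain "is" where w: "length is = 2 * m" "set is \<subseteq> {1, 2}" "ind (act (wordm is) (1, 0)) \<noteq> 0"
      using half_sum_funpow_nonzero by blast
    then have "vmod (int N) (act (wordm is) (1, 0)) = vmod (int N) u"
      by (auto simp: ind_def split: if_splits)
    moreover have "real (2 * m) \<le> (12 / \<rho> + 4) * log 2 N"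
    proof -
      have "ln (2 :: real) \<le> 1" using ln_le_minus_one[of 2] by simp
      then have "ln 2 * ln (real N) \<le> 1 * ln (real N)" using lnN by (intro mult_right_mono) auto
      then have 1: "ln (real N) \<le> log 2 N" using lnN by (simp add: log_def field_simps)
      have "log 2 2 \<le> log 2 (real N)" using N by (subst log_le_cancel_iff) auto
      then have 2: "1 \<le> log 2 (real N)" by simp
      have "real (2 * m) \<le> 12 / \<rho> * ln N + 4" using m(2) by simp
      also have "\<dots> \<le> 12 / \<rho> * log 2 N + 4 * log 2 N"
        using 1 2 \<rho> by (intro add_mono mult_left_mono) auto
      finally show ?thesis by (simp add: algebra_simps)
    qed
    ultimately show ?thesis using w by (intro exI[of _ "is"]) (simp add: m_def)
  qed
  then show ?thesis by blast
qed

lemma A_mat_vector: "A_mat *v vector [x, y] = vector [x + y, y]"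
  and D_mat_vector: "D_mat *v vector [x, y] = vector [x, x + y]"
  by (simp_all add: vec_eq_iff forall_2 matrix_vector_mult_def sum_2 A_mat_def D_mat_def)

lemma AD_word_vector:
  assumes "set is \<subseteq> {1, 2}"
  shows "AD_word is *v vector [x, y] = vector [fst (act (wordm is) (x, y)), snd (act (wordm is) (x, y))]"
  using assms
proof (induction "is")
  case Nil
  then show ?case by (simp add: AD_word_def)
next
  case (Cons i "is")
  obtain p q where pq: "act (wordm is) (x, y) = (p, q)" by (cases "act (wordm is) (x, y)")
  have "AD_word (i # is) *v vector [x, y] = mat_pow A_mat i *v (D_mat *v vector [p, q])"
    using Cons pq by (simp add: AD_word_def matrix_vector_mul_assoc[symmetric])
  also have "\<dots> = vector [fst (act (mAD i) (p, q)), snd (act (mAD i) (p, q))]"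
    using Cons.prems
    by (auto simp: D_mat_vector A_mat_vector mAD_def numeral_2_eq_2 matrix_vector_mul_assoc[symmetric] algebra_simps)
  finally show ?case by (simp add: act_mmul pq)
qed

section \<open>Spanning trees, deletion and contraction\<close>

text \<open>Connectedness through cuts: a two-colouring that is constant on each edge is constant.
  Contracting, subdividing or attaching edges then only requires transporting colourings, with no
  paths to rebuild.\<close>

definition conn :: "'v set \<Rightarrow> 'e set \<Rightarrow> ('e \<Rightarrow> 'v set) \<Rightarrow> bool" where
  "conn V E en \<longleftrightarrow> V \<noteq> {} \<and>
     (\<forall>c :: 'v \<Rightarrow> bool. (\<forall>e\<in>E. \<forall>x\<in>en e. \<forall>y\<in>en e. c x = c y) \<longrightarrow> (\<forall>u\<in>V. \<forall>v\<in>V. c u = c v))"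

lemma connD:
  assumes "conn V E en" "\<And>e x y. e \<in> E \<Longrightarrow> x \<in> en e \<Longrightarrow> y \<in> en e \<Longrightarrow> c x = (c y :: bool)" "u \<in> V" "v \<in> V"
  shows "c u = c v"
proof -
  have "\<forall>e\<in>E. \<forall>x\<in>en e. \<forall>y\<in>en e. c x = c y"
    by (intro ballI) (rule assms(2))
  then have "\<forall>u\<in>V. \<forall>v\<in>V. c u = c v"
    by (rule assms(1)[unfolded conn_def, THEN conjunct2, THEN spec[of _ c], THEN mp])
  then show ?thesis by (rule bspec[OF bspec[OF _ assms(3)] assms(4)])
qed

lemma connI:
  assumes "V \<noteq> {}"
    and "\<And>c :: 'v \<Rightarrow> bool. (\<And>e x y. e \<in> E \<Longrightarrow> x \<in> en e \<Longrightarrow> y \<in> en e \<Longrightarrow> c x = c y) \<Longrightarrow> (\<And>u v. u \<in> V \<Longrightarrow> v \<in> V \<Longrightarrow> c u = c v)"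
  shows "conn V E en"
proof -
  have "c u = c v" if "\<forall>e\<in>E. \<forall>x\<in>en e. \<forall>y\<in>en e. c x = c y" "u \<in> V" "v \<in> V" for c :: "'v \<Rightarrow> bool" and u v
    by (rule assms(2)[OF _ that(2,3)]) (rule that(1)[rule_format])
  then show ?thesis using assms(1) unfolding conn_def by (intro conjI allI impI ballI)
qed

text \<open>From cuts to paths, the colouring by reachability from \<open>u\<close> does it.\<close>

lemma connected_graph_conn:
  assumes "wf_multigraph G"
  shows "connected_graph G \<longleftrightarrow> conn (verts G) (edges G) (ends G)"
proof
  let ?R = "{(x, y). \<exists>e\<in>edges G. ends G e = {x, y}}"
  assume G: "connected_graph G"
  show "conn (verts G) (edges G) (ends G)"
  proof (rule connI)
    fix c :: "'a \<Rightarrow> bool" and u v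
    assume c: "\<And>e x y. e \<in> edges G \<Longrightarrow> x \<in> ends G e \<Longrightarrow> y \<in> ends G e \<Longrightarrow> c x = c y"
      and uv: "u \<in> verts G" "v \<in> verts G"
    have "(u, v) \<in> ?R\<^sup>*" using G uv by (simp add: connected_graph_def)
    then show "c u = c v"
    proof (induction rule: rtrancl_induct)
      case (step y z)
      then obtain e where "e \<in> edges G" "ends G e = {y, z}" by blast
      then show ?case using c[of e y z] step.IH by simp
    qed simp
  qed (use G in \<open>simp add: connected_graph_def\<close>)
next
  let ?R = "{(x, y). \<exists>e\<in>edges G. ends G e = {x, y}}"
  assume G: "conn (verts G) (edges G) (ends G)"
  have "(u, v) \<in> ?R\<^sup>*" if uv: "u \<in> verts G" "v \<in> verts G" for u v
  proof -
    have "((u, u) \<in> ?R\<^sup>*) = ((u, v) \<in> ?R\<^sup>*)"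
    proof (rule connD[OF G _ uv, where c = "\<lambda>x. (u, x) \<in> ?R\<^sup>*"])
      fix e x y assume e: "e \<in> edges G" "x \<in> ends G e" "y \<in> ends G e"
      show "((u, x) \<in> ?R\<^sup>*) = ((u, y) \<in> ?R\<^sup>*)"
      proof (cases "x = y")
        case False
        have "card (ends G e) \<in> {1, 2}" using assms e(1) by (simp add: wf_multigraph_def)
        then have "card (ends G e) \<le> 2" "finite (ends G e)" using card_ge_0_finite by force+
        then have "ends G e = {x, y}"
          using e False card_seteq[of "ends G e" "{x, y}"] by simp
        then have "(x, y) \<in> ?R" "(y, x) \<in> ?R" using e(1) by (auto simp: insert_commute)
        then show ?thesis by (meson rtrancl.rtrancl_into_rtrancl)
      qed simp
    qed
    then show ?thesis by simp
  qed
  then show "connected_graph G" using G by (simp add: connected_graph_def conn_def)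
qed

text \<open>A subtree is grown vertex by vertex: as long as \<open>W \<noteq> V\<close>, the
  colouring by membership in \<open>W\<close> is not constant, so some edge leaves
  \<open>W\<close>.\<close>

lemma exists_spanning_tree:
  assumes fin: "finite V" and conn: "conn V E en"
    and ends: "\<And>e. e \<in> E \<Longrightarrow> en e \<subseteq> V" "\<And>e. e \<in> E \<Longrightarrow> finite (en e) \<and> card (en e) \<le> 2"
  shows "\<exists>T\<subseteq>E. finite T \<and> conn V T en \<and> card T + 1 = card V"
proof -
  have subtree: "\<exists>W T. W \<subseteq> V \<and> T \<subseteq> E \<and> finite T \<and> card W = k \<and> card T + 1 = k \<and> (\<forall>t\<in>T. en t \<subseteq> W) \<and> conn W T en"
    if "1 \<le> k" "k \<le> card V" for k
    using that
  proof (induction k rule: dec_induct)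
    case base
    obtain x where "x \<in> V" using conn by (auto simp: conn_def)
    then show ?case by (intro exI[of _ "{x}"] exI[of _ "{}"]) (auto simp: conn_def)
  next
    case (step k)
    then obtain W T where W: "W \<subseteq> V" "T \<subseteq> E" "finite T" "card W = k" "card T + 1 = k"
      "\<forall>t\<in>T. en t \<subseteq> W" "conn W T en" by auto
    have "W \<noteq> V" using W(4) step by auto
    then obtain z where z: "z \<in> V" "z \<notin> W" using W(1) by blast
    obtain w where w: "w \<in> W" using W(7) by (auto simp: conn_def)
    have "\<exists>e\<in>E. \<exists>x\<in>en e. \<exists>y\<in>en e. (x \<in> W) \<noteq> (y \<in> W)"
    proof (rule ccontr)
      assume "\<not> ?thesis"
      then have inv: "(x \<in> W) = (y \<in> W)" if "e \<in> E" "x \<in> en e" "y \<in> en e" for e x y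
        using that by blast
      have "(w \<in> W) = (z \<in> W)"
        by (rule connD[OF conn inv]) (use w z W(1) in auto)
      then show False using w z by simp
    qed
    then obtain e x y where e: "e \<in> E" "x \<in> en e" "y \<in> en e" "x \<in> W" "y \<notin> W" by blast
    have "x \<noteq> y" using e(4,5) by blast
    then have "{x, y} = en e" using e ends(2)[OF e(1)] by (intro card_seteq) auto
    then have en_e: "en e = {x, y}" by simp
    have yV: "y \<in> V" using ends(1)[OF e(1)] e(3) by blast
    have eT: "e \<notin> T" using W(6) e(3,5) by blast
    have finW: "finite W" using W(1) fin finite_subset by blast
    have "conn (insert y W) (insert e T) en"
    proof (rule connI)
      fix c :: "'a \<Rightarrow> bool" and u v
      assume c: "\<And>f a b. f \<in> insert e T \<Longrightarrow> a \<in> en f \<Longrightarrow> b \<in> en f \<Longrightarrow> c a = c b"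
        and uv: "u \<in> insert y W" "v \<in> insert y W"
      have "c a = c x" if "a \<in> insert y W" for a
      proof (cases "a = y")
        case True
        then show ?thesis using c[of e y x] en_e by simp
      next
        case False
        then show ?thesis using that connD[OF W(7), of c a x] c e(4) by blast
      qed
      then show "c u = c v" using uv by simp
    qed simp
    moreover have "card (insert y W) = Suc k" "card (insert e T) + 1 = Suc k"
      using W finW e(5) eT by simp_all
    ultimately show ?case
      using W yV e(1,4) en_e by (intro exI[of _ "insert y W"] exI[of _ "insert e T"]) auto
  qed
  have "1 \<le> card V" using conn fin by (simp add: conn_def Suc_le_eq card_gt_0_iff)
  then obtain W T where W: "W \<subseteq> V" "T \<subseteq> E" "finite T" "card W = card V" "card T + 1 = card V" "conn W T en"
    using subtree[OF _ order_refl] by blast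
  then have "W = V" using fin card_subset_eq by blast
  then show ?thesis using W by blast
qed

lemma conn_card_le:
  assumes "finite V" "finite E" "conn V E en"
    "\<And>e. e \<in> E \<Longrightarrow> en e \<subseteq> V" "\<And>e. e \<in> E \<Longrightarrow> finite (en e) \<and> card (en e) \<le> 2"
  shows "card V \<le> card E + 1"
proof -
  obtain T where T: "T \<subseteq> E" "card T + 1 = card V"
    using exists_spanning_tree[OF assms(1,3-5)] by blast
  then show ?thesis using card_mono[OF assms(2) T(1)] by linarith
qed

text \<open>Prepending a step may revisit \<open>x\<close>; the path is then cut back to the
  existing visit by dropping its first \<open>k\<close> edges.\<close>

lemma rtrancl_simple_path:
  assumes "(x, y) \<in> {(a, b). \<exists>e\<in>T. en e = {a, b}}\<^sup>*"
  shows "\<exists>vs es. distinct vs \<and> length vs = Suc (length es) \<and> hd vs = x \<and> last vs = y \<and> set es \<subseteq> T \<and>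
     (\<forall>i<length es. en (es ! i) = {vs ! i, vs ! Suc i})"
  using assms
proof (induction rule: converse_rtrancl_induct)
  case base
  show ?case by (intro exI[of _ "[y]"] exI[of _ "[]"]) simp
next
  case (step x z)
  obtain e where e: "e \<in> T" "en e = {x, z}" using step.hyps(1) by blast
  obtain vs es where p: "distinct vs" "length vs = Suc (length es)" "hd vs = z" "last vs = y" "set es \<subseteq> T"
    "\<forall>i<length es. en (es ! i) = {vs ! i, vs ! Suc i}" using step.IH by blast
  show ?case
  proof (cases "x \<in> set vs")
    case True
    then obtain k where k: "k < length vs" "vs ! k = x" by (auto simp: in_set_conv_nth)
    have "set (drop k es) \<subseteq> T" using p(5) set_drop_subset by fast
    moreover have "en (drop k es ! i) = {drop k vs ! i, drop k vs ! Suc i}" if "i < length (drop k es)" for i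
    proof -
      have "k + i < length es" using that by simp
      then show ?thesis using p(2,6) k(1) by simp
    qed
    moreover have "hd (drop k vs) = x" "last (drop k vs) = y"
      using k p(4) by (simp_all add: hd_drop_conv_nth)
    moreover have "distinct (drop k vs)" "length (drop k vs) = Suc (length (drop k es))"
      using k(1) p(1,2) by auto
    ultimately show ?thesis by blast
  next
    case False
    have "vs \<noteq> []" using p(2) by auto
    have "en ((e # es) ! i) = {(x # vs) ! i, (x # vs) ! Suc i}" if "i < length (e # es)" for i
    proof (cases i)
      case 0
      then show ?thesis using e p(3) \<open>vs \<noteq> []\<close> by (simp add: hd_conv_nth)
    next
      case (Suc j)
      then show ?thesis using p(6) that by simp
    qed
    then show ?thesis using p e False \<open>vs \<noteq> []\<close>
      by (intro exI[of _ "x # vs"] exI[of _ "e # es"]) auto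
  qed
qed

text \<open>Trades cycles for an edge count. An edge on a cycle can be deleted without
  disconnecting, so a connected graph with a cycle has too many edges; conversely an edge outside a
  spanning tree closes the tree path between its ends to a cycle, possibly a loop.\<close>

lemma tree_graph_iff:
  assumes wf: "wf_multigraph G"
  shows "tree_graph G \<longleftrightarrow> conn (verts G) (edges G) (ends G) \<and> card (edges G) + 1 = card (verts G)"
proof -
  let ?V = "verts G" and ?E = "edges G" and ?en = "ends G"
  have fin: "finite ?V" "finite ?E" using wf by (simp_all add: wf_multigraph_def)
  have ends: "?en e \<subseteq> ?V" "finite (?en e) \<and> card (?en e) \<le> 2" if "e \<in> ?E" for e
  proof -
    show "?en e \<subseteq> ?V" using wf that by (simp add: wf_multigraph_def)
    have "card (?en e) \<in> {1, 2}" using wf that by (simp add: wf_multigraph_def)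
    then show "finite (?en e) \<and> card (?en e) \<le> 2" by (auto intro: card_ge_0_finite)
  qed
  have cyc: "card ?V \<le> card ?E" if conn: "conn ?V ?E ?en" and cycle: "has_cycle G"
  proof -
    obtain vs es where p: "es \<noteq> []" "length vs = length es" "distinct vs" "distinct es" "set vs \<subseteq> ?V" "set es \<subseteq> ?E"
      "\<forall>i<length es. ?en (es ! i) = {vs ! i, vs ! (Suc i mod length es)}"
      using cycle unfolding has_cycle_def by blast
    define n where "n = length es - 1"
    have n: "length es = Suc n" using p(1) by (cases es) (simp_all add: n_def)
    define e where "e = es ! n"
    have eE: "e \<in> ?E" using p(6) n by (auto simp: e_def)
    have en_e: "?en e = {vs ! n, vs ! 0}" using p(7) n by (simp add: e_def)
    have "conn ?V (?E - {e}) ?en"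
    proof (rule connI)
      show "?V \<noteq> {}" using conn by (simp add: conn_def)
      fix c :: "'a \<Rightarrow> bool" and u v
      assume c: "\<And>f a b. f \<in> ?E - {e} \<Longrightarrow> a \<in> ?en f \<Longrightarrow> b \<in> ?en f \<Longrightarrow> c a = c b" and uv: "u \<in> ?V" "v \<in> ?V"
      have walk: "c (vs ! i) = c (vs ! 0)" if "i \<le> n" for i
        using that
      proof (induction i)
        case (Suc i)
        have "es ! i \<noteq> e" using Suc.prems n p(4) by (simp add: e_def nth_eq_iff_index_eq)
        moreover have "es ! i \<in> ?E" using p(6) Suc.prems n by auto
        moreover have "?en (es ! i) = {vs ! i, vs ! Suc i}" using p(7) Suc.prems n by simp
        ultimately have "c (vs ! i) = c (vs ! Suc i)" by (intro c[of "es ! i"]) auto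
        then show ?case using Suc by simp
      qed simp
      have ce: "c a = c b" if "a \<in> ?en e" "b \<in> ?en e" for a b
        using that walk[of n] en_e by auto
      have "c a = c b" if "f \<in> ?E" "a \<in> ?en f" "b \<in> ?en f" for f a b
      proof (cases "f = e")
        case True
        then show ?thesis using ce that(2,3) by blast
      next
        case False
        then show ?thesis by (intro c[of f]) (use that in auto)
      qed
      then show "c u = c v" using connD[OF conn, of c] uv by blast
    qed
    then have "card ?V \<le> card (?E - {e}) + 1"
      using fin ends by (intro conn_card_le) auto
    moreover have "card (?E - {e}) + 1 = card ?E"
      using eE fin(2) by (metis Suc_eq_plus1 card_Suc_Diff1)
    ultimately show ?thesis by simp
  qed
  have acyc: "card ?E + 1 = card ?V" if conn: "conn ?V ?E ?en" and nc: "\<not> has_cycle G"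
  proof -
    obtain T where T: "T \<subseteq> ?E" "finite T" "conn ?V T ?en" "card T + 1 = card ?V"
      using exists_spanning_tree[OF fin(1) conn ends] by blast
    have "T = ?E"
    proof (rule ccontr)
      assume "T \<noteq> ?E"
      then obtain e where e: "e \<in> ?E" "e \<notin> T" using T(1) by blast
      have "card (?en e) \<in> {1, 2}" using wf e(1) by (simp add: wf_multigraph_def)
      then obtain x y where xy: "?en e = {x, y}"
        by (auto simp: card_1_singleton_iff card_2_iff)
      have V: "x \<in> ?V" "y \<in> ?V" using ends(1)[OF e(1)] xy by auto
      let ?G = "G\<lparr>edges := T\<rparr>"
      have "wf_multigraph ?G" using wf T(1,2) by (auto simp: wf_multigraph_def)
      then have "connected_graph ?G" using connected_graph_conn[of ?G] T(3) by simp
      then have "(x, y) \<in> {(a, b). \<exists>e\<in>T. ?en e = {a, b}}\<^sup>*" using V by (simp add: connected_graph_def)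
      then obtain vs es where p: "distinct vs" "length vs = Suc (length es)" "hd vs = x" "last vs = y" "set es \<subseteq> T"
        "\<forall>i<length es. ?en (es ! i) = {vs ! i, vs ! Suc i}"
        using rtrancl_simple_path[of x y T ?en] by auto
      have vs0: "vs \<noteq> []" using p(2) by auto
      have inV: "set vs \<subseteq> ?V"
      proof
        fix v assume "v \<in> set vs"
        then obtain i where i: "i < length vs" "v = vs ! i" by (auto simp: in_set_conv_nth)
        show "v \<in> ?V"
        proof (cases i)
          case 0
          then show ?thesis using V(1) p(3) i vs0 by (simp add: hd_conv_nth)
        next
          case (Suc j)
          then have j: "j < length es" using i p(2) by simp
          then have "es ! j \<in> ?E" using p(5) T(1) nth_mem[of j es] by blast
          moreover have "v \<in> ?en (es ! j)" using i Suc p(6) j by simp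
          ultimately show ?thesis using ends(1) by blast
        qed
      qed
      \<comment> \<open>An edge determines its set of ends, and along distinct vertices the
        successive pairs differ.\<close>
      have "distinct es"
      proof (subst distinct_conv_nth, intro allI impI notI)
        fix i j assume ij: "i < length es" "j < length es" "i \<noteq> j" "es ! i = es ! j"
        then have eq: "{vs ! i, vs ! Suc i} = {vs ! j, vs ! Suc j}" using p(6) by metis
        have "i = j \<or> i = Suc j" "j = i \<or> j = Suc i" "Suc i = j \<or> Suc i = Suc j"
          using eq p(1,2) ij by (auto simp: doubleton_eq_iff nth_eq_iff_index_eq)
        then show False using ij by auto
      qed
      then have dist: "distinct (es @ [e])" using e(2) p(5) by auto
      have "?en ((es @ [e]) ! i) = {vs ! i, vs ! (Suc i mod length (es @ [e]))}" if "i < length (es @ [e])" for i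
      proof (cases "i < length es")
        case True
        then show ?thesis using p(6) by (simp add: nth_append)
      next
        case False
        then have i: "i = length es" using that by simp
        then show ?thesis using xy p(2,3,4) vs0 by (simp add: hd_conv_nth last_conv_nth insert_commute)
      qed
      then have "has_cycle G"
        unfolding has_cycle_def using p(1,2,5) inV dist T(1) e(1)
        by (intro exI[of _ vs] exI[of _ "es @ [e]"]) auto
      then show False using nc by simp
    qed
    then show ?thesis using T(4) by simp
  qed
  show ?thesis
    unfolding tree_graph_def connected_graph_conn[OF wf] using cyc acyc by fastforce
qed

lemma wf_subgraph: "wf_multigraph G \<Longrightarrow> T \<subseteq> edges G \<Longrightarrow> wf_multigraph (G\<lparr>edges := T\<rparr>)"
  by (auto simp: wf_multigraph_def intro: finite_subset)

lemma spanning_trees_eq: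
  assumes "wf_multigraph G"
  shows "spanning_trees G = {T. T \<subseteq> edges G \<and> conn (verts G) T (ends G) \<and> card T + 1 = card (verts G)}"
  unfolding spanning_trees_def using tree_graph_iff[OF wf_subgraph[OF assms]] by auto

lemma wf_contract_edge:
  assumes "wf_multigraph G" "e \<in> edges G"
  shows "wf_multigraph (contract_edge G e)"
proof -
  have "card (merge_ends G e ` ends G f) \<in> {1, 2}" if "f \<in> edges G" for f
  proof -
    have f: "card (ends G f) \<in> {1, 2}" using assms(1) that by (simp add: wf_multigraph_def)
    then have fin: "finite (ends G f)" "ends G f \<noteq> {}" using card_ge_0_finite by force+
    then have "card (merge_ends G e ` ends G f) > 0" by (simp add: card_gt_0_iff)
    moreover have "card (merge_ends G e ` ends G f) \<le> card (ends G f)" by (rule card_image_le[OF fin(1)])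
    ultimately show ?thesis using f by auto
  qed
  then show ?thesis using assms(1) by (auto simp: wf_multigraph_def contract_edge_def)
qed

text \<open>Two-colourings of the contraction correspond to colourings of \<open>G\<close> that
  agree at the ends of \<open>e\<close>, so \<open>T\<close> connects the contraction iff
  \<open>insert e T\<close> connects \<open>G\<close>. The counts match because one vertex is
  lost.\<close>

lemma num_spanning_trees_contract:
  assumes wf: "wf_multigraph G" and e: "e \<in> edges G" "card (ends G e) = 2"
  shows "num_spanning_trees (contract_edge G e) = card {T\<in>spanning_trees G. e \<in> T}"
proof -
  let ?V = "verts G" and ?en = "ends G" and ?m = "merge_ends G e"
  let ?V' = "?m ` ?V" and ?en' = "\<lambda>f. ?m ` ?en f"
  have finV: "finite ?V" and finE: "finite (edges G)" and enV: "\<And>f. f \<in> edges G \<Longrightarrow> ?en f \<subseteq> ?V"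
    using wf by (auto simp: wf_multigraph_def)
  obtain x y where xy: "?en e = {x, y}" "x \<noteq> y" using e(2) by (auto simp: card_2_iff)
  have V: "x \<in> ?V" "y \<in> ?V" using enV[OF e(1)] xy by auto
  have meq: "?m u = ?m v \<longleftrightarrow> u = v \<or> (u \<in> {x, y} \<and> v \<in> {x, y})" for u v
    using xy by (auto simp: merge_ends_def)
  have cardV': "card ?V' + 1 = card ?V"
  proof -
    have "?V' = ?m ` (?V - {y})"
    proof
      show "?V' \<subseteq> ?m ` (?V - {y})"
      proof
        fix A assume "A \<in> ?V'"
        then obtain v where v: "v \<in> ?V" "A = ?m v" by blast
        show "A \<in> ?m ` (?V - {y})"
        proof (cases "v = y")
          case True
          then have "A = ?m x" using v meq by simp
          then show ?thesis using V xy(2) by blast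
        qed (use v in blast)
      qed
    qed blast
    moreover have "inj_on ?m (?V - {y})" by (auto simp: inj_on_def meq)
    ultimately have "card ?V' = card (?V - {y})" by (simp add: card_image)
    then show ?thesis using V(2) finV by (metis Suc_eq_plus1 card_Suc_Diff1)
  qed
  have conn_eq: "conn ?V' T ?en' \<longleftrightarrow> conn ?V (insert e T) ?en" if "T \<subseteq> edges G" for T
  proof
    assume L: "conn ?V' T ?en'"
    show "conn ?V (insert e T) ?en"
    proof (rule connI)
      show "?V \<noteq> {}" using V by blast
      fix c :: "'a \<Rightarrow> bool" and u v
      assume c: "\<And>f a b. f \<in> insert e T \<Longrightarrow> a \<in> ?en f \<Longrightarrow> b \<in> ?en f \<Longrightarrow> c a = c b" and uv: "u \<in> ?V" "v \<in> ?V"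
      have cxy: "c x = c y" using c[of e x y] xy by simp
      \<comment> \<open>All members of a class have the same colour, so the existential picks
        it.\<close>
      define c' where "c' A = (\<exists>v\<in>A. c v)" for A
      have c': "c' (?m v) = c v" for v
        using cxy xy by (auto simp: c'_def merge_ends_def)
      have "c' (?m u) = c' (?m v)"
      proof (rule connD[OF L])
        fix f A B assume f: "f \<in> T" "A \<in> ?en' f" "B \<in> ?en' f"
        then obtain a b where "A = ?m a" "B = ?m b" "a \<in> ?en f" "b \<in> ?en f" by blast
        then show "c' A = c' B" using c[of f a b] f(1) by (simp add: c')
      qed (use uv in auto)
      then show "c u = c v" by (simp add: c')
    qed
  next
    assume R: "conn ?V (insert e T) ?en"
    show "conn ?V' T ?en'"
    proof (rule connI)
      show "?V' \<noteq> {}" using V by blast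
      fix c :: "'a set \<Rightarrow> bool" and A B
      assume c: "\<And>f a b. f \<in> T \<Longrightarrow> a \<in> ?en' f \<Longrightarrow> b \<in> ?en' f \<Longrightarrow> c a = c b" and AB: "A \<in> ?V'" "B \<in> ?V'"
      obtain u v where uv: "A = ?m u" "B = ?m v" "u \<in> ?V" "v \<in> ?V" using AB by blast
      have "c (?m u) = c (?m v)"
      proof (rule connD[OF R _ uv(3,4), where c = "\<lambda>v. c (?m v)"])
        fix f a b assume f: "f \<in> insert e T" "a \<in> ?en f" "b \<in> ?en f"
        show "c (?m a) = c (?m b)"
        proof (cases "f \<in> T")
          case True
          then show ?thesis using c[of f] f by blast
        next
          case False
          then have "?m a = ?m b" using f xy meq by auto
          then show ?thesis by simp
        qed
      qed
      then show "c A = c B" using uv by simp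
    qed
  qed
  have "spanning_trees (contract_edge G e) = {T. T \<subseteq> edges G - {e} \<and> conn ?V' T ?en' \<and> card T + 1 = card ?V'}"
    using spanning_trees_eq[OF wf_contract_edge[OF wf e(1)]] by (simp add: contract_edge_def)
  also have "\<dots> = {T. T \<subseteq> edges G - {e} \<and> insert e T \<in> spanning_trees G}"
  proof -
    have "card (insert e T) = card T + 1" if "T \<subseteq> edges G - {e}" for T
      using that finE finite_subset[of T "edges G - {e}"] by (auto simp: card_insert_if)
    then show ?thesis
      using conn_eq cardV' e(1) unfolding spanning_trees_eq[OF wf] by (intro Collect_cong) auto
  qed
  finally have st: "spanning_trees (contract_edge G e) = {T. T \<subseteq> edges G - {e} \<and> insert e T \<in> spanning_trees G}" .
  have "bij_betw (insert e) (spanning_trees (contract_edge G e)) {T\<in>spanning_trees G. e \<in> T}"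
  proof (rule bij_betw_byWitness[where f' = "\<lambda>T. T - {e}"])
    show "(\<lambda>T. T - {e}) ` {T\<in>spanning_trees G. e \<in> T} \<subseteq> spanning_trees (contract_edge G e)"
      unfolding st by (auto simp: insert_absorb spanning_trees_def)
  qed (auto simp: st)
  then show ?thesis by (simp add: num_spanning_trees_def bij_betw_same_card)
qed

lemma num_spanning_trees_delete: "num_spanning_trees (delete_edge G e) = card {T\<in>spanning_trees G. e \<notin> T}"
proof -
  have "spanning_trees (delete_edge G e) = {T\<in>spanning_trees G. e \<notin> T}"
    by (auto simp: spanning_trees_def delete_edge_def)
  then show ?thesis by (simp add: num_spanning_trees_def)
qed

lemma conn_pendant:
  assumes "x \<in> V" "z \<notin> V" "en e = {x, z}" "\<And>f. f \<in> E \<Longrightarrow> en f \<subseteq> V"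
  shows "conn (insert z V) (insert e E) en \<longleftrightarrow> conn V E en"
proof
  assume L: "conn (insert z V) (insert e E) en"
  show "conn V E en"
  proof (rule connI)
    show "V \<noteq> {}" using assms(1) by blast
    fix c :: "'a \<Rightarrow> bool" and u v
    assume c: "\<And>f a b. f \<in> E \<Longrightarrow> a \<in> en f \<Longrightarrow> b \<in> en f \<Longrightarrow> c a = c b" and uv: "u \<in> V" "v \<in> V"
    have "(c(z := c x)) u = (c(z := c x)) v"
    proof (rule connD[OF L])
      fix f a b assume f: "f \<in> insert e E" "a \<in> en f" "b \<in> en f"
      show "(c(z := c x)) a = (c(z := c x)) b"
      proof (cases "f = e")
        case True
        then show ?thesis using f assms(1-3) by auto
      next
        case False
        then have "a \<noteq> z" "b \<noteq> z" using f assms(2,4) by blast+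
        then show ?thesis using c[of f a b] f False by simp
      qed
    qed (use uv in auto)
    moreover have "u \<noteq> z" "v \<noteq> z" using uv assms(2) by auto
    ultimately show "c u = c v" by simp
  qed
next
  assume R: "conn V E en"
  show "conn (insert z V) (insert e E) en"
  proof (rule connI)
    fix c :: "'a \<Rightarrow> bool" and u v
    assume c: "\<And>f a b. f \<in> insert e E \<Longrightarrow> a \<in> en f \<Longrightarrow> b \<in> en f \<Longrightarrow> c a = c b" and uv: "u \<in> insert z V" "v \<in> insert z V"
    have "c a = c x" if "a \<in> insert z V" for a
    proof (cases "a = z")
      case True
      then show ?thesis using c[of e z x] assms(3) by simp
    next
      case False
      then show ?thesis using that connD[OF R, of c a x] c assms(1) by blast
    qed
    then show "c u = c v" using uv by simp
  qed simp
qed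

text \<open>A colouring extends to the new vertex \<open>z\<close> by the colour of
  \<open>x\<close>; conversely the two edges at \<open>z\<close> force \<open>x\<close> and
  \<open>y\<close> to agree, just as \<open>e\<close> does.\<close>

lemma conn_subdivide:
  assumes "x \<in> V" "y \<in> V" "z \<notin> V" "en e1 = {x, z}" "en e2 = {y, z}" "en e = {y, x}" "\<And>f. f \<in> E \<Longrightarrow> en f \<subseteq> V"
  shows "conn (insert z V) (insert e1 (insert e2 E)) en \<longleftrightarrow> conn V (insert e E) en"
proof
  assume L: "conn (insert z V) (insert e1 (insert e2 E)) en"
  show "conn V (insert e E) en"
  proof (rule connI)
    show "V \<noteq> {}" using assms(1) by blast
    fix c :: "'a \<Rightarrow> bool" and u v
    assume c: "\<And>f a b. f \<in> insert e E \<Longrightarrow> a \<in> en f \<Longrightarrow> b \<in> en f \<Longrightarrow> c a = c b" and uv: "u \<in> V" "v \<in> V"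
    have cxy: "c x = c y" using c[of e x y] assms(6) by simp
    have "(c(z := c x)) u = (c(z := c x)) v"
    proof (rule connD[OF L])
      fix f a b assume f: "f \<in> insert e1 (insert e2 E)" "a \<in> en f" "b \<in> en f"
      show "(c(z := c x)) a = (c(z := c x)) b"
      proof (cases "f = e1 \<or> f = e2")
        case True
        then show ?thesis using f assms(1-5) cxy by auto
      next
        case False
        then have "a \<noteq> z" "b \<noteq> z" using f assms(3,7) by blast+
        then show ?thesis using c[of f a b] f False by simp
      qed
    qed (use uv in auto)
    moreover have "u \<noteq> z" "v \<noteq> z" using uv assms(3) by auto
    ultimately show "c u = c v" by simp
  qed
next
  assume R: "conn V (insert e E) en"
  show "conn (insert z V) (insert e1 (insert e2 E)) en"
  proof (rule connI)
    fix c :: "'a \<Rightarrow> bool" and u v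
    assume c: "\<And>f a b. f \<in> insert e1 (insert e2 E) \<Longrightarrow> a \<in> en f \<Longrightarrow> b \<in> en f \<Longrightarrow> c a = c b"
      and uv: "u \<in> insert z V" "v \<in> insert z V"
    have cz: "c z = c x" "c z = c y" using c[of e1 z x] c[of e2 z y] assms(4,5) by simp_all
    have "c a = c x" if "a \<in> insert z V" for a
    proof (cases "a = z")
      case True
      then show ?thesis using cz by simp
    next
      case False
      then have "a \<in> V" using \<open>a \<in> insert z V\<close> by simp
      show ?thesis
      proof (rule connD[OF R _ \<open>a \<in> V\<close> assms(1)])
        fix f a b assume f: "f \<in> insert e E" "a \<in> en f" "b \<in> en f"
        show "c a = c b"
        proof (cases "f = e")
          case True
          then show ?thesis using f assms(6) cz by auto
        next
          case False
          then show ?thesis using f c[of f a b] by simp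
        qed
      qed
    qed
    then show "c u = c v" using uv by simp
  qed simp
qed

section \<open>Fans\<close>

text \<open>One numbering for all fans: growing the path or adding a spoke renames no edge, so trees
  of different fans can be compared as sets.\<close>

definition fan_ends :: "nat \<Rightarrow> nat set" where
  "fan_ends e = (if even e then {0, e div 2} else {e div 2, Suc (e div 2)})"

text \<open>
  The hub \<open>0\<close>, the path \<open>1, \<dots>, n\<close> and a spoke to each member of \<open>S\<close>: edge \<open>2 * k\<close> is the spoke to
  \<open>k\<close>, and edge \<open>2 * k + 1\<close> joins \<open>k\<close> to \<open>k + 1\<close>.
\<close>

definition fan :: "nat \<Rightarrow> nat set \<Rightarrow> (nat, nat) multigraph" where
  "fan n S = \<lparr>verts = {0..n}, edges = (*) 2 ` S \<union> (\<lambda>k. Suc (2 * k)) ` {1..<n}, ends = fan_ends\<rparr>"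

lemma fan_ends_simps [simp]: "fan_ends (2 * k) = {0, k}" "fan_ends (Suc (2 * k)) = {k, Suc k}"
  by (simp_all add: fan_ends_def)

lemma fan_sel [simp]: "verts (fan n S) = {0..n}" "ends (fan n S) = fan_ends"
  by (simp_all add: fan_def)

lemma edges_fan: "edges (fan n S) = (*) 2 ` S \<union> (\<lambda>k. Suc (2 * k)) ` {1..<n}"
  by (simp add: fan_def)

lemma mem_edges_fan [simp]:
  "2 * k \<in> edges (fan n S) \<longleftrightarrow> k \<in> S" "Suc (2 * k) \<in> edges (fan n S) \<longleftrightarrow> 1 \<le> k \<and> k < n"
proof -
  have parity: "2 * a \<noteq> Suc (2 * b)" for a b :: nat by presburger
  show "2 * k \<in> edges (fan n S) \<longleftrightarrow> k \<in> S"
    using parity by (auto simp: edges_fan)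
  show "Suc (2 * k) \<in> edges (fan n S) \<longleftrightarrow> 1 \<le> k \<and> k < n"
    using parity[symmetric] by (auto simp: edges_fan)
qed

lemma edges_fanE:
  assumes "e \<in> edges (fan n S)"
  obtains k where "e = 2 * k" "k \<in> S" | k where "e = Suc (2 * k)" "1 \<le> k" "k < n"
  using assms by (auto simp: edges_fan)

lemma edges_fan_insert: "edges (fan n (insert k S)) = insert (2 * k) (edges (fan n S))"
  by (simp add: edges_fan)

lemma edges_fan_Suc: "1 \<le> n \<Longrightarrow> edges (fan (Suc n) S) = insert (Suc (2 * n)) (edges (fan n S))"
  by (simp add: edges_fan atLeastLessThanSuc)

context
  fixes n :: nat and S :: "nat set"
  assumes S: "S \<subseteq> {1..n}"
begin

lemma finite_edges_fan: "finite (edges (fan n S))"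
  using finite_subset[OF S] by (simp add: edges_fan)

lemma fan_ends_subset: "e \<in> edges (fan n S) \<Longrightarrow> fan_ends e \<subseteq> {0..n}"
  using S by (elim edges_fanE) auto

lemma simple_graph_fan: "simple_graph (fan n S)"
proof -
  have "card (fan_ends e) = 2" if "e \<in> edges (fan n S)" for e
    using that S by (elim edges_fanE) (auto simp: card_insert_if)
  moreover have "inj_on fan_ends (edges (fan n S))"
  proof (rule inj_onI)
    fix e f assume "e \<in> edges (fan n S)" "f \<in> edges (fan n S)" "fan_ends e = fan_ends f"
    then show "e = f"
      using S by (elim edges_fanE) (auto simp: doubleton_eq_iff)
  qed
  ultimately show ?thesis
    using finite_edges_fan fan_ends_subset by (simp add: simple_graph_def wf_multigraph_def)
qed

lemma wf_fan: "wf_multigraph (fan n S)"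
  using simple_graph_fan by (simp add: simple_graph_def)

lemma spanning_trees_fan:
  "T \<in> spanning_trees (fan n S) \<longleftrightarrow> T \<subseteq> edges (fan n S) \<and> conn {0..n} T fan_ends \<and> card T = n"
  by (simp add: spanning_trees_eq[OF wf_fan])

lemma finite_spanning_trees_fan: "finite (spanning_trees (fan n S))"
proof (rule finite_subset)
  show "spanning_trees (fan n S) \<subseteq> Pow (edges (fan n S))" using spanning_trees_fan by blast
qed (use finite_edges_fan in simp)

end

section \<open>Recurrences for the spanning trees of fans\<close>

context
  fixes n :: nat and S :: "nat set"
  assumes S: "S \<subseteq> {1..n}"
begin

lemma conn_fan_pendant:
  assumes "T \<subseteq> edges (fan n S)" "x \<le> n" "fan_ends e = {x, Suc n}"
  shows "conn {0..Suc n} (insert e T) fan_ends \<longleftrightarrow> conn {0..n} T fan_ends"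
  unfolding atLeast0_atMost_Suc
  by (rule conn_pendant[of x "{0..n}" "Suc n" fan_ends e T]) (use assms fan_ends_subset[OF S] in auto)

lemma insert_path_edge_tree_iff:
  assumes n: "1 \<le> n" and T: "T \<subseteq> edges (fan n S)"
  shows "insert (Suc (2 * n)) T \<in> spanning_trees (fan (Suc n) S) \<longleftrightarrow> T \<in> spanning_trees (fan n S)"
proof -
  have S': "S \<subseteq> {1..Suc n}" using S by auto
  have "Suc (2 * n) \<notin> T" using T by auto
  moreover have "finite T" using T finite_edges_fan[OF S] finite_subset by blast
  ultimately have "card (insert (Suc (2 * n)) T) = Suc (card T)" by simp
  then show ?thesis
    using T conn_fan_pendant[OF T, of n "Suc (2 * n)"] edges_fan_Suc[OF n, of S]
    by (auto simp: spanning_trees_fan[OF S] spanning_trees_fan[OF S'])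
qed

lemma insert_spoke_tree_iff:
  assumes n: "1 \<le> n" and T: "T \<subseteq> edges (fan n S)"
  shows "insert (2 * Suc n) T \<in> spanning_trees (fan (Suc n) (insert (Suc n) S)) \<longleftrightarrow> T \<in> spanning_trees (fan n S)"
proof -
  have S': "insert (Suc n) S \<subseteq> {1..Suc n}" using S by auto
  have "2 * Suc n \<notin> T" using T S by (metis atLeastAtMost_iff mem_edges_fan(1) not_less_eq_eq order_refl subsetD)
  moreover have "finite T" using T finite_edges_fan[OF S] finite_subset by blast
  ultimately have "card (insert (2 * Suc n) T) = Suc (card T)" by simp
  moreover have "insert (2 * Suc n) T \<subseteq> edges (fan (Suc n) (insert (Suc n) S))"
    using T unfolding edges_fan_insert edges_fan_Suc[OF n] by blast
  moreover have "fan_ends (2 * Suc n) = {0, Suc n}" by (rule fan_ends_simps)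
  ultimately show ?thesis
    using T conn_fan_pendant[OF T, of 0 "2 * Suc n"]
    by (simp only: spanning_trees_fan[OF S] spanning_trees_fan[OF S'] le0 simp_thms nat.inject)
qed

text \<open>The vertex \<open>n + 1\<close> has only these two edges, which together subdivide a
  spoke to \<open>n\<close>.\<close>

lemma insert_spoke_path_edge_tree_iff:
  assumes n: "1 \<le> n" and T: "T \<subseteq> edges (fan n S)"
  shows "insert (2 * Suc n) (insert (Suc (2 * n)) T) \<in> spanning_trees (fan (Suc n) (insert (Suc n) S))
    \<longleftrightarrow> 2 * n \<notin> T \<and> insert (2 * n) T \<in> spanning_trees (fan n (insert n S))"
proof -
  have S': "insert (Suc n) S \<subseteq> {1..Suc n}" "insert n S \<subseteq> {1..n}" using S n by auto
  have "2 * Suc n \<notin> T" using T S by (metis atLeastAtMost_iff mem_edges_fan(1) not_less_eq_eq order_refl subsetD)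
  moreover have "Suc (2 * n) \<notin> T" using T by auto
  moreover have finT: "finite T" using T finite_edges_fan[OF S] finite_subset by blast
  moreover have "2 * Suc n \<noteq> Suc (2 * n)" by presburger
  ultimately have card1: "card (insert (2 * Suc n) (insert (Suc (2 * n)) T)) = Suc (Suc (card T))" by simp
  have sub1: "insert (2 * Suc n) (insert (Suc (2 * n)) T) \<subseteq> edges (fan (Suc n) (insert (Suc n) S))"
    using T unfolding edges_fan_insert edges_fan_Suc[OF n] by blast
  have sub2: "insert (2 * n) T \<subseteq> edges (fan n (insert n S))"
    using T unfolding edges_fan_insert by blast
  have ends: "fan_ends (2 * Suc n) = {0, Suc n}" "fan_ends (Suc (2 * n)) = {n, Suc n}" "fan_ends (2 * n) = {n, 0}"
    using fan_ends_simps by (auto simp del: mult_Suc_right)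
  have conn: "conn {0..Suc n} (insert (2 * Suc n) (insert (Suc (2 * n)) T)) fan_ends \<longleftrightarrow> conn {0..n} (insert (2 * n) T) fan_ends"
    unfolding atLeast0_atMost_Suc
    by (rule conn_subdivide[of 0 "{0..n}" n "Suc n" fan_ends "2 * Suc n" "Suc (2 * n)" "2 * n" T, OF _ _ _ ends]) (use T fan_ends_subset[OF S] in auto)
  \<comment> \<open>If \<open>T\<close> already had the spoke to \<open>n\<close>, it would connect
    \<open>n + 1\<close> vertices with only \<open>n - 1\<close> edges.\<close>
  have "card {0..n} \<le> card T + 1" if "2 * n \<in> T" "conn {0..n} (insert (2 * n) T) fan_ends"
  proof (rule conn_card_le[OF _ finT])
    fix e assume e: "e \<in> T"
    then show "fan_ends e \<subseteq> {0..n}" using T fan_ends_subset[OF S] by blast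
    show "finite (fan_ends e) \<and> card (fan_ends e) \<le> 2" by (simp add: fan_ends_def card_insert_if)
  qed (use that in \<open>simp_all add: insert_absorb\<close>)
  then have notin: "2 * n \<notin> T" if "conn {0..n} (insert (2 * n) T) fan_ends" "Suc (Suc (card T)) = Suc n"
    using that by force
  show ?thesis
    unfolding spanning_trees_fan[OF S'(1)] spanning_trees_fan[OF S'(2)] conn card1
  proof (cases "2 * n \<in> T")
    case out: False
    then have "card (insert (2 * n) T) = Suc (card T)" using finT by simp
    then show "(insert (2 * Suc n) (insert (Suc (2 * n)) T) \<subseteq> edges (fan (Suc n) (insert (Suc n) S)) \<and>
        conn {0..n} (insert (2 * n) T) fan_ends \<and> Suc (Suc (card T)) = Suc n) \<longleftrightarrow>
      2 * n \<notin> T \<and> insert (2 * n) T \<subseteq> edges (fan n (insert n S)) \<and>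
        conn {0..n} (insert (2 * n) T) fan_ends \<and> card (insert (2 * n) T) = n"
      using sub1 sub2 out by (simp only: simp_thms nat.inject)
  qed (use notin in blast)
qed

text \<open>Without a spoke of its own the vertex \<open>n + 1\<close> is a leaf, and its edge lies
  in every spanning tree. This is the second coordinate of the action of \<open>A\<close>.\<close>

lemma card_spanning_trees_extend:
  assumes n: "1 \<le> n"
  shows "card (spanning_trees (fan (Suc n) S)) = card (spanning_trees (fan n S))"
proof -
  have S': "S \<subseteq> {1..Suc n}" using S by auto
  let ?e = "Suc (2 * n)"
  have "T \<in> insert ?e ` spanning_trees (fan n S)" if T: "T \<in> spanning_trees (fan (Suc n) S)" for T
  proof -
    have T': "T \<subseteq> insert ?e (edges (fan n S))" "conn {0..Suc n} T fan_ends"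
      using T unfolding spanning_trees_fan[OF S'] edges_fan_Suc[OF n] by auto
    have e: "?e \<in> T"
    proof (rule ccontr)
      assume "?e \<notin> T"
      then have f: "fan_ends f \<subseteq> {0..n}" if "f \<in> T" for f using T'(1) that fan_ends_subset[OF S] by blast
      have "(u = Suc n) = (v = Suc n)" if "g \<in> T" "u \<in> fan_ends g" "v \<in> fan_ends g" for g u v
      proof -
        have "u \<le> n" "v \<le> n" using f[OF that(1)] that(2,3) by auto
        then show ?thesis by simp
      qed
      then have "(0 = Suc n) = (Suc n = Suc n)"
        by (rule connD[OF T'(2), where c = "\<lambda>v. v = Suc n"]) auto
      then show False by simp
    qed
    then have "insert ?e (T - {?e}) = T" by blast
    moreover have "T - {?e} \<subseteq> edges (fan n S)" using T'(1) by blast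
    ultimately have "T - {?e} \<in> spanning_trees (fan n S)"
      using insert_path_edge_tree_iff[OF n, of "T - {?e}"] T by simp
    then show ?thesis using \<open>insert ?e (T - {?e}) = T\<close> by blast
  qed
  moreover have "insert ?e T \<in> spanning_trees (fan (Suc n) S)" if "T \<in> spanning_trees (fan n S)" for T
    using that insert_path_edge_tree_iff[OF n] spanning_trees_fan[OF S] by blast
  ultimately have "spanning_trees (fan (Suc n) S) = insert ?e ` spanning_trees (fan n S)" by blast
  moreover have "inj_on (insert ?e) (spanning_trees (fan n S))"
  proof (rule inj_onI)
    have "?e \<notin> edges (fan n S)" by simp
    then have e: "?e \<notin> A" if "A \<in> spanning_trees (fan n S)" for A
      using that spanning_trees_fan[OF S] by blast
    fix A B assume AB: "A \<in> spanning_trees (fan n S)" "B \<in> spanning_trees (fan n S)" "insert ?e A = insert ?e B"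
    show "A = B" by (rule iffD1[OF insert_ident[OF e[OF AB(1)] e[OF AB(2)]] AB(3)])
  qed
  ultimately show ?thesis by (simp add: card_image)
qed

text \<open>The first coordinate of the action of \<open>A\<close>. Trees through the new spoke that
  avoid the new path edge come from trees of \<open>fan n S\<close>; in the others the two edges at
  \<open>n + 1\<close> replace the spoke to \<open>n\<close>.\<close>

lemma card_spanning_trees_extend_spoke:
  assumes n: "1 \<le> n"
  shows "card {T\<in>spanning_trees (fan (Suc n) (insert (Suc n) S)). 2 * Suc n \<in> T} =
    card (spanning_trees (fan n S)) + card {T\<in>spanning_trees (fan n (insert n S)). 2 * n \<in> T}"
proof -
  have S': "insert (Suc n) S \<subseteq> {1..Suc n}" "insert n S \<subseteq> {1..n}" using S n by auto
  define a b d where "a = 2 * Suc n" and "b = Suc (2 * n)" and "d = 2 * n"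
  have abd: "a \<noteq> b" "a \<noteq> d" "b \<noteq> d" unfolding a_def b_def d_def by presburger+
  define E where "E = edges (fan n S)"
  have abE: "a \<notin> E" "b \<notin> E"
    unfolding a_def b_def E_def mem_edges_fan using S by auto
  define TT T1 T2 where "TT = spanning_trees (fan (Suc n) (insert (Suc n) S))"
    and "T1 = spanning_trees (fan n S)" and "T2 = {T\<in>spanning_trees (fan n (insert n S)). d \<in> T}"
  have TT: "T \<subseteq> insert a (insert b E)" if "T \<in> TT" for T
    using that unfolding TT_def E_def a_def b_def spanning_trees_fan[OF S'(1)] edges_fan_insert edges_fan_Suc[OF n] by blast
  have T1: "T \<subseteq> E" if "T \<in> T1" for T
    using that unfolding T1_def E_def spanning_trees_fan[OF S] by blast
  have T2: "T \<subseteq> insert d E" "d \<in> T" if "T \<in> T2" for T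
    using that unfolding T2_def E_def d_def spanning_trees_fan[OF S'(2)] edges_fan_insert by blast+
  have iff1: "insert a T \<in> TT \<longleftrightarrow> T \<in> T1" if "T \<subseteq> E" for T
    using insert_spoke_tree_iff[OF n] that unfolding a_def TT_def T1_def E_def by blast
  have iff2: "insert a (insert b T) \<in> TT \<longleftrightarrow> d \<notin> T \<and> insert d T \<in> T2" if "T \<subseteq> E" for T
    using insert_spoke_path_edge_tree_iff[OF n] that unfolding a_def b_def d_def TT_def T2_def E_def by blast
  let ?A = "{T\<in>TT. a \<in> T \<and> b \<notin> T}" and ?B = "{T\<in>TT. a \<in> T \<and> b \<in> T}"
  have "bij_betw (insert a) T1 ?A"
  proof (rule bij_betw_byWitness[where f' = "\<lambda>T. T - {a}"])
    show "\<forall>T\<in>T1. insert a T - {a} = T" using T1 abE(1) by blast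
    show "\<forall>T\<in>?A. insert a (T - {a}) = T" by blast
    show "insert a ` T1 \<subseteq> ?A" using T1 abE abd(1) iff1 by blast
    show "(\<lambda>T. T - {a}) ` ?A \<subseteq> T1"
    proof
      fix T assume "T \<in> (\<lambda>T. T - {a}) ` ?A"
      then obtain R where R: "R \<in> TT" "a \<in> R" "b \<notin> R" "T = R - {a}" by blast
      have "T \<subseteq> E" using TT[OF R(1)] R(3,4) by blast
      moreover have "insert a T = R" using R(2,4) by blast
      ultimately show "T \<in> T1" using iff1[of T] R(1) by simp
    qed
  qed
  then have A: "card ?A = card T1" by (rule bij_betw_same_card[symmetric])
  have "bij_betw (\<lambda>T. insert a (insert b (T - {d}))) T2 ?B"
  proof (rule bij_betw_byWitness[where f' = "\<lambda>T. insert d (T - {a, b})"])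
    show "\<forall>T\<in>T2. insert d (insert a (insert b (T - {d})) - {a, b}) = T" using T2 abE abd by blast
    have dR: "d \<notin> R" if R: "R \<in> TT" "a \<in> R" "b \<in> R" for R
    proof -
      have "insert a (insert b (R - {a, b})) = R" using R by blast
      moreover have "R - {a, b} \<subseteq> E" using TT[OF R(1)] by blast
      ultimately have "d \<notin> R - {a, b}" using iff2[of "R - {a, b}"] R(1) by simp
      then show ?thesis using abd by blast
    qed
    show "\<forall>T\<in>?B. insert a (insert b (insert d (T - {a, b}) - {d})) = T" using dR abd by blast
    show "(\<lambda>T. insert a (insert b (T - {d}))) ` T2 \<subseteq> ?B"
    proof
      fix T assume "T \<in> (\<lambda>T. insert a (insert b (T - {d}))) ` T2"
      then obtain R where R: "R \<in> T2" "T = insert a (insert b (R - {d}))" by blast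
      have "R - {d} \<subseteq> E" using T2(1)[OF R(1)] by blast
      moreover have "insert d (R - {d}) = R" using T2(2)[OF R(1)] by blast
      ultimately have "T \<in> TT" using iff2[of "R - {d}"] R by simp
      then show "T \<in> ?B" using R(2) by blast
    qed
    show "(\<lambda>T. insert d (T - {a, b})) ` ?B \<subseteq> T2"
    proof
      fix T assume "T \<in> (\<lambda>T. insert d (T - {a, b})) ` ?B"
      then obtain R where R: "R \<in> TT" "a \<in> R" "b \<in> R" "T = insert d (R - {a, b})" by blast
      have "R - {a, b} \<subseteq> E" using TT[OF R(1)] by blast
      moreover have "insert a (insert b (R - {a, b})) = R" using R by blast
      ultimately show "T \<in> T2" using iff2[of "R - {a, b}"] R by simp
    qed
  qed
  then have B: "card ?B = card T2" by (rule bij_betw_same_card[symmetric])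
  have finTT: "finite TT" unfolding TT_def by (rule finite_spanning_trees_fan[OF S'(1)])
  have "{T\<in>TT. a \<in> T} = ?A \<union> ?B" by blast
  moreover have "card (?A \<union> ?B) = card ?A + card ?B" using finTT by (intro card_Un_disjoint) auto
  ultimately show ?thesis using A B unfolding TT_def T1_def T2_def a_def d_def by simp
qed

lemma spanning_trees_without_spoke:
  assumes n: "1 \<le> n" "n \<notin> S"
  shows "{T\<in>spanning_trees (fan n (insert n S)). 2 * n \<notin> T} = spanning_trees (fan n S)"
proof -
  have S': "insert n S \<subseteq> {1..n}" using S n by auto
  have "2 * n \<notin> edges (fan n S)" using n by simp
  then show ?thesis
    unfolding set_eq_iff mem_Collect_eq spanning_trees_fan[OF S'] spanning_trees_fan[OF S] edges_fan_insert by blast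
qed

text \<open>Deletion and contraction of the spoke to \<open>n\<close>. It gives the second
  coordinate of the action of \<open>D\<close>, because deleting one of two parallel copies of an
  edge leaves the graph with a single copy.\<close>

lemma card_spanning_trees_insert_spoke:
  assumes n: "1 \<le> n" "n \<notin> S"
  shows "card (spanning_trees (fan n (insert n S))) =
    card (spanning_trees (fan n S)) + card {T\<in>spanning_trees (fan n (insert n S)). 2 * n \<in> T}"
proof -
  have S': "insert n S \<subseteq> {1..n}" using S n by auto
  let ?T = "spanning_trees (fan n (insert n S))"
  have "?T = {T\<in>?T. 2 * n \<notin> T} \<union> {T\<in>?T. 2 * n \<in> T}" by blast
  also have "card \<dots> = card {T\<in>?T. 2 * n \<notin> T} + card {T\<in>?T. 2 * n \<in> T}"
    using finite_spanning_trees_fan[OF S'] by (intro card_Un_disjoint) auto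
  finally show ?thesis unfolding spanning_trees_without_spoke[OF n] .
qed

end

section \<open>A straight-line drawing of fans: hub at \<open>\<i>\<close>, path on the real
  axis\<close>

definition fan_point :: "nat \<Rightarrow> complex" where
  "fan_point v = (if v = 0 then \<i> else of_nat v)"

lemma mem_spoke:
  "z \<in> closed_segment \<i> (of_nat k) \<longleftrightarrow> 0 \<le> Im z \<and> Im z \<le> 1 \<and> Re z = (1 - Im z) * real k"
proof
  assume "z \<in> closed_segment \<i> (of_nat k)"
  then obtain u where "0 \<le> u" "u \<le> 1" "z = (1 - u) *\<^sub>R \<i> + u *\<^sub>R of_nat k"
    by (auto simp: in_segment)
  then show "0 \<le> Im z \<and> Im z \<le> 1 \<and> Re z = (1 - Im z) * real k" by simp
next
  assume z: "0 \<le> Im z \<and> Im z \<le> 1 \<and> Re z = (1 - Im z) * real k"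
  then have "z = (1 - (1 - Im z)) *\<^sub>R \<i> + (1 - Im z) *\<^sub>R of_nat k"
    by (simp add: complex_eq_iff)
  then show "z \<in> closed_segment \<i> (of_nat k)"
    using z unfolding in_segment by (intro exI[of _ "1 - Im z"]) auto
qed

lemma mem_path_edge:
  "z \<in> closed_segment (of_nat k) (of_nat (Suc k)) \<longleftrightarrow> Im z = 0 \<and> real k \<le> Re z \<and> Re z \<le> real k + 1"
proof
  assume "z \<in> closed_segment (of_nat k) (of_nat (Suc k))"
  then obtain u where "0 \<le> u" "u \<le> 1" "z = (1 - u) *\<^sub>R of_nat k + u *\<^sub>R of_nat (Suc k)"
    by (auto simp: in_segment)
  then show "Im z = 0 \<and> real k \<le> Re z \<and> Re z \<le> real k + 1" by (simp add: algebra_simps)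
next
  assume z: "Im z = 0 \<and> real k \<le> Re z \<and> Re z \<le> real k + 1"
  then have "z = (1 - (Re z - k)) *\<^sub>R of_nat k + (Re z - k) *\<^sub>R of_nat (Suc k)"
    by (simp add: complex_eq_iff algebra_simps)
  then show "z \<in> closed_segment (of_nat k) (of_nat (Suc k))"
    using z unfolding in_segment by (intro exI[of _ "Re z - k"]) auto
qed

text \<open>Membership in a segment becomes equations in \<open>Re\<close> and \<open>Im\<close>. A
  common point of two spokes has \<open>Im z = 1\<close>, one of a spoke and a path edge has
  \<open>Im z = 0\<close>, and two path edges share at most an integer point.\<close>

lemma planar_graph_fan:
  assumes S: "S \<subseteq> {1..n}"
  shows "planar_graph (fan n S)"
proof -
  let ?p = fan_point
  define \<gamma> where "\<gamma> e = (if even e then linepath \<i> (of_nat (e div 2)) else linepath (of_nat (e div 2)) (of_nat (Suc (e div 2))))"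
    for e :: nat
  have p [simp]: "?p 0 = \<i>" "?p (Suc v) = of_nat (Suc v)" for v by (simp_all add: fan_point_def)
  have p_pos: "?p v = of_nat v" if "1 \<le> v" for v using that by (simp add: fan_point_def)
  have inj: "?p u = ?p v \<longleftrightarrow> u = v" for u v
    by (cases u; cases v) (auto simp: complex_eq_iff)
  have mem_spoke': "z \<in> path_image (\<gamma> (2 * k)) \<longleftrightarrow> 0 \<le> Im z \<and> Im z \<le> 1 \<and> Re z = (1 - Im z) * real k"
    and mem_path_edge': "z \<in> path_image (\<gamma> (Suc (2 * k))) \<longleftrightarrow> Im z = 0 \<and> real k \<le> Re z \<and> Re z \<le> real k + 1"
    for z k
    by (simp_all add: \<gamma>_def mem_spoke mem_path_edge del: of_nat_Suc)
  have on_spoke: "?p v \<in> path_image (\<gamma> (2 * k)) \<longleftrightarrow> v = 0 \<or> v = k" if "1 \<le> k" for v k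
    using that by (cases v) (auto simp: mem_spoke')
  have on_path: "?p v \<in> path_image (\<gamma> (Suc (2 * k))) \<longleftrightarrow> v = k \<or> v = Suc k" if "1 \<le> k" for v k
  proof (cases v)
    case 0
    then show ?thesis using that by (simp add: mem_path_edge' del: of_nat_Suc)
  next
    case (Suc m)
    then have "?p v \<in> path_image (\<gamma> (Suc (2 * k))) \<longleftrightarrow> real k \<le> real v \<and> real v \<le> real k + 1"
      by (simp add: mem_path_edge' del: of_nat_Suc)
    also have "\<dots> \<longleftrightarrow> v = k \<or> v = Suc k" by linarith
    finally show ?thesis .
  qed
  have on: "?p v \<in> path_image (\<gamma> e) \<longleftrightarrow> v \<in> fan_ends e" if "e \<in> edges (fan n S)" for v e
    using that
  proof (cases rule: edges_fanE)
    case (1 k)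
    then have "1 \<le> k" using S by auto
    then show ?thesis using 1 by (simp add: on_spoke)
  next
    case (2 k)
    then show ?thesis by (simp add: on_path)
  qed
  have meet: "\<exists>v\<in>fan_ends e \<inter> fan_ends f. z = ?p v"
    if ef: "e \<in> edges (fan n S)" "f \<in> edges (fan n S)" "e < f" and z: "z \<in> path_image (\<gamma> e)" "z \<in> path_image (\<gamma> f)" for e f z
  proof -
    have spoke_path: "k \<in> {l, Suc l} \<and> z = ?p k"
      if "1 \<le> k" "z \<in> path_image (\<gamma> (2 * k))" "z \<in> path_image (\<gamma> (Suc (2 * l)))" for k l
    proof -
      have "Im z = 0" "Re z = real k" "real l \<le> Re z" "Re z \<le> real l + 1"
        using that by (auto simp: mem_spoke' mem_path_edge')
      then have "z = of_nat k" "real l \<le> real k" "real k \<le> real l + 1" by (simp_all add: complex_eq_iff)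
      then show ?thesis using that(1) p_pos[of k] by auto
    qed
    from ef(1) show ?thesis
    proof (cases rule: edges_fanE)
      case e: (1 k)
      from ef(2) show ?thesis
      proof (cases rule: edges_fanE)
        case f: (1 l)
        have "Re z = (1 - Im z) * real k" "Re z = (1 - Im z) * real l"
          using z e f by (simp_all add: mem_spoke')
        moreover from this have "(1 - Im z) * real k = (1 - Im z) * real l" by (rule trans[OF sym])
        moreover have "real k \<noteq> real l" using ef(3) e f by simp
        ultimately have "1 - Im z = 0" "Re z = (1 - Im z) * real k" using mult_left_cancel by blast+
        then have "z = \<i>" by (simp add: complex_eq_iff)
        then show ?thesis using e f by (intro bexI[of _ 0]) auto
      next
        case f: (2 l)
        then show ?thesis using spoke_path[of k l] e S z by (intro bexI[of _ k]) auto
      qed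
    next
      case e: (2 k)
      from ef(2) show ?thesis
      proof (cases rule: edges_fanE)
        case f: (1 l)
        then show ?thesis using spoke_path[of l k] e S z by (intro bexI[of _ l]) auto
      next
        case f: (2 l)
        have "Im z = 0" "real l \<le> Re z" "Re z \<le> real k + 1"
          using z e f by (simp_all add: mem_path_edge')
        moreover have "k < l" using ef(3) e f by simp
        ultimately have "l = Suc k" "Re z = real l" by linarith+
        have "z = ?p l"
          using \<open>Im z = 0\<close> \<open>Re z = real l\<close> \<open>k < l\<close> by (simp add: complex_eq_iff p_pos)
        moreover have "l \<in> fan_ends e" unfolding e(1) fan_ends_simps using \<open>l = Suc k\<close> by simp
        moreover have "l \<in> fan_ends f" unfolding f(1) fan_ends_simps by simp
        ultimately show ?thesis by blast
      qed
    qed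
  qed
  have "plane_drawing (fan n S) ?p \<gamma>"
    unfolding plane_drawing_def fan_sel
  proof (intro conjI ballI impI)
    show "inj_on ?p {0..n}" by (rule inj_onI) (simp add: inj)
    fix e assume e: "e \<in> edges (fan n S)"
    then show "simple_path (\<gamma> e)"
      by (elim edges_fanE) (auto simp: \<gamma>_def complex_eq_iff intro!: simple_path_linepath)
    show "{pathstart (\<gamma> e), pathfinish (\<gamma> e)} = ?p ` fan_ends e"
      using e S by (elim edges_fanE) (auto simp: \<gamma>_def p_pos)
    show "path_image (\<gamma> e) \<inter> ?p ` {0..n} = ?p ` fan_ends e"
      using on[OF e] fan_ends_subset[OF S e] by auto
    fix f assume f: "f \<in> edges (fan n S)" "e \<noteq> f"
    show "path_image (\<gamma> e) \<inter> path_image (\<gamma> f) = ?p ` (fan_ends e \<inter> fan_ends f)"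
    proof
      show "path_image (\<gamma> e) \<inter> path_image (\<gamma> f) \<subseteq> ?p ` (fan_ends e \<inter> fan_ends f)"
        using meet[OF e f(1)] meet[OF f(1) e] f(2) by (cases "e < f") (auto simp: not_less_iff_gr_or_eq)
      show "?p ` (fan_ends e \<inter> fan_ends f) \<subseteq> path_image (\<gamma> e) \<inter> path_image (\<gamma> f)"
        using on[OF e] on[OF f(1)] by auto
    qed
  qed
  then show ?thesis unfolding planar_graph_def by blast
qed

text \<open>\<open>Suc n\<close> counts the hub \<open>0\<close> together with the path
  \<open>1, ..., n\<close>; excluding \<open>n\<close> from \<open>S\<close> makes the spoke to
  \<open>n\<close> the distinguished edge.\<close>

lemma planar_feasible_fan:
  assumes S: "S \<subseteq> {1..<n}" and n: "1 \<le> n"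
    and x: "x = int (card {T\<in>spanning_trees (fan n (insert n S)). 2 * n \<in> T})"
    and y: "y = int (card (spanning_trees (fan n S)))"
  shows "planar_feasible (Suc n) (vector [x, y])"
proof -
  have S': "S \<subseteq> {1..n}" "insert n S \<subseteq> {1..n}" "n \<notin> S" using S n by auto
  let ?G = "fan n (insert n S)"
  have "2 * n \<in> edges ?G" by simp
  moreover have "card (ends ?G (2 * n)) = 2" using n by simp
  ultimately show ?thesis
    unfolding planar_feasible_def
    using simple_graph_fan[OF S'(2)] planar_graph_fan[OF S'(2)] x y n
      num_spanning_trees_contract[OF wf_fan[OF S'(2)], of "2 * n"]
      num_spanning_trees_delete[of ?G "2 * n"] spanning_trees_without_spoke[OF S'(1) n S'(3)]
    by (intro exI[of _ ?G] exI[of _ "2 * n"]) simp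
qed

text \<open>Induction with the invariant that the distinguished edge is the spoke to the end
  \<open>n\<close> and that \<open>S\<close> omits \<open>n\<close>. The start is a single edge:
  contracting it leaves one tree and deleting it none, which is the vector
  \<open>(1, 0)\<close>.\<close>

lemma fan_word:
  assumes "set is \<subseteq> {1, 2}"
  shows "\<exists>n S. 1 \<le> n \<and> n \<le> 1 + 2 * length is \<and> S \<subseteq> {1..<n} \<and>
    act (wordm is) (1, 0) = (int (card {T\<in>spanning_trees (fan n (insert n S)). 2 * n \<in> T}), int (card (spanning_trees (fan n S))))"
  using assms
proof (induction "is")
  case Nil
  have edges: "edges (fan 1 {}) = {}" "edges (fan 1 {1}) = {2}" by (auto simp: edges_fan)
  have "\<not> conn {0..1} {} fan_ends"
  proof
    assume "conn {0..1} {} fan_ends"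
    then have "(0 = (0 :: nat)) = (1 = (0 :: nat))" by (rule connD[where c = "\<lambda>v. v = 0"]) auto
    then show False by simp
  qed
  then have "spanning_trees (fan 1 {}) = {}"
    using spanning_trees_fan[of "{}" 1] edges by auto
  moreover have "{T\<in>spanning_trees (fan 1 {1}). 2 \<in> T} = {{2}}"
  proof -
    have "conn {0..1} {2} fan_ends"
    proof (rule connI)
      fix c :: "nat \<Rightarrow> bool" and u v :: nat
      assume c: "\<And>e x y. e \<in> {2} \<Longrightarrow> x \<in> fan_ends e \<Longrightarrow> y \<in> fan_ends e \<Longrightarrow> c x = c y" and uv: "u \<in> {0..1}" "v \<in> {0..1}"
      have "c 0 = c 1" by (rule c[of 2]) (simp_all add: fan_ends_def)
      moreover have "u = 0 \<or> u = 1" "v = 0 \<or> v = 1" using uv by auto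
      ultimately show "c u = c v" by auto
    qed simp
    moreover have "T = {2}" if "T \<subseteq> {2}" "2 \<in> T" for T :: "nat set" using that by blast
    ultimately show ?thesis
      using spanning_trees_fan[of "{1}" 1] edges(2) by auto
  qed
  ultimately show ?case
    by (intro exI[of _ 1] exI[of _ "{}"]) simp
next
  case (Cons i "is")
  then obtain n S where n: "1 \<le> n" "n \<le> 1 + 2 * length is" and S: "S \<subseteq> {1..<n}"
    and eq: "act (wordm is) (1, 0) = (int (card {T\<in>spanning_trees (fan n (insert n S)). 2 * n \<in> T}), int (card (spanning_trees (fan n S))))"
    by auto
  define S' where "S' = insert n S"
  have S1: "S \<subseteq> {1..n}" "n \<notin> S" using S by auto
  have S': "S' \<subseteq> {1..n}" "S' \<subseteq> {1..Suc n}" using S n(1) by (auto simp: S'_def)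
  \<comment> \<open>At \<open>k = n\<close> the pair describes a doubled spoke: its parallel copy
    becomes a loop under contraction and survives deletion, which is why \<open>S'\<close> may
    contain \<open>n\<close>. Each letter then lengthens the path by \<open>i \<ge> 1\<close>, so at
    \<open>n + i\<close> the pair comes from a simple graph again.\<close>
  define U V where "U k = int (card (spanning_trees (fan k S')))"
    and "V k = int (card {T\<in>spanning_trees (fan k (insert k S')). 2 * k \<in> T})" for k
  have V0: "V n = int (card {T\<in>spanning_trees (fan n (insert n S)). 2 * n \<in> T})"
    by (simp add: V_def S'_def)
  have U0: "U n = int (card (spanning_trees (fan n S))) + V n"
    using card_spanning_trees_insert_spoke[OF S1(1) n(1) S1(2)] unfolding V0 by (simp add: U_def S'_def)
  have D: "act mD (act (wordm is) (1, 0)) = (V n, U n)"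
    unfolding eq U0 V0 by (simp add: mD_def)
  have A: "act mA (V k, U k) = (V (Suc k), U (Suc k))" if "1 \<le> k" "S' \<subseteq> {1..k}" for k
    using card_spanning_trees_extend[OF that(2,1)] card_spanning_trees_extend_spoke[OF that(2,1)]
    by (simp add: U_def V_def mA_def)
  have "act (wordm (i # is)) (1, 0) = act (mAD i) (act (wordm is) (1, 0))" by (simp add: act_mmul)
  moreover have "i = Suc 0 \<or> i = 2" using Cons.prems by auto
  ultimately have "act (wordm (i # is)) (1, 0) = (V (n + i), U (n + i))"
    using A[OF n(1) S'(1)] A[of "Suc n", OF _ S'(2)] by (auto simp: act_mAD D simp del: wordm.simps)
  moreover have "n + i \<le> 1 + 2 * length (i # is)" using n(2) Cons.prems by auto
  moreover have "S' \<subseteq> {1..<n + i}" using S'(1) Cons.prems by auto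
  ultimately show ?case using n(1) by (intro exI[of _ "n + i"] exI[of _ S']) (simp add: U_def V_def)
qed

theorem theorem3p1:
  shows "\<exists>(C1 :: real) (C2 :: real) (N0 :: nat). \<forall>N \<ge> N0. \<forall>a b :: int. coprime a b \<longrightarrow>
    (\<exists>is :: nat list. 1 \<le> length is \<and> real (length is) \<le> C1 * log 2 (real N) \<and> set is \<subseteq> {1, 2} \<and>
       vec_cong (vector [a, b]) (AD_word is *v vector [1, 0]) (int N)) \<and>
    (\<exists>(n :: nat) (x :: int) (y :: int). real n \<le> C2 * log 2 (real N) \<and>
       planar_feasible n (vector [x, y]) \<and> [x = a] (mod int N) \<and> [y = b] (mod int N))"
proof -
  obtain C where C: "\<And>N u. N \<ge> 2 \<Longrightarrow> prim (int N) u \<Longrightarrow> \<exists>is. 1 \<le> length is \<and> real (length is) \<le> C * log 2 N \<and>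
      set is \<subseteq> {1, 2} \<and> vmod (int N) (act (wordm is) (1, 0)) = vmod (int N) u"
    using exists_word by blast
  show ?thesis
  \<comment> \<open>A word of length \<open>l\<close> needs at most \<open>2 * l + 2\<close>
    vertices including the hub, and the summand 2 is absorbed since \<open>log 2 N \<ge> 1\<close>
    from \<open>N = 2\<close> on.\<close>
  proof (rule exI[of _ C], rule exI[of _ "2 * C + 2"], rule exI[of _ 2], intro allI impI)
    fix N :: nat and a b :: int
    assume N: "2 \<le> N" and ab: "coprime a b"
    have "prim (int N) (a, b)" using ab by (simp add: prim_def)
    then obtain "is" where w: "1 \<le> length is" "real (length is) \<le> C * log 2 N" "set is \<subseteq> {1, 2}"
      "vmod (int N) (act (wordm is) (1, 0)) = vmod (int N) (a, b)"
      using C[OF N] by blast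
    obtain x y where xy: "act (wordm is) (1, 0) = (x, y)" by (cases "act (wordm is) (1, 0)")
    have cong: "[x = a] (mod int N)" "[y = b] (mod int N)"
      using w(4) unfolding xy by (simp_all add: vmod_def cong_def)
    have "vec_cong (vector [a, b]) (AD_word is *v vector [1, 0]) (int N)"
      unfolding AD_word_vector[OF w(3)] xy using cong by (simp add: vec_cong_def forall_2 cong_sym)
    moreover obtain n S where n: "1 \<le> n" "n \<le> 1 + 2 * length is" "S \<subseteq> {1..<n}"
      "x = int (card {T\<in>spanning_trees (fan n (insert n S)). 2 * n \<in> T})" "y = int (card (spanning_trees (fan n S)))"
      using fan_word[OF w(3)] unfolding xy by auto
    have "log 2 2 \<le> log 2 (real N)" using N by (subst log_le_cancel_iff) auto
    then have "1 \<le> log 2 (real N)" by simp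
    then have "real (Suc n) \<le> (2 * C + 2) * log 2 (real N)" using n(2) w(2) by (simp add: algebra_simps)
    moreover have "planar_feasible (Suc n) (vector [x, y])"
      by (rule planar_feasible_fan[OF n(3,1,4,5)])
    ultimately show "(\<exists>is :: nat list. 1 \<le> length is \<and> real (length is) \<le> C * log 2 (real N) \<and> set is \<subseteq> {1, 2} \<and>
        vec_cong (vector [a, b]) (AD_word is *v vector [1, 0]) (int N)) \<and>
      (\<exists>(n :: nat) (x :: int) (y :: int). real n \<le> (2 * C + 2) * log 2 (real N) \<and>
        planar_feasible n (vector [x, y]) \<and> [x = a] (mod int N) \<and> [y = b] (mod int N))"
      using w(1-3) cong by blast
  qed
qed

end
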